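(* Let $t_1\approx1.2$ be the unique positive solution of $t=\coth t$, let $T_1=2t_1$, and for $T>0$ let $\mathbb{A}_T=[0,T]\times\mathbb{S}^1$. For any $T\geqslant T_1$ there exists a rotationally symmetric free boundary harmonic map $\hat\Psi_T\colon\mathbb{A}_T\to\mathbb{B}^3$ of spectral index $1$. Furthermore, the corresponding $\bar\sigma_1$-conformally extremal pair $(g_{\hat\Psi_T},\rho_{\hat\Psi_T})$ possesses the following properties. (1) $\hat\Psi_{T_1}$ is the immersion of the critical (free boundary minimal) catenoid. (2) The pair $(g_{\hat\Psi_T},\rho_{\hat\Psi_T})$ is rotationally symmetric; in particular, $\rho_{\hat\Psi_T}$ is constant on each boundary component. There exists $T_2$ such that for $T\geqslant T_2$ one has $\rho_{\hat\Psi_T}(0)\neq\rho_{\hat\Psi_T}(T)$, where $\rho_{\hat\Psi_T}(0)$ and $\rho_{\hat\Psi_T}(T)$ denote the values of $\rho_{\hat\Psi_T}$ on $\{0\}\times\mathbb{S}^1$ and $\{T\}\times\mathbb{S}^1$. (3) One has $$\bar\sigma_1(\mathbb{A}_T,g_{\hat\Psi_T},\rho_{\hat\Psi_T})=2E(\hat\Psi_T)>2\pi\qquad\text{and}\qquad\lim_{T\to\infty}\bar\sigma_1(\mathbb{A}_T,g_{\hat\Psi_T},\rho_{\hat\Psi_T})=2\pi.$$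
   Context: $\mathbb{S}^1=\mathbb{R}/2\pi\mathbb{Z}$ with coordinate $\theta$, and $\mathbb{A}_T$ carries the conformal class $\mathcal{C}_T$ of the flat metric $dt^2+d\theta^2$. $\mathbb{B}^3\subset\mathbb{R}^3$ is the closed unit ball, $\mathbb{S}^2$ its boundary. A free boundary harmonic map $\hat\Psi\colon(\mathbb{A}_T,g)\to\mathbb{B}^3$ is a map with $\Delta_g\hat\Psi=0$ in $\mathbb{A}_T$ that is proper ($\hat\Psi(x)\in\mathbb{S}^2$ iff $x\in\partial\mathbb{A}_T$) and satisfies $\partial_{\nu_g}\hat\Psi=|\partial_{\nu_g}\hat\Psi|\hat\Psi$ on $\partial\mathbb{A}_T$ ($\nu_g$ the outer unit normal); this depends only on the conformal class. It is non-degenerate if $d\hat\Psi$ vanishes nowhere. It is rotationally symmetric if $\hat\Psi(t,\theta+\varphi)=R_\varphi\hat\Psi(t,\theta)$ for all $\varphi$, where $R_\varphi$ is the rotation by angle $\varphi$ about a fixed axis through the origin. The energy is $E(\hat\Psi)=\frac12\int|d\hat\Psi|_g^2\,dv_g$ (conformally invariant). For non-degenerate $\hat\Psi$, $g_{\hat\Psi}=\frac12|d\hat\Psi|_g^2\,g$ and $\rho_{\hat\Psi}=|\partial_{\nu_{g_{\hat\Psi}}}\hat\Psi|=\sqrt2\,|\partial_{\nu_g}\hat\Psi|/|d\hat\Psi|_g$ on the boundary. A pair $(g,\rho)$ is rotationally symmetric if both $g$ and $\rho$ are invariant under rotations of the $\mathbb{S}^1$ factor. For a metric $g$ and a positive smooth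 density $\rho$ on $\partial\mathbb{A}_T$, $\sigma_k(\mathbb{A}_T,g,\rho)$ are the eigenvalues $0=\sigma_0<\sigma_1\leqslant\dots$ (with multiplicity) of $\Delta_gu=0$ in $\mathbb{A}_T$, $\partial_{\nu_g}u=\sigma\rho u$ on $\partial\mathbb{A}_T$, and $\bar\sigma_k(\mathbb{A}_T,g,\rho)=\sigma_k(\mathbb{A}_T,g,\rho)\int_{\partial\mathbb{A}_T}\rho\,dA_g$ (with $dA_g$ the boundary length measure). A pair $(g,\rho)$ is $\bar\sigma_k$-conformally extremal if for every smooth family $(g(t),\rho(t))$ with $g(t)\in[g]$, $\rho(t)>0$, $(g(0),\rho(0))=(g,\rho)$, either $\bar\sigma_k(g(t),\rho(t))\leqslant\bar\sigma_k(g,\rho)+o(t)$ or $\bar\sigma_k(g(t),\rho(t))\geqslant\bar\sigma_k(g,\rho)+o(t)$ as $t\to0$. The spectral index of a non-degenerate $\hat\Psi$ is the number of negative eigenvalues of the operator $u\mapsto\partial_{\nu_g}\hat u-|\partial_{\nu_g}\hat\Psi|u$ on $C^\infty(\partial\mathbb{A}_T)$, where $\hat u$ is the harmonic extension of $u$; equivalently it is the smallest $k$ with $\sigma_k(\mathbb{A}_T,g_{\hat\Psi},\rho_{\hat\Psi})=1$. The pair $(g_{\hat\Psi},\rho_{\hat\Psi})$ of a non-degenerate $\hat\Psi$ of spectral index $1$ is $\bar\sigma_1$-conformally extremal. The critical catenoid is the piece of a catenoid, centered at the origin and suitably scaled, that lies in $\mathbb{B}^3$ and meets $\mathbb{S}^2$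 orthogonally along its boundary. *)

theory Defs
  imports "HOL-Analysis.Analysis" "HOL-Library.Landau_Symbols" "HOL-Library.Extended_Nat"
begin

section \<open>Smooth functions up to the boundary\<close>

text \<open>
  A function is smooth on \<open>S\<close> if it is differentiable within \<open>S\<close> and its partial derivatives
  \<open>D b\<close> in the coordinate directions \<open>b \<in> Basis\<close> are again smooth on \<open>S\<close>. On closed strips such as
  \<open>{0..T} \<times> UNIV\<close> this is smoothness up to the boundary; values outside \<open>S\<close> are irrelevant.
\<close>

coinductive smooth_on :: "'a::euclidean_space set \<Rightarrow> ('a \<Rightarrow> 'b::real_normed_vector) \<Rightarrow> bool"
  for S where
  "(\<And>x. x \<in> S \<Longrightarrow> (f has_derivative (\<lambda>h. \<Sum>b\<in>Basis. (h \<bullet> b) *\<^sub>R D b x)) (at x within S)) \<Longrightarrow>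
   (\<And>b. b \<in> Basis \<Longrightarrow> smooth_on S (D b)) \<Longrightarrow> smooth_on S f"


section \<open>The annulus and conformal metrics\<close>

text \<open>
  Points of \<open>[0,T] \<times> \<real>/2\<pi>\<int>\<close> are given by coordinates \<open>(t, \<theta>)\<close> with \<open>\<theta>\<close> real; functions on the annulus
  are the functions that are \<open>2\<pi>\<close>-periodic in \<open>\<theta>\<close>.

  All metrics are in the conformal class of the flat metric. The metric \<open>w (dt\<^sup>2 + d\<theta>\<^sup>2)\<close> is
  represented by its conformal factor \<open>w\<close>; the flat metric itself is \<open>flat\<close>.
\<close>

definition annulus :: "real \<Rightarrow> (real \<times> real) set" where
  "annulus T = {0..T} \<times> UNIV"

definition annulus_bdry :: "real \<Rightarrow> (real \<times> real) set" where
  "annulus_bdry T = {0, T} \<times> UNIV"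

definition smooth_annulus_fun ::
    "real \<Rightarrow> (real \<times> real \<Rightarrow> 'b::real_normed_vector) \<Rightarrow> bool" where
  "smooth_annulus_fun T u \<longleftrightarrow> smooth_on (annulus T) u \<and>
     (\<forall>(t, \<theta>) \<in> annulus T. u (t, \<theta> + 2 * pi) = u (t, \<theta>))"

definition smooth_bdry_fun :: "real \<Rightarrow> (real \<times> real \<Rightarrow> real) \<Rightarrow> bool" where
  "smooth_bdry_fun T r \<longleftrightarrow> (\<forall>t \<in> {0, T}. smooth_on UNIV (\<lambda>\<theta>. r (t, \<theta>))) \<and>
     (\<forall>(t, \<theta>) \<in> annulus_bdry T. r (t, \<theta> + 2 * pi) = r (t, \<theta>))"

definition conformal_metric :: "real \<Rightarrow> (real \<times> real \<Rightarrow> real) \<Rightarrow> bool" where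
  "conformal_metric T w \<longleftrightarrow> smooth_annulus_fun T w \<and> (\<forall>x \<in> annulus T. w x > 0)"

definition bdry_density :: "real \<Rightarrow> (real \<times> real \<Rightarrow> real) \<Rightarrow> bool" where
  "bdry_density T \<rho> \<longleftrightarrow> smooth_bdry_fun T \<rho> \<and> (\<forall>x \<in> annulus_bdry T. \<rho> x > 0)"

definition flat :: "real \<times> real \<Rightarrow> real" where
  "flat = (\<lambda>_. 1)"

text \<open>The \<open>t\<close>-derivative is one-sided at \<open>t = 0\<close> and \<open>t = T\<close>.\<close>

definition d_t ::
    "real \<Rightarrow> (real \<times> real \<Rightarrow> 'b::real_normed_vector) \<Rightarrow> real \<times> real \<Rightarrow> 'b" where
  "d_t T u = (\<lambda>(t, \<theta>). vector_derivative (\<lambda>s. u (s, \<theta>)) (at t within {0..T}))"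

definition d_theta ::
    "(real \<times> real \<Rightarrow> 'b::real_normed_vector) \<Rightarrow> real \<times> real \<Rightarrow> 'b" where
  "d_theta u = (\<lambda>(t, \<theta>). vector_derivative (\<lambda>s. u (t, s)) (at \<theta>))"

definition laplacian :: "real \<Rightarrow> (real \<times> real \<Rightarrow> real) \<Rightarrow>
    (real \<times> real \<Rightarrow> 'b::real_normed_vector) \<Rightarrow> real \<times> real \<Rightarrow> 'b" where
  "laplacian T w u x = (d_t T (d_t T u) x + d_theta (d_theta u) x) /\<^sub>R w x"

text \<open>The outer unit normal is \<open>- w\<^sup>-\<^sup>1\<^sup>/\<^sup>2 \<partial>\<^sub>t\<close> at \<open>t = 0\<close> and \<open>w\<^sup>-\<^sup>1\<^sup>/\<^sup>2 \<partial>\<^sub>t\<close> at \<open>t = T\<close>.\<close>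

definition normal_deriv :: "real \<Rightarrow> (real \<times> real \<Rightarrow> real) \<Rightarrow>
    (real \<times> real \<Rightarrow> 'b::real_normed_vector) \<Rightarrow> real \<times> real \<Rightarrow> 'b" where
  "normal_deriv T w u x = (if fst x = 0 then - d_t T u x else d_t T u x) /\<^sub>R sqrt (w x)"

text \<open>\<open>|du|\<^sup>2\<close> with respect to the metric \<open>w (dt\<^sup>2 + d\<theta>\<^sup>2)\<close>.\<close>

definition differential_sq :: "real \<Rightarrow> (real \<times> real \<Rightarrow> real) \<Rightarrow>
    (real \<times> real \<Rightarrow> 'b::real_normed_vector) \<Rightarrow> real \<times> real \<Rightarrow> real" where
  "differential_sq T w u x = ((norm (d_t T u x))\<^sup>2 + (norm (d_theta u x))\<^sup>2) / w x"

definition energy :: "real \<Rightarrow> (real \<times> real \<Rightarrow> real) \<Rightarrow>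
    (real \<times> real \<Rightarrow> 'b::real_normed_vector) \<Rightarrow> real" where
  "energy T w u = 1/2 * integral ({0..T} \<times> {0..2 * pi}) (\<lambda>x. differential_sq T w u x * w x)"

definition bdry_integral ::
    "real \<Rightarrow> (real \<times> real \<Rightarrow> real) \<Rightarrow> (real \<times> real \<Rightarrow> real) \<Rightarrow> real" where
  "bdry_integral T w r = (\<Sum>t \<in> {0, T}. integral {0..2 * pi} (\<lambda>\<theta>. r (t, \<theta>) * sqrt (w (t, \<theta>))))"

definition harmonic :: "real \<Rightarrow> (real \<times> real \<Rightarrow> real) \<Rightarrow>
    (real \<times> real \<Rightarrow> 'b::real_normed_vector) \<Rightarrow> bool" where
  "harmonic T w u \<longleftrightarrow> smooth_annulus_fun T u \<and> (\<forall>x \<in> annulus T. laplacian T w u x = 0)"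


section \<open>Steklov eigenvalues\<close>

definition lin_indep_on :: "'a set \<Rightarrow> ('a \<Rightarrow> real) list \<Rightarrow> bool" where
  "lin_indep_on A us \<longleftrightarrow> (\<forall>c. (\<forall>x \<in> A. (\<Sum>i<length us. c i * (us ! i) x) = 0) \<longrightarrow>
     (\<forall>i<length us. c i = 0))"

text \<open>The zero function is included here.\<close>

definition steklov_eigenfunction :: "real \<Rightarrow> (real \<times> real \<Rightarrow> real) \<Rightarrow>
    (real \<times> real \<Rightarrow> real) \<Rightarrow> real \<Rightarrow> (real \<times> real \<Rightarrow> real) \<Rightarrow> bool" where
  "steklov_eigenfunction T w \<rho> s u \<longleftrightarrow> harmonic T w u \<and>
     (\<forall>x \<in> annulus_bdry T. normal_deriv T w u x = s * \<rho> x * u x)"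

text \<open>
  With the eigenvalues listed in increasing order with multiplicity, starting at index \<open>0\<close>, the
  \<open>k\<close>-th one is the smallest \<open>s\<close> such that the eigenvalues \<open>\<le> s\<close> have total multiplicity at least
  \<open>k + 1\<close>, i.e. admit \<open>k + 1\<close> linearly independent eigenfunctions.
\<close>

definition steklov :: "nat \<Rightarrow> real \<Rightarrow> (real \<times> real \<Rightarrow> real) \<Rightarrow> (real \<times> real \<Rightarrow> real) \<Rightarrow> real" where
  "steklov k T w \<rho> = Inf {s. \<exists>us. length us = k + 1 \<and> lin_indep_on (annulus T) us \<and>
     (\<forall>u \<in> set us. \<exists>s' \<le> s. steklov_eigenfunction T w \<rho> s' u)}"

definition steklov_bar ::
    "nat \<Rightarrow> real \<Rightarrow> (real \<times> real \<Rightarrow> real) \<Rightarrow> (real \<times> real \<Rightarrow> real) \<Rightarrow> real" where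
  "steklov_bar k T w \<rho> = steklov k T w \<rho> * bdry_integral T w \<rho>"

text \<open>Smooth families of metrics and densities with parameter in \<open>{-\<epsilon><..<\<epsilon>}\<close>, jointly smooth in
  the parameter and the point.\<close>

definition smooth_family :: "real \<Rightarrow> real \<Rightarrow> (real \<Rightarrow> real \<times> real \<Rightarrow> real) \<Rightarrow>
    (real \<Rightarrow> real \<times> real \<Rightarrow> real) \<Rightarrow> bool" where
  "smooth_family T \<epsilon> W P \<longleftrightarrow>
     smooth_on ({-\<epsilon><..<\<epsilon>} \<times> annulus T) (\<lambda>(s, x). W s x) \<and>
     (\<forall>t \<in> {0, T}. smooth_on ({-\<epsilon><..<\<epsilon>} \<times> UNIV) (\<lambda>(s, \<theta>). P s (t, \<theta>))) \<and>
     (\<forall>s \<in> {-\<epsilon><..<\<epsilon>}. conformal_metric T (W s) \<and> bdry_density T (P s))"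

definition conformally_extremal ::
    "nat \<Rightarrow> real \<Rightarrow> (real \<times> real \<Rightarrow> real) \<Rightarrow> (real \<times> real \<Rightarrow> real) \<Rightarrow> bool" where
  "conformally_extremal k T w \<rho> \<longleftrightarrow> conformal_metric T w \<and> bdry_density T \<rho> \<and>
     (\<forall>\<epsilon>>0. \<forall>W P. smooth_family T \<epsilon> W P \<longrightarrow>
        (\<forall>x \<in> annulus T. W 0 x = w x) \<longrightarrow> (\<forall>x \<in> annulus_bdry T. P 0 x = \<rho> x) \<longrightarrow>
        (\<exists>r \<in> o[at 0](\<lambda>s. s). \<forall>\<^sub>F s in at 0.
           steklov_bar k T (W s) (P s) \<le> steklov_bar k T w \<rho> + r s) \<or>
        (\<exists>r \<in> o[at 0](\<lambda>s. s). \<forall>\<^sub>F s in at 0.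
           steklov_bar k T (W s) (P s) \<ge> steklov_bar k T w \<rho> + r s))"


section \<open>Free boundary harmonic maps into the unit ball\<close>

definition free_boundary_harmonic ::
    "real \<Rightarrow> (real \<times> real \<Rightarrow> real) \<Rightarrow> (real \<times> real \<Rightarrow> real^3) \<Rightarrow> bool" where
  "free_boundary_harmonic T w \<Psi> \<longleftrightarrow> harmonic T w \<Psi> \<and>
     (\<forall>x \<in> annulus T. \<Psi> x \<in> cball 0 1 \<and> (\<Psi> x \<in> sphere 0 1 \<longleftrightarrow> x \<in> annulus_bdry T)) \<and>
     (\<forall>x \<in> annulus_bdry T. normal_deriv T w \<Psi> x = norm (normal_deriv T w \<Psi> x) *\<^sub>R \<Psi> x)"

definition nondegenerate :: "real \<Rightarrow> (real \<times> real \<Rightarrow> real^3) \<Rightarrow> bool" where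
  "nondegenerate T \<Psi> \<longleftrightarrow> (\<forall>x \<in> annulus T. d_t T \<Psi> x \<noteq> 0 \<or> d_theta \<Psi> x \<noteq> 0)"

text \<open>Rodrigues' formula for the rotation by angle \<open>\<phi>\<close> about the axis spanned by the unit vector \<open>e\<close>.\<close>

definition rotation_about :: "real^3 \<Rightarrow> real \<Rightarrow> real^3 \<Rightarrow> real^3" where
  "rotation_about e \<phi> v = cos \<phi> *\<^sub>R v + sin \<phi> *\<^sub>R cross3 e v + ((1 - cos \<phi>) * (e \<bullet> v)) *\<^sub>R e"

definition rot_symmetric_map :: "real \<Rightarrow> (real \<times> real \<Rightarrow> real^3) \<Rightarrow> bool" where
  "rot_symmetric_map T \<Psi> \<longleftrightarrow> (\<exists>e. norm e = 1 \<and>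
     (\<forall>(t, \<theta>) \<in> annulus T. \<forall>\<phi>. \<Psi> (t, \<theta> + \<phi>) = rotation_about e \<phi> (\<Psi> (t, \<theta>))))"

definition rot_symmetric_pair ::
    "real \<Rightarrow> (real \<times> real \<Rightarrow> real) \<Rightarrow> (real \<times> real \<Rightarrow> real) \<Rightarrow> bool" where
  "rot_symmetric_pair T w \<rho> \<longleftrightarrow>
     (\<forall>(t, \<theta>) \<in> annulus T. \<forall>\<phi>. w (t, \<theta> + \<phi>) = w (t, \<theta>)) \<and>
     (\<forall>(t, \<theta>) \<in> annulus_bdry T. \<forall>\<phi>. \<rho> (t, \<theta> + \<phi>) = \<rho> (t, \<theta>))"

text \<open>Eigenfunctions, on the boundary, of \<open>u \<mapsto> \<partial>\<^sub>\<nu> v - |\<partial>\<^sub>\<nu> \<Psi>| u\<close>, where \<open>v\<close> is the harmonic extension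
  of \<open>u\<close>.\<close>

definition index_eigenfunction :: "real \<Rightarrow> (real \<times> real \<Rightarrow> real) \<Rightarrow> (real \<times> real \<Rightarrow> real^3) \<Rightarrow>
    real \<Rightarrow> (real \<times> real \<Rightarrow> real) \<Rightarrow> bool" where
  "index_eigenfunction T w \<Psi> \<mu> u \<longleftrightarrow> smooth_bdry_fun T u \<and>
     (\<exists>v. harmonic T w v \<and> (\<forall>x \<in> annulus_bdry T. v x = u x \<and>
        normal_deriv T w v x - norm (normal_deriv T w \<Psi> x) * u x = \<mu> * u x))"

text \<open>The number of negative eigenvalues, counted with multiplicity.\<close>

definition spectral_index ::
    "real \<Rightarrow> (real \<times> real \<Rightarrow> real) \<Rightarrow> (real \<times> real \<Rightarrow> real^3) \<Rightarrow> enat" where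
  "spectral_index T w \<Psi> = Sup {enat n |n. \<exists>us. length us = n \<and> lin_indep_on (annulus_bdry T) us \<and>
     (\<forall>u \<in> set us. \<exists>\<mu> < 0. index_eigenfunction T w \<Psi> \<mu> u)}"

text \<open>The metric and the density induced by a map: \<open>|d\<Psi>|\<^sup>2/2\<close> times the background metric \<open>w\<close>, and
  the length of the normal derivative with respect to the induced metric.\<close>

definition induced_metric ::
    "real \<Rightarrow> (real \<times> real \<Rightarrow> real) \<Rightarrow> (real \<times> real \<Rightarrow> real^3) \<Rightarrow> real \<times> real \<Rightarrow> real" where
  "induced_metric T w \<Psi> x = 1/2 * differential_sq T w \<Psi> x * w x"

definition induced_density ::
    "real \<Rightarrow> (real \<times> real \<Rightarrow> real) \<Rightarrow> (real \<times> real \<Rightarrow> real^3) \<Rightarrow> real \<times> real \<Rightarrow> real" where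
  "induced_density T w \<Psi> x = norm (normal_deriv T (induced_metric T w \<Psi>) \<Psi> x)"


section \<open>The critical catenoid\<close>

text \<open>The catenoid centred at the origin with axis spanned by the unit vector \<open>e\<close> and neck radius \<open>c\<close>.\<close>

definition catenoid :: "real^3 \<Rightarrow> real \<Rightarrow> (real^3) set" where
  "catenoid e c = {v. norm (v - (v \<bullet> e) *\<^sub>R e) = c * cosh ((v \<bullet> e) / c)}"

text \<open>Velocities at \<open>v\<close> of curves in \<open>M\<close>; for an embedded surface \<open>M\<close> this is the tangent plane.\<close>

definition tangent_vectors :: "(real^3) set \<Rightarrow> real^3 \<Rightarrow> (real^3) set" where
  "tangent_vectors M v = {\<xi>. \<exists>\<gamma>::real \<Rightarrow> real^3. range \<gamma> \<subseteq> M \<and> \<gamma> 0 = v \<and>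
     (\<gamma> has_vector_derivative \<xi>) (at 0)}"

text \<open>A surface \<open>M\<close> meets the unit sphere orthogonally at \<open>v\<close> if the normal \<open>v\<close> of the sphere is
  tangent to \<open>M\<close>.\<close>

definition critical_catenoid :: "(real^3) set \<Rightarrow> bool" where
  "critical_catenoid K \<longleftrightarrow> (\<exists>e c. norm e = 1 \<and> c > 0 \<and> K = catenoid e c \<inter> cball 0 1 \<and>
     catenoid e c \<inter> sphere 0 1 \<noteq> {} \<and>
     (\<forall>v \<in> catenoid e c \<inter> sphere 0 1. v \<in> tangent_vectors (catenoid e c) v))"

text \<open>\<open>\<Psi>\<close> is a conformal immersion of the annulus parametrizing \<open>K\<close> bijectively.\<close>

definition conformal_parametrization ::
    "real \<Rightarrow> (real \<times> real \<Rightarrow> real^3) \<Rightarrow> (real^3) set \<Rightarrow> bool" where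
  "conformal_parametrization T \<Psi> K \<longleftrightarrow> smooth_annulus_fun T \<Psi> \<and>
     (\<forall>x \<in> annulus T. d_t T \<Psi> x \<noteq> 0 \<and> d_t T \<Psi> x \<bullet> d_theta \<Psi> x = 0 \<and>
        norm (d_t T \<Psi> x) = norm (d_theta \<Psi> x)) \<and>
     bij_betw \<Psi> ({0..T} \<times> {0..<2 * pi}) K"


section \<open>The critical modulus\<close>

definition coth :: "real \<Rightarrow> real" where
  "coth t = cosh t / sinh t"

definition t1 :: real where
  "t1 = (THE t. t > 0 \<and> t = coth t)"

definition T1 :: real where
  "T1 = 2 * t1"

end

theory Submission
  imports Defs
begin

text \<open>
  \<^bold>\<open>The maps.\<close> A rotationally symmetric harmonic map has the form
  \<open>\<Psi> = (f(t) cos \<theta>, f(t) sin \<theta>, h(t))\<close> with \<open>f'' = f\<close> and \<open>h'' = 0\<close>, say \<open>f = a cosh (t - p)\<close> and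
  \<open>h = b (t - q)\<close>. Asking that \<open>\<Psi>\<close> be a Steklov map on both boundary circles gives \<open>q = coth p\<close>
  and \<open>T - q = coth (T - p)\<close>, that is, the single equation \<open>coth p + coth (T - p) = T\<close>; the two
  conditions \<open>|\<Psi>| = 1\<close> on the boundary are then linear in \<open>a\<^sup>2\<close> and \<open>b\<^sup>2\<close>. At \<open>T = 2 t\<^sub>1\<close> the
  symmetric solution \<open>p = T/2 = t\<^sub>1\<close> is available and, with \<open>a = b\<close>, gives the critical catenoid.
  For larger \<open>T\<close> a solution \<open>p < T/2\<close> branches off, by the intermediate value theorem. Since
  \<open>coth p\<close> is close to \<open>T\<close> for large \<open>T\<close>, the neck moves to one end of the annulus: \<open>tanh p \<sim> 1/T\<close>
  and \<open>tanh (T - p) \<rightarrow> 1\<close>. The normal derivatives on the boundary have lengths \<open>tanh p\<close> and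
  \<open>tanh (T - p)\<close>, and integration by parts gives \<open>2E = 2\<pi> (tanh p + tanh (T - p))\<close>; the bound
  \<open>2E > 2\<pi>\<close> and both statements about large \<open>T\<close> are estimates of these two numbers.

  \<^bold>\<open>The first eigenvalue and the index.\<close> The functions \<open>\<Psi>\<^sub>i\<close> are Steklov eigenfunctions with
  eigenvalue \<open>1\<close> for the induced pair. For an eigenfunction with eigenvalue below \<open>1\<close>, every
  Fourier coefficient in \<open>\<theta>\<close> of nonzero frequency vanishes, because \<open>cosh (t - p)\<close> is a positive
  solution at the critical Robin parameters (\<open>robin_ode_trivial\<close>). What remains is an affine
  function of \<open>t\<close>, and the boundary conditions become a quadratic equation that can be solved
  explicitly. It yields \<open>\<sigma>\<^sub>1 = 1\<close> (\<open>steklov_1_Psi\<close>), and the same argument applied to the index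
  operator yields exactly one negative eigenvalue (\<open>spectral_index_Psi\<close>).

  \<^bold>\<open>Extremality.\<close> For an arbitrary competitor \<open>(w, r)\<close> the functions \<open>\<Psi>\<^sub>i - c\<^sub>i\<close>, with \<open>c\<close> the
  centre of mass of the boundary measure, are admissible in the variational characterization of
  \<open>\<sigma>\<^sub>1\<close>. Because \<open>|\<Psi>| = 1\<close> on the boundary, summing over \<open>i\<close> bounds \<open>\<sigma>\<^sub>1 M (1 - |c|\<^sup>2)\<close> by \<open>2E\<close>,
  where \<open>M\<close> is the mass of the boundary (\<open>hersch\<close>). Along a smooth family through the extremal
  pair the centre of mass starts at the origin and moves by \<open>O(s)\<close>, so \<open>\<sigma>\<^sub>1 M \<le> 2E + O(s\<^sup>2)\<close>
  (\<open>conformally_extremal_Psi\<close>).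

  \<^bold>\<open>Existence of an eigenfunction.\<close> The eigenvalue \<open>\<sigma>\<^sub>1\<close> is an infimum over eigenvalues that have
  eigenfunctions smooth up to the boundary. A variational upper bound for it therefore needs, for
  every smooth density, a smooth eigenfunction whose eigenvalue lies below the Rayleigh quotients
  in question. It is obtained as a series in the explicit harmonic modes of the annulus, in which
  the Dirichlet energy is diagonal and the boundary measure becomes a matrix whose entries decay
  rapidly in the sum and the difference of the frequencies. Minimizers on the first \<open>N\<close> modes have
  coefficients that decay faster than any power of the frequency, uniformly in \<open>N\<close>
  (\<open>galerkin_solution_decay\<close>); hence a subsequence converges and the limiting series may be
  differentiated term by term (\<open>ex_limit_solution\<close>, \<open>ex_steklov_solution\<close>).
\<close>

section \<open>Functions smooth up to the boundary\<close>

lemma smooth_on_cong: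
  assumes "smooth_on S f" "\<And>x. x \<in> S \<Longrightarrow> f x = g x"
  shows "smooth_on S g"
proof -
  from assms(1) obtain D where D:
    "\<And>x. x \<in> S \<Longrightarrow> (f has_derivative (\<lambda>h. \<Sum>b\<in>Basis. (h \<bullet> b) *\<^sub>R D b x)) (at x within S)"
    "\<And>b. b \<in> Basis \<Longrightarrow> smooth_on S (D b)"
    by (cases rule: smooth_on.cases) blast
  show ?thesis
  proof (rule smooth_on.intros[of _ g D])
    fix x assume "x \<in> S"
    then show "(g has_derivative (\<lambda>h. \<Sum>b\<in>Basis. (h \<bullet> b) *\<^sub>R D b x)) (at x within S)"
      using has_derivative_transform[OF _ _ D(1)] assms(2) by metis
  qed (use D in auto)
qed

lemma smooth_on_obtain:
  assumes "smooth_on S f"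
  obtains D where
    "\<And>x. x \<in> S \<Longrightarrow> (f has_derivative (\<lambda>h. \<Sum>b\<in>Basis. (h \<bullet> b) *\<^sub>R D b x)) (at x within S)"
    "\<And>b. b \<in> Basis \<Longrightarrow> smooth_on S (D b)"
  using assms by (cases rule: smooth_on.cases) blast

lemma smooth_on_unfold:
  "smooth_on S f \<longleftrightarrow> (\<exists>D. (\<forall>x\<in>S. (f has_derivative (\<lambda>h. \<Sum>b\<in>Basis. (h \<bullet> b) *\<^sub>R D b x)) (at x within S))
    \<and> (\<forall>b\<in>Basis. smooth_on S (D b)))"
  by (subst smooth_on.simps) blast

lemma smooth_on_imp_continuous_on: "smooth_on S f \<Longrightarrow> continuous_on S f"
  by (erule smooth_on_obtain) (rule has_derivative_continuous_on)

text \<open>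
  The form of coinduction used throughout: a class of differentiable functions that is closed
  under taking partial derivatives consists of smooth functions.
\<close>

lemma smooth_on_from_closure:
  assumes "P f"
    and "\<And>f. P f \<Longrightarrow> \<exists>D. (\<forall>x\<in>S. (f has_derivative (\<lambda>h. \<Sum>b\<in>Basis. (h \<bullet> b) *\<^sub>R D b x)) (at x within S))
        \<and> (\<forall>b\<in>Basis. P (D b))"
  shows "smooth_on S f"
  using assms(1)
proof (coinduction arbitrary: f rule: smooth_on.coinduct)
  case smooth_on
  with assms(2)[OF this] show ?case by blast
qed

lemma smooth_on_const: "smooth_on S (\<lambda>_. c)"
proof (rule smooth_on_from_closure[of "\<lambda>f. \<exists>c. f = (\<lambda>_. c)"])
  fix f :: "'a \<Rightarrow> 'b" assume "\<exists>c. f = (\<lambda>_. c)"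
  then obtain c where "f = (\<lambda>_. c)" by blast
  then show "\<exists>D. (\<forall>x\<in>S. (f has_derivative (\<lambda>h. \<Sum>b\<in>Basis. (h \<bullet> b) *\<^sub>R D b x)) (at x within S))
        \<and> (\<forall>b\<in>Basis. \<exists>c. D b = (\<lambda>_. c))"
    by (intro exI[of _ "\<lambda>_ _. 0"]) auto
qed auto

lemma smooth_on_linear:
  assumes "bounded_linear f"
  shows "smooth_on S f"
proof (rule smooth_on.intros[of _ _ "\<lambda>b _. f b"])
  interpret bounded_linear f by fact
  fix x
  have "f = (\<lambda>h. \<Sum>b\<in>Basis. (h \<bullet> b) *\<^sub>R f b)"
  proof
    fix h
    have "f h = f (\<Sum>b\<in>Basis. (h \<bullet> b) *\<^sub>R b)" by (simp add: euclidean_representation)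
    also have "\<dots> = (\<Sum>b\<in>Basis. (h \<bullet> b) *\<^sub>R f b)" by (simp add: sum scaleR)
    finally show "f h = (\<Sum>b\<in>Basis. (h \<bullet> b) *\<^sub>R f b)" .
  qed
  then show "(f has_derivative (\<lambda>h. \<Sum>b\<in>Basis. (h \<bullet> b) *\<^sub>R f b)) (at x within S)"
    using bounded_linear_imp_has_derivative[OF assms] by metis
qed (rule smooth_on_const)

text \<open>
  Products and compositions of smooth functions have partial derivatives that are sums of such
  terms again, so neither class is closed under differentiation by itself. Generating both
  together gives a class that is. The rule for composition takes a whole sequence \<open>F\<close> of iterated
  derivatives of the outer function.
\<close>

inductive smooth_gen :: "'a::euclidean_space set \<Rightarrow> ('a \<Rightarrow> real) \<Rightarrow> bool" for S where
  base: "smooth_on S f \<Longrightarrow> smooth_gen S f"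
| add: "smooth_gen S f \<Longrightarrow> smooth_gen S g \<Longrightarrow> smooth_gen S (\<lambda>x. f x + g x)"
| mult: "smooth_gen S f \<Longrightarrow> smooth_gen S g \<Longrightarrow> smooth_gen S (\<lambda>x. f x * g x)"
| comp: "smooth_on S f \<Longrightarrow> (\<And>k y. y \<in> U \<Longrightarrow> (F k has_real_derivative F (Suc k) y) (at y)) \<Longrightarrow>
    f ` S \<subseteq> U \<Longrightarrow> smooth_gen S (\<lambda>x. F (k::nat) (f x))"

lemma smooth_gen_derivative:
  assumes "smooth_gen S f"
  shows "\<exists>D. (\<forall>x\<in>S. (f has_derivative (\<lambda>h. \<Sum>b\<in>Basis. (h \<bullet> b) *\<^sub>R D b x)) (at x within S))
    \<and> (\<forall>b\<in>Basis. smooth_gen S (D b))"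
  using assms
proof (induction rule: smooth_gen.induct)
  case (base f)
  then show ?case by (elim smooth_on_obtain) (blast intro: smooth_gen.base)
next
  case (add f g)
  then obtain D E where *:
    "\<forall>x\<in>S. (f has_derivative (\<lambda>h. \<Sum>b\<in>Basis. (h \<bullet> b) *\<^sub>R D b x)) (at x within S)"
    "\<forall>b\<in>Basis. smooth_gen S (D b)"
    "\<forall>x\<in>S. (g has_derivative (\<lambda>h. \<Sum>b\<in>Basis. (h \<bullet> b) *\<^sub>R E b x)) (at x within S)"
    "\<forall>b\<in>Basis. smooth_gen S (E b)" by blast
  show ?case
  proof (intro exI[of _ "\<lambda>b x. D b x + E b x"] conjI ballI)
    fix x assume "x \<in> S"
    then have "((\<lambda>x. f x + g x) has_derivative
        (\<lambda>h. (\<Sum>b\<in>Basis. (h \<bullet> b) *\<^sub>R D b x) + (\<Sum>b\<in>Basis. (h \<bullet> b) *\<^sub>R E b x))) (at x within S)"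
      using * by (intro has_derivative_add) auto
    then show "((\<lambda>x. f x + g x) has_derivative
        (\<lambda>h. \<Sum>b\<in>Basis. (h \<bullet> b) *\<^sub>R (D b x + E b x))) (at x within S)"
      by (simp add: sum.distrib algebra_simps)
  qed (use * in \<open>auto intro: smooth_gen.add\<close>)
next
  case (mult f g)
  then obtain D E where *:
    "\<forall>x\<in>S. (f has_derivative (\<lambda>h. \<Sum>b\<in>Basis. (h \<bullet> b) *\<^sub>R D b x)) (at x within S)"
    "\<forall>b\<in>Basis. smooth_gen S (D b)"
    "\<forall>x\<in>S. (g has_derivative (\<lambda>h. \<Sum>b\<in>Basis. (h \<bullet> b) *\<^sub>R E b x)) (at x within S)"
    "\<forall>b\<in>Basis. smooth_gen S (E b)" by blast
  show ?case
  proof (intro exI[of _ "\<lambda>b x. f x * E b x + D b x * g x"] conjI ballI)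
    fix x assume "x \<in> S"
    then have "((\<lambda>x. f x * g x) has_derivative
        (\<lambda>h. f x * (\<Sum>b\<in>Basis. (h \<bullet> b) *\<^sub>R E b x) + (\<Sum>b\<in>Basis. (h \<bullet> b) *\<^sub>R D b x) * g x)) (at x within S)"
      using * by (intro has_derivative_mult) auto
    then show "((\<lambda>x. f x * g x) has_derivative
        (\<lambda>h. \<Sum>b\<in>Basis. (h \<bullet> b) *\<^sub>R (f x * E b x + D b x * g x))) (at x within S)"
      by (simp add: sum.distrib algebra_simps sum_distrib_left sum_distrib_right)
  next
    fix b :: 'a assume "b \<in> Basis"
    with * mult(1,2) show "smooth_gen S (\<lambda>x. f x * E b x + D b x * g x)"
      by (intro smooth_gen.add smooth_gen.mult) auto
  qed
next
  case (comp f U F k)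
  from comp(1) obtain D where D:
    "\<And>x. x \<in> S \<Longrightarrow> (f has_derivative (\<lambda>h. \<Sum>b\<in>Basis. (h \<bullet> b) *\<^sub>R D b x)) (at x within S)"
    "\<And>b. b \<in> Basis \<Longrightarrow> smooth_on S (D b)"
    by (rule smooth_on_obtain) blast
  show ?case
  proof (intro exI[of _ "\<lambda>b x. F (Suc k) (f x) * D b x"] conjI ballI)
    fix x assume x: "x \<in> S"
    then have "(F k has_derivative (*) (F (Suc k) (f x))) (at (f x))"
      using comp(2,3) by (auto simp: has_field_derivative_def)
    from has_derivative_compose[OF D(1)[OF x] this]
    show "((\<lambda>x. F k (f x)) has_derivative
        (\<lambda>h. \<Sum>b\<in>Basis. (h \<bullet> b) *\<^sub>R (F (Suc k) (f x) * D b x))) (at x within S)"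
      by (simp add: sum_distrib_left algebra_simps)
  next
    fix b :: 'a assume "b \<in> Basis"
    then show "smooth_gen S (\<lambda>x. F (Suc k) (f x) * D b x)"
      using D(2) by (intro smooth_gen.mult smooth_gen.comp[of _ f U F "Suc k"] comp) (auto intro: smooth_gen.base)
  qed
qed

lemma smooth_gen_imp_smooth_on: "smooth_gen S f \<Longrightarrow> smooth_on S f"
  by (rule smooth_on_from_closure[of "smooth_gen S"]) (assumption | rule smooth_gen_derivative)+

lemma smooth_on_add_real:
  fixes f g :: "'a::euclidean_space \<Rightarrow> real"
  shows "smooth_on S f \<Longrightarrow> smooth_on S g \<Longrightarrow> smooth_on S (\<lambda>x. f x + g x)"
  by (blast intro: smooth_gen_imp_smooth_on smooth_gen.intros)

lemma smooth_on_mult: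
  fixes f g :: "'a::euclidean_space \<Rightarrow> real"
  shows "smooth_on S f \<Longrightarrow> smooth_on S g \<Longrightarrow> smooth_on S (\<lambda>x. f x * g x)"
  by (blast intro: smooth_gen_imp_smooth_on smooth_gen.intros)

text \<open>
  The outer function is given by the sequence of its derivatives, and only near the values of \<open>f\<close>,
  so that the rule covers the square root of a positive function.
\<close>

lemma smooth_on_compose_derivs:
  fixes f :: "'a::euclidean_space \<Rightarrow> real" and F :: "nat \<Rightarrow> real \<Rightarrow> real"
  assumes "smooth_on S f" "\<And>k y. y \<in> U \<Longrightarrow> (F k has_real_derivative F (Suc k) y) (at y)"
    and "f ` S \<subseteq> U"
  shows "smooth_on S (\<lambda>x. F k (f x))"
  using assms by (blast intro: smooth_gen_imp_smooth_on smooth_gen.comp)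

lemma smooth_on_cos:
  fixes f :: "'a::euclidean_space \<Rightarrow> real"
  assumes "smooth_on S f" shows "smooth_on S (\<lambda>x. cos (f x))"
proof -
  have "((\<lambda>y. cos (y + real k * pi / 2)) has_real_derivative cos (y + real (Suc k) * pi / 2)) (at y)"
    for k y
  proof -
    have "cos (y + real (Suc k) * pi / 2) = cos ((y + real k * pi / 2) + pi / 2)"
      by (simp add: field_simps)
    also have "\<dots> = - sin (y + real k * pi / 2)"
      by (simp add: minus_sin_cos_eq)
    finally show ?thesis by (auto intro!: derivative_eq_intros)
  qed
  then have "smooth_on S (\<lambda>x. (\<lambda>k y. cos (y + real k * pi / 2)) 0 (f x))"
    by (intro smooth_on_compose_derivs[OF assms, of UNIV "\<lambda>k y. cos (y + real k * pi / 2)" 0]) auto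
  then show ?thesis by simp
qed

lemma smooth_on_exp:
  fixes f :: "'a::euclidean_space \<Rightarrow> real"
  assumes "smooth_on S f" shows "smooth_on S (\<lambda>x. exp (f x))"
  using smooth_on_compose_derivs[OF assms, of UNIV "\<lambda>_. exp" 0]
  by (auto intro!: derivative_eq_intros)

lemma smooth_on_sqrt:
  fixes f :: "'a::euclidean_space \<Rightarrow> real"
  assumes "smooth_on S f" "\<And>x. x \<in> S \<Longrightarrow> f x > 0" shows "smooth_on S (\<lambda>x. sqrt (f x))"
proof -
  have "smooth_on S (\<lambda>x. (\<lambda>k y. (\<Prod>i<k. 1/2 - real i) * y powr (1/2 - real k)) 0 (f x))"
    by (rule smooth_on_compose_derivs[OF assms(1), of "{0<..}"])
       (use assms(2) in \<open>auto intro!: derivative_eq_intros simp: algebra_simps\<close>)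
  then show ?thesis
    by (rule smooth_on_cong) (use assms(2) in \<open>auto simp: powr_half_sqrt less_imp_le\<close>)
qed

lemma smooth_on_scaleR_const:
  fixes v :: "'b::real_normed_vector"
  assumes "smooth_on S f"
  shows "smooth_on S (\<lambda>x. f x *\<^sub>R v)"
proof (rule smooth_on_from_closure[of "\<lambda>F. \<exists>f. smooth_on S f \<and> F = (\<lambda>x. f x *\<^sub>R v)"])
  fix F assume "\<exists>f. smooth_on S f \<and> F = (\<lambda>x. f x *\<^sub>R v)"
  then obtain f where F: "F = (\<lambda>x. f x *\<^sub>R v)" and "smooth_on S f" by blast
  from this(2) obtain D where D:
    "\<And>x. x \<in> S \<Longrightarrow> (f has_derivative (\<lambda>h. \<Sum>b\<in>Basis. (h \<bullet> b) *\<^sub>R D b x)) (at x within S)"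
    "\<And>b. b \<in> Basis \<Longrightarrow> smooth_on S (D b)"
    unfolding smooth_on_unfold[of S f] by blast
  show "\<exists>D. (\<forall>x\<in>S. (F has_derivative (\<lambda>h. \<Sum>b\<in>Basis. (h \<bullet> b) *\<^sub>R D b x)) (at x within S)) \<and>
      (\<forall>b\<in>Basis. \<exists>f. smooth_on S f \<and> D b = (\<lambda>x. f x *\<^sub>R v))"
  proof (intro exI[of _ "\<lambda>b x. D b x *\<^sub>R v"] conjI ballI)
    fix x assume "x \<in> S"
    from has_derivative_scaleR_left[OF D(1)[OF this]]
    show "(F has_derivative (\<lambda>h. \<Sum>b\<in>Basis. (h \<bullet> b) *\<^sub>R D b x *\<^sub>R v)) (at x within S)"
      by (simp add: F scaleR_sum_left)
  qed (use D in auto)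
qed (use assms in auto)

lemma smooth_on_add:
  fixes f g :: "'a::euclidean_space \<Rightarrow> 'b::real_normed_vector"
  assumes "smooth_on S f" "smooth_on S g"
  shows "smooth_on S (\<lambda>x. f x + g x)"
proof (rule smooth_on_from_closure[of "\<lambda>F. \<exists>f g. smooth_on S f \<and> smooth_on S g \<and> F = (\<lambda>x. f x + g x)"])
  fix F :: "'a \<Rightarrow> 'b" assume "\<exists>f g. smooth_on S f \<and> smooth_on S g \<and> F = (\<lambda>x. f x + g x)"
  then obtain f g where F: "F = (\<lambda>x. f x + g x)" and "smooth_on S f" "smooth_on S g" by blast
  from this(2,3) obtain D E where D:
    "\<And>x. x \<in> S \<Longrightarrow> (f has_derivative (\<lambda>h. \<Sum>b\<in>Basis. (h \<bullet> b) *\<^sub>R D b x)) (at x within S)"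
    "\<And>b. b \<in> Basis \<Longrightarrow> smooth_on S (D b)"
    "\<And>x. x \<in> S \<Longrightarrow> (g has_derivative (\<lambda>h. \<Sum>b\<in>Basis. (h \<bullet> b) *\<^sub>R E b x)) (at x within S)"
    "\<And>b. b \<in> Basis \<Longrightarrow> smooth_on S (E b)"
    unfolding smooth_on_unfold[of S f] smooth_on_unfold[of S g] by blast
  show "\<exists>D. (\<forall>x\<in>S. (F has_derivative (\<lambda>h. \<Sum>b\<in>Basis. (h \<bullet> b) *\<^sub>R D b x)) (at x within S)) \<and>
      (\<forall>b\<in>Basis. \<exists>f g. smooth_on S f \<and> smooth_on S g \<and> D b = (\<lambda>x. f x + g x))"
  proof (intro exI[of _ "\<lambda>b x. D b x + E b x"] conjI ballI)
    fix x assume "x \<in> S"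
    from has_derivative_add[OF D(1)[OF this] D(3)[OF this]]
    show "(F has_derivative (\<lambda>h. \<Sum>b\<in>Basis. (h \<bullet> b) *\<^sub>R (D b x + E b x))) (at x within S)"
      by (simp add: F sum.distrib scaleR_add_right)
  qed (use D in blast)
qed (use assms in blast)

lemma Basis_real2: "(Basis :: (real \<times> real) set) = {(1,0),(0,1)}"
  by (auto simp: Basis_prod_def)

lemma partials_real2:
  "(\<Sum>b\<in>Basis. ((h :: real \<times> real) \<bullet> b) *\<^sub>R D b) = fst h *\<^sub>R D (1,0) + snd h *\<^sub>R (D (0,1) :: 'b::real_vector)"
  by (cases h) (simp add: Basis_real2)

text \<open>
  Differentiation of a series term by term. The double index \<open>a b\<close> counts derivatives in the two
  coordinate directions, so that one summable majorant for each \<open>a b\<close> controls all derivatives of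
  the sum.
\<close>

lemma smooth_on_series:
  fixes G :: "nat \<Rightarrow> nat \<Rightarrow> nat \<Rightarrow> real \<times> real \<Rightarrow> real"
  assumes S: "convex S"
    and deriv: "\<And>a b k x. x \<in> S \<Longrightarrow> (G a b k has_derivative
      (\<lambda>h. fst h * G (Suc a) b k x + snd h * G a (Suc b) k x)) (at x within S)"
    and bound: "\<And>a b k x. x \<in> S \<Longrightarrow> \<bar>G a b k x\<bar> \<le> M a b k"
    and M: "\<And>a b. summable (M a b)"
  shows "\<And>a b x. x \<in> S \<Longrightarrow> ((\<lambda>x. \<Sum>k. G a b k x) has_derivative
      (\<lambda>h. fst h * (\<Sum>k. G (Suc a) b k x) + snd h * (\<Sum>k. G a (Suc b) k x))) (at x within S)"
    and "smooth_on S (\<lambda>x. \<Sum>k. G a b k x)"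
proof -
  have sm: "summable (\<lambda>k. G a b k x)" if "x \<in> S" for a b x
    by (rule summable_comparison_test[OF _ M[of a b]]) (use bound[OF that] in auto)
  have ul: "uniform_limit S (\<lambda>n x. \<Sum>k<n. G a b k x) (\<lambda>x. \<Sum>k. G a b k x) sequentially" for a b
    by (rule Weierstrass_m_test[OF _ M[of a b]]) (use bound in auto)
  show main: "((\<lambda>x. \<Sum>k. G a b k x) has_derivative
      (\<lambda>h. fst h * (\<Sum>k. G (Suc a) b k x) + snd h * (\<Sum>k. G a (Suc b) k x))) (at x within S)"
    if x: "x \<in> S" for a b x
  proof -
    have "\<exists>g. \<forall>x\<in>S. (\<lambda>n. G a b n x) sums g x \<and> (g has_derivative
        (\<lambda>h. fst h * (\<Sum>k. G (Suc a) b k x) + snd h * (\<Sum>k. G a (Suc b) k x))) (at x within S)"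
    proof (rule has_derivative_series[OF S deriv _ x summable_sums[OF sm[OF x]]])
      fix e :: real assume e: "e > 0"
      have "\<forall>\<^sub>F n in sequentially. \<forall>x\<in>S. dist (\<Sum>k<n. G (Suc a) b k x) (\<Sum>k. G (Suc a) b k x) < e/2"
        "\<forall>\<^sub>F n in sequentially. \<forall>x\<in>S. dist (\<Sum>k<n. G a (Suc b) k x) (\<Sum>k. G a (Suc b) k x) < e/2"
        using uniform_limitD[OF ul, of "e/2"] e by auto
      then show "\<forall>\<^sub>F n in sequentially. \<forall>x\<in>S. \<forall>h. norm ((\<Sum>i<n. fst h * G (Suc a) b i x + snd h * G a (Suc b) i x)
          - (fst h * (\<Sum>k. G (Suc a) b k x) + snd h * (\<Sum>k. G a (Suc b) k x))) \<le> e * norm h"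
      proof (eventually_elim, intro ballI allI)
        fix n x and h :: "real \<times> real"
        assume elim: "\<forall>x\<in>S. dist (\<Sum>k<n. G (Suc a) b k x) (\<Sum>k. G (Suc a) b k x) < e/2"
          "\<forall>x\<in>S. dist (\<Sum>k<n. G a (Suc b) k x) (\<Sum>k. G a (Suc b) k x) < e/2" "x \<in> S"
        let ?A = "(\<Sum>k<n. G (Suc a) b k x) - (\<Sum>k. G (Suc a) b k x)"
        let ?B = "(\<Sum>k<n. G a (Suc b) k x) - (\<Sum>k. G a (Suc b) k x)"
        have "norm ((\<Sum>i<n. fst h * G (Suc a) b i x + snd h * G a (Suc b) i x)
          - (fst h * (\<Sum>k. G (Suc a) b k x) + snd h * (\<Sum>k. G a (Suc b) k x))) = \<bar>fst h * ?A + snd h * ?B\<bar>"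
          unfolding sum.distrib sum_distrib_left[symmetric] right_diff_distrib real_norm_def
          by (simp only: add_diff_add)
        also have "\<dots> \<le> \<bar>fst h\<bar> * \<bar>?A\<bar> + \<bar>snd h\<bar> * \<bar>?B\<bar>"
          using abs_triangle_ineq[of "fst h * ?A" "snd h * ?B"] by (simp only: abs_mult)
        also have "\<dots> \<le> norm h * (e/2) + norm h * (e/2)"
        proof -
          have "\<bar>?A\<bar> \<le> e/2" "\<bar>?B\<bar> \<le> e/2" using elim by (auto simp: dist_real_def)
          moreover have "\<bar>fst h\<bar> \<le> norm h" "\<bar>snd h\<bar> \<le> norm h"
            using norm_fst_le[of "fst h" "snd h"] norm_snd_le[of "snd h" "fst h"] by auto
          ultimately show ?thesis by (intro add_mono mult_mono) auto
        qed
        finally show "norm ((\<Sum>i<n. fst h * G (Suc a) b i x + snd h * G a (Suc b) i x)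
          - (fst h * (\<Sum>k. G (Suc a) b k x) + snd h * (\<Sum>k. G a (Suc b) k x))) \<le> e * norm h"
          by (simp only: mult.commute[of e] distrib_left[symmetric] field_sum_of_halves)
      qed
    qed
    then obtain g where g: "\<And>x. x \<in> S \<Longrightarrow> (\<lambda>n. G a b n x) sums g x"
      "\<And>x. x \<in> S \<Longrightarrow> (g has_derivative
        (\<lambda>h. fst h * (\<Sum>k. G (Suc a) b k x) + snd h * (\<Sum>k. G a (Suc b) k x))) (at x within S)" by blast
    show ?thesis
      by (rule has_derivative_transform[OF x _ g(2)[OF x]]) (use sums_unique[OF g(1)] in simp)
  qed
  show "smooth_on S (\<lambda>x. \<Sum>k. G a b k x)"
  proof (rule smooth_on_from_closure[of "\<lambda>F. \<exists>a b. F = (\<lambda>x. \<Sum>k. G a b k x)"])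
    fix F assume "\<exists>a b. F = (\<lambda>x. \<Sum>k. G a b k x)"
    then obtain a b where F: "F = (\<lambda>x. \<Sum>k. G a b k x)" by blast
    show "\<exists>D. (\<forall>x\<in>S. (F has_derivative (\<lambda>h. \<Sum>b\<in>Basis. (h \<bullet> b) *\<^sub>R D b x)) (at x within S)) \<and>
      (\<forall>b\<in>Basis. \<exists>a' b'. D b = (\<lambda>x. \<Sum>k. G a' b' k x))"
    proof (intro exI[of _ "\<lambda>c x. if c = (1,0) then \<Sum>k. G (Suc a) b k x else \<Sum>k. G a (Suc b) k x"] conjI ballI)
      fix x assume "x \<in> S"
      from main[OF this, of a b] show "(F has_derivative (\<lambda>h. \<Sum>c\<in>Basis. (h \<bullet> c) *\<^sub>R
          (if c = (1,0) then \<Sum>k. G (Suc a) b k x else \<Sum>k. G a (Suc b) k x))) (at x within S)"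
        unfolding F partials_real2 by simp
    next
      fix c :: "real \<times> real"
      show "\<exists>a' b'. (\<lambda>x. if c = (1,0) then \<Sum>k. G (Suc a) b k x else \<Sum>k. G a (Suc b) k x)
          = (\<lambda>x. \<Sum>k. G a' b' k x)" by (cases "c = (1,0)") auto
    qed
  qed auto
qed

text \<open>
  The linear part is required to map coordinate vectors to coordinate vectors, so the partial
  derivatives of the composition are compositions of the same kind with the partial derivatives of
  \<open>f\<close>.
\<close>

lemma smooth_on_affine_subst:
  fixes f :: "'a::euclidean_space \<Rightarrow> 'b::real_normed_vector" and l :: "'c::euclidean_space \<Rightarrow> 'a"
  assumes "smooth_on S f" and l: "bounded_linear l" and basis: "\<And>e. e \<in> Basis \<Longrightarrow> l e \<in> Basis"
    and sub: "\<And>y. y \<in> S' \<Longrightarrow> c + l y \<in> S"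
  shows "smooth_on S' (\<lambda>y. f (c + l y))"
proof (rule smooth_on_from_closure[of "\<lambda>F. \<exists>f. smooth_on S f \<and> F = (\<lambda>y. f (c + l y))"])
  fix F :: "'c \<Rightarrow> 'b" assume "\<exists>f. smooth_on S f \<and> F = (\<lambda>y. f (c + l y))"
  then obtain f where F: "F = (\<lambda>y. f (c + l y))" and "smooth_on S f" by blast
  from this(2) obtain D where D:
    "\<And>x. x \<in> S \<Longrightarrow> (f has_derivative (\<lambda>h. \<Sum>b\<in>Basis. (h \<bullet> b) *\<^sub>R D b x)) (at x within S)"
    "\<And>b. b \<in> Basis \<Longrightarrow> smooth_on S (D b)"
    unfolding smooth_on_unfold[of S f] by blast
  interpret l: bounded_linear l by (rule l)
  show "\<exists>D. (\<forall>x\<in>S'. (F has_derivative (\<lambda>h. \<Sum>b\<in>Basis. (h \<bullet> b) *\<^sub>R D b x)) (at x within S')) \<and>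
      (\<forall>b\<in>Basis. \<exists>f. smooth_on S f \<and> D b = (\<lambda>y. f (c + l y)))"
  proof (intro exI[of _ "\<lambda>e y. D (l e) (c + l y)"] conjI ballI)
    fix y assume y: "y \<in> S'"
    have 1: "((\<lambda>y. c + l y) has_derivative l) (at y within S')"
      using bounded_linear_imp_has_derivative[OF l] by (auto intro!: derivative_eq_intros)
    have 2: "(f has_derivative (\<lambda>h. \<Sum>b\<in>Basis. (h \<bullet> b) *\<^sub>R D b (c + l y))) (at (c + l y) within (\<lambda>y. c + l y) ` S')"
      by (rule has_derivative_subset[OF D(1)[OF sub[OF y]]]) (use sub in auto)
    have "(F has_derivative (\<lambda>h. \<Sum>b\<in>Basis. (l h \<bullet> b) *\<^sub>R D b (c + l y))) (at y within S')"
      unfolding F using has_derivative_in_compose[OF 1 2] .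
    moreover have "(\<Sum>b\<in>Basis. (l h \<bullet> b) *\<^sub>R D b (c + l y)) = (\<Sum>e\<in>Basis. (h \<bullet> e) *\<^sub>R D (l e) (c + l y))" for h
    proof -
      have "l h = l (\<Sum>e\<in>Basis. (h \<bullet> e) *\<^sub>R e)" by (simp add: euclidean_representation)
      also have "\<dots> = (\<Sum>e\<in>Basis. (h \<bullet> e) *\<^sub>R l e)" by (simp add: l.sum l.scaleR)
      finally have lh: "l h = (\<Sum>e\<in>Basis. (h \<bullet> e) *\<^sub>R l e)" .
      have "(\<Sum>b\<in>Basis. (l h \<bullet> b) *\<^sub>R D b (c + l y)) = (\<Sum>b\<in>Basis. \<Sum>e\<in>Basis. ((h \<bullet> e) * (l e \<bullet> b)) *\<^sub>R D b (c + l y))"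
        unfolding lh by (simp add: inner_sum_left scaleR_sum_left)
      also have "\<dots> = (\<Sum>e\<in>Basis. \<Sum>b\<in>Basis. ((h \<bullet> e) * (l e \<bullet> b)) *\<^sub>R D b (c + l y))" by (rule sum.swap)
      also have "\<dots> = (\<Sum>e\<in>Basis. (h \<bullet> e) *\<^sub>R D (l e) (c + l y))"
      proof (rule sum.cong[OF refl])
        fix e :: 'c assume e: "e \<in> Basis"
        have "(\<Sum>b\<in>Basis. ((h \<bullet> e) * (l e \<bullet> b)) *\<^sub>R D b (c + l y)) =
            (\<Sum>b\<in>Basis. if b = l e then (h \<bullet> e) *\<^sub>R D b (c + l y) else 0)"
          by (rule sum.cong[OF refl]) (use basis[OF e] in \<open>auto simp: inner_Basis\<close>)
        also have "\<dots> = (h \<bullet> e) *\<^sub>R D (l e) (c + l y)" using basis[OF e] by (simp add: sum.delta)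
        finally show "(\<Sum>b\<in>Basis. ((h \<bullet> e) * (l e \<bullet> b)) *\<^sub>R D b (c + l y)) = (h \<bullet> e) *\<^sub>R D (l e) (c + l y)" .
      qed
      finally show ?thesis .
    qed
    ultimately show "(F has_derivative (\<lambda>h. \<Sum>e\<in>Basis. (h \<bullet> e) *\<^sub>R D (l e) (c + l y))) (at y within S')" by simp
  next
    fix e :: 'c assume "e \<in> Basis"
    then show "\<exists>f. smooth_on S f \<and> (\<lambda>y. D (l e) (c + l y)) = (\<lambda>y. f (c + l y))"
      using D(2)[OF basis] by blast
  qed
qed (use assms in blast)

lemma smooth_on_slice:
  fixes f :: "real \<times> real \<Rightarrow> 'b::real_normed_vector"
  assumes "smooth_on (A \<times> UNIV) f" "t \<in> A"
  shows "smooth_on UNIV (\<lambda>\<theta>. f (t, \<theta>))"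
proof -
  have "smooth_on UNIV (\<lambda>\<theta>. f ((t, 0) + (0, \<theta>)))"
  proof (rule smooth_on_affine_subst[OF assms(1)])
    show "bounded_linear (\<lambda>\<theta> :: real. (0 :: real, \<theta>))"
      by (intro bounded_linear_Pair bounded_linear_zero bounded_linear_ident)
  qed (use assms(2) in \<open>auto simp: Basis_real2\<close>)
  then show ?thesis by simp
qed

section \<open>Fourier coefficients of periodic functions\<close>

lemma periodic_int_shift:
  fixes g :: "real \<Rightarrow> 'b"
  assumes "\<And>\<theta>. g (\<theta> + 2 * pi) = g \<theta>"
  shows "g (\<theta> + 2 * pi * of_int k) = g \<theta>"
proof -
  have nat: "g (\<theta> + 2 * pi * real n) = g \<theta>" for n \<theta>
  proof (induction n)
    case (Suc n)
    have "g (\<theta> + 2 * pi * real (Suc n)) = g ((\<theta> + 2 * pi * real n) + 2 * pi)"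
      by (simp add: algebra_simps)
    then show ?case using Suc assms by simp
  qed simp
  show ?thesis
  proof (cases "k \<ge> 0")
    case True then show ?thesis using nat[of \<theta> "nat k"] by simp
  next
    case False
    then show ?thesis using nat[of "\<theta> + 2 * pi * of_int k" "nat (- k)"] by simp
  qed
qed

lemma periodic_representative:
  fixes g :: "real \<Rightarrow> 'b"
  assumes "\<And>\<theta>. g (\<theta> + 2 * pi) = g \<theta>"
  obtains \<theta>' where "\<theta>' \<in> {0..<2 * pi}" "g \<theta> = g \<theta>'"
proof -
  let ?k = "\<lfloor>\<theta> / (2 * pi)\<rfloor>"
  have "of_int ?k \<le> \<theta> / (2 * pi)" "\<theta> / (2 * pi) < of_int ?k + 1" by linarith+
  then have "of_int ?k * (2 * pi) \<le> \<theta>" "\<theta> < (of_int ?k + 1) * (2 * pi)"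
    using pi_gt_zero by (simp_all only: pos_le_divide_eq pos_divide_less_eq mult_pos_pos zero_less_numeral)
  then have "\<theta> + 2 * pi * of_int (- ?k) \<in> {0..<2 * pi}" by (simp add: algebra_simps)
  moreover have "g \<theta> = g (\<theta> + 2 * pi * of_int (- ?k))"
    using periodic_int_shift[of g \<theta> "- ?k"] assms by simp
  ultimately show thesis by (rule that)
qed

inductive trig_poly :: "(real \<Rightarrow> real) \<Rightarrow> bool" where
  atom: "trig_poly (\<lambda>\<theta>. c * cos (of_int n * \<theta> + \<phi>))"
| add: "trig_poly g \<Longrightarrow> trig_poly h \<Longrightarrow> trig_poly (\<lambda>\<theta>. g \<theta> + h \<theta>)"

lemma trig_poly_mult:
  assumes "trig_poly g" "trig_poly h"
  shows "trig_poly (\<lambda>\<theta>. g \<theta> * h \<theta>)"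
  using assms
proof (induction arbitrary: h)
  case (atom c n \<phi>)
  then show ?case
  proof (induction)
    case (atom d m \<psi>)
    have "(c * cos (of_int n * \<theta> + \<phi>)) * (d * cos (of_int m * \<theta> + \<psi>)) =
      (c * d / 2) * cos (of_int (n - m) * \<theta> + (\<phi> - \<psi>)) + (c * d / 2) * cos (of_int (n + m) * \<theta> + (\<phi> + \<psi>))"
      for \<theta>
    proof -
      have "of_int (n - m) * \<theta> + (\<phi> - \<psi>) = (of_int n * \<theta> + \<phi>) - (of_int m * \<theta> + \<psi>)"
        "of_int (n + m) * \<theta> + (\<phi> + \<psi>) = (of_int n * \<theta> + \<phi>) + (of_int m * \<theta> + \<psi>)"
        by (simp_all add: algebra_simps)
      then show ?thesis by (simp only: cos_add cos_diff) (simp add: algebra_simps)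
    qed
    then show ?case by (simp only:) (intro trig_poly.intros)
  next
    case (add g h)
    then show ?case using trig_poly.add by (fastforce simp: distrib_left)
  qed
next
  case (add g1 g2)
  then show ?case using trig_poly.add[OF add.IH(1)[OF add.prems] add.IH(2)[OF add.prems]]
    by (simp add: distrib_right)
qed

lemma trig_poly_real_polynomial_cis:
  assumes "real_polynomial_function p"
  shows "trig_poly (\<lambda>\<theta>. p (cis \<theta>))"
  using assms
proof induction
  case (linear f)
  interpret bounded_linear f by fact
  have "f (cis \<theta>) = f 1 * cos (of_int 1 * \<theta> + 0) + f \<i> * cos (of_int 1 * \<theta> + (- pi / 2))" for \<theta>
  proof -
    have "cis \<theta> = cos \<theta> *\<^sub>R 1 + sin \<theta> *\<^sub>R \<i>" by (simp add: complex_eq_iff)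
    then have "f (cis \<theta>) = cos \<theta> * f 1 + sin \<theta> * f \<i>" by (simp only: add scaleR) simp
    moreover have "cos (\<theta> + (- pi / 2)) = sin \<theta>" by (simp add: cos_diff)
    ultimately show ?thesis by simp
  qed
  then show ?case by (simp only:) (intro trig_poly.intros)
next
  case (const c)
  show ?case using trig_poly.atom[of c 0 0] by simp
qed (auto intro: trig_poly.add trig_poly_mult)

lemma trig_poly_orthogonal:
  assumes "trig_poly h" and g: "continuous_on UNIV g"
    and ortho: "\<And>(n::int) \<phi>. integral {0..2 * pi} (\<lambda>\<theta>. g \<theta> * cos (of_int n * \<theta> + \<phi>)) = 0"
  shows "continuous_on UNIV h \<and> integral {0..2 * pi} (\<lambda>\<theta>. g \<theta> * h \<theta>) = 0"
  using assms(1)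
proof induction
  case (atom c n \<phi>)
  have "integral {0..2 * pi} (\<lambda>\<theta>. g \<theta> * (c * cos (of_int n * \<theta> + \<phi>))) =
    integral {0..2 * pi} (\<lambda>\<theta>. c * (g \<theta> * cos (of_int n * \<theta> + \<phi>)))"
    by (rule arg_cong[of _ _ "integral _"]) auto
  also have "\<dots> = 0" using ortho by simp
  finally show ?case by (auto intro!: continuous_intros)
next
  case (add h1 h2)
  have "(\<lambda>\<theta>. g \<theta> * h1 \<theta>) integrable_on {0..2 * pi}" "(\<lambda>\<theta>. g \<theta> * h2 \<theta>) integrable_on {0..2 * pi}"
    using add g by (auto intro!: integrable_continuous_real continuous_intros elim: continuous_on_subset)
  then show ?case using add by (auto intro!: continuous_intros simp: distrib_left integral_add)
qed

text \<open>
  Completeness of the trigonometric system: viewed on the unit circle, \<open>g\<close> is a uniform limit of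
  polynomials in \<open>cos \<theta>\<close> and \<open>sin \<theta>\<close> by the Stone-Weierstrass theorem. These are combinations of
  waves and hence orthogonal to \<open>g\<close>, so \<open>g\<close> is orthogonal to itself. The free phase \<open>\<phi>\<close> treats
  sines and cosines at once.
\<close>

lemma trig_complete:
  fixes g :: "real \<Rightarrow> real"
  assumes g: "continuous_on UNIV g" and per: "\<And>\<theta>. g (\<theta> + 2 * pi) = g \<theta>"
    and ortho: "\<And>(n::int) \<phi>. integral {0..2 * pi} (\<lambda>\<theta>. g \<theta> * cos (of_int n * \<theta> + \<phi>)) = 0"
  shows "g \<theta> = 0"
proof -
  let ?C = "sphere (0::complex) 1" and ?I = "{0..2 * pi}"
  define G where "G z = g (Arg2pi z)" for z
  have gI: "continuous_on ?I g" using g continuous_on_subset by blast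
  have img: "cis ` ?I = ?C"
  proof
    show "?C \<subseteq> cis ` ?I"
    proof
      fix z :: complex assume "z \<in> ?C"
      then have "z = cis (Arg2pi z)" using Arg2pi_eq[of z] by (simp add: cis_conv_exp)
      moreover have "Arg2pi z \<in> ?I" using Arg2pi_ge_0[of z] Arg2pi_lt_2pi[of z] by simp
      ultimately show "z \<in> cis ` ?I" by blast
    qed
  qed auto
  have Gcis: "G (cis \<theta>) = g \<theta>" if "\<theta> \<in> ?I" for \<theta>
  proof (cases "\<theta> = 2 * pi")
    case True
    have "Arg2pi (cis (2*pi)) = 0" by (simp add: Arg2pi_of_real[of 1, simplified])
    then show ?thesis using per[of 0] True by (simp add: G_def)
  next
    case False
    then have "Arg2pi (cis \<theta>) = \<theta>"
      using that Arg2pi_unique[of 1 \<theta> "cis \<theta>"] by (simp add: cis_conv_exp)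
    then show ?thesis by (simp add: G_def)
  qed
  \<comment> \<open>Continuity descends to the circle because \<open>cis\<close> on the closed interval is a quotient map.\<close>
  have "continuous_on ?C G"
  proof (subst continuous_on_open_gen[of G ?C UNIV], simp, intro allI impI)
    fix U :: "real set" assume "openin (top_of_set UNIV) U"
    then have U: "open U" by simp
    have "?I \<inter> cis -` (?C \<inter> G -` U) = ?I \<inter> g -` U" using Gcis img by auto
    moreover have "openin (top_of_set ?I) (?I \<inter> g -` U)"
      using continuous_openin_preimage_gen[OF gI U] .
    moreover have "openin (top_of_set ?I) (?I \<inter> cis -` (?C \<inter> G -` U)) = openin (top_of_set ?C) (?C \<inter> G -` U)"
      by (rule Abstract_Topology_2.continuous_imp_quotient_map[OF _ img]) (auto intro!: continuous_intros)
    ultimately show "openin (top_of_set ?C) (?C \<inter> G -` U)" by simp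
  qed
  define A where "A = integral ?I (\<lambda>\<theta>. \<bar>g \<theta>\<bar>)"
  have A0: "A \<ge> 0" unfolding A_def by (rule integral_nonneg) (use gI in \<open>auto intro!: integrable_continuous_real continuous_intros\<close>)
  have small: "integral ?I (\<lambda>\<theta>. g \<theta> * g \<theta>) \<le> e * A" if e: "e > 0" for e
  proof -
    obtain p where p: "real_polynomial_function p" "\<And>z. z \<in> ?C \<Longrightarrow> \<bar>G z - p z\<bar> < e"
      using Stone_Weierstrass_real_polynomial_function[OF compact_sphere \<open>continuous_on ?C G\<close> e] by blast
    define h where "h \<theta> = p (cis \<theta>)" for \<theta>
    have h: "continuous_on UNIV h" "integral ?I (\<lambda>\<theta>. g \<theta> * h \<theta>) = 0"
      using trig_poly_orthogonal[OF trig_poly_real_polynomial_cis[OF p(1)] g ortho] by (auto simp: h_def)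
    have hI: "continuous_on ?I h" using h(1) continuous_on_subset by blast
    have "integral ?I (\<lambda>\<theta>. g \<theta> * g \<theta>) = integral ?I (\<lambda>\<theta>. g \<theta> * g \<theta>) - integral ?I (\<lambda>\<theta>. g \<theta> * h \<theta>)"
      using h by simp
    also have "\<dots> = integral ?I (\<lambda>\<theta>. g \<theta> * g \<theta> - g \<theta> * h \<theta>)"
      by (rule integral_diff[symmetric]) (use gI hI in \<open>auto intro!: integrable_continuous_real continuous_intros\<close>)
    also have "\<dots> \<le> integral ?I (\<lambda>\<theta>. e * \<bar>g \<theta>\<bar>)"
    proof (rule integral_le)
      fix \<theta> assume \<theta>: "\<theta> \<in> ?I"
      have "\<bar>g \<theta> - h \<theta>\<bar> \<le> e" using p(2)[of "cis \<theta>"] Gcis[OF \<theta>] by (simp add: h_def)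
      then have "\<bar>g \<theta>\<bar> * \<bar>g \<theta> - h \<theta>\<bar> \<le> \<bar>g \<theta>\<bar> * e" by (intro mult_left_mono) auto
      moreover have "g \<theta> * g \<theta> - g \<theta> * h \<theta> \<le> \<bar>g \<theta>\<bar> * \<bar>g \<theta> - h \<theta>\<bar>"
        by (simp add: abs_mult[symmetric] right_diff_distrib[symmetric])
      ultimately show "g \<theta> * g \<theta> - g \<theta> * h \<theta> \<le> e * \<bar>g \<theta>\<bar>" by (simp add: mult.commute)
    qed (use gI hI in \<open>auto intro!: integrable_continuous_real continuous_intros\<close>)
    finally show ?thesis by (simp add: A_def)
  qed
  have "integral ?I (\<lambda>\<theta>. g \<theta> * g \<theta>) \<le> 0"
  proof (rule field_le_epsilon)
    fix e :: real assume e: "e > 0"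
    have "integral ?I (\<lambda>\<theta>. g \<theta> * g \<theta>) \<le> (e / (A + 1)) * A" by (rule small) (use e A0 in auto)
    also have "\<dots> \<le> e" using e A0 by (simp add: field_simps)
    finally show "integral ?I (\<lambda>\<theta>. g \<theta> * g \<theta>) \<le> 0 + e" by simp
  qed
  moreover have "integral ?I (\<lambda>\<theta>. g \<theta> * g \<theta>) \<ge> 0"
    by (rule integral_nonneg) (use gI in \<open>auto intro!: integrable_continuous_real continuous_intros\<close>)
  ultimately have "integral ?I (\<lambda>\<theta>. g \<theta> * g \<theta>) = 0" by simp
  then have zero: "\<forall>\<theta>\<in>?I. g \<theta> * g \<theta> = 0"
    by (subst (asm) integral_eq_0_iff) (use gI in \<open>auto intro!: continuous_intros\<close>)
  obtain \<theta>' where "\<theta>' \<in> {0..<2*pi}" "g \<theta> = g \<theta>'" using periodic_representative[of g \<theta>] per by blast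
  then show ?thesis using zero by simp
qed

lemma smooth_real_derivative:
  fixes g :: "real \<Rightarrow> real"
  assumes "smooth_on UNIV g"
  obtains g' where "\<And>x. (g has_real_derivative g' x) (at x)" "smooth_on UNIV g'"
  using assms
proof (rule smooth_on_obtain)
  fix D assume D: "\<And>x. x \<in> UNIV \<Longrightarrow> (g has_derivative (\<lambda>h. \<Sum>b\<in>Basis. (h \<bullet> b) *\<^sub>R D b x)) (at x)"
    "\<And>b::real. b \<in> Basis \<Longrightarrow> smooth_on UNIV (D b)"
  show thesis
    by (rule that[of "D 1"]) (use D in \<open>auto simp: has_field_derivative_def mult.commute[of _ "D 1 _"]\<close>)
qed

lemma periodic_derivative:
  fixes g :: "real \<Rightarrow> real"
  assumes "\<And>x. (g has_real_derivative g' x) (at x)" "\<And>x. g (x + 2 * pi) = g x"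
  shows "g' (x + 2 * pi) = g' x"
proof -
  have "((\<lambda>x. g (x + 2 * pi)) has_real_derivative g' (x + 2 * pi)) (at x)"
    using assms(1)[of "x + 2 * pi"] DERIV_shift[of g "g' (x + 2 * pi)" x "2 * pi"] by simp
  then have "(g has_real_derivative g' (x + 2 * pi)) (at x)" using assms(2) by simp
  then show ?thesis using assms(1) DERIV_unique by blast
qed

text \<open>Each integration by parts trades one power of the frequency for one derivative of \<open>g\<close>.\<close>

lemma fourier_decay_power:
  fixes g :: "real \<Rightarrow> real"
  assumes "smooth_on UNIV g" "\<And>x. g (x + 2 * pi) = g x"
  shows "\<exists>C. \<forall>(k::int) \<phi>. \<bar>of_int k\<bar> ^ m * \<bar>integral {0..2 * pi} (\<lambda>\<theta>. g \<theta> * cos (of_int k * \<theta> + \<phi>))\<bar> \<le> C"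
  using assms
proof (induction m arbitrary: g)
  case 0
  have gc: "continuous_on {0..2*pi} g"
    using smooth_on_imp_continuous_on[OF 0(1)] continuous_on_subset by blast
  have "\<bar>integral {0..2 * pi} (\<lambda>\<theta>. g \<theta> * cos (of_int k * \<theta> + \<phi>))\<bar> \<le> integral {0..2*pi} (\<lambda>\<theta>. \<bar>g \<theta>\<bar>)"
    for k :: int and \<phi>
    unfolding real_norm_def[symmetric]
    by (rule integral_norm_bound_integral)
       (use gc in \<open>auto intro!: integrable_continuous_real continuous_intros simp: abs_mult mult_left_le\<close>)
  then show ?case by auto
next
  case (Suc m)
  obtain g' where g': "\<And>x. (g has_real_derivative g' x) (at x)" "smooth_on UNIV g'"
    using smooth_real_derivative[OF Suc.prems(1)] by blast
  have gc: "continuous_on {0..2*pi} g" "continuous_on {0..2*pi} g'"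
    using smooth_on_imp_continuous_on[OF Suc.prems(1)] smooth_on_imp_continuous_on[OF g'(2)]
      continuous_on_subset by blast+
  obtain C where C: "\<And>(k::int) \<phi>. \<bar>of_int k\<bar> ^ m * \<bar>integral {0..2 * pi} (\<lambda>\<theta>. g' \<theta> * cos (of_int k * \<theta> + \<phi>))\<bar> \<le> C"
    using Suc.IH[OF g'(2) periodic_derivative[OF g'(1) Suc.prems(2)]] by blast
  have parts: "of_int k * integral {0..2 * pi} (\<lambda>\<theta>. g \<theta> * cos (of_int k * \<theta> + \<phi>)) =
      - integral {0..2 * pi} (\<lambda>\<theta>. g' \<theta> * cos (of_int k * \<theta> + (\<phi> - pi/2)))" for k :: int and \<phi>
  proof -
    let ?F = "\<lambda>\<theta>. g \<theta> * sin (of_int k * \<theta> + \<phi>)"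
    have "((\<lambda>\<theta>. of_int k * (g \<theta> * cos (of_int k * \<theta> + \<phi>)) + g' \<theta> * sin (of_int k * \<theta> + \<phi>))
        has_integral (?F (2*pi) - ?F 0)) {0..2*pi}"
      by (rule fundamental_theorem_of_calculus)
         (auto intro!: derivative_eq_intros DERIV_subset[OF g'(1)] simp: has_real_derivative_iff_has_vector_derivative[symmetric])
    moreover have "?F (2*pi) - ?F 0 = 0"
    proof -
      have "sin (of_int k * (2*pi) + \<phi>) = sin (\<phi> + 2 * pi * of_int k)" by (simp add: algebra_simps)
      also have "\<dots> = sin \<phi>" using periodic_int_shift[of sin] by simp
      finally show ?thesis using Suc.prems(2)[of 0] by simp
    qed
    ultimately have "integral {0..2*pi} (\<lambda>\<theta>. of_int k * (g \<theta> * cos (of_int k * \<theta> + \<phi>)) + g' \<theta> * sin (of_int k * \<theta> + \<phi>)) = 0"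
      by (simp add: integral_unique)
    then have "integral {0..2*pi} (\<lambda>\<theta>. of_int k * (g \<theta> * cos (of_int k * \<theta> + \<phi>))) +
        integral {0..2*pi} (\<lambda>\<theta>. g' \<theta> * sin (of_int k * \<theta> + \<phi>)) = 0"
      by (subst (asm) integral_add) (use gc in \<open>auto intro!: integrable_continuous_real continuous_intros\<close>)
    moreover have "cos (of_int k * \<theta> + (\<phi> - pi/2)) = sin (of_int k * \<theta> + \<phi>)" for \<theta>
      by (simp add: add_diff_eq cos_diff)
    ultimately show ?thesis by simp
  qed
  have "\<bar>of_int k\<bar> ^ Suc m * \<bar>integral {0..2 * pi} (\<lambda>\<theta>. g \<theta> * cos (of_int k * \<theta> + \<phi>))\<bar> \<le> C" for k :: int and \<phi>
  proof -
    have "\<bar>of_int k\<bar> ^ Suc m * \<bar>integral {0..2 * pi} (\<lambda>\<theta>. g \<theta> * cos (of_int k * \<theta> + \<phi>))\<bar> =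
      \<bar>of_int k\<bar> ^ m * \<bar>of_int k * integral {0..2 * pi} (\<lambda>\<theta>. g \<theta> * cos (of_int k * \<theta> + \<phi>))\<bar>"
      by (simp add: abs_mult)
    also have "\<dots> \<le> C" unfolding parts abs_minus_cancel by (rule C)
    finally show ?thesis .
  qed
  then show ?case by blast
qed

lemma fourier_decay:
  fixes g :: "real \<Rightarrow> real"
  assumes "smooth_on UNIV g" "\<And>x. g (x + 2 * pi) = g x"
  shows "\<exists>C. \<forall>(k::int) \<phi>. \<bar>integral {0..2 * pi} (\<lambda>\<theta>. g \<theta> * cos (of_int k * \<theta> + \<phi>))\<bar> \<le> C / (1 + \<bar>of_int k\<bar>) ^ m"
proof -
  obtain C where C: "\<And>(k::int) \<phi>. \<bar>of_int k\<bar> ^ m * \<bar>integral {0..2 * pi} (\<lambda>\<theta>. g \<theta> * cos (of_int k * \<theta> + \<phi>))\<bar> \<le> C"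
    using fourier_decay_power[OF assms] by blast
  obtain C0 where C0: "\<And>(k::int) \<phi>. \<bar>integral {0..2 * pi} (\<lambda>\<theta>. g \<theta> * cos (of_int k * \<theta> + \<phi>))\<bar> \<le> C0"
    using fourier_decay_power[OF assms, of 0] by auto
  have nn: "0 \<le> C0" using C0[of 0 0] by linarith
  have nn': "0 \<le> C" using C[of 0 0] by (rule order_trans[rotated]) simp
  have "\<bar>integral {0..2 * pi} (\<lambda>\<theta>. g \<theta> * cos (of_int k * \<theta> + \<phi>))\<bar> \<le> (C0 + 2 ^ m * C) / (1 + \<bar>of_int k\<bar>) ^ m"
    for k :: int and \<phi>
  proof (cases "k = 0")
    case True
    then show ?thesis using C0[of 0 \<phi>] nn' by (simp add: add_increasing2)
  next
    case False
    let ?I = "\<bar>integral {0..2 * pi} (\<lambda>\<theta>. g \<theta> * cos (of_int k * \<theta> + \<phi>))\<bar>"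
    have "1 \<le> \<bar>real_of_int k\<bar>" using False by linarith
    then have "(1 + \<bar>real_of_int k\<bar>) ^ m \<le> (2 * \<bar>real_of_int k\<bar>) ^ m" by (intro power_mono) auto
    then have "(1 + \<bar>real_of_int k\<bar>) ^ m * ?I \<le> (2 * \<bar>real_of_int k\<bar>) ^ m * ?I"
      by (intro mult_right_mono) auto
    also have "\<dots> = 2 ^ m * (\<bar>of_int k\<bar> ^ m * ?I)" by (simp add: power_mult_distrib)
    also have "\<dots> \<le> 2 ^ m * C" by (intro mult_left_mono C) auto
    also have "\<dots> \<le> C0 + 2 ^ m * C" using nn by simp
    finally show ?thesis by (simp add: pos_le_divide_eq mult.commute)
  qed
  then show ?thesis by blast
qed

section \<open>A weighted eigenvalue problem for sequences\<close>

text \<open>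
  In terms of coefficients with respect to harmonic modes the Steklov problem reads \<open>L c = \<sigma> B c\<close>,
  where \<open>L\<close> is the diagonal matrix of the Dirichlet energy and \<open>B\<close> the matrix of the boundary
  measure. This problem is treated abstractly here; index \<open>0\<close> stands for the constant function.
\<close>

lemma compact_bounded_functions:
  fixes M :: "nat \<Rightarrow> real"
  shows "compact {c :: nat \<Rightarrow> real. \<forall>j. \<bar>c j\<bar> \<le> M j}"
proof -
  have "compactin (product_topology (\<lambda>i. euclidean) (UNIV :: nat set)) (PiE UNIV (\<lambda>j. {- M j .. M j}))"
    by (subst compactin_PiE) auto
  moreover have "PiE UNIV (\<lambda>j. {- M j .. M j}) = {c :: nat \<Rightarrow> real. \<forall>j. \<bar>c j\<bar> \<le> M j}"
  proof -
    have "x \<in> {- m .. m} \<longleftrightarrow> \<bar>x\<bar> \<le> m" for x m :: real by auto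
    then show ?thesis by (simp only: PiE_UNIV_domain Pi_def) simp
  qed
  ultimately show ?thesis by (simp add: euclidean_product_topology)
qed

definition bilin :: "nat \<Rightarrow> (nat \<Rightarrow> nat \<Rightarrow> real) \<Rightarrow> (nat \<Rightarrow> real) \<Rightarrow> (nat \<Rightarrow> real) \<Rightarrow> real" where
  "bilin N B c d = (\<Sum>j<N. \<Sum>k<N. B j k * c j * d k)"

lemma bilin_add_right: "bilin N B d (\<lambda>j. c j + e j) = bilin N B d c + bilin N B d e"
  by (simp add: bilin_def sum.distrib algebra_simps)

lemma bilin_scale_right: "bilin N B c (\<lambda>j. r * d j) = r * bilin N B c d"
  by (simp add: bilin_def sum_distrib_left algebra_simps)

lemma bilin_sym:
  assumes "\<And>j k. B j k = B k j"
  shows "bilin N B c d = bilin N B d c"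
  unfolding bilin_def by (subst sum.swap) (simp add: assms mult.commute mult.left_commute)

lemma bilin_unit_left:
  assumes "i < N" shows "bilin N B (\<lambda>j. if j = i then 1 else 0) d = (\<Sum>k<N. B i k * d k)"
proof -
  have "bilin N B (\<lambda>j. if j = i then 1 else 0) d = (\<Sum>j<N. if j = i then (\<Sum>k<N. B j k * d k) else 0)"
    unfolding bilin_def by (rule sum.cong) auto
  then show ?thesis using assms by (simp add: sum.delta)
qed

lemma nonneg_quadratic_imp_zero:
  fixes a b :: real
  assumes "\<And>t. 0 \<le> 2 * t * a + t\<^sup>2 * b"
  shows "a = 0"
proof (rule ccontr)
  assume a: "a \<noteq> 0"
  obtain r where r: "r > 0" "b \<le> r" by (metis abs_ge_self abs_ge_zero add_nonneg_pos le_add_same_cancel1 order_trans zero_less_one zero_le_one)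
  define t where "t = - a / r"
  have "2 * t * a + t\<^sup>2 * b \<le> 2 * t * a + t\<^sup>2 * r"
    by (intro add_left_mono mult_left_mono r) auto
  also have "\<dots> = - (a\<^sup>2 / r)"
    using r(1) by (simp add: t_def field_simps power2_eq_square)
  also have "\<dots> < 0" using a r by simp
  finally show False using assms[of t] by simp
qed

text \<open>
  Minimization of the Rayleigh quotient \<open>L(c,c) / B(c,c)\<close> over the \<open>c\<close> that are \<open>B\<close>-orthogonal to
  the constants. By homogeneity the Euclidean unit sphere, which is compact, is enough. The
  Euler-Lagrange equation comes from the quadratic form \<open>Q = L - \<sigma> B\<close>: it is nonnegative on the
  constraint space and vanishes at the minimizer, hence \<open>Q(c, \<cdot>) = 0\<close> there. It also vanishes on
  the constants, because \<open>L 0 = 0\<close> and \<open>c\<close> satisfies the constraint, and so the constraint leaves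
  no Lagrange multiplier behind.
\<close>

lemma constrained_minimizer:
  fixes B :: "nat \<Rightarrow> nat \<Rightarrow> real" and L :: "nat \<Rightarrow> real"
  assumes N: "2 \<le> N" and sym: "\<And>j k. B j k = B k j"
    and L: "\<And>j. L j \<ge> 0" "L 0 = 0"
    and B00: "B 0 0 > 0"
    and pos: "\<And>c. bilin N B c c \<ge> \<delta> * (\<Sum>j<N. (c j)\<^sup>2)" "\<delta> > 0"
  obtains c \<sigma> where "(\<Sum>j<N. (c j)\<^sup>2) = 1" "\<And>j. j \<ge> N \<Longrightarrow> c j = 0" "(\<Sum>k<N. B 0 k * c k) = 0"
    "\<sigma> \<ge> 0" "\<And>j. j < N \<Longrightarrow> L j * c j = \<sigma> * (\<Sum>k<N. B j k * c k)"
    "\<And>d. (\<Sum>k<N. B 0 k * d k) = 0 \<Longrightarrow> \<sigma> * bilin N B d d \<le> (\<Sum>j<N. L j * (d j)\<^sup>2)"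
proof -
  have bs: "bilin N B a b = bilin N B b a" for a b
    by (rule bilin_sym) (rule sym)
  define K where "K = {c :: nat \<Rightarrow> real. \<forall>j. \<bar>c j\<bar> \<le> (if j < N then 1 else 0)} \<inter>
    {c. (\<Sum>j<N. (c j)\<^sup>2) = 1 \<and> (\<Sum>k<N. B 0 k * c k) = 0}"
  have cont: "continuous_on UNIV (\<lambda>c :: nat \<Rightarrow> real. c j)" for j
    by (rule continuous_on_product_coordinates)
  note [continuous_intros] = continuous_on_subset[OF cont]
  have "closed {c :: nat \<Rightarrow> real. (\<Sum>j<N. (c j)\<^sup>2) = 1 \<and> (\<Sum>k<N. B 0 k * c k) = 0}"
    by (intro closed_Collect_conj closed_Collect_eq continuous_intros) auto
  then have K: "compact K" unfolding K_def by (intro compact_Int_closed compact_bounded_functions)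
  have normalize: "(\<lambda>j. if j < N then d j / sqrt (\<Sum>j<N. (d j)\<^sup>2) else 0) \<in> K"
    if d: "(\<Sum>k<N. B 0 k * d k) = 0" "(\<Sum>j<N. (d j)\<^sup>2) > 0" for d
  proof -
    let ?s = "\<Sum>j<N. (d j)\<^sup>2"
    have le: "\<bar>d j\<bar> \<le> sqrt ?s" if "j < N" for j
      using that by (intro real_le_rsqrt) (simp, rule member_le_sum, auto)
    have "(\<Sum>j<N. (d j / sqrt ?s)\<^sup>2) = 1"
      using d(2) by (simp add: power_divide sum_divide_distrib[symmetric])
    moreover have "(\<Sum>k<N. B 0 k * (d k / sqrt ?s)) = 0"
      using d(1) by (simp add: sum_divide_distrib[symmetric])
    ultimately show ?thesis using le d(2) by (auto simp: K_def pos_divide_le_eq)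
  qed
  have ne: "K \<noteq> {}"
  proof -
    \<comment> \<open>A vector in the first two coordinates satisfying the constraint; here \<open>2 \<le> N\<close> is needed.\<close>
    define d :: "nat \<Rightarrow> real" where "d j = (if j = 0 then - B 0 1 else if j = 1 then B 0 0 else 0)" for j
    have e: "(\<Sum>k<N. F k) = F 0 + F 1" if "\<And>k. k \<ge> 2 \<Longrightarrow> F k = 0" for F :: "nat \<Rightarrow> real"
    proof -
      have "(\<Sum>k<N. F k) = (\<Sum>k<2. F k)"
        by (rule sum.mono_neutral_right) (use N that in \<open>auto simp: not_less\<close>)
      then show ?thesis by (simp add: numeral_2_eq_2)
    qed
    have "(\<Sum>k<N. B 0 k * d k) = 0" by (subst e) (auto simp: d_def)
    moreover have "(\<Sum>j<N. (d j)\<^sup>2) > 0" using B00 by (subst e) (auto simp: d_def add_nonneg_pos)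
    ultimately show ?thesis using normalize by blast
  qed
  have bpos: "bilin N B c c > 0" if "c \<in> K" for c
    using pos(1)[of c] pos(2) that by (auto simp: K_def)
  have "continuous_on K (\<lambda>c. (\<Sum>j<N. L j * (c j)\<^sup>2) / bilin N B c c)"
  proof (rule continuous_on_divide)
    show "\<forall>c\<in>K. bilin N B c c \<noteq> 0" using bpos by fastforce
  qed (unfold bilin_def, (intro continuous_intros subset_UNIV)+)
  from continuous_attains_inf[OF K ne this] obtain c where c: "c \<in> K"
    and min: "\<And>d. d \<in> K \<Longrightarrow> (\<Sum>j<N. L j * (c j)\<^sup>2) / bilin N B c c \<le> (\<Sum>j<N. L j * (d j)\<^sup>2) / bilin N B d d"
    by blast
  define \<sigma> where "\<sigma> = (\<Sum>j<N. L j * (c j)\<^sup>2) / bilin N B c c"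
  have \<sigma>0: "\<sigma> \<ge> 0" unfolding \<sigma>_def using bpos[OF c] L by (auto intro!: divide_nonneg_pos sum_nonneg)
  define Q where "Q = (\<lambda>a b. (\<Sum>j<N. L j * a j * b j) - \<sigma> * bilin N B a b)"
  have Qpos: "Q d d \<ge> 0" if d: "(\<Sum>k<N. B 0 k * d k) = 0" for d
  proof (cases "(\<Sum>j<N. (d j)\<^sup>2) > 0")
    case True
    let ?s = "\<Sum>j<N. (d j)\<^sup>2"
    let ?e = "\<lambda>j. if j < N then d j / sqrt ?s else 0"
    have e: "?e \<in> K" using normalize d True by blast
    have 1: "(\<Sum>j<N. L j * (?e j)\<^sup>2) = (\<Sum>j<N. L j * (d j)\<^sup>2) / ?s"
      using True by (simp add: power_divide sum_divide_distrib)
    have 2: "bilin N B ?e ?e = bilin N B d d / ?s"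
      using True by (simp add: bilin_def sum_divide_distrib)
    have "\<sigma> \<le> (\<Sum>j<N. L j * (?e j)\<^sup>2) / bilin N B ?e ?e"
      unfolding \<sigma>_def by (rule min[OF e])
    then have "\<sigma> * bilin N B ?e ?e \<le> (\<Sum>j<N. L j * (?e j)\<^sup>2)"
      using bpos[OF e] by (simp add: pos_le_divide_eq)
    then have "\<sigma> * bilin N B d d \<le> (\<Sum>j<N. L j * (d j)\<^sup>2)"
      unfolding 1 2 using True by (simp add: field_simps)
    then show ?thesis by (simp add: Q_def power2_eq_square mult.assoc)
  next
    case False
    then have "(\<Sum>j<N. (d j)\<^sup>2) = 0" using sum_nonneg[of "{..<N}" "\<lambda>j. (d j)\<^sup>2"] by force
    then have "\<And>j. j < N \<Longrightarrow> d j = 0" by (subst (asm) sum_nonneg_eq_0_iff) auto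
    then show ?thesis by (simp add: Q_def bilin_def)
  qed
  have cc: "(\<Sum>k<N. B 0 k * c k) = 0" "(\<Sum>j<N. (c j)\<^sup>2) = 1" using c by (auto simp: K_def)
  have Qcc: "Q c c = 0"
    using bpos[OF c] by (simp add: Q_def \<sigma>_def power2_eq_square mult.assoc)
  have Qsym: "Q a b = Q b a" for a b
    unfolding Q_def bs[of a b] by (simp add: mult.commute mult.left_commute)
  have Qadd: "Q a (\<lambda>j. b j + d j) = Q a b + Q a d" for a b d
    by (simp add: Q_def bilin_add_right sum.distrib algebra_simps)
  have Qscale: "Q a (\<lambda>j. r * b j) = r * Q a b" for a b r
    by (simp add: Q_def bilin_scale_right sum_distrib_left algebra_simps)
  have Qc: "Q c d = 0" if d: "(\<Sum>k<N. B 0 k * d k) = 0" for d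
  proof (rule nonneg_quadratic_imp_zero)
    fix t :: real
    have "(\<Sum>k<N. B 0 k * (c k + t * d k)) = (\<Sum>k<N. B 0 k * c k) + t * (\<Sum>k<N. B 0 k * d k)"
      by (simp add: sum.distrib sum_distrib_left algebra_simps)
    then have "0 \<le> Q (\<lambda>j. c j + t * d j) (\<lambda>j. c j + t * d j)" using cc d by (intro Qpos) simp
    also have "\<dots> = Q c c + 2 * t * Q c d + t\<^sup>2 * Q d d"
      by (simp add: Qadd Qscale Qsym[of "\<lambda>j. c j + t * d j"] Qsym[of d c] power2_eq_square algebra_simps)
    finally show "0 \<le> 2 * t * Q c d + t\<^sup>2 * Q d d" using Qcc by simp
  qed
  have Q0: "Q c (\<lambda>j. if j = 0 then 1 else 0) = 0"
  proof -
    have "(\<Sum>j<N. L j * c j * (if j = 0 then 1 else 0)) = 0" using L by (intro sum.neutral) auto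
    then show ?thesis
      using N cc by (simp add: Q_def bs[of c] bilin_unit_left)
  qed
  have EL: "L j * c j = \<sigma> * (\<Sum>k<N. B j k * c k)" if j: "j < N" for j
  proof -
    let ?u = "\<lambda>j i::nat. if i = j then 1 else (0::real)"
    \<comment> \<open>The \<open>j\<close>-th unit vector, corrected by a constant so as to satisfy the constraint.\<close>
    let ?d = "\<lambda>i. ?u j i + (- B 0 j / B 0 0) * ?u 0 i"
    have un: "(\<Sum>k<N. F k * ?u i k) = F i" if "i < N" for F i
      using that by (simp add: if_distrib sum.delta cong: if_cong)
    have "(\<Sum>k<N. B 0 k * ?d k) = (\<Sum>k<N. B 0 k * ?u j k) + (- B 0 j / B 0 0) * (\<Sum>k<N. B 0 k * ?u 0 k)"
      unfolding sum_distrib_left sum.distrib[symmetric] by (rule sum.cong) (auto simp: algebra_simps)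
    also have "\<dots> = 0" using un[of j] un[of 0] j N B00 by simp
    finally have "Q c ?d = 0" by (rule Qc)
    then have "Q c (?u j) = 0" using Q0 by (simp only: Qadd Qscale mult_zero_right add_0_right)
    moreover have "(\<Sum>i<N. L i * c i * ?u j i) = L j * c j" by (rule un[OF j])
    ultimately show ?thesis
      using j by (simp add: Q_def bs[of c] bilin_unit_left)
  qed
  have supp: "c j = 0" if "N \<le> j" for j
  proof -
    have "\<bar>c j\<bar> \<le> (if j < N then 1 else 0)" using c unfolding K_def by blast
    then show ?thesis using that by simp
  qed
  have Qd: "\<sigma> * bilin N B d d \<le> (\<Sum>j<N. L j * (d j)\<^sup>2)" if "(\<Sum>k<N. B 0 k * d k) = 0" for d
    using Qpos[OF that] by (simp add: Q_def power2_eq_square mult.assoc)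
  show thesis by (rule that[OF cc(2) supp cc(1) \<sigma>0 EL Qd])
qed

text \<open>
  Enumeration of modes: each integer frequency occurs exactly twice, at an even index and at the
  following odd one.
\<close>

definition freq :: "nat \<Rightarrow> int" where "freq j = int_decode (j div 2)"

lemma sum_inverse_squares_int_bounded:
  obtains W :: real where "\<And>A. finite A \<Longrightarrow> (\<Sum>m\<in>A. 1 / (1 + \<bar>of_int m\<bar>)\<^sup>2) \<le> W"
proof -
  let ?v = "\<lambda>n::nat. 1 / (1 + real n)\<^sup>2"
  have sm: "summable ?v"
    using inverse_power_summable[of 2, where 'a = real] summable_Suc_iff[of "\<lambda>n. inverse (real n ^ 2)"]
    by (simp add: inverse_eq_divide add.commute)
  have half: "(\<Sum>m\<in>A. 1 / (1 + \<bar>real_of_int m\<bar>)\<^sup>2) \<le> suminf ?v"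
    if "finite A" "inj_on (\<lambda>m. nat \<bar>m\<bar>) A" for A
  proof -
    have "(\<Sum>m\<in>A. 1 / (1 + \<bar>real_of_int m\<bar>)\<^sup>2) = (\<Sum>m\<in>A. ?v (nat \<bar>m\<bar>))" by simp
    also have "\<dots> = sum ?v ((\<lambda>m. nat \<bar>m\<bar>) ` A)" by (subst sum.reindex) (use that in auto)
    also have "\<dots> \<le> suminf ?v" by (rule sum_le_suminf[OF sm]) (use that in auto)
    finally show ?thesis .
  qed
  have "(\<Sum>m\<in>A. 1 / (1 + \<bar>real_of_int m\<bar>)\<^sup>2) \<le> suminf ?v + suminf ?v" if "finite A" for A
  proof -
    have "(\<Sum>m\<in>A. 1 / (1 + \<bar>real_of_int m\<bar>)\<^sup>2) =
      (\<Sum>m\<in>A \<inter> {0..}. 1 / (1 + \<bar>real_of_int m\<bar>)\<^sup>2) + (\<Sum>m\<in>A \<inter> - {0..}. 1 / (1 + \<bar>real_of_int m\<bar>)\<^sup>2)"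
      by (subst sum.union_disjoint[symmetric]) (use that in \<open>auto intro!: sum.cong\<close>)
    also have "\<dots> \<le> suminf ?v + suminf ?v"
      by (intro add_mono half) (use that in \<open>auto simp: inj_on_def\<close>)
    finally show ?thesis .
  qed
  then show thesis by (rule that)
qed

lemma sum_freq_bounded:
  obtains W :: real where "W \<ge> 0"
    "\<And>N n. (\<Sum>k<N. 1 / (1 + \<bar>of_int (n - freq k)\<bar>)\<^sup>2) \<le> W"
    "\<And>N n. (\<Sum>k<N. 1 / (1 + \<bar>of_int (n + freq k)\<bar>)\<^sup>2) \<le> W"
proof -
  obtain W :: real where W: "\<And>A. finite A \<Longrightarrow> (\<Sum>m\<in>A. 1 / (1 + \<bar>of_int m\<bar>)\<^sup>2) \<le> W"
    using sum_inverse_squares_int_bounded by blast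
  have W0: "W \<ge> 0" using W[of "{}"] by simp
  have double: "(\<Sum>k<2 * N. f (k div 2)) = 2 * (\<Sum>i<N. f i)" for f :: "nat \<Rightarrow> real" and N
    by (induction N) auto
  have bound: "(\<Sum>k<N. 1 / (1 + \<bar>of_int (g (freq k))\<bar>)\<^sup>2) \<le> 2 * W" if g: "inj g" for g :: "int \<Rightarrow> int" and N
  proof -
    have "(\<Sum>k<N. 1 / (1 + \<bar>real_of_int (g (freq k))\<bar>)\<^sup>2) \<le> (\<Sum>k<2 * N. 1 / (1 + \<bar>of_int (g (freq k))\<bar>)\<^sup>2)"
      by (rule sum_mono2) auto
    also have "\<dots> = 2 * (\<Sum>i<N. 1 / (1 + \<bar>of_int (g (int_decode i))\<bar>)\<^sup>2)"
      unfolding freq_def by (rule double)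
    also have "(\<Sum>i<N. 1 / (1 + \<bar>real_of_int (g (int_decode i))\<bar>)\<^sup>2) =
        (\<Sum>m\<in>(\<lambda>i. g (int_decode i)) ` {..<N}. 1 / (1 + \<bar>of_int m\<bar>)\<^sup>2)"
    proof -
      have "inj (g \<circ> int_decode)" by (rule inj_compose[OF g bij_is_inj[OF bij_int_decode]])
      then have "inj_on (\<lambda>i. g (int_decode i)) {..<N}" by (simp add: inj_on_def o_def)
      then show ?thesis by (simp only: sum.reindex o_def)
    qed
    also have "2 * \<dots> \<le> 2 * W" using W[of "(\<lambda>i. g (int_decode i)) ` {..<N}"] by simp
    finally show ?thesis by simp
  qed
  show thesis
  proof (rule that[of "2 * W"])
    fix N :: nat and n :: int
    show "(\<Sum>k<N. 1 / (1 + \<bar>of_int (n - freq k)\<bar>)\<^sup>2) \<le> 2 * W"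
      by (rule bound) (simp add: inj_on_def)
    show "(\<Sum>k<N. 1 / (1 + \<bar>of_int (n + freq k)\<bar>)\<^sup>2) \<le> 2 * W"
      by (rule bound) (simp add: inj_on_def)
  qed (use W0 in simp)
qed

lemma summable_freq: "summable (\<lambda>k. A / (1 + \<bar>of_int (freq k)\<bar> :: real)\<^sup>2)"
proof -
  obtain W :: real where W: "W \<ge> 0"
    "\<And>N n. (\<Sum>k<N. 1 / (1 + \<bar>of_int (n - freq k)\<bar>)\<^sup>2) \<le> W"
    "\<And>N n. (\<Sum>k<N. 1 / (1 + \<bar>of_int (n + freq k)\<bar>)\<^sup>2) \<le> W"
    by (rule sum_freq_bounded) blast
  have "(\<Sum>k<N. 1 / (1 + \<bar>of_int (freq k)\<bar> :: real)\<^sup>2) \<le> W" for N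
    using W(3)[where n = 0 and N = N] by simp
  then have "summable (\<lambda>k. 1 / (1 + \<bar>of_int (freq k)\<bar> :: real)\<^sup>2)"
    by (intro summableI_nonneg_bounded) simp_all
  from summable_mult[OF this, of A] show ?thesis by simp
qed

text \<open>
  Peetre's inequality: with the weight \<open>\<langle>m\<rangle> = 1 + |m|\<close> one has \<open>\<langle>a\<rangle> \<le> \<langle>a - b\<rangle> \<langle>b\<rangle>\<close>. In this form
  it moves decay in \<open>b\<close> over to decay in \<open>a\<close> at the cost of decay in \<open>a - b\<close>; the two powers of
  \<open>\<langle>a - b\<rangle>\<close> that are kept make the sum over \<open>b\<close> converge.
\<close>

lemma peetre:
  fixes a b :: int
  shows "1 / (1 + \<bar>of_int (a - b)\<bar>) ^ (p + 2) / (1 + \<bar>of_int b\<bar>) ^ p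
    \<le> 1 / (1 + \<bar>of_int (a - b)\<bar>)\<^sup>2 / (1 + \<bar>of_int a\<bar> :: real) ^ p"
proof -
  let ?u = "1 + \<bar>real_of_int (a - b)\<bar>" and ?v = "1 + \<bar>real_of_int b\<bar>" and ?w = "1 + \<bar>real_of_int a\<bar>"
  have pos: "?u > 0" "?v > 0" "?w > 0" by linarith+
  have "\<bar>real_of_int a\<bar> \<le> \<bar>real_of_int (a - b)\<bar> + \<bar>real_of_int b\<bar>" by simp
  moreover have "0 \<le> \<bar>real_of_int (a - b)\<bar> * \<bar>real_of_int b\<bar>" by simp
  moreover have "?u * ?v = 1 + \<bar>real_of_int (a - b)\<bar> + \<bar>real_of_int b\<bar> + \<bar>real_of_int (a - b)\<bar> * \<bar>real_of_int b\<bar>"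
    by (simp only: distrib_left distrib_right mult_1_left mult_1_right add.assoc)
  ultimately have "?w \<le> ?u * ?v" by linarith
  then have "?w ^ p \<le> (?u * ?v) ^ p" by (rule power_mono) simp
  then have "?w ^ p * ?u\<^sup>2 \<le> (?u ^ p * ?v ^ p) * ?u\<^sup>2"
    by (intro mult_right_mono) (simp_all add: power_mult_distrib)
  then have "1 / ((?u ^ p * ?v ^ p) * ?u\<^sup>2) \<le> 1 / (?w ^ p * ?u\<^sup>2)"
    using pos by (intro divide_left_mono mult_pos_pos zero_less_power) auto
  moreover have "1 / ?u ^ (p + 2) / ?v ^ p = 1 / ((?u ^ p * ?v ^ p) * ?u\<^sup>2)"
    by (simp only: power_add divide_divide_eq_left ac_simps)
  moreover have "1 / ?u\<^sup>2 / ?w ^ p = 1 / (?w ^ p * ?u\<^sup>2)"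
    by (simp only: divide_divide_eq_left ac_simps)
  ultimately show ?thesis by (simp only:)
qed

text \<open>
  The hypotheses mirror the boundary problem: \<open>L\<close> grows linearly in the frequency, like the
  Dirichlet-to-Neumann operator, \<open>B\<close> is bounded below since the boundary density is, and the
  entries of \<open>B\<close> decay faster than any power because the density is smooth. Products of two waves
  involve both the difference and the sum of their frequencies, so both occur in the decay.
\<close>

locale galerkin =
  fixes B :: "nat \<Rightarrow> nat \<Rightarrow> real" and L :: "nat \<Rightarrow> real" and \<delta> \<gamma> :: real
  assumes sym: "\<And>j k. B j k = B k j"
    and L0: "L 0 = 0"
    and Lpos: "\<And>j. j \<ge> 1 \<Longrightarrow> L j \<ge> \<gamma> * (1 + \<bar>of_int (freq j)\<bar>)" and \<gamma>: "\<gamma> > 0"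
    and pos: "\<And>N c. bilin N B c c \<ge> \<delta> * (\<Sum>j<N. (c j)\<^sup>2)" and \<delta>: "\<delta> > 0"
    and decay: "\<And>m. \<exists>C. \<forall>j k. \<bar>B j k\<bar> \<le> C * (1 / (1 + \<bar>of_int (freq j - freq k)\<bar>) ^ m
        + 1 / (1 + \<bar>of_int (freq j + freq k)\<bar>) ^ m)"
begin

definition galerkin_solution :: "nat \<Rightarrow> (nat \<Rightarrow> real) \<Rightarrow> real \<Rightarrow> bool" where
  "galerkin_solution N c \<sigma> \<longleftrightarrow> (\<Sum>j<N. (c j)\<^sup>2) = 1 \<and> (\<forall>j\<ge>N. c j = 0) \<and> (\<Sum>k<N. B 0 k * c k) = 0 \<and>
    \<sigma> \<ge> 0 \<and> (\<forall>j<N. L j * c j = \<sigma> * (\<Sum>k<N. B j k * c k)) \<and>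
    (\<forall>d. (\<Sum>k<N. B 0 k * d k) = 0 \<longrightarrow> \<sigma> * bilin N B d d \<le> (\<Sum>j<N. L j * (d j)\<^sup>2))"

lemma L_nonneg: "L j \<ge> 0"
proof (cases "j = 0")
  case False
  then have "0 \<le> \<gamma> * (1 + \<bar>real_of_int (freq j)\<bar>)" "\<gamma> * (1 + \<bar>of_int (freq j)\<bar>) \<le> L j"
    using \<gamma> Lpos[of j] by auto
  then show ?thesis by linarith
qed (simp add: L0)

lemma B00_pos: "B 0 0 > 0"
  using pos[where N = 1 and c = "\<lambda>_. 1"] \<delta> by (simp add: bilin_def)

lemma ex_galerkin_solution:
  assumes "2 \<le> N" obtains c \<sigma> where "galerkin_solution N c \<sigma>"
proof (rule constrained_minimizer[of N B L \<delta>])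
  fix c \<sigma>
  assume "(\<Sum>j<N. (c j)\<^sup>2) = 1" "\<And>j. j \<ge> N \<Longrightarrow> c j = 0" "(\<Sum>k<N. B 0 k * c k) = 0"
    "\<sigma> \<ge> 0" "\<And>j. j < N \<Longrightarrow> L j * c j = \<sigma> * (\<Sum>k<N. B j k * c k)"
    "\<And>d. (\<Sum>k<N. B 0 k * d k) = 0 \<Longrightarrow> \<sigma> * bilin N B d d \<le> (\<Sum>j<N. L j * (d j)\<^sup>2)"
  then show thesis by (intro that[of c \<sigma>]) (auto simp: galerkin_solution_def)
qed (use assms sym L_nonneg L0 B00_pos pos \<delta> in blast)+

text \<open>
  Elliptic regularity for sequences, uniform in the cutoff \<open>N\<close>. If the coefficients decay with
  power \<open>p\<close>, then so does \<open>B c\<close>, by Peetre's inequality; since \<open>L c = \<sigma> B c\<close> and \<open>L\<close> grows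
  linearly, \<open>c\<close> decays with power \<open>p + 1\<close>. The induction starts from the normalization of \<open>c\<close>.
\<close>

lemma galerkin_solution_decay:
  "\<exists>A\<ge>0. \<forall>N c \<sigma>. galerkin_solution N c \<sigma> \<longrightarrow> \<sigma> \<le> s \<longrightarrow> (\<forall>k. \<bar>c k\<bar> \<le> A / (1 + \<bar>of_int (freq k)\<bar>) ^ p)"
proof (induction p)
  case 0
  have "\<bar>c k\<bar> \<le> 1" if "galerkin_solution N c \<sigma>" for N c \<sigma> k
  proof (cases "k < N")
    case True
    then have "(c k)\<^sup>2 \<le> (\<Sum>j<N. (c j)\<^sup>2)" by (intro member_le_sum) auto
    then show ?thesis using that by (simp add: galerkin_solution_def abs_square_le_1)
  qed (use that in \<open>auto simp: galerkin_solution_def\<close>)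
  then show ?case by (intro exI[of _ 1]) auto
next
  case (Suc p)
  then obtain A where A: "A \<ge> 0"
    "\<And>N c \<sigma> k. galerkin_solution N c \<sigma> \<Longrightarrow> \<sigma> \<le> s \<Longrightarrow> \<bar>c k\<bar> \<le> A / (1 + \<bar>of_int (freq k)\<bar>) ^ p" by blast
  obtain C where C: "\<And>j k. \<bar>B j k\<bar> \<le> C * (1 / (1 + \<bar>of_int (freq j - freq k)\<bar>) ^ (p + 2)
        + 1 / (1 + \<bar>of_int (freq j + freq k)\<bar>) ^ (p + 2))" using decay by blast
  have C0: "C \<ge> 0"
  proof -
    have "0 \<le> \<bar>B 0 0\<bar>" by simp
    also have "\<dots> \<le> C * (1 + 1)" using C[of 0 0] by (simp add: freq_def int_decode_def sum_decode_def)
    finally show ?thesis by simp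
  qed
  obtain W :: real where W: "W \<ge> 0"
    "\<And>N n. (\<Sum>k<N. 1 / (1 + \<bar>of_int (n - freq k)\<bar>)\<^sup>2) \<le> W"
    "\<And>N n. (\<Sum>k<N. 1 / (1 + \<bar>of_int (n + freq k)\<bar>)\<^sup>2) \<le> W"
    using sum_freq_bounded by blast
  define A' where "A' = A + \<bar>s\<bar> * (C * A * (W + W)) / \<gamma>"
  have A': "A' \<ge> 0" unfolding A'_def using A C0 W(1) \<gamma> by simp
  have "\<bar>c j\<bar> \<le> A' / (1 + \<bar>of_int (freq j)\<bar>) ^ Suc p"
    if sol: "galerkin_solution N c \<sigma>" and s: "\<sigma> \<le> s" for N c \<sigma> j
  proof -
    let ?w = "1 + \<bar>real_of_int (freq j)\<bar>"
    have w: "?w > 0" by linarith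
    consider "j = 0" | "j \<ge> N" "j \<noteq> 0" | "j \<ge> 1" "j < N" by linarith
    then show ?thesis
    proof cases
      case 1
      have "\<bar>c 0\<bar> \<le> A" using A(2)[OF sol s, of 0] by (simp add: freq_def int_decode_def sum_decode_def)
      also have "A \<le> A'" unfolding A'_def using A C0 W(1) \<gamma> by simp
      finally show ?thesis using 1 by (simp add: freq_def int_decode_def sum_decode_def)
    next
      case 2
      then show ?thesis using sol A' by (simp add: galerkin_solution_def)
    next
      case 3
      have tm: "\<bar>B j k * c k\<bar> \<le> C * A / ?w ^ p * (1 / (1 + \<bar>of_int (freq j - freq k)\<bar>)\<^sup>2
          + 1 / (1 + \<bar>of_int (freq j + freq k)\<bar>)\<^sup>2)" for k
      proof -
        let ?a = "\<lambda>q. 1 / (1 + \<bar>real_of_int (freq j - freq k)\<bar>) ^ q"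
        let ?b = "\<lambda>q. 1 / (1 + \<bar>real_of_int (freq j + freq k)\<bar>) ^ q"
        let ?v = "(1 + \<bar>real_of_int (freq k)\<bar>) ^ p"
        have "\<bar>B j k * c k\<bar> \<le> (C * (?a (p+2) + ?b (p+2))) * (A / ?v)"
          unfolding abs_mult by (intro mult_mono C A(2)[OF sol s]) (use C0 in auto)
        also have "\<dots> = C * A * (?a (p+2) / ?v + ?b (p+2) / ?v)"
          by (simp add: add_divide_distrib algebra_simps)
        also have "\<dots> \<le> C * A * (?a 2 / ?w ^ p + ?b 2 / ?w ^ p)"
          using peetre[of "freq j" "freq k" p] peetre[of "freq j" "- freq k" p] C0 A(1)
          by (intro mult_left_mono add_mono) simp_all
        also have "\<dots> = C * A / ?w ^ p * (?a 2 + ?b 2)"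
          by (simp add: add_divide_distrib algebra_simps)
        finally show ?thesis .
      qed
      have "\<bar>\<Sum>k<N. B j k * c k\<bar> \<le> (\<Sum>k<N. \<bar>B j k * c k\<bar>)" by (rule sum_abs)
      also have "\<dots> \<le> (\<Sum>k<N. C * A / ?w ^ p * (1 / (1 + \<bar>of_int (freq j - freq k)\<bar>)\<^sup>2
          + 1 / (1 + \<bar>of_int (freq j + freq k)\<bar>)\<^sup>2))" by (intro sum_mono tm)
      also have "\<dots> = C * A / ?w ^ p * ((\<Sum>k<N. 1 / (1 + \<bar>of_int (freq j - freq k)\<bar>)\<^sup>2)
          + (\<Sum>k<N. 1 / (1 + \<bar>of_int (freq j + freq k)\<bar>)\<^sup>2))"
        unfolding sum_distrib_left sum.distrib[symmetric] by (rule sum.cong) (auto simp: algebra_simps)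
      also have "\<dots> \<le> C * A / ?w ^ p * (W + W)"
        using C0 A(1) by (intro mult_left_mono add_mono W) auto
      finally have S: "\<bar>\<Sum>k<N. B j k * c k\<bar> \<le> C * A * (W + W) / ?w ^ p" by simp
      have "\<gamma> * ?w * \<bar>c j\<bar> \<le> L j * \<bar>c j\<bar>" using Lpos[OF 3(1)] by (intro mult_right_mono) auto
      also have "\<dots> = \<bar>L j * c j\<bar>" using L_nonneg by (simp add: abs_mult)
      also have "\<dots> = \<sigma> * \<bar>\<Sum>k<N. B j k * c k\<bar>"
        using sol 3 by (auto simp: galerkin_solution_def abs_mult)
      also have "\<dots> \<le> \<bar>s\<bar> * (C * A * (W + W) / ?w ^ p)"
        using S s sol by (intro mult_mono) (auto simp: galerkin_solution_def)
      finally have "\<gamma> * ?w * \<bar>c j\<bar> \<le> \<bar>s\<bar> * (C * A * (W + W) / ?w ^ p)" .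
      then have "\<bar>c j\<bar> \<le> \<bar>s\<bar> * (C * A * (W + W) / ?w ^ p) / (\<gamma> * ?w)"
        using \<gamma> w by (simp only: pos_le_divide_eq mult_pos_pos mult.commute[of "\<bar>c j\<bar>"])
      also have "\<dots> = (\<bar>s\<bar> * (C * A * (W + W)) / \<gamma>) / ?w ^ Suc p" by (simp add: mult.commute)
      also have "\<dots> \<le> A' / ?w ^ Suc p"
        unfolding A'_def using A(1) w by (intro divide_right_mono) auto
      finally show ?thesis .
    qed
  qed
  then show ?case using A' by blast
qed

lemma bilin_support:
  assumes "\<And>j. j \<ge> M \<Longrightarrow> d j = 0" "M \<le> N"
  shows "bilin N B d d = bilin M B d d"
proof -
  have inner: "(\<Sum>k<N. B j k * d j * d k) = (\<Sum>k<M. B j k * d j * d k)" for j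
    by (rule sum.mono_neutral_right) (use assms in auto)
  show ?thesis unfolding bilin_def inner
    by (rule sum.mono_neutral_right) (use assms in auto)
qed

lemma support_sum:
  fixes f d :: "nat \<Rightarrow> real"
  assumes "\<And>j. j \<ge> M \<Longrightarrow> d j = 0" "M \<le> N"
  shows "(\<Sum>k<N. f k * d k) = (\<Sum>k<M. f k * d k)"
  by (rule sum.mono_neutral_right) (use assms in auto)

text \<open>
  The minimal values decrease as the cutoff grows, since a minimizer for \<open>N\<close> is a competitor for
  \<open>N + 1\<close>. Therefore one decay estimate holds for all cutoffs. Coefficientwise limits along a
  subsequence commute with the infinite sums by dominated convergence, so the equation, the
  normalization and the variational inequality all survive; normalization together with
  orthogonality to constants excludes a constant limit.
\<close>

theorem ex_limit_solution:
  obtains c \<sigma> where "\<sigma> \<ge> 0" "\<And>p. \<exists>A. \<forall>k. \<bar>c k\<bar> \<le> A / (1 + \<bar>of_int (freq k)\<bar>) ^ p"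
    "\<exists>k\<ge>1. c k \<noteq> 0" "\<And>j. L j * c j = \<sigma> * (\<Sum>k. B j k * c k)"
    "\<And>M d. (\<And>j. j \<ge> M \<Longrightarrow> d j = 0) \<Longrightarrow> (\<Sum>k<M. B 0 k * d k) = 0 \<Longrightarrow>
        \<sigma> * bilin M B d d \<le> (\<Sum>j<M. L j * (d j)\<^sup>2)"
proof -
  have "\<forall>n. \<exists>x. galerkin_solution (n + 2) (fst x) (snd x)"
    using ex_galerkin_solution by (metis fst_conv le_add2 snd_conv)
  then obtain X where X: "\<And>n. galerkin_solution (n + 2) (fst (X n)) (snd (X n))" by metis
  define cc where "cc n = fst (X n)" for n
  define ss where "ss n = snd (X n)" for n
  have sol: "galerkin_solution (n + 2) (cc n) (ss n)" for n using X by (simp add: cc_def ss_def)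
  have test: "ss n * bilin M B d d \<le> (\<Sum>j<M. L j * (d j)\<^sup>2)"
    if d: "\<And>j. j \<ge> M \<Longrightarrow> d j = 0" "(\<Sum>k<M. B 0 k * d k) = 0" and n: "M \<le> n + 2" for M d n
  proof -
    define N where "N = n + 2"
    have N: "M \<le> N" "galerkin_solution N (cc n) (ss n)" using n sol by (auto simp: N_def)
    have "(\<Sum>j<N. (L j * d j) * d j) = (\<Sum>j<M. (L j * d j) * d j)"
      by (rule support_sum) (use d N in auto)
    then have 1: "(\<Sum>j<N. L j * (d j)\<^sup>2) = (\<Sum>j<M. L j * (d j)\<^sup>2)"
      by (simp add: power2_eq_square mult.assoc)
    have 2: "(\<Sum>k<N. B 0 k * d k) = 0" using support_sum[OF d(1) N(1), where f = "B 0"] d(2) by simp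
    have 3: "bilin N B d d = bilin M B d d" by (rule bilin_support[OF d(1) N(1)])
    show ?thesis using N(2) 2 unfolding galerkin_solution_def 1[symmetric] 3[symmetric] by blast
  qed
  have dec: "ss (Suc n) \<le> ss n" for n
  proof -
    let ?c = "cc n"
    have c: "(\<Sum>j<n+2. (?c j)\<^sup>2) = 1" "\<And>j. j \<ge> n + 2 \<Longrightarrow> ?c j = 0" "(\<Sum>k<n+2. B 0 k * ?c k) = 0"
      "\<And>j. j < n + 2 \<Longrightarrow> L j * ?c j = ss n * (\<Sum>k<n+2. B j k * ?c k)"
      using sol[of n] unfolding galerkin_solution_def by blast+
    have "ss (Suc n) * bilin (n+2) B ?c ?c \<le> (\<Sum>j<n+2. L j * (?c j)\<^sup>2)"
      by (rule test) (use c in auto)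
    also have "\<dots> = (\<Sum>j<n+2. (L j * ?c j) * ?c j)" by (simp add: power2_eq_square mult.assoc)
    also have "\<dots> = (\<Sum>j<n+2. (ss n * (\<Sum>k<n+2. B j k * ?c k)) * ?c j)"
      by (rule sum.cong) (use c(4) in auto)
    also have "\<dots> = ss n * bilin (n+2) B ?c ?c"
      by (simp only: bilin_def sum_distrib_left sum_distrib_right) (simp add: mult.commute mult.left_commute)
    finally have "ss (Suc n) * bilin (n+2) B ?c ?c \<le> ss n * bilin (n+2) B ?c ?c" .
    moreover have "bilin (n+2) B ?c ?c > 0" using pos[where N = "n+2" and c = ?c] c(1) \<delta> by simp
    ultimately show ?thesis by simp
  qed
  have ss0: "ss n \<ge> 0" for n using sol[of n] by (simp add: galerkin_solution_def)
  have "decseq ss" using dec by (simp add: decseq_Suc_iff)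
  then have ss_le: "ss n \<le> ss 0" for n by (simp add: decseq_def)
  obtain \<sigma> where \<sigma>: "ss \<longlonglongrightarrow> \<sigma>" using decseq_convergent[OF \<open>decseq ss\<close>, of 0] ss0 by blast
  have decayA: "\<exists>A\<ge>0. \<forall>n k. \<bar>cc n k\<bar> \<le> A / (1 + \<bar>of_int (freq k)\<bar>) ^ p" for p
    using galerkin_solution_decay[of "ss 0" p] sol ss_le by meson
  obtain A0 where A0: "A0 \<ge> 0" "\<And>n k. \<bar>cc n k\<bar> \<le> A0" using decayA[of 0] by auto
  have "seq_compact {c :: nat \<Rightarrow> real. \<forall>j. \<bar>c j\<bar> \<le> A0}"
    using compact_bounded_functions[of "\<lambda>_. A0"] by (simp add: compact_eq_seq_compact_metric)
  moreover have "\<forall>n. cc n \<in> {c. \<forall>j. \<bar>c j\<bar> \<le> A0}" using A0(2) by blast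
  ultimately have "\<exists>l\<in>{c. \<forall>j. \<bar>c j\<bar> \<le> A0}. \<exists>r. strict_mono r \<and> (cc \<circ> r) \<longlonglongrightarrow> l"
    unfolding seq_compact_def by blast
  then obtain c r where r: "strict_mono (r :: nat \<Rightarrow> nat)" and lim: "(cc \<circ> r) \<longlonglongrightarrow> c" by blast
  have limj: "(\<lambda>n. cc (r n) j) \<longlonglongrightarrow> c j" for j
    using continuous_on_tendsto_compose[OF continuous_on_product_coordinates lim, of j] by (simp add: o_def)
  have \<sigma>r: "(\<lambda>n. ss (r n)) \<longlonglongrightarrow> \<sigma>" using LIMSEQ_subseq_LIMSEQ[OF \<sigma> r] by (simp add: o_def)
  obtain A2 where A2: "A2 \<ge> 0" "\<And>n k. \<bar>cc n k\<bar> \<le> A2 / (1 + \<bar>of_int (freq k)\<bar>)\<^sup>2" using decayA[of 2] by auto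
  obtain C where C: "\<And>j k. \<bar>B j k\<bar> \<le> C" using decay[of 0] by auto
  have C0: "C \<ge> 0" using C[of 0 0] by linarith
  have limB: "(\<lambda>n. \<Sum>k. B j k * cc (r n) k) \<longlonglongrightarrow> (\<Sum>k. B j k * c k)" for j
  proof -
    have bd: "\<bar>B j k * cc n k\<bar> \<le> C * A2 / (1 + \<bar>of_int (freq k)\<bar>)\<^sup>2" for k n
      using mult_mono[OF C[of j k] A2(2)[of n k]] C0 by (simp add: abs_mult)
    show ?thesis
      by (rule tannerys_theorem[THEN conjunct2, THEN conjunct2, OF _ _ summable_freq[of "C * A2"]])
         (use bd in \<open>auto intro!: tendsto_intros limj always_eventually\<close>)
  qed
  have suminf_cut: "(\<Sum>k. f k * cc n k) = (\<Sum>k<n+2. f k * cc n k)" for f :: "nat \<Rightarrow> real" and n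
    by (rule suminf_finite) (use sol[of n] in \<open>auto simp: galerkin_solution_def\<close>)
  have EL: "L j * c j = \<sigma> * (\<Sum>k. B j k * c k)" for j
  proof (rule LIMSEQ_unique)
    show "(\<lambda>n. L j * cc (r n) j) \<longlonglongrightarrow> L j * c j" by (intro tendsto_intros limj)
    have "(\<lambda>n. ss (r n) * (\<Sum>k. B j k * cc (r n) k)) \<longlonglongrightarrow> \<sigma> * (\<Sum>k. B j k * c k)"
      by (intro tendsto_intros \<sigma>r limB)
    moreover have "\<forall>\<^sub>F n in sequentially. ss (r n) * (\<Sum>k. B j k * cc (r n) k) = L j * cc (r n) j"
      using eventually_ge_at_top[of j]
    proof eventually_elim
      case (elim n)
      then have "j < r n + 2" using seq_suble[OF r, of n] by linarith
      then show ?case using sol[of "r n"] suminf_cut by (simp add: galerkin_solution_def)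
    qed
    ultimately show "(\<lambda>n. L j * cc (r n) j) \<longlonglongrightarrow> \<sigma> * (\<Sum>k. B j k * c k)"
      by (rule Lim_transform_eventually)
  qed
  have orth: "(\<Sum>k. B 0 k * c k) = 0"
    using limB[of 0] suminf_cut sol by (simp add: galerkin_solution_def LIMSEQ_const_iff)
  have norm1: "(\<Sum>k. (c k)\<^sup>2) = 1"
  proof -
    have bd: "\<bar>(cc n k)\<^sup>2\<bar> \<le> A0 * A2 / (1 + \<bar>of_int (freq k)\<bar>)\<^sup>2" for k n
      using mult_mono[OF A0(2)[of n k] A2(2)[of n k]] A0(1) by (simp add: abs_mult power2_eq_square)
    have "(\<lambda>n. \<Sum>k. (cc (r n) k)\<^sup>2) \<longlonglongrightarrow> (\<Sum>k. (c k)\<^sup>2)"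
      by (rule tannerys_theorem[THEN conjunct2, THEN conjunct2, OF _ _ summable_freq[of "A0 * A2"]])
         (use bd in \<open>auto intro!: tendsto_intros limj always_eventually\<close>)
    moreover have "(\<Sum>k. (cc n k)\<^sup>2) = 1" for n
      using suminf_cut[of "cc n" n] sol[of n] by (simp add: galerkin_solution_def power2_eq_square)
    ultimately show ?thesis by (simp add: LIMSEQ_const_iff)
  qed
  show thesis
  proof (rule that[of \<sigma> c, OF _ _ _ EL])
    show "\<sigma> \<ge> 0" using ss0 by (intro LIMSEQ_le_const[OF \<sigma>]) auto
    show "\<exists>A. \<forall>k. \<bar>c k\<bar> \<le> A / (1 + \<bar>of_int (freq k)\<bar>) ^ p" for p
    proof -
      obtain A where "\<And>n k. \<bar>cc n k\<bar> \<le> A / (1 + \<bar>of_int (freq k)\<bar>) ^ p" using decayA by blast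
      then have "\<bar>c k\<bar> \<le> A / (1 + \<bar>of_int (freq k)\<bar>) ^ p" for k
        by (intro LIMSEQ_le_const2[OF tendsto_rabs[OF limj]]) auto
      then show ?thesis by blast
    qed
    show "\<exists>k\<ge>1. c k \<noteq> 0"
    proof (rule ccontr)
      assume "\<not> ?thesis"
      then have z: "c k = 0" if "k \<notin> {0}" for k using that by (cases k) auto
      have "(\<Sum>k. B 0 k * c k) = (\<Sum>k\<in>{0}. B 0 k * c k)" by (rule suminf_finite) (use z in auto)
      then have "c 0 = 0" using orth B00_pos by simp
      then have "c k = 0" for k using z[of k] by (cases "k = 0") auto
      then show False using norm1 by simp
    qed
    fix M d assume d: "\<And>j. j \<ge> M \<Longrightarrow> d j = 0" "(\<Sum>k<M. B 0 k * d k) = 0"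
    show "\<sigma> * bilin M B d d \<le> (\<Sum>j<M. L j * (d j)\<^sup>2)"
    proof (rule LIMSEQ_le_const2)
      show "(\<lambda>n. ss n * bilin M B d d) \<longlonglongrightarrow> \<sigma> * bilin M B d d" by (intro tendsto_intros \<sigma>)
      show "\<exists>N. \<forall>n\<ge>N. ss n * bilin M B d d \<le> (\<Sum>j<M. L j * (d j)\<^sup>2)"
        by (rule exI[of _ M]) (use test d in auto)
    qed
  qed
qed

end

section \<open>Harmonic modes of the annulus\<close>

lemma integral_suminf:
  fixes F :: "nat \<Rightarrow> real \<Rightarrow> real"
  assumes cont: "\<And>k. continuous_on {a..b} (F k)" and bound: "\<And>k x. x \<in> {a..b} \<Longrightarrow> \<bar>F k x\<bar> \<le> M k"
    and M: "summable M"
  shows "continuous_on {a..b} (\<lambda>x. \<Sum>k. F k x)"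
    and "(\<lambda>k. integral {a..b} (F k)) sums integral {a..b} (\<lambda>x. \<Sum>k. F k x)"
proof -
  have ul: "uniform_limit {a..b} (\<lambda>n x. \<Sum>k<n. F k x) (\<lambda>x. \<Sum>k. F k x) sequentially"
    by (rule Weierstrass_m_test[OF _ M]) (use bound in auto)
  have c: "continuous_on {a..b} (\<lambda>x. \<Sum>k<n. F k x)" for n by (intro continuous_intros cont)
  show "continuous_on {a..b} (\<lambda>x. \<Sum>k. F k x)"
    by (rule uniform_limit_theorem[OF _ ul]) (use c in auto)
  obtain I J where IJ: "\<And>n. ((\<lambda>x. \<Sum>k<n. F k x) has_integral I n) {a..b}"
    "((\<lambda>x. \<Sum>k. F k x) has_integral J) {a..b}" "I \<longlonglongrightarrow> J"
    by (rule uniform_limit_integral[OF ul c]) auto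
  have "I n = (\<Sum>k<n. integral {a..b} (F k))" for n
    using integral_unique[OF IJ(1)[of n]] by (simp add: integral_sum integrable_continuous_real cont)
  then have "I = (\<lambda>n. \<Sum>k<n. integral {a..b} (F k))" by (rule ext)
  then show "(\<lambda>k. integral {a..b} (F k)) sums integral {a..b} (\<lambda>x. \<Sum>k. F k x)"
    using IJ(3) unfolding sums_def integral_unique[OF IJ(2)] by (simp only:)
qed

lemma integral_cos_freq:
  fixes n :: int
  shows "integral {0..2 * pi} (\<lambda>\<theta>. cos (of_int n * \<theta> + \<phi>)) = (if n = 0 then 2 * pi * cos \<phi> else 0)"
proof (cases "n = 0")
  case False
  have "((\<lambda>\<theta>. cos (of_int n * \<theta> + \<phi>)) has_integral
      (sin (of_int n * (2 * pi) + \<phi>) / of_int n - sin (of_int n * 0 + \<phi>) / of_int n)) {0..2 * pi}"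
    by (rule fundamental_theorem_of_calculus)
       (use False in \<open>auto intro!: derivative_eq_intros simp: has_real_derivative_iff_has_vector_derivative[symmetric]\<close>)
  moreover have "sin (of_int n * (2 * pi) + \<phi>) = sin \<phi>"
  proof -
    have "of_int n * (2 * pi) + \<phi> = \<phi> + 2 * pi * of_int n" by simp
    moreover have "sin (\<phi> + 2 * pi * of_int n) = sin \<phi>" by (rule periodic_int_shift) simp
    ultimately show ?thesis by (simp only:)
  qed
  ultimately show ?thesis using False by (simp add: integral_unique)
qed simp

text \<open>
  The \<open>j\<close>-th mode is \<open>radial T 0 j t * angular 0 j \<theta>\<close>. It is even or odd under the reflection
  \<open>t \<mapsto> T - t\<close>, according to the parity of \<open>j\<close>; being normalized by the value \<open>1\<close> of its radial
  factor at \<open>t = T\<close>, that factor equals \<open>parity j\<close> at \<open>t = 0\<close>.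
\<close>

definition parity :: "nat \<Rightarrow> real" where "parity j = (if even j then 1 else - 1)"

text \<open>Nonnegative frequencies carry cosines and negative ones carry sines.\<close>

definition phase :: "nat \<Rightarrow> real" where "phase j = (if freq j \<ge> 0 then 0 else - pi / 2)"

text \<open>The \<open>b\<close>-th derivative of the angular factor, in closed form.\<close>

definition angular :: "nat \<Rightarrow> nat \<Rightarrow> real \<Rightarrow> real" where
  "angular b j \<theta> = of_int (freq j) ^ b * cos (of_int (freq j) * \<theta> + phase j + real b * pi / 2)"

text \<open>
  The \<open>a\<close>-th derivative of the radial factor, which for frequency \<open>n \<noteq> 0\<close> is a multiple of
  \<open>cosh (n (t - T/2))\<close> or \<open>sinh (n (t - T/2))\<close>. All exponents are nonpositive on \<open>[0, T]\<close>, which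
  makes the bounds uniform in \<open>n\<close>. The odd mode of frequency zero, which has index \<open>1\<close>, is affine
  in \<open>t\<close>; the general formula degenerates to \<open>0 / 0\<close> for it.
\<close>

definition radial :: "real \<Rightarrow> nat \<Rightarrow> nat \<Rightarrow> real \<Rightarrow> real" where
  "radial T a j t = (if j = 1 then (if a = 0 then (2 * t - T) / T else if a = 1 then 2 / T else 0)
     else let n = \<bar>of_int (freq j)\<bar> in
       n ^ a * (exp (- n * (T - t)) + (- 1) ^ a * parity j * exp (- n * t)) / (1 + parity j * exp (- n * T)))"

text \<open>The eigenvalues of the Dirichlet-to-Neumann operator of the flat annulus.\<close>

definition dtn :: "real \<Rightarrow> nat \<Rightarrow> real" where "dtn T j = radial T 1 j T"

lemma freq_simps [simp]: "freq 0 = 0" "freq (Suc 0) = 0" "freq 1 = 0"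
proof -
  have "int_decode 0 = 0" by (simp add: int_decode_def sum_decode_def)
  then show "freq 0 = 0" "freq (Suc 0) = 0" "freq 1 = 0" by (simp_all add: freq_def)
qed

lemma freq_eq_0_iff: "freq j = 0 \<longleftrightarrow> j = 0 \<or> j = 1"
proof -
  have "freq j = 0 \<longleftrightarrow> int_decode (j div 2) = int_decode 0" by (simp add: freq_def int_decode_def sum_decode_def)
  also have "\<dots> \<longleftrightarrow> j div 2 = 0" by (simp only: int_decode_eq)
  finally show ?thesis by auto
qed

lemma parity_cases: "parity j = 1 \<or> parity j = - 1" by (simp add: parity_def)

lemma parity_sq [simp]: "parity j * parity j = 1" by (simp add: parity_def)

lemma parity_simps [simp]: "parity 0 = 1" "parity (Suc 0) = - 1" by (simp_all add: parity_def)

lemma angular_deriv: "(angular b j has_real_derivative angular (Suc b) j \<theta>) (at \<theta>)"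
proof -
  have "cos (of_int (freq j) * \<theta> + phase j + real (Suc b) * pi / 2) =
      cos ((of_int (freq j) * \<theta> + phase j + real b * pi / 2) + pi / 2)"
    by (simp add: field_simps)
  also have "\<dots> = - sin (of_int (freq j) * \<theta> + phase j + real b * pi / 2)"
    by (simp add: minus_sin_cos_eq)
  finally show ?thesis unfolding angular_def by (auto intro!: derivative_eq_intros)
qed

lemma radial_deriv:
  assumes "T > 0"
  shows "(radial T a j has_real_derivative radial T (Suc a) j t) (at t)"
proof (cases "j = 1")
  case True
  have "((\<lambda>t. (2 * t - T) / T) has_real_derivative 2 / T) (at t)"
    using assms by (auto intro!: derivative_eq_intros)
  moreover have "radial T a j = (\<lambda>t. if a = 0 then (2 * t - T) / T else if a = 1 then 2 / T else 0)" for a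
    using True by (simp add: radial_def fun_eq_iff)
  ultimately show ?thesis by (cases "a = 0"; cases "a = 1") simp_all
next
  case False
  have f: "radial T a j = (\<lambda>t. \<bar>of_int (freq j)\<bar> ^ a * (exp (- \<bar>of_int (freq j)\<bar> * (T - t))
      + (- 1) ^ a * parity j * exp (- \<bar>of_int (freq j)\<bar> * t)) / (1 + parity j * exp (- \<bar>of_int (freq j)\<bar> * T)))" for a
    using False by (simp add: radial_def fun_eq_iff Let_def)
  have gen: "((\<lambda>t. n ^ a * (exp (- n * (T - t)) + s * exp (- n * t)) / D) has_real_derivative
      n ^ Suc a * (exp (- n * (T - t)) + (- s) * exp (- n * t)) / D) (at t)" for n s D :: real
  proof -
    have "((\<lambda>t. exp (- n * (T - t)) + s * exp (- n * t)) has_real_derivative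
        n * (exp (- n * (T - t)) + (- s) * exp (- n * t))) (at t)"
      by (auto intro!: derivative_eq_intros simp: algebra_simps)
    from DERIV_cdivide[OF DERIV_cmult[OF this, of "n ^ a"], of D] show ?thesis
      by (simp only: power_Suc mult.assoc mult.commute mult.left_commute)
  qed
  show ?thesis unfolding f
    using gen[of "\<bar>of_int (freq j)\<bar>" "(- 1) ^ a * parity j"] by (simp only: power_Suc mult_minus1 mult_minus_left mult_1_left)
qed

lemma exp_freq_le:
  assumes "T > 0" "j \<noteq> 0" "j \<noteq> 1"
  shows "exp (- \<bar>real_of_int (freq j)\<bar> * T) \<le> exp (- T)" "\<bar>real_of_int (freq j)\<bar> \<ge> 1"
proof -
  have "freq j \<noteq> 0" using assms freq_eq_0_iff[of j] by simp
  then show *: "\<bar>real_of_int (freq j)\<bar> \<ge> 1" by linarith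
  show "exp (- \<bar>real_of_int (freq j)\<bar> * T) \<le> exp (- T)" using * assms(1) by simp
qed

lemma radial_denominator:
  assumes "T > 0" "j \<noteq> 1"
  shows "1 + parity j * exp (- \<bar>of_int (freq j)\<bar> * T) \<ge> 1 - exp (- T)"
proof (cases "j = 0")
  case False
  have "exp (- \<bar>of_int (freq j)\<bar> * T) > 0" "exp (- T) > 0" by simp_all
  then show ?thesis using exp_freq_le(1)[OF assms(1) False assms(2)] parity_cases[of j]
    by (elim disjE; simp only: mult_1_left mult_minus_left; linarith)
next
  case True
  have "0 < exp (- T)" by simp
  then have "- 1 \<le> exp (- T)" by linarith
  then show ?thesis using True by simp
qed

lemma radial_boundary:
  assumes "T > 0"
  shows "radial T 0 j T = 1" "radial T 0 j 0 = parity j" "radial T 1 j 0 = - parity j * dtn T j"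
proof -
  have e: "0 < 1 - exp (- T)" using assms by simp
  have d: "1 + parity j * exp (- \<bar>of_int (freq j)\<bar> * T) \<noteq> 0" if "j \<noteq> 1"
    using radial_denominator[OF assms that] e by linarith
  show "radial T 0 j T = 1"
  proof (cases "j = 1")
    case False
    then show ?thesis using d[OF False] by (simp add: radial_def Let_def)
  qed (use assms in \<open>simp add: radial_def\<close>)
  show "radial T 0 j 0 = parity j"
  proof (cases "j = 1")
    case False
    have "exp (- \<bar>of_int (freq j)\<bar> * T) + parity j = parity j * (1 + parity j * exp (- \<bar>of_int (freq j)\<bar> * T))"
      by (simp add: distrib_left mult.assoc[symmetric])
    then show ?thesis using d[OF False] False by (simp add: radial_def Let_def)
  qed (use assms in \<open>simp add: radial_def\<close>)
  show "radial T 1 j 0 = - parity j * dtn T j"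
  proof (cases "j = 1")
    case False
    let ?n = "\<bar>real_of_int (freq j)\<bar>" and ?e = "exp (- \<bar>real_of_int (freq j)\<bar> * T)"
    have num: "?n ^ 1 * (?e + (- 1) ^ 1 * parity j * 1) = - parity j * (?n ^ 1 * (1 + (- 1) ^ 1 * parity j * ?e))"
      using parity_cases[of j] by (elim disjE) (simp_all add: right_diff_distrib distrib_left)
    have "radial T 1 j 0 = ?n ^ 1 * (?e + (- 1) ^ 1 * parity j * 1) / (1 + parity j * ?e)"
      using False by (simp add: radial_def Let_def)
    also have "\<dots> = - parity j * dtn T j"
      unfolding num using False by (simp add: dtn_def radial_def Let_def)
    finally show ?thesis .
  qed (use assms in \<open>simp add: radial_def dtn_def\<close>)
qed

lemma dtn_0 [simp]: "dtn T 0 = 0" by (simp add: dtn_def radial_def)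

lemma radial_bound:
  assumes "T > 0"
  obtains R where "\<And>a j t. t \<in> {0..T} \<Longrightarrow> \<bar>radial T a j t\<bar> \<le> R * (1 + \<bar>of_int (freq j)\<bar>) ^ a" "R \<ge> 0"
proof -
  define R where "R = 2 / (1 - exp (- T)) + 1 + 2 / T"
  have e: "1 - exp (- T) > 0" using assms by simp
  have R: "R \<ge> 2 / (1 - exp (- T))" "R \<ge> 1" "R \<ge> 2 / T" using assms e by (auto simp: R_def)
  have "\<bar>radial T a j t\<bar> \<le> R * (1 + \<bar>of_int (freq j)\<bar>) ^ a" if t: "t \<in> {0..T}" for a j t
  proof (cases "j = 1")
    case True
    have "\<bar>(2 * t - T) / T\<bar> \<le> 1" using t assms by (auto simp: abs_le_iff field_simps)
    then have "\<bar>(2 * t - T) / T\<bar> \<le> R" using R by linarith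
    moreover have "\<bar>2 / T\<bar> \<le> R" using R assms by simp
    ultimately show ?thesis using True R by (simp add: radial_def)
  next
    case False
    let ?n = "\<bar>real_of_int (freq j)\<bar>"
    let ?D = "1 + parity j * exp (- ?n * T)"
    let ?X = "exp (- ?n * (T - t)) + (- 1) ^ a * parity j * exp (- ?n * t)"
    have D: "?D \<ge> 1 - exp (- T)" by (rule radial_denominator[OF assms False])
    have "\<bar>?X\<bar> \<le> \<bar>exp (- ?n * (T - t))\<bar> + \<bar>(- 1) ^ a * parity j * exp (- ?n * t)\<bar>" by (rule abs_triangle_ineq)
    also have "\<dots> \<le> 1 + 1" using t parity_cases[of j] by (intro add_mono) (auto simp: abs_mult power_abs)
    finally have X: "\<bar>?X\<bar> \<le> 2" by simp
    have D0: "?D > 0" using D e by linarith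
    then have "\<bar>?D\<bar> = ?D" by linarith
    then have "\<bar>radial T a j t\<bar> = ?n ^ a * (\<bar>?X\<bar> / ?D)"
      using False by (simp only: radial_def Let_def abs_mult power_abs abs_divide abs_abs if_False times_divide_eq_right)
    also have "\<dots> \<le> (1 + ?n) ^ a * (2 / (1 - exp (- T)))"
    proof (intro mult_mono power_mono frac_le X D)
      show "0 \<le> \<bar>?X\<bar> / ?D" using D0 by (intro divide_nonneg_pos) auto
    qed (use e in auto)
    also have "\<dots> \<le> (1 + ?n) ^ a * R" using R by (intro mult_left_mono) auto
    finally show ?thesis by (simp add: mult.commute)
  qed
  moreover have "R \<ge> 0" using R by simp
  ultimately show thesis by (rule that)
qed

lemma angular_bound: "\<bar>angular b j \<theta>\<bar> \<le> (1 + \<bar>of_int (freq j)\<bar>) ^ b"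
proof -
  have "\<bar>angular b j \<theta>\<bar> \<le> \<bar>of_int (freq j)\<bar> ^ b * 1"
    unfolding angular_def abs_mult power_abs by (intro mult_left_mono) auto
  also have "\<dots> \<le> (1 + \<bar>of_int (freq j)\<bar>) ^ b" by (simp add: power_mono)
  finally show ?thesis .
qed

text \<open>
  The eigenvalue of a mode of frequency \<open>n \<noteq> 0\<close> is \<open>|n|\<close> times a factor that is at least
  \<open>(1 - exp (- T)) / 2\<close>. The constant \<open>\<gamma>\<close> also accommodates the affine mode, with eigenvalue
  \<open>2 / T\<close>.
\<close>

lemma dtn_lower_bound:
  assumes "T > 0"
  obtains \<gamma> where "\<gamma> > 0" "\<And>j. j \<ge> 1 \<Longrightarrow> dtn T j \<ge> \<gamma> * (1 + \<bar>of_int (freq j)\<bar>)"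
proof -
  define \<gamma> where "\<gamma> = min ((1 - exp (- T)) / 4) (2 / T)"
  have e: "1 - exp (- T) > 0" using assms by simp
  have \<gamma>: "\<gamma> > 0" "\<gamma> \<le> (1 - exp (- T)) / 4" "\<gamma> \<le> 2 / T" using assms e unfolding \<gamma>_def by (simp_all only: min.cobounded1 min.cobounded2 min_less_iff_conj) simp
  have "dtn T j \<ge> \<gamma> * (1 + \<bar>of_int (freq j)\<bar>)" if "j \<ge> 1" for j
  proof (cases "j = 1")
    case True
    then show ?thesis using \<gamma> by (simp add: dtn_def radial_def)
  next
    case False
    then have j: "j \<noteq> 0" "j \<noteq> 1" using that by auto
    let ?n = "\<bar>real_of_int (freq j)\<bar>" and ?e = "exp (- \<bar>real_of_int (freq j)\<bar> * T)"
    note n = exp_freq_le[OF assms j]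
    have D: "1 + parity j * ?e > 0" "1 + parity j * ?e \<le> 2"
    proof -
      show "1 + parity j * ?e > 0" by (rule less_le_trans[OF e radial_denominator[OF assms j(2)]])
      have "exp (- T) \<le> 1" "?e > 0" using assms by simp_all
      then show "1 + parity j * ?e \<le> 2"
        using parity_cases[of j] n by (elim disjE; simp only: mult_1_left mult_minus_left; linarith)
    qed
    have "exp (- T) > 0" "?e > 0" by simp_all
    then have num: "1 - parity j * ?e \<ge> 1 - exp (- T)"
      using parity_cases[of j] n by (elim disjE; simp only: mult_1_left mult_minus_left; linarith)
    have "\<gamma> * (1 + ?n) \<le> (1 - exp (- T)) / 4 * (?n + ?n)"
      using \<gamma> n(2) e by (intro mult_mono) auto
    also have "\<dots> = ?n * ((1 - exp (- T)) / 2)" by simp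
    also have "\<dots> \<le> ?n * ((1 - parity j * ?e) / (1 + parity j * ?e))"
    proof (intro mult_left_mono frac_le num D)
      show "0 \<le> 1 - parity j * ?e" using num e by linarith
    qed simp
    also have "\<dots> = dtn T j" using j by (simp add: dtn_def radial_def Let_def)
    finally show ?thesis .
  qed
  then show thesis using \<gamma>(1) that by blast
qed

lemma angular_mult:
  "angular 0 j \<theta> * angular 0 k \<theta> = (cos (of_int (freq j - freq k) * \<theta> + (phase j - phase k))
     + cos (of_int (freq j + freq k) * \<theta> + (phase j + phase k))) / 2"
proof -
  have eq: "of_int (freq j - freq k) * \<theta> + (phase j - phase k) =
      (of_int (freq j) * \<theta> + phase j) - (of_int (freq k) * \<theta> + phase k)"
    "of_int (freq j + freq k) * \<theta> + (phase j + phase k) =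
      (of_int (freq j) * \<theta> + phase j) + (of_int (freq k) * \<theta> + phase k)"
    by (simp_all add: algebra_simps)
  have "cos a * cos b = (cos (a - b) + cos (a + b)) / 2" for a b :: real
    by (simp add: cos_add cos_diff)
  then show ?thesis unfolding eq by (simp only: angular_def power_0 mult_1_left of_nat_0 mult_zero_left div_0 add_0_right)
qed

lemma continuous_on_angular [continuous_intros]: "continuous_on S (angular b j)"
  unfolding angular_def by (intro continuous_intros)

text \<open>The square of the norm of the \<open>j\<close>-th mode in \<open>L\<^sup>2\<close> of the boundary of the flat annulus.\<close>

definition mode_mass :: "nat \<Rightarrow> real" where "mode_mass j = (if freq j = 0 then 4 * pi else 2 * pi)"

text \<open>
  The inner product of two modes in \<open>L\<^sup>2\<close> of the whole boundary. The summand \<open>1\<close> comes from the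
  end \<open>t = T\<close> and the summand \<open>parity j * parity k\<close> from the end \<open>t = 0\<close>: two modes with equal
  frequency and opposite parity are orthogonal only because the two ends cancel.
\<close>

lemma angular_orthogonal:
  "(1 + parity j * parity k) * integral {0..2 * pi} (\<lambda>\<theta>. angular 0 j \<theta> * angular 0 k \<theta>) =
     (if j = k then mode_mass j else 0)"
proof -
  have I: "integral {0..2 * pi} (\<lambda>\<theta>. angular 0 j \<theta> * angular 0 k \<theta>) =
    ((if freq j - freq k = 0 then 2 * pi * cos (phase j - phase k) else 0) +
     (if freq j + freq k = 0 then 2 * pi * cos (phase j + phase k) else 0)) / 2"
  proof -
    have "integral {0..2 * pi} (\<lambda>\<theta>. angular 0 j \<theta> * angular 0 k \<theta>) =
      (integral {0..2 * pi} (\<lambda>\<theta>. cos (of_int (freq j - freq k) * \<theta> + (phase j - phase k)))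
      + integral {0..2 * pi} (\<lambda>\<theta>. cos (of_int (freq j + freq k) * \<theta> + (phase j + phase k)))) / 2"
      unfolding angular_mult
      by (subst integral_add[symmetric]) (auto intro!: integrable_continuous_real continuous_intros)
    then show ?thesis unfolding integral_cos_freq .
  qed
  show ?thesis
  proof (cases "freq j = freq k")
    case True
    then have div: "j div 2 = k div 2" by (simp add: freq_def int_decode_eq)
    show ?thesis
    proof (cases "j = k")
      case True
      then show ?thesis unfolding I by (auto simp: mode_mass_def phase_def)
    next
      case False
      then have "even j \<noteq> even k" using div by (metis even_two_times_div_two odd_two_times_div_two_succ)
      then show ?thesis using False by (auto simp: parity_def)
    qed
  next
    case False
    have "cos (phase j + phase k) = 0" if "freq j + freq k = 0"
    proof -
      have "(freq j \<ge> 0) \<noteq> (freq k \<ge> 0)" using that False by linarith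
      then show ?thesis by (auto simp: phase_def)
    qed
    then show ?thesis unfolding I using False by auto
  qed
qed

section \<open>Existence of a first Steklov eigenfunction\<close>

text \<open>
  The Gram matrix of the modes for the boundary measure with densities \<open>b0\<close> at \<open>t = 0\<close> and \<open>b1\<close> at
  \<open>t = T\<close>. Below, \<open>trace0\<close> and \<open>trace1\<close> are the restrictions to the two ends of a finite
  combination of modes.
\<close>

definition weight_matrix :: "(real \<Rightarrow> real) \<Rightarrow> (real \<Rightarrow> real) \<Rightarrow> nat \<Rightarrow> nat \<Rightarrow> real" where
  "weight_matrix b0 b1 j k = integral {0..2 * pi} (\<lambda>\<theta>.
     (b1 \<theta> + parity j * parity k * b0 \<theta>) * (angular 0 j \<theta> * angular 0 k \<theta>))"

definition trace0 :: "nat \<Rightarrow> (nat \<Rightarrow> real) \<Rightarrow> real \<Rightarrow> real" where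
  "trace0 N c \<theta> = (\<Sum>j<N. c j * parity j * angular 0 j \<theta>)"

definition trace1 :: "nat \<Rightarrow> (nat \<Rightarrow> real) \<Rightarrow> real \<Rightarrow> real" where
  "trace1 N c \<theta> = (\<Sum>j<N. c j * angular 0 j \<theta>)"

lemma bilin_weight_matrix:
  assumes [continuous_intros]: "continuous_on {0..2*pi} b0" "continuous_on {0..2*pi} b1"
  shows "bilin N (weight_matrix b0 b1) c c =
    integral {0..2 * pi} (\<lambda>\<theta>. b0 \<theta> * (trace0 N c \<theta>)\<^sup>2 + b1 \<theta> * (trace1 N c \<theta>)\<^sup>2)"
proof -
  have pt: "b0 \<theta> * (trace0 N c \<theta>)\<^sup>2 + b1 \<theta> * (trace1 N c \<theta>)\<^sup>2 =
    (\<Sum>j<N. \<Sum>k<N. c j * c k * ((b1 \<theta> + parity j * parity k * b0 \<theta>) * (angular 0 j \<theta> * angular 0 k \<theta>)))" for \<theta>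
  proof -
    have t0: "(trace0 N c \<theta>)\<^sup>2 = (\<Sum>j<N. \<Sum>k<N. (c j * parity j * angular 0 j \<theta>) * (c k * parity k * angular 0 k \<theta>))"
      and t1: "(trace1 N c \<theta>)\<^sup>2 = (\<Sum>j<N. \<Sum>k<N. (c j * angular 0 j \<theta>) * (c k * angular 0 k \<theta>))"
      by (simp_all only: trace0_def trace1_def power2_eq_square sum_product)
    show ?thesis unfolding t0 t1 sum_distrib_left sum.distrib[symmetric]
      by (intro sum.cong refl) (simp add: algebra_simps)
  qed
  have i: "(\<lambda>\<theta>. c j * c k * ((b1 \<theta> + parity j * parity k * b0 \<theta>) * (angular 0 j \<theta> * angular 0 k \<theta>)))
    integrable_on {0..2*pi}" for j k
    by (intro integrable_continuous_real continuous_intros)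
  have "integral {0..2 * pi} (\<lambda>\<theta>. b0 \<theta> * (trace0 N c \<theta>)\<^sup>2 + b1 \<theta> * (trace1 N c \<theta>)\<^sup>2) =
    (\<Sum>j<N. \<Sum>k<N. integral {0..2*pi} (\<lambda>\<theta>. c j * c k *
      ((b1 \<theta> + parity j * parity k * b0 \<theta>) * (angular 0 j \<theta> * angular 0 k \<theta>))))"
    unfolding pt by (simp only: integral_sum integrable_sum i finite_lessThan)
  also have "\<dots> = bilin N (weight_matrix b0 b1) c c"
    unfolding bilin_def weight_matrix_def integral_mult_right
    by (intro sum.cong refl) (simp only: mult.commute mult.left_commute mult.assoc)
  finally show ?thesis by (rule sym)
qed

lemma weight_matrix_row0:
  assumes [continuous_intros]: "continuous_on {0..2*pi} b0" "continuous_on {0..2*pi} b1"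
  shows "(\<Sum>k<N. weight_matrix b0 b1 0 k * c k) =
    integral {0..2 * pi} (\<lambda>\<theta>. b0 \<theta> * trace0 N c \<theta> + b1 \<theta> * trace1 N c \<theta>)"
proof -
  have one: "angular 0 0 \<theta> = 1" for \<theta> by (simp add: angular_def phase_def)
  have pt: "b0 \<theta> * trace0 N c \<theta> + b1 \<theta> * trace1 N c \<theta> =
    (\<Sum>k<N. c k * ((b1 \<theta> + parity 0 * parity k * b0 \<theta>) * (angular 0 0 \<theta> * angular 0 k \<theta>)))" for \<theta>
    unfolding trace0_def trace1_def sum_distrib_left sum.distrib[symmetric] one
    by (intro sum.cong refl) (simp add: algebra_simps)
  have i: "(\<lambda>\<theta>. c k * ((b1 \<theta> + parity 0 * parity k * b0 \<theta>) * (angular 0 0 \<theta> * angular 0 k \<theta>)))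
    integrable_on {0..2*pi}" for k
    by (intro integrable_continuous_real continuous_intros)
  have "integral {0..2 * pi} (\<lambda>\<theta>. b0 \<theta> * trace0 N c \<theta> + b1 \<theta> * trace1 N c \<theta>) =
      (\<Sum>k<N. integral {0..2*pi} (\<lambda>\<theta>. c k * ((b1 \<theta> + parity 0 * parity k * b0 \<theta>) * (angular 0 0 \<theta> * angular 0 k \<theta>))))"
    unfolding pt by (rule integral_sum[OF finite_lessThan i])
  also have "\<dots> = (\<Sum>k<N. weight_matrix b0 b1 0 k * c k)"
    unfolding weight_matrix_def integral_mult_right by (intro sum.cong refl mult.commute)
  finally show ?thesis by (rule sym)
qed

lemma weight_matrix_one: "weight_matrix (\<lambda>_. 1) (\<lambda>_. 1) j k = (if j = k then mode_mass j else 0)"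
  using angular_orthogonal[of j k] by (simp add: weight_matrix_def)

lemma weight_matrix_pos:
  assumes cont: "continuous_on {0..2*pi} b0" "continuous_on {0..2*pi} b1"
    and lb: "\<And>\<theta>. \<theta> \<in> {0..2*pi} \<Longrightarrow> b0 \<theta> \<ge> \<delta>" "\<And>\<theta>. \<theta> \<in> {0..2*pi} \<Longrightarrow> b1 \<theta> \<ge> \<delta>" and \<delta>: "\<delta> > 0"
  shows "bilin N (weight_matrix b0 b1) c c \<ge> \<delta> * (\<Sum>j<N. (c j)\<^sup>2)"
proof -
  note [continuous_intros] = cont
  have [continuous_intros]: "continuous_on {0..2*pi} (trace0 N c)" "continuous_on {0..2*pi} (trace1 N c)"
    unfolding trace0_def trace1_def by (intro continuous_intros)+
  have "(\<Sum>j<N. (c j)\<^sup>2) \<le> (\<Sum>j<N. mode_mass j * (c j)\<^sup>2)"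
  proof (intro sum_mono)
    fix j
    have "1 \<le> mode_mass j" using pi_ge_two by (simp add: mode_mass_def)
    then show "(c j)\<^sup>2 \<le> mode_mass j * (c j)\<^sup>2" using mult_right_mono[of 1 "mode_mass j" "(c j)\<^sup>2"] by simp
  qed
  also have "\<dots> = bilin N (weight_matrix (\<lambda>_. 1) (\<lambda>_. 1)) c c"
    unfolding bilin_def weight_matrix_one
    by (simp add: if_distrib[of "\<lambda>x. x * _"] sum.delta' power2_eq_square mult.assoc cong: if_cong)
  also have "\<dots> = integral {0..2 * pi} (\<lambda>\<theta>. (trace0 N c \<theta>)\<^sup>2 + (trace1 N c \<theta>)\<^sup>2)"
    by (subst bilin_weight_matrix) (auto intro!: continuous_intros)
  finally have "\<delta> * (\<Sum>j<N. (c j)\<^sup>2) \<le> \<delta> * integral {0..2 * pi} (\<lambda>\<theta>. (trace0 N c \<theta>)\<^sup>2 + (trace1 N c \<theta>)\<^sup>2)"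
    using \<delta> by (intro mult_left_mono) auto
  also have "\<dots> = integral {0..2 * pi} (\<lambda>\<theta>. \<delta> * ((trace0 N c \<theta>)\<^sup>2 + (trace1 N c \<theta>)\<^sup>2))" by simp
  also have "\<dots> \<le> integral {0..2 * pi} (\<lambda>\<theta>. b0 \<theta> * (trace0 N c \<theta>)\<^sup>2 + b1 \<theta> * (trace1 N c \<theta>)\<^sup>2)"
  proof (rule integral_le)
    fix \<theta> assume "\<theta> \<in> {0..2*pi}"
    then show "\<delta> * ((trace0 N c \<theta>)\<^sup>2 + (trace1 N c \<theta>)\<^sup>2) \<le> b0 \<theta> * (trace0 N c \<theta>)\<^sup>2 + b1 \<theta> * (trace1 N c \<theta>)\<^sup>2"
      unfolding distrib_left by (intro add_mono mult_right_mono lb) auto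
  qed (intro integrable_continuous_real continuous_intros)+
  also have "\<dots> = bilin N (weight_matrix b0 b1) c c" by (rule bilin_weight_matrix[OF cont, symmetric])
  finally show ?thesis .
qed

lemma angular_product_decay:
  assumes "smooth_on UNIV g" "\<And>x. g (x + 2 * pi) = g x"
  shows "\<exists>C. \<forall>j k. \<bar>integral {0..2 * pi} (\<lambda>\<theta>. g \<theta> * (angular 0 j \<theta> * angular 0 k \<theta>))\<bar> \<le>
    C * (1 / (1 + \<bar>of_int (freq j - freq k)\<bar>) ^ m + 1 / (1 + \<bar>of_int (freq j + freq k)\<bar>) ^ m)"
proof -
  obtain C where C: "\<And>(k::int) \<phi>. \<bar>integral {0..2 * pi} (\<lambda>\<theta>. g \<theta> * cos (of_int k * \<theta> + \<phi>))\<bar> \<le> C / (1 + \<bar>of_int k\<bar>) ^ m"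
    using fourier_decay[OF assms, of m] by blast
  have [continuous_intros]: "continuous_on {0..2*pi} g"
    using smooth_on_imp_continuous_on[OF assms(1)] continuous_on_subset by blast
  have "\<bar>integral {0..2 * pi} (\<lambda>\<theta>. g \<theta> * (angular 0 j \<theta> * angular 0 k \<theta>))\<bar> \<le>
    C / 2 * (1 / (1 + \<bar>of_int (freq j - freq k)\<bar>) ^ m + 1 / (1 + \<bar>of_int (freq j + freq k)\<bar>) ^ m)" for j k
  proof -
    let ?A = "integral {0..2 * pi} (\<lambda>\<theta>. g \<theta> * cos (of_int (freq j - freq k) * \<theta> + (phase j - phase k)))"
    let ?B = "integral {0..2 * pi} (\<lambda>\<theta>. g \<theta> * cos (of_int (freq j + freq k) * \<theta> + (phase j + phase k)))"
    have "integral {0..2 * pi} (\<lambda>\<theta>. g \<theta> * (angular 0 j \<theta> * angular 0 k \<theta>)) =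
        integral {0..2 * pi} (\<lambda>\<theta>. (g \<theta> * cos (of_int (freq j - freq k) * \<theta> + (phase j - phase k))
        + g \<theta> * cos (of_int (freq j + freq k) * \<theta> + (phase j + phase k))) / 2)"
      by (simp only: angular_mult times_divide_eq_right distrib_left)
    also have "\<dots> = (?A + ?B) / 2"
      unfolding integral_divide
      by (subst integral_add) (auto intro!: integrable_continuous_real continuous_intros)
    finally have "\<bar>integral {0..2 * pi} (\<lambda>\<theta>. g \<theta> * (angular 0 j \<theta> * angular 0 k \<theta>))\<bar> = \<bar>?A + ?B\<bar> / 2" by simp
    also have "\<dots> \<le> (C / (1 + \<bar>of_int (freq j - freq k)\<bar>) ^ m + C / (1 + \<bar>of_int (freq j + freq k)\<bar>) ^ m) / 2"
      by (intro divide_right_mono order_trans[OF abs_triangle_ineq] add_mono C) auto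
    finally show ?thesis by (simp add: distrib_left)
  qed
  then show ?thesis by blast
qed

locale boundary_weight =
  fixes T :: real and b0 b1 :: "real \<Rightarrow> real"
  assumes T: "T > 0"
    and smooth: "smooth_on UNIV b0" "smooth_on UNIV b1"
    and per: "\<And>\<theta>. b0 (\<theta> + 2 * pi) = b0 \<theta>" "\<And>\<theta>. b1 (\<theta> + 2 * pi) = b1 \<theta>"
    and pos: "\<And>\<theta>. b0 \<theta> > 0" "\<And>\<theta>. b1 \<theta> > 0"
begin

abbreviation "B \<equiv> weight_matrix b0 b1"

abbreviation "L \<equiv> \<lambda>j. dtn T j * mode_mass j"

lemma cont: "continuous_on S b0" "continuous_on S b1"
  using smooth_on_imp_continuous_on[OF smooth(1)] smooth_on_imp_continuous_on[OF smooth(2)]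
    continuous_on_subset by blast+

lemma weight_matrix_split:
  "B j k = integral {0..2 * pi} (\<lambda>\<theta>. b1 \<theta> * (angular 0 j \<theta> * angular 0 k \<theta>))
    + parity j * parity k * integral {0..2 * pi} (\<lambda>\<theta>. b0 \<theta> * (angular 0 j \<theta> * angular 0 k \<theta>))"
proof -
  note [continuous_intros] = cont
  show ?thesis unfolding weight_matrix_def distrib_right
    by (subst integral_add) (auto intro!: integrable_continuous_real continuous_intros simp: mult.assoc)
qed

lemma ex_galerkin: "\<exists>\<delta> \<gamma>. galerkin B L \<delta> \<gamma>"
proof -
  have "\<exists>\<delta>>0. (\<forall>\<theta>\<in>{0..2*pi}. b0 \<theta> \<ge> \<delta>) \<and> (\<forall>\<theta>\<in>{0..2*pi}. b1 \<theta> \<ge> \<delta>)"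
  proof -
    have ne: "{0..2*pi} \<noteq> {}" by simp
    obtain x where x: "\<And>\<theta>. \<theta> \<in> {0..2*pi} \<Longrightarrow> b0 x \<le> b0 \<theta>"
      using continuous_attains_inf[OF compact_Icc ne cont(1)] by blast
    obtain y where y: "\<And>\<theta>. \<theta> \<in> {0..2*pi} \<Longrightarrow> b1 y \<le> b1 \<theta>"
      using continuous_attains_inf[OF compact_Icc ne cont(2)] by blast
    show ?thesis
    proof (intro exI[of _ "min (b0 x) (b1 y)"] conjI ballI)
      show "0 < min (b0 x) (b1 y)" using pos by simp
    qed (use x y in \<open>auto intro: min.coboundedI1 min.coboundedI2\<close>)
  qed
  then obtain \<delta> where \<delta>: "\<delta> > 0" "\<And>\<theta>. \<theta> \<in> {0..2*pi} \<Longrightarrow> b0 \<theta> \<ge> \<delta>" "\<And>\<theta>. \<theta> \<in> {0..2*pi} \<Longrightarrow> b1 \<theta> \<ge> \<delta>" by blast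
  obtain \<gamma> where \<gamma>: "\<gamma> > 0" "\<And>j. j \<ge> 1 \<Longrightarrow> dtn T j \<ge> \<gamma> * (1 + \<bar>of_int (freq j)\<bar>)"
    using dtn_lower_bound[OF T] by blast
  have "galerkin B L \<delta> \<gamma>"
  proof
    show "B j k = B k j" for j k by (simp add: weight_matrix_def mult.commute mult.left_commute)
    show "\<gamma> * (1 + \<bar>of_int (freq j)\<bar>) \<le> dtn T j * mode_mass j" if "1 \<le> j" for j
    proof -
      have "1 \<le> mode_mass j" using pi_ge_two by (simp add: mode_mass_def)
      moreover have "0 \<le> \<gamma> * (1 + \<bar>real_of_int (freq j)\<bar>)" using \<gamma>(1) by simp
      ultimately have "\<gamma> * (1 + \<bar>real_of_int (freq j)\<bar>) * 1 \<le> dtn T j * mode_mass j"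
        using \<gamma>(2)[OF that] by (intro mult_mono) auto
      then show ?thesis by simp
    qed
    show "\<delta> * (\<Sum>j<N. (c j)\<^sup>2) \<le> bilin N B c c" for N c
      by (rule weight_matrix_pos[OF cont \<delta>(2,3,1)])
    fix m
    obtain C0 where C0: "\<And>j k. \<bar>integral {0..2 * pi} (\<lambda>\<theta>. b0 \<theta> * (angular 0 j \<theta> * angular 0 k \<theta>))\<bar> \<le>
      C0 * (1 / (1 + \<bar>of_int (freq j - freq k)\<bar>) ^ m + 1 / (1 + \<bar>of_int (freq j + freq k)\<bar>) ^ m)"
      using angular_product_decay[OF smooth(1) per(1), of m] by blast
    obtain C1 where C1: "\<And>j k. \<bar>integral {0..2 * pi} (\<lambda>\<theta>. b1 \<theta> * (angular 0 j \<theta> * angular 0 k \<theta>))\<bar> \<le>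
      C1 * (1 / (1 + \<bar>of_int (freq j - freq k)\<bar>) ^ m + 1 / (1 + \<bar>of_int (freq j + freq k)\<bar>) ^ m)"
      using angular_product_decay[OF smooth(2) per(2), of m] by blast
    have "\<bar>B j k\<bar> \<le> (C1 + C0) * (1 / (1 + \<bar>of_int (freq j - freq k)\<bar>) ^ m + 1 / (1 + \<bar>of_int (freq j + freq k)\<bar>) ^ m)" for j k
    proof -
      have p: "\<bar>parity j * parity k * x\<bar> = \<bar>x\<bar>" for x using parity_cases[of j] parity_cases[of k] by auto
      show ?thesis unfolding weight_matrix_split distrib_right[of C1]
        by (intro order_trans[OF abs_triangle_ineq] add_mono) (simp_all only: p C0 C1)
    qed
    then show "\<exists>C. \<forall>j k. \<bar>B j k\<bar> \<le> C * (1 / (1 + \<bar>of_int (freq j - freq k)\<bar>) ^ m + 1 / (1 + \<bar>of_int (freq j + freq k)\<bar>) ^ m)" by blast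
  qed (use \<delta> \<gamma> in auto)
  then show ?thesis by blast
qed

text \<open>
  Each frequency appears with one sign of phase only, but \<open>n\<close> and \<open>- n\<close> together supply both the
  cosine and the sine.
\<close>

lemma all_frequencies:
  assumes g: "continuous_on {0..2*pi} g" and z: "\<And>j. integral {0..2 * pi} (\<lambda>\<theta>. g \<theta> * angular 0 j \<theta>) = 0"
  shows "integral {0..2 * pi} (\<lambda>\<theta>. g \<theta> * cos (of_int n * \<theta> + \<phi>)) = 0"
proof -
  note [continuous_intros] = g
  have fr: "\<exists>j. freq j = m" for m
  proof -
    have "int_decode (int_encode m) = m" by simp
    then show ?thesis unfolding freq_def by (intro exI[of _ "2 * int_encode m"]) simp
  qed
  have C: "integral {0..2 * pi} (\<lambda>\<theta>. g \<theta> * cos (of_int m * \<theta>)) = 0" if "m \<ge> 0" for m :: int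
  proof -
    obtain j where "freq j = m" using fr by blast
    then show ?thesis using z[of j] that by (simp add: angular_def phase_def)
  qed
  have S: "integral {0..2 * pi} (\<lambda>\<theta>. g \<theta> * sin (of_int m * \<theta>)) = 0" if "m < 0" for m :: int
  proof -
    obtain j where "freq j = m" using fr by blast
    then show ?thesis using z[of j] that by (simp add: angular_def phase_def cos_diff)
  qed
  have C': "integral {0..2 * pi} (\<lambda>\<theta>. g \<theta> * cos (of_int m * \<theta>)) = 0" for m :: int
    using C[of m] C[of "- m"] by (cases "m \<ge> 0") auto
  have S': "integral {0..2 * pi} (\<lambda>\<theta>. g \<theta> * sin (of_int m * \<theta>)) = 0" for m :: int
    using S[of m] S[of "- m"] by (cases "m < 0"; cases "m = 0") auto
  have "integral {0..2 * pi} (\<lambda>\<theta>. g \<theta> * cos (of_int n * \<theta> + \<phi>)) =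
    integral {0..2 * pi} (\<lambda>\<theta>. cos \<phi> * (g \<theta> * cos (of_int n * \<theta>)) - sin \<phi> * (g \<theta> * sin (of_int n * \<theta>)))"
    by (simp add: cos_add algebra_simps)
  also have "\<dots> = cos \<phi> * integral {0..2 * pi} (\<lambda>\<theta>. g \<theta> * cos (of_int n * \<theta>))
      - sin \<phi> * integral {0..2 * pi} (\<lambda>\<theta>. g \<theta> * sin (of_int n * \<theta>))"
    by (subst integral_diff) (auto intro!: integrable_continuous_real continuous_intros)
  finally show ?thesis using C' S' by simp
qed

text \<open>
  The function is the series of harmonic modes with the coefficients of \<open>ex_limit_solution\<close>; rapid
  decay makes it smooth up to the boundary and harmonic. The discrete equation says that the
  defect of the Steklov condition is orthogonal, on the whole boundary, to every mode. Combining
  the two modes of the same frequency separates the two ends, and completeness of the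
  trigonometric system shows that the defect vanishes on each. The last clause is the variational
  property, tested on finite combinations of modes.
\<close>

theorem ex_steklov_solution:
  obtains \<sigma> u where "smooth_on (annulus T) u"
    "\<And>t \<theta>. u (t, \<theta> + 2 * pi) = u (t, \<theta>)"
    "\<exists>u1 u2 u11 u12 u22. (\<forall>x\<in>annulus T.
        (u has_derivative (\<lambda>h. fst h * u1 x + snd h * u2 x)) (at x within annulus T) \<and>
        (u1 has_derivative (\<lambda>h. fst h * u11 x + snd h * u12 x)) (at x within annulus T) \<and>
        (u2 has_derivative (\<lambda>h. fst h * u12 x + snd h * u22 x)) (at x within annulus T) \<and>
        u11 x + u22 x = 0) \<and>
      (\<forall>\<theta>. - u1 (0, \<theta>) = \<sigma> * b0 \<theta> * u (0, \<theta>) \<and> u1 (T, \<theta>) = \<sigma> * b1 \<theta> * u (T, \<theta>))"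
    "\<nexists>c. \<forall>x\<in>annulus T. u x = c" "\<sigma> \<ge> 0"
    "\<And>N d. (\<And>j. j \<ge> N \<Longrightarrow> d j = 0) \<Longrightarrow>
       integral {0..2 * pi} (\<lambda>\<theta>. b0 \<theta> * trace0 N d \<theta> + b1 \<theta> * trace1 N d \<theta>) = 0 \<Longrightarrow>
       \<sigma> * integral {0..2 * pi} (\<lambda>\<theta>. b0 \<theta> * (trace0 N d \<theta>)\<^sup>2 + b1 \<theta> * (trace1 N d \<theta>)\<^sup>2)
         \<le> (\<Sum>j<N. dtn T j * mode_mass j * (d j)\<^sup>2)"
proof -
  obtain \<delta> \<gamma> where "galerkin B L \<delta> \<gamma>" using ex_galerkin by blast
  then interpret galerkin B L \<delta> \<gamma> .
  obtain c \<sigma> where \<sigma>: "\<sigma> \<ge> 0" and dec: "\<And>p. \<exists>A. \<forall>k. \<bar>c k\<bar> \<le> A / (1 + \<bar>of_int (freq k)\<bar>) ^ p"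
    and nc: "\<exists>k\<ge>1. c k \<noteq> 0" and EL: "\<And>j. L j * c j = \<sigma> * (\<Sum>k. B j k * c k)"
    and test: "\<And>M d. (\<And>j. j \<ge> M \<Longrightarrow> d j = 0) \<Longrightarrow> (\<Sum>k<M. B 0 k * d k) = 0 \<Longrightarrow>
        \<sigma> * bilin M B d d \<le> (\<Sum>j<M. L j * (d j)\<^sup>2)"
    by (rule ex_limit_solution) blast
  note [continuous_intros] = cont
  define G where "G a b k x = c k * (radial T a k (fst x) * angular b k (snd x))" for a b k and x :: "real \<times> real"
  obtain R where R: "\<And>a j t. t \<in> {0..T} \<Longrightarrow> \<bar>radial T a j t\<bar> \<le> R * (1 + \<bar>of_int (freq j)\<bar>) ^ a" "R \<ge> 0"
    using radial_bound[OF T] by blast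
  define M where "M a b k = \<bar>c k\<bar> * (R * (1 + \<bar>real_of_int (freq k)\<bar>) ^ a * (1 + \<bar>of_int (freq k)\<bar>) ^ b)" for a b k
  have bound: "\<bar>G a b k x\<bar> \<le> M a b k" if "x \<in> annulus T" for a b k x
    unfolding G_def M_def abs_mult using that R(2)
    by (intro mult_left_mono mult_mono R(1) angular_bound) (auto simp: annulus_def)
  have sm: "summable (M a b)" for a b
  proof -
    obtain A where A: "\<And>k. \<bar>c k\<bar> \<le> A / (1 + \<bar>of_int (freq k)\<bar>) ^ (a + b + 2)" using dec by blast
    have "M a b k \<le> A * R / (1 + \<bar>of_int (freq k)\<bar>)\<^sup>2" for k
    proof -
      let ?w = "1 + \<bar>real_of_int (freq k)\<bar>"
      have w: "?w > 0" by linarith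
      have "M a b k \<le> A / ?w ^ (a + b + 2) * (R * ?w ^ a * ?w ^ b)"
        unfolding M_def using R(2) w by (intro mult_right_mono A) auto
      also have "\<dots> = A * R / ?w\<^sup>2"
      proof -
        have "A / v ^ (a + b + 2) * (R * v ^ a * v ^ b) = A * R / v\<^sup>2" if "v > 0" for v :: real
          using that by (simp add: power_add power2_eq_square)
        then show ?thesis using w by blast
      qed
      finally show ?thesis .
    qed
    moreover have "0 \<le> M a b k" for k unfolding M_def using R(2) by simp
    ultimately show ?thesis
      by (intro summable_comparison_test[OF _ summable_freq[of "A * R"]]) auto
  qed
  have deriv: "(G a b k has_derivative (\<lambda>h. fst h * G (Suc a) b k x + snd h * G a (Suc b) k x)) (at x within annulus T)"
    for a b k x
  proof -
    have "((\<lambda>x. radial T a k (fst x)) has_derivative (\<lambda>h. fst h * radial T (Suc a) k (fst x))) (at x within annulus T)"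
      by (rule DERIV_compose_FDERIV[OF radial_deriv[OF T]]) (auto intro!: derivative_eq_intros)
    moreover have "((\<lambda>x. angular b k (snd x)) has_derivative (\<lambda>h. snd h * angular (Suc b) k (snd x))) (at x within annulus T)"
      by (rule DERIV_compose_FDERIV[OF angular_deriv]) (auto intro!: derivative_eq_intros)
    ultimately have "((\<lambda>x. c k * (radial T a k (fst x) * angular b k (snd x))) has_derivative
      (\<lambda>h. c k * (radial T a k (fst x) * (snd h * angular (Suc b) k (snd x)) +
        fst h * radial T (Suc a) k (fst x) * angular b k (snd x)))) (at x within annulus T)"
      by (intro has_derivative_mult_right has_derivative_mult)
    then show ?thesis unfolding G_def by (rule has_derivative_eq_rhs) (auto simp: algebra_simps)
  qed
  have cvx: "convex (annulus T)" unfolding annulus_def by (intro convex_Times) auto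
  have ser1: "((\<lambda>x. \<Sum>k. G a b k x) has_derivative (\<lambda>h. fst h * (\<Sum>k. G (Suc a) b k x)
      + snd h * (\<Sum>k. G a (Suc b) k x))) (at x within annulus T)" if "x \<in> annulus T" for a b x
    by (rule smooth_on_series(1)[of "annulus T" G M, OF cvx _ _ sm that]) (use deriv bound in blast)+
  have ser2: "smooth_on (annulus T) (\<lambda>x. \<Sum>k. G a b k x)" for a b
    by (rule smooth_on_series(2)[of "annulus T" G M, OF cvx _ _ sm]) (use deriv bound in blast)+
  define U where "U a b x = (\<Sum>k. G a b k x)" for a b x
  have sum_U: "(\<lambda>k. G a b k x) sums U a b x" if "x \<in> annulus T" for a b x
    unfolding U_def by (intro summable_sums summable_comparison_test[OF _ sm[of a b]]) (use bound[OF that] in auto)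
  have U_deriv: "(U a b has_derivative (\<lambda>h. fst h * U (Suc a) b x + snd h * U a (Suc b) x)) (at x within annulus T)"
    if "x \<in> annulus T" for a b x
    using ser1[OF that] unfolding U_def .
  have harm: "U 2 0 x + U 0 2 x = 0" if "x \<in> annulus T" for x
  proof -
    have "G 2 0 k x + G 0 2 k x = 0" for k
    proof (cases "k = 1")
      case False
      have "radial T 2 k t = of_int (freq k) ^ 2 * radial T 0 k t" for t
        using False by (simp add: radial_def Let_def)
      moreover have "angular 2 k \<theta> = - (of_int (freq k) ^ 2) * angular 0 k \<theta>" for \<theta>
        by (simp add: angular_def)
      ultimately show ?thesis by (simp add: G_def)
    qed (simp add: G_def radial_def angular_def)
    then have "(\<lambda>k. 0) sums (U 2 0 x + U 0 2 x)"
      using sums_add[OF sum_U[OF that, of 2 0] sum_U[OF that, of 0 2]] by simp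
    then show ?thesis using sums_unique2[OF _ sums_zero] by blast
  qed
  have dT: "(T, \<theta>) \<in> annulus T" and d0: "(0, \<theta>) \<in> annulus T" for \<theta> using T by (auto simp: annulus_def)
  have bT: "G 0 0 k (T, \<theta>) = c k * angular 0 k \<theta>" "G 1 0 k (T, \<theta>) = c k * dtn T k * angular 0 k \<theta>"
    "G 0 0 k (0, \<theta>) = c k * parity k * angular 0 k \<theta>" "G 1 0 k (0, \<theta>) = - (c k * dtn T k * parity k * angular 0 k \<theta>)" for k \<theta>
    using radial_boundary[OF T] by (simp_all add: G_def dtn_def)
  have U_cont: "continuous_on UNIV (\<lambda>\<theta>. U a b (t, \<theta>))" if "t \<in> {0..T}" for a b t
  proof -
    have "continuous_on (annulus T) (U a b)" by (rule has_derivative_continuous_on[OF U_deriv])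
    then show ?thesis
      by (rule continuous_on_compose2) (use that in \<open>auto simp: annulus_def intro!: continuous_intros\<close>)
  qed
  have U_per: "U a b (t, \<theta> + 2 * pi) = U a b (t, \<theta>)" for a b t \<theta>
  proof -
    have "angular b k (\<theta> + 2 * pi) = angular b k \<theta>" for k
    proof -
      have "of_int (freq k) * (\<theta> + 2 * pi) + phase k + real b * pi / 2 =
        (of_int (freq k) * \<theta> + phase k + real b * pi / 2) + 2 * pi * of_int (freq k)"
        by (simp add: algebra_simps)
      moreover have "cos (x + 2 * pi * of_int (freq k)) = cos x" for x by (rule periodic_int_shift) simp
      ultimately show ?thesis by (simp only: angular_def)
    qed
    then show ?thesis by (simp add: U_def G_def)
  qed
  have int_U: "(\<lambda>k. integral {0..2*pi} (\<lambda>\<theta>. G a b k (t, \<theta>) * w \<theta>)) sums integral {0..2*pi} (\<lambda>\<theta>. U a b (t, \<theta>) * w \<theta>)"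
    if t: "t \<in> {0..T}" and w: "continuous_on {0..2*pi} w" for a b t w
  proof -
    have "compact (w ` {0..2*pi})" by (rule compact_continuous_image[OF w]) simp
    then obtain K where K: "\<And>\<theta>. \<theta> \<in> {0..2*pi} \<Longrightarrow> \<bar>w \<theta>\<bar> \<le> K"
      using compact_imp_bounded bounded_iff by (metis image_eqI real_norm_def)
    have x: "(t, \<theta>) \<in> annulus T" for \<theta> using t by (simp add: annulus_def)
    have "(\<lambda>k. integral {0..2*pi} (\<lambda>\<theta>. G a b k (t, \<theta>) * w \<theta>)) sums
      integral {0..2*pi} (\<lambda>\<theta>. \<Sum>k. G a b k (t, \<theta>) * w \<theta>)"
    proof (rule integral_suminf(2)[where M = "\<lambda>k. M a b k * K"])
      show "continuous_on {0..2*pi} (\<lambda>\<theta>. G a b k (t, \<theta>) * w \<theta>)" for k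
        unfolding G_def by (auto intro!: continuous_intros w)
      show "\<bar>G a b k (t, \<theta>) * w \<theta>\<bar> \<le> M a b k * K" if "\<theta> \<in> {0..2*pi}" for k \<theta>
        unfolding abs_mult by (intro mult_mono bound x K that order_trans[OF abs_ge_zero bound[OF x]]) auto
      show "summable (\<lambda>k. M a b k * K)" by (intro summable_mult2 sm)
    qed
    moreover have "(\<Sum>k. G a b k (t, \<theta>) * w \<theta>) = U a b (t, \<theta>) * w \<theta>" for \<theta>
      by (rule sums_unique[symmetric, OF sums_mult2[OF sum_U[OF x]]])
    ultimately show ?thesis by simp
  qed
  have ca: "continuous_on {0..2*pi} (angular 0 j)" for j by (intro continuous_intros)
  have cb: "continuous_on {0..2*pi} (\<lambda>\<theta>. b0 \<theta> * angular 0 j \<theta>)" "continuous_on {0..2*pi} (\<lambda>\<theta>. b1 \<theta> * angular 0 j \<theta>)" for j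
    by (intro continuous_intros)+
  \<comment> \<open>The defects of the Steklov condition at the two ends.\<close>
  define g0 where "g0 \<theta> = - U 1 0 (0, \<theta>) - \<sigma> * b0 \<theta> * U 0 0 (0, \<theta>)" for \<theta>
  define g1 where "g1 \<theta> = U 1 0 (T, \<theta>) - \<sigma> * b1 \<theta> * U 0 0 (T, \<theta>)" for \<theta>
  have U_cont': "continuous_on {0..2*pi} (\<lambda>\<theta>. U a b (t, \<theta>))" if "t \<in> {0..T}" for a b t
    using U_cont[OF that] continuous_on_subset by blast
  have zT: "T \<in> {0..T}" "0 \<in> {0..T}" using T by auto
  note [continuous_intros] = U_cont[OF zT(1)] U_cont[OF zT(2)] U_cont'[OF zT(1)] U_cont'[OF zT(2)]
  have ortho: "integral {0..2*pi} (\<lambda>\<theta>. g1 \<theta> * angular 0 j \<theta>) + parity j * integral {0..2*pi} (\<lambda>\<theta>. g0 \<theta> * angular 0 j \<theta>) = 0" for j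
  proof -
    let ?e = "angular 0 j" and ?I = "integral {0..2*pi}"
    let ?E = "\<lambda>k. ?I (\<lambda>\<theta>. angular 0 j \<theta> * angular 0 k \<theta>)"
    have s1: "(\<lambda>k. c k * dtn T k * ?E k) sums ?I (\<lambda>\<theta>. U 1 0 (T, \<theta>) * ?e \<theta>)"
    proof -
      have "(\<lambda>\<theta>. G 1 0 k (T, \<theta>) * ?e \<theta>) = (\<lambda>\<theta>. (c k * dtn T k) * (?e \<theta> * angular 0 k \<theta>))" for k
        by (rule ext) (simp only: bT mult.assoc mult.commute mult.left_commute)
      then show ?thesis using int_U[OF zT(1) ca[of j], of 1 0] by (simp only: integral_mult_right)
    qed
    have s2: "(\<lambda>k. - (c k * dtn T k * parity k * ?E k)) sums ?I (\<lambda>\<theta>. U 1 0 (0, \<theta>) * ?e \<theta>)"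
    proof -
      have "(\<lambda>\<theta>. G 1 0 k (0, \<theta>) * ?e \<theta>) = (\<lambda>\<theta>. (- (c k * dtn T k * parity k)) * (?e \<theta> * angular 0 k \<theta>))" for k
        by (rule ext) (simp only: bT mult_minus_left mult_minus_right mult.assoc mult.commute mult.left_commute)
      then have "(\<lambda>k. (- (c k * dtn T k * parity k)) * ?E k) sums ?I (\<lambda>\<theta>. U 1 0 (0, \<theta>) * ?e \<theta>)"
        using int_U[OF zT(2) ca[of j], of 1 0] by (simp only: integral_mult_right)
      then show ?thesis by (simp only: mult_minus_left)
    qed
    have s3: "(\<lambda>k. c k * ?I (\<lambda>\<theta>. b1 \<theta> * (?e \<theta> * angular 0 k \<theta>))) sums ?I (\<lambda>\<theta>. U 0 0 (T, \<theta>) * (b1 \<theta> * ?e \<theta>))"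
    proof -
      have "(\<lambda>\<theta>. G 0 0 k (T, \<theta>) * (b1 \<theta> * ?e \<theta>)) = (\<lambda>\<theta>. c k * (b1 \<theta> * (?e \<theta> * angular 0 k \<theta>)))" for k
        by (rule ext) (simp only: bT mult.assoc mult.commute mult.left_commute)
      then show ?thesis using int_U[OF zT(1) cb(2)[of j], of 0 0] by (simp only: integral_mult_right)
    qed
    have s4: "(\<lambda>k. c k * parity k * ?I (\<lambda>\<theta>. b0 \<theta> * (?e \<theta> * angular 0 k \<theta>))) sums ?I (\<lambda>\<theta>. U 0 0 (0, \<theta>) * (b0 \<theta> * ?e \<theta>))"
    proof -
      have "(\<lambda>\<theta>. G 0 0 k (0, \<theta>) * (b0 \<theta> * ?e \<theta>)) = (\<lambda>\<theta>. (c k * parity k) * (b0 \<theta> * (?e \<theta> * angular 0 k \<theta>)))" for k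
        by (rule ext) (simp only: bT mult.assoc mult.commute mult.left_commute)
      then show ?thesis using int_U[OF zT(2) cb(1)[of j], of 0 0] by (simp only: integral_mult_right)
    qed
    have "(\<lambda>k. c k * dtn T k * ?E k + parity j * - (- (c k * dtn T k * parity k * ?E k))) sums
       (?I (\<lambda>\<theta>. U 1 0 (T, \<theta>) * ?e \<theta>) + parity j * - ?I (\<lambda>\<theta>. U 1 0 (0, \<theta>) * ?e \<theta>))"
      by (intro sums_add sums_mult sums_minus s1 s2)
    moreover have "(\<lambda>k. c k * dtn T k * ?E k + parity j * - (- (c k * dtn T k * parity k * ?E k))) =
        (\<lambda>k. if k = j then L j * c j else 0)"
    proof
      fix k
      have "c k * dtn T k * ?E k + parity j * - (- (c k * dtn T k * parity k * ?E k)) =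
        c k * dtn T k * ((1 + parity j * parity k) * ?E k)" by (simp add: algebra_simps)
      then show "c k * dtn T k * ?E k + parity j * - (- (c k * dtn T k * parity k * ?E k)) = (if k = j then L j * c j else 0)"
        unfolding angular_orthogonal by simp
    qed
    ultimately have A: "?I (\<lambda>\<theta>. U 1 0 (T, \<theta>) * ?e \<theta>) + parity j * - ?I (\<lambda>\<theta>. U 1 0 (0, \<theta>) * ?e \<theta>) = L j * c j"
      using sums_unique2[OF _ sums_single[of j "\<lambda>_. L j * c j"]] by simp
    have "(\<lambda>k. c k * ?I (\<lambda>\<theta>. b1 \<theta> * (?e \<theta> * angular 0 k \<theta>)) + parity j * (c k * parity k * ?I (\<lambda>\<theta>. b0 \<theta> * (?e \<theta> * angular 0 k \<theta>)))) sums
       (?I (\<lambda>\<theta>. U 0 0 (T, \<theta>) * (b1 \<theta> * ?e \<theta>)) + parity j * ?I (\<lambda>\<theta>. U 0 0 (0, \<theta>) * (b0 \<theta> * ?e \<theta>)))"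
      by (intro sums_add sums_mult s3 s4)
    moreover have "(\<lambda>k. c k * ?I (\<lambda>\<theta>. b1 \<theta> * (?e \<theta> * angular 0 k \<theta>)) + parity j * (c k * parity k * ?I (\<lambda>\<theta>. b0 \<theta> * (?e \<theta> * angular 0 k \<theta>)))) = (\<lambda>k. B j k * c k)"
      unfolding weight_matrix_split by (simp add: algebra_simps)
    ultimately have "(\<lambda>k. B j k * c k) sums
        (?I (\<lambda>\<theta>. U 0 0 (T, \<theta>) * (b1 \<theta> * ?e \<theta>)) + parity j * ?I (\<lambda>\<theta>. U 0 0 (0, \<theta>) * (b0 \<theta> * ?e \<theta>)))"
      by (simp only:)
    then have Bs: "(\<Sum>k. B j k * c k) = ?I (\<lambda>\<theta>. U 0 0 (T, \<theta>) * (b1 \<theta> * ?e \<theta>)) + parity j * ?I (\<lambda>\<theta>. U 0 0 (0, \<theta>) * (b0 \<theta> * ?e \<theta>))"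
      by (rule sums_unique[symmetric])
    have "?I (\<lambda>\<theta>. g1 \<theta> * ?e \<theta>) = ?I (\<lambda>\<theta>. U 1 0 (T, \<theta>) * ?e \<theta> - \<sigma> * (U 0 0 (T, \<theta>) * (b1 \<theta> * ?e \<theta>)))"
      unfolding g1_def by (simp add: algebra_simps)
    also have "\<dots> = ?I (\<lambda>\<theta>. U 1 0 (T, \<theta>) * ?e \<theta>) - \<sigma> * ?I (\<lambda>\<theta>. U 0 0 (T, \<theta>) * (b1 \<theta> * ?e \<theta>))"
      by (subst integral_diff) (auto intro!: integrable_continuous_real continuous_intros)
    finally have i1: "?I (\<lambda>\<theta>. g1 \<theta> * ?e \<theta>) = ?I (\<lambda>\<theta>. U 1 0 (T, \<theta>) * ?e \<theta>) - \<sigma> * ?I (\<lambda>\<theta>. U 0 0 (T, \<theta>) * (b1 \<theta> * ?e \<theta>))" .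
    have "?I (\<lambda>\<theta>. g0 \<theta> * ?e \<theta>) = ?I (\<lambda>\<theta>. - (U 1 0 (0, \<theta>) * ?e \<theta>) - \<sigma> * (U 0 0 (0, \<theta>) * (b0 \<theta> * ?e \<theta>)))"
      unfolding g0_def by (simp add: algebra_simps)
    also have "\<dots> = - ?I (\<lambda>\<theta>. U 1 0 (0, \<theta>) * ?e \<theta>) - \<sigma> * ?I (\<lambda>\<theta>. U 0 0 (0, \<theta>) * (b0 \<theta> * ?e \<theta>))"
      by (subst integral_diff) (auto intro!: integrable_continuous_real continuous_intros)
    finally have i0: "?I (\<lambda>\<theta>. g0 \<theta> * ?e \<theta>) = - ?I (\<lambda>\<theta>. U 1 0 (0, \<theta>) * ?e \<theta>) - \<sigma> * ?I (\<lambda>\<theta>. U 0 0 (0, \<theta>) * (b0 \<theta> * ?e \<theta>))" .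
    show ?thesis using A EL[of j] unfolding i0 i1 Bs by (simp add: algebra_simps)
  qed
  have gz: "integral {0..2*pi} (\<lambda>\<theta>. g0 \<theta> * angular 0 j \<theta>) = 0" "integral {0..2*pi} (\<lambda>\<theta>. g1 \<theta> * angular 0 j \<theta>) = 0" for j
  proof -
    \<comment> \<open>The even and the odd mode of the same frequency give the sum and the difference of the two ends.\<close>
    define i where "i = 2 * (j div 2)"
    have f: "freq i = freq j" "freq (Suc i) = freq j" by (simp_all add: freq_def i_def)
    then have a: "angular 0 i = angular 0 j" "angular 0 (Suc i) = angular 0 j"
      by (simp_all add: fun_eq_iff angular_def phase_def)
    have p: "parity i = 1" "parity (Suc i) = - 1" by (simp_all add: parity_def i_def)
    show "integral {0..2*pi} (\<lambda>\<theta>. g0 \<theta> * angular 0 j \<theta>) = 0" "integral {0..2*pi} (\<lambda>\<theta>. g1 \<theta> * angular 0 j \<theta>) = 0"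
      using ortho[of i] ortho[of "Suc i"] unfolding a p by simp_all
  qed
  have gc: "continuous_on UNIV g0" "continuous_on UNIV g1"
    unfolding g0_def g1_def by (intro continuous_intros)+
  have g0: "g0 \<theta> = 0" and g1: "g1 \<theta> = 0" for \<theta>
    by (rule trig_complete[OF gc(1) _ all_frequencies[OF continuous_on_subset[OF gc(1)] gz(1)]],
        simp_all add: g0_def U_per per)
       (rule trig_complete[OF gc(2) _ all_frequencies[OF continuous_on_subset[OF gc(2)] gz(2)]],
        simp_all add: g1_def U_per per)
  show thesis
  proof (rule that[of "U 0 0" \<sigma>])
    show "smooth_on (annulus T) (U 0 0)" using ser2[of 0 0] unfolding U_def .
    show "U 0 0 (t, \<theta> + 2 * pi) = U 0 0 (t, \<theta>)" for t \<theta> by (rule U_per)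
    have S: "Suc 0 = 1" "Suc 1 = 2" by simp_all
    show "\<exists>u1 u2 u11 u12 u22. (\<forall>x\<in>annulus T.
        (U 0 0 has_derivative (\<lambda>h. fst h * u1 x + snd h * u2 x)) (at x within annulus T) \<and>
        (u1 has_derivative (\<lambda>h. fst h * u11 x + snd h * u12 x)) (at x within annulus T) \<and>
        (u2 has_derivative (\<lambda>h. fst h * u12 x + snd h * u22 x)) (at x within annulus T) \<and>
        u11 x + u22 x = 0) \<and>
      (\<forall>\<theta>. - u1 (0, \<theta>) = \<sigma> * b0 \<theta> * U 0 0 (0, \<theta>) \<and> u1 (T, \<theta>) = \<sigma> * b1 \<theta> * U 0 0 (T, \<theta>))"
    proof (intro exI conjI ballI allI)
      fix x assume x: "x \<in> annulus T"
      show "(U 0 0 has_derivative (\<lambda>h. fst h * U 1 0 x + snd h * U 0 1 x)) (at x within annulus T)"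
        "(U 1 0 has_derivative (\<lambda>h. fst h * U 2 0 x + snd h * U 1 1 x)) (at x within annulus T)"
        "(U 0 1 has_derivative (\<lambda>h. fst h * U 1 1 x + snd h * U 0 2 x)) (at x within annulus T)"
        using U_deriv[OF x, of 0 0] U_deriv[OF x, of 1 0] U_deriv[OF x, of 0 1] unfolding S by this
      show "U 2 0 x + U 0 2 x = 0" by (rule harm[OF x])
    next
      fix \<theta>
      show "- U 1 0 (0, \<theta>) = \<sigma> * b0 \<theta> * U 0 0 (0, \<theta>)" using g0[of \<theta>] unfolding g0_def by linarith
      show "U 1 0 (T, \<theta>) = \<sigma> * b1 \<theta> * U 0 0 (T, \<theta>)" using g1[of \<theta>] unfolding g1_def by linarith
    qed
    show "\<sigma> \<ge> 0" by fact
    show "\<nexists>r. \<forall>x\<in>annulus T. U 0 0 x = r"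
    proof
      assume "\<exists>r. \<forall>x\<in>annulus T. U 0 0 x = r"
      then obtain r where r: "\<And>x. x \<in> annulus T \<Longrightarrow> U 0 0 x = r" by blast
      obtain k where k: "k \<ge> 1" "c k \<noteq> 0" using nc by blast
      let ?I = "integral {0..2*pi}"
      let ?E = "\<lambda>j. ?I (\<lambda>\<theta>. angular 0 k \<theta> * angular 0 j \<theta>)"
      have s1: "(\<lambda>j. c j * ?E j) sums ?I (\<lambda>\<theta>. U 0 0 (T, \<theta>) * angular 0 k \<theta>)"
      proof -
        have "(\<lambda>\<theta>. G 0 0 j (T, \<theta>) * angular 0 k \<theta>) = (\<lambda>\<theta>. c j * (angular 0 k \<theta> * angular 0 j \<theta>))" for j
          by (rule ext) (simp only: bT mult.assoc mult.commute mult.left_commute)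
        then show ?thesis using int_U[OF zT(1) ca[of k], of 0 0] by (simp only: integral_mult_right)
      qed
      have s2: "(\<lambda>j. c j * parity j * ?E j) sums ?I (\<lambda>\<theta>. U 0 0 (0, \<theta>) * angular 0 k \<theta>)"
      proof -
        have "(\<lambda>\<theta>. G 0 0 j (0, \<theta>) * angular 0 k \<theta>) = (\<lambda>\<theta>. (c j * parity j) * (angular 0 k \<theta> * angular 0 j \<theta>))" for j
          by (rule ext) (simp only: bT mult.assoc mult.commute mult.left_commute)
        then show ?thesis using int_U[OF zT(2) ca[of k], of 0 0] by (simp only: integral_mult_right)
      qed
      have "(\<lambda>j. c j * ?E j + parity k * (c j * parity j * ?E j)) sums
        (?I (\<lambda>\<theta>. U 0 0 (T, \<theta>) * angular 0 k \<theta>) + parity k * ?I (\<lambda>\<theta>. U 0 0 (0, \<theta>) * angular 0 k \<theta>))"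
        by (intro sums_add sums_mult s1 s2)
      moreover have "(\<lambda>j. c j * ?E j + parity k * (c j * parity j * ?E j)) = (\<lambda>j. if j = k then mode_mass k * c k else 0)"
      proof
        fix j
        have "c j * ?E j + parity k * (c j * parity j * ?E j) = c j * ((1 + parity k * parity j) * ?E j)"
          by (simp add: algebra_simps)
        then show "c j * ?E j + parity k * (c j * parity j * ?E j) = (if j = k then mode_mass k * c k else 0)"
          unfolding angular_orthogonal by simp
      qed
      ultimately have "?I (\<lambda>\<theta>. U 0 0 (T, \<theta>) * angular 0 k \<theta>) + parity k * ?I (\<lambda>\<theta>. U 0 0 (0, \<theta>) * angular 0 k \<theta>) = mode_mass k * c k"
        using sums_unique2[OF _ sums_single[of k "\<lambda>_. mode_mass k * c k"]] by simp
      then have *: "(1 + parity k) * (r * ?I (angular 0 k)) = mode_mass k * c k"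
        by (simp add: r[OF dT] r[OF d0] algebra_simps)
      have "(1 + parity k) * ?I (angular 0 k) = 0"
      proof (cases "k = 1")
        case False
        then have "freq k \<noteq> 0" using freq_eq_0_iff[of k] k(1) by simp
        moreover have "angular 0 k = (\<lambda>\<theta>. cos (of_int (freq k) * \<theta> + phase k))"
          by (simp add: angular_def fun_eq_iff)
        ultimately show ?thesis using integral_cos_freq[of "freq k" "phase k"] by simp
      qed simp
      then have "mode_mass k * c k = 0" using * by auto
      moreover have "mode_mass k \<noteq> 0" by (simp add: mode_mass_def)
      ultimately show False using k by simp
    qed
    fix N d assume d: "\<And>j. j \<ge> N \<Longrightarrow> d j = 0"
      "integral {0..2 * pi} (\<lambda>\<theta>. b0 \<theta> * trace0 N d \<theta> + b1 \<theta> * trace1 N d \<theta>) = 0"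
    then show "\<sigma> * integral {0..2 * pi} (\<lambda>\<theta>. b0 \<theta> * (trace0 N d \<theta>)\<^sup>2 + b1 \<theta> * (trace1 N d \<theta>)\<^sup>2)
         \<le> (\<Sum>j<N. dtn T j * mode_mass j * (d j)\<^sup>2)"
      using test[where M = N and d = d] weight_matrix_row0[OF cont] bilin_weight_matrix[OF cont] by simp
  qed
qed

end

section \<open>Harmonic functions on the annulus\<close>

lemma at_annulus_t:
  assumes "(u has_derivative u') (at (t, \<theta>) within annulus T)" "t \<in> {0..T}"
  shows "((\<lambda>s. u (s, \<theta>)) has_vector_derivative u' (1, 0)) (at t within {0..T})"
proof -
  have 1: "((\<lambda>s. (s, \<theta>)) has_derivative (\<lambda>h. (h, 0))) (at t within {0..T})"
    by (auto intro!: derivative_eq_intros)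
  have 2: "(u has_derivative u') (at (t, \<theta>) within (\<lambda>s. (s, \<theta>)) ` {0..T})"
    by (rule has_derivative_subset[OF assms(1)]) (auto simp: annulus_def)
  have "((\<lambda>s. u (s, \<theta>)) has_derivative (\<lambda>h. u' (h, 0))) (at t within {0..T})"
    using has_derivative_in_compose[OF 1 2] .
  moreover have "(\<lambda>h. u' (h, 0)) = (\<lambda>h. h *\<^sub>R u' (1, 0))"
  proof
    fix h :: real
    have "(h, 0) = h *\<^sub>R ((1, 0) :: real \<times> real)" by simp
    then show "u' (h, 0) = h *\<^sub>R u' (1, 0)"
      using linear_scale[OF has_derivative_linear[OF assms(1)], of h "(1, 0)"] by (simp only:)
  qed
  ultimately show ?thesis unfolding has_vector_derivative_def by (simp only:)
qed

lemma at_annulus_theta: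
  assumes "(u has_derivative u') (at (t, \<theta>) within annulus T)" "t \<in> {0..T}"
  shows "((\<lambda>s. u (t, s)) has_vector_derivative u' (0, 1)) (at \<theta>)"
proof -
  have 1: "((\<lambda>s. (t, s)) has_derivative (\<lambda>h. (0, h))) (at \<theta>)"
    by (auto intro!: derivative_eq_intros)
  have 2: "(u has_derivative u') (at (t, \<theta>) within (\<lambda>s. (t, s)) ` UNIV)"
    by (rule has_derivative_subset[OF assms(1)]) (use assms(2) in \<open>auto simp: annulus_def\<close>)
  have "((\<lambda>s. u (t, s)) has_derivative (\<lambda>h. u' (0, h))) (at \<theta>)"
    using has_derivative_in_compose[OF 1 2] .
  moreover have "(\<lambda>h. u' (0, h)) = (\<lambda>h. h *\<^sub>R u' (0, 1))"
  proof
    fix h :: real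
    have "(0, h) = h *\<^sub>R ((0, 1) :: real \<times> real)" by simp
    then show "u' (0, h) = h *\<^sub>R u' (0, 1)"
      using linear_scale[OF has_derivative_linear[OF assms(1)], of h "(0, 1)"] by (simp only:)
  qed
  ultimately show ?thesis unfolding has_vector_derivative_def by (simp only:)
qed

lemma vector_derivative_within_Icc:
  fixes f :: "real \<Rightarrow> 'b::real_normed_vector"
  assumes "a < b" "x \<in> {a..b}" "(f has_vector_derivative f') (at x within {a..b})"
  shows "vector_derivative f (at x within {a..b}) = f'"
  by (rule vector_derivative_within[OF _ assms(3)]) (use assms(1,2) in \<open>simp add: trivial_limit_within\<close>)

lemma d_t_d_theta_eq:
  assumes "T > 0" "x \<in> annulus T"
    and "(u has_derivative (\<lambda>h. fst h *\<^sub>R a + snd h *\<^sub>R b)) (at x within annulus T)"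
  shows "d_t T u x = a" "d_theta u x = b"
proof -
  obtain t \<theta> where x: "x = (t, \<theta>)" by (cases x)
  have t: "t \<in> {0..T}" using assms(2) by (simp add: x annulus_def)
  show "d_t T u x = a"
    using at_annulus_t[OF assms(3)[unfolded x] t] vector_derivative_within_Icc[OF assms(1) t]
    by (simp add: x d_t_def)
  show "d_theta u x = b"
    using vector_derivative_at[OF at_annulus_theta[OF assms(3)[unfolded x] t]]
    by (simp add: x d_theta_def)
qed

lemma d_t_cong:
  assumes "\<And>x. x \<in> annulus T \<Longrightarrow> u x = v x" "x \<in> annulus T"
  shows "d_t T u x = d_t T v x"
proof -
  obtain t \<theta> where x: "x = (t, \<theta>)" by (cases x)
  then have "t \<in> {0..T}" using assms(2) by (simp add: annulus_def)
  have eq: "u (s, \<theta>) = v (s, \<theta>)" if "s \<in> {0..T}" for s using that assms(1) by (simp add: annulus_def)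
  have "((\<lambda>s. u (s, \<theta>)) has_vector_derivative d) (at t within {0..T}) \<longleftrightarrow>
      ((\<lambda>s. v (s, \<theta>)) has_vector_derivative d) (at t within {0..T})" for d
    using has_vector_derivative_transform[OF \<open>t \<in> {0..T}\<close>, of "\<lambda>s. u (s, \<theta>)" "\<lambda>s. v (s, \<theta>)" d]
      has_vector_derivative_transform[OF \<open>t \<in> {0..T}\<close>, of "\<lambda>s. v (s, \<theta>)" "\<lambda>s. u (s, \<theta>)" d] eq by auto
  then show ?thesis by (simp add: x d_t_def vector_derivative_def)
qed

lemma d_theta_cong:
  assumes "\<And>x. x \<in> annulus T \<Longrightarrow> u x = v x" "x \<in> annulus T"
  shows "d_theta u x = d_theta v x"
  using assms by (cases x) (simp add: d_theta_def annulus_def)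

text \<open>
  Since \<open>d_t\<close> and \<open>d_theta\<close> are defined by choice of a derivative, harmonicity is most easily
  established by exhibiting the derivatives; only values on the annulus enter, so one-sided
  derivatives at the boundary cause no trouble.
\<close>

lemma harmonicI:
  fixes u :: "real \<times> real \<Rightarrow> 'b::real_normed_vector"
  assumes T: "T > 0" and smooth: "smooth_on (annulus T) u"
    and per: "\<And>t \<theta>. u (t, \<theta> + 2 * pi) = u (t, \<theta>)"
    and u: "\<And>x. x \<in> annulus T \<Longrightarrow> (u has_derivative (\<lambda>h. fst h *\<^sub>R u1 x + snd h *\<^sub>R u2 x)) (at x within annulus T)"
    and u1: "\<And>x. x \<in> annulus T \<Longrightarrow> (u1 has_derivative (\<lambda>h. fst h *\<^sub>R u11 x + snd h *\<^sub>R u12 x)) (at x within annulus T)"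
    and u2: "\<And>x. x \<in> annulus T \<Longrightarrow> (u2 has_derivative (\<lambda>h. fst h *\<^sub>R u21 x + snd h *\<^sub>R u22 x)) (at x within annulus T)"
    and lap: "\<And>x. x \<in> annulus T \<Longrightarrow> u11 x + u22 x = 0"
  shows "harmonic T w u"
proof -
  have "laplacian T w u x = 0" if x: "x \<in> annulus T" for x
  proof -
    have "d_t T (d_t T u) x = d_t T u1 x"
      by (rule d_t_cong[OF d_t_d_theta_eq(1)[OF T _ u] x])
    moreover have "d_theta (d_theta u) x = d_theta u2 x"
      by (rule d_theta_cong[OF d_t_d_theta_eq(2)[OF T _ u] x])
    ultimately show ?thesis
      using d_t_d_theta_eq(1)[OF T x u1[OF x]] d_t_d_theta_eq(2)[OF T x u2[OF x]] lap[OF x]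
      by (simp add: laplacian_def)
  qed
  then show ?thesis using smooth per by (auto simp: harmonic_def smooth_annulus_fun_def)
qed

text \<open>
  The partial derivatives provided by smoothness agree on the annulus with \<open>d_t\<close> and \<open>d_theta\<close>.
  This makes the latter smooth and, by uniqueness of derivatives, periodic.
\<close>

lemma smooth_annulus_fun_derivatives:
  fixes u :: "real \<times> real \<Rightarrow> 'b::real_normed_vector"
  assumes T: "T > 0" and u: "smooth_annulus_fun T u"
  shows "x \<in> annulus T \<Longrightarrow>
      (u has_derivative (\<lambda>h. fst h *\<^sub>R d_t T u x + snd h *\<^sub>R d_theta u x)) (at x within annulus T)"
    and "smooth_annulus_fun T (d_t T u)" and "smooth_annulus_fun T (d_theta u)"
proof -
  have "smooth_on (annulus T) u" using u by (simp add: smooth_annulus_fun_def)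
  then obtain D where
    "\<And>x. x \<in> annulus T \<Longrightarrow> (u has_derivative (\<lambda>h. \<Sum>b\<in>Basis. (h \<bullet> b) *\<^sub>R D b x)) (at x within annulus T)"
    "\<And>b. b \<in> Basis \<Longrightarrow> smooth_on (annulus T) (D b)"
    unfolding smooth_on_unfold[of _ u] by blast
  then have D: "\<And>x. x \<in> annulus T \<Longrightarrow>
      (u has_derivative (\<lambda>h. fst h *\<^sub>R D (1,0) x + snd h *\<^sub>R D (0,1) x)) (at x within annulus T)"
    "smooth_on (annulus T) (D (1,0))" "smooth_on (annulus T) (D (0,1))"
    by (simp_all only: partials_real2) (simp_all add: Basis_real2)
  have eq: "d_t T u x = D (1,0) x" "d_theta u x = D (0,1) x" if "x \<in> annulus T" for x
    using d_t_d_theta_eq[OF T that D(1)[OF that]] by auto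
  show "x \<in> annulus T \<Longrightarrow>
      (u has_derivative (\<lambda>h. fst h *\<^sub>R d_t T u x + snd h *\<^sub>R d_theta u x)) (at x within annulus T)"
    using D(1) eq by simp
  have sm: "smooth_on (annulus T) (d_t T u)" "smooth_on (annulus T) (d_theta u)"
    using smooth_on_cong[OF D(2)] smooth_on_cong[OF D(3)] eq by metis+
  have per: "u (t, \<theta> + 2 * pi) = u (t, \<theta>)" if "t \<in> {0..T}" for t \<theta>
    using u that by (auto simp: smooth_annulus_fun_def annulus_def)
  have "d_t T u (t, \<theta> + 2 * pi) = d_t T u (t, \<theta>)" if t: "t \<in> {0..T}" for t \<theta>
  proof -
    let ?d = "d_t T u (t, \<theta> + 2 * pi)"
    have a: "(t, \<theta> + 2 * pi) \<in> annulus T" using t by (simp add: annulus_def)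
    have "((\<lambda>s. u (s, \<theta> + 2 * pi)) has_vector_derivative ?d) (at t within {0..T})"
      using at_annulus_t[OF D(1)[OF a] t] eq(1)[OF a] by simp
    then have "((\<lambda>s. u (s, \<theta>)) has_vector_derivative ?d) (at t within {0..T})"
      by (rule has_vector_derivative_transform[OF t, rotated]) (simp add: per)
    from vector_derivative_within_Icc[OF T t this] show ?thesis by (simp add: d_t_def)
  qed
  then show "smooth_annulus_fun T (d_t T u)" using sm(1) by (auto simp: smooth_annulus_fun_def annulus_def)
  have "d_theta u (t, \<theta> + 2 * pi) = d_theta u (t, \<theta>)" if t: "t \<in> {0..T}" for t \<theta>
  proof -
    let ?d = "d_theta u (t, \<theta> + 2 * pi)"
    have a: "(t, \<theta> + 2 * pi) \<in> annulus T" using t by (simp add: annulus_def)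
    have "((\<lambda>s. u (t, s)) has_vector_derivative ?d) (at (\<theta> + 2 * pi))"
      using at_annulus_theta[OF D(1)[OF a] t] eq(2)[OF a] by simp
    moreover have "((\<lambda>s. s + 2 * pi) has_vector_derivative 1) (at \<theta>)"
      by (auto intro!: derivative_eq_intros)
    ultimately have "((\<lambda>s. u (t, s + 2 * pi)) has_vector_derivative ?d) (at \<theta>)"
      using vector_diff_chain_at[of "\<lambda>s. s + 2 * pi" 1 \<theta> "\<lambda>s. u (t, s)" ?d] by (simp add: o_def)
    then have "((\<lambda>s. u (t, s)) has_vector_derivative ?d) (at \<theta>)" by (simp add: per[OF t])
    from vector_derivative_at[OF this] show ?thesis by (simp add: d_theta_def)
  qed
  then show "smooth_annulus_fun T (d_theta u)" using sm(2) by (auto simp: smooth_annulus_fun_def annulus_def)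
qed

lemma annulus_slice_continuous:
  assumes "continuous_on (annulus T) v" "t \<in> {0..T}"
  shows "continuous_on S (\<lambda>\<theta>. v (t, \<theta>))"
  by (rule continuous_on_compose2[OF assms(1)]) (use assms(2) in \<open>auto simp: annulus_def intro!: continuous_intros\<close>)

lemma deriv_circle_integral:
  fixes v v1 v2 :: "real \<times> real \<Rightarrow> real"
  assumes v: "\<And>x. x \<in> annulus T \<Longrightarrow> (v has_derivative (\<lambda>h. fst h *\<^sub>R v1 x + snd h *\<^sub>R v2 x)) (at x within annulus T)"
    and v1: "continuous_on (annulus T) v1" and t: "t \<in> {0..T}"
  shows "((\<lambda>t. integral {0..2 * pi} (\<lambda>\<theta>. v (t, \<theta>))) has_real_derivative
      integral {0..2 * pi} (\<lambda>\<theta>. v1 (t, \<theta>))) (at t within {0..T})"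
  unfolding cbox_interval[symmetric]
proof (rule leibniz_rule_field_derivative)
  show "((\<lambda>t. v (t, \<theta>)) has_real_derivative v1 (t, \<theta>)) (at t within cbox 0 T)" if "t \<in> cbox 0 T" for t \<theta>
  proof -
    have "(t, \<theta>) \<in> annulus T" "t \<in> {0..T}" using that by (auto simp: annulus_def)
    from at_annulus_t[OF v[OF this(1)] this(2)] show ?thesis
      by (simp add: has_real_derivative_iff_has_vector_derivative)
  qed
  have "continuous_on (annulus T) v" using v by (rule has_derivative_continuous_on)
  then show "(\<lambda>\<theta>. v (t, \<theta>)) integrable_on cbox 0 (2 * pi)" if "t \<in> cbox 0 T" for t
    using that by (intro integrable_continuous annulus_slice_continuous) auto
  show "continuous_on (cbox 0 T \<times> cbox 0 (2 * pi)) (\<lambda>(t, \<theta>). v1 (t, \<theta>))"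
    using v1 by (auto intro: continuous_on_subset simp: annulus_def)
qed (use t in auto)

lemma circle_integral_derivative_zero:
  fixes v v1 v2 :: "real \<times> real \<Rightarrow> real"
  assumes v: "\<And>x. x \<in> annulus T \<Longrightarrow> (v has_derivative (\<lambda>h. fst h *\<^sub>R v1 x + snd h *\<^sub>R v2 x)) (at x within annulus T)"
    and per: "v (t, 2 * pi) = v (t, 0)" and t: "t \<in> {0..T}"
  shows "((\<lambda>\<theta>. v2 (t, \<theta>)) has_integral 0) {0..2 * pi}"
proof -
  have "((\<lambda>\<theta>. v2 (t, \<theta>)) has_integral (v (t, 2 * pi) - v (t, 0))) {0..2 * pi}"
  proof (rule fundamental_theorem_of_calculus)
    fix \<theta> assume "\<theta> \<in> {0..2*pi}"
    have "(t, \<theta>) \<in> annulus T" using t by (auto simp: annulus_def)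
    from at_annulus_theta[OF v[OF this] t]
    show "((\<lambda>\<theta>. v (t, \<theta>)) has_vector_derivative v2 (t, \<theta>)) (at \<theta> within {0..2*pi})"
      by (auto intro: has_vector_derivative_at_within)
  qed simp
  then show ?thesis using per by simp
qed

locale harmonic_annulus =
  fixes T :: real and w u
  assumes T: "T > 0" and harm: "harmonic T w (u :: real \<times> real \<Rightarrow> real)"
    and w: "\<And>x. x \<in> annulus T \<Longrightarrow> w x > 0"
begin

abbreviation "ut \<equiv> d_t T u"
abbreviation "u\<theta> \<equiv> d_theta u"
abbreviation "utt \<equiv> d_t T (d_t T u)"
abbreviation "u\<theta>\<theta> \<equiv> d_theta (d_theta u)"

lemma smooth: "smooth_annulus_fun T u" "smooth_annulus_fun T ut" "smooth_annulus_fun T u\<theta>"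
    "smooth_annulus_fun T utt" "smooth_annulus_fun T u\<theta>\<theta>"
proof -
  show "smooth_annulus_fun T u" using harm by (simp add: harmonic_def)
  note D = smooth_annulus_fun_derivatives(2,3)[OF T]
  show "smooth_annulus_fun T ut" by (rule D(1)) fact
  show "smooth_annulus_fun T u\<theta>" by (rule D(2)) fact
  show "smooth_annulus_fun T utt" by (rule D(1)) fact
  show "smooth_annulus_fun T u\<theta>\<theta>" by (rule D(2)) fact
qed

lemma cont: "continuous_on (annulus T) u" "continuous_on (annulus T) ut" "continuous_on (annulus T) u\<theta>"
    "continuous_on (annulus T) utt" "continuous_on (annulus T) u\<theta>\<theta>"
  using smooth by (auto simp: smooth_annulus_fun_def intro: smooth_on_imp_continuous_on)

lemma derivs: assumes "x \<in> annulus T"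
  shows "(u has_derivative (\<lambda>h. fst h *\<^sub>R ut x + snd h *\<^sub>R u\<theta> x)) (at x within annulus T)"
    "(ut has_derivative (\<lambda>h. fst h *\<^sub>R utt x + snd h *\<^sub>R d_theta ut x)) (at x within annulus T)"
    "(u\<theta> has_derivative (\<lambda>h. fst h *\<^sub>R d_t T u\<theta> x + snd h *\<^sub>R u\<theta>\<theta> x)) (at x within annulus T)"
  by (rule smooth_annulus_fun_derivatives(1)[OF T _ assms], rule smooth)+

lemma laplace: assumes "x \<in> annulus T" shows "utt x = - u\<theta>\<theta> x"
  using harm w[OF assms] assms by (auto simp: harmonic_def laplacian_def eq_neg_iff_add_eq_0)

lemma periodic: assumes "t \<in> {0..T}"
  shows "u (t, \<theta> + 2 * pi) = u (t, \<theta>)" "u\<theta> (t, \<theta> + 2 * pi) = u\<theta> (t, \<theta>)"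
  using smooth assms by (auto simp: smooth_annulus_fun_def annulus_def)

text \<open>
  Fourier coefficients in \<open>\<theta>\<close> of \<open>u\<close> and of its \<open>t\<close>-derivative, as functions of \<open>t\<close>. Harmonicity
  turns into the equation \<open>a'' = n\<^sup>2 a\<close> for them.
\<close>

definition coeff :: "int \<Rightarrow> real \<Rightarrow> real \<Rightarrow> real" where
  "coeff n \<phi> t = integral {0..2 * pi} (\<lambda>\<theta>. u (t, \<theta>) * cos (of_int n * \<theta> + \<phi>))"

definition coeff1 :: "int \<Rightarrow> real \<Rightarrow> real \<Rightarrow> real" where
  "coeff1 n \<phi> t = integral {0..2 * pi} (\<lambda>\<theta>. ut (t, \<theta>) * cos (of_int n * \<theta> + \<phi>))"

lemma fst_snd_deriv:
  "((\<lambda>x :: real \<times> real. cos (of_int n * snd x + \<phi>)) has_derivative (\<lambda>h. snd h * (- of_int n * sin (of_int n * snd x + \<phi>)))) (at x within S)"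
  "((\<lambda>x :: real \<times> real. sin (of_int n * snd x + \<phi>)) has_derivative (\<lambda>h. snd h * (of_int n * cos (of_int n * snd x + \<phi>)))) (at x within S)"
  by (auto intro!: derivative_eq_intros)

lemma coeff_deriv:
  assumes t: "t \<in> {0..T}"
  shows "(coeff n \<phi> has_real_derivative coeff1 n \<phi> t) (at t within {0..T})"
    and "(coeff1 n \<phi> has_real_derivative of_int n ^ 2 * coeff n \<phi> t) (at t within {0..T})"
proof -
  let ?c = "\<lambda>x :: real \<times> real. cos (of_int n * snd x + \<phi>)" and ?s = "\<lambda>x :: real \<times> real. sin (of_int n * snd x + \<phi>)"
  note [continuous_intros] = cont
  have "((\<lambda>x. v x * ?c x) has_derivative (\<lambda>h. fst h *\<^sub>R (v1 x * ?c x) + snd h *\<^sub>R (v2 x * ?c x - of_int n * (v x * ?s x)))) (at x within annulus T)"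
    if "(v has_derivative (\<lambda>h. fst h *\<^sub>R v1 x + snd h *\<^sub>R v2 x)) (at x within annulus T)" for v v1 v2 x
    by (rule has_derivative_eq_rhs[OF has_derivative_mult[OF that fst_snd_deriv(1)]]) (auto simp: algebra_simps)
  note mc = this
  have d1: "((\<lambda>x. u x * ?c x) has_derivative (\<lambda>h. fst h *\<^sub>R (ut x * ?c x)
      + snd h *\<^sub>R (u\<theta> x * ?c x - of_int n * (u x * ?s x)))) (at x within annulus T)" if "x \<in> annulus T" for x
    by (rule mc[where v = u and ?v1.0 = ut and ?v2.0 = u\<theta>, OF derivs(1)[OF that]])
  have d2: "((\<lambda>x. ut x * ?c x) has_derivative (\<lambda>h. fst h *\<^sub>R (utt x * ?c x)
      + snd h *\<^sub>R (d_theta ut x * ?c x - of_int n * (ut x * ?s x)))) (at x within annulus T)" if "x \<in> annulus T" for x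
    by (rule mc[where v = ut and ?v1.0 = utt and ?v2.0 = "d_theta ut", OF derivs(2)[OF that]])
  have "continuous_on (annulus T) (\<lambda>x. ut x * ?c x)" "continuous_on (annulus T) (\<lambda>x. utt x * ?c x)"
    by (intro continuous_intros)+
  note D = deriv_circle_integral[OF d1 this(1) t] deriv_circle_integral[OF d2 this(2) t]
  show "(coeff n \<phi> has_real_derivative coeff1 n \<phi> t) (at t within {0..T})"
    using D(1) unfolding coeff_def coeff1_def by simp
  have 1: "(coeff1 n \<phi> has_real_derivative integral {0..2*pi} (\<lambda>\<theta>. utt (t, \<theta>) * cos (of_int n * \<theta> + \<phi>))) (at t within {0..T})"
    using D(2) unfolding coeff1_def by simp
  have "((\<lambda>\<theta>. u\<theta>\<theta> (t, \<theta>) * cos (of_int n * \<theta> + \<phi>) + of_int n ^ 2 * (u (t, \<theta>) * cos (of_int n * \<theta> + \<phi>))) has_integral 0) {0..2*pi}"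
  proof -
    let ?v = "\<lambda>x. u\<theta> x * ?c x + of_int n * (u x * ?s x)"
    have "(?v has_derivative (\<lambda>h. fst h *\<^sub>R (d_t T u\<theta> x * ?c x + of_int n * (ut x * ?s x)) +
       snd h *\<^sub>R (u\<theta>\<theta> x * ?c x + of_int n ^ 2 * (u x * ?c x)))) (at x within annulus T)" if "x \<in> annulus T" for x
      by (rule has_derivative_eq_rhs[OF has_derivative_add[OF mc[where v = u\<theta> and ?v1.0 = "d_t T u\<theta>" and ?v2.0 = u\<theta>\<theta>, OF derivs(3)[OF that]]
            has_derivative_mult_right[OF has_derivative_mult[OF derivs(1)[OF that] fst_snd_deriv(2)]]]])
         (auto simp: algebra_simps power2_eq_square)
    note dv = this
    have sc: "cos (of_int n * (2 * pi) + \<phi>) = cos \<phi>" "sin (of_int n * (2 * pi) + \<phi>) = sin \<phi>"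
    proof -
      have "of_int n * (2 * pi) + \<phi> = \<phi> + 2 * pi * of_int n" by simp
      moreover have "cos (\<phi> + 2 * pi * of_int n) = cos \<phi>" "sin (\<phi> + 2 * pi * of_int n) = sin \<phi>"
        by (rule periodic_int_shift, simp)+
      ultimately show "cos (of_int n * (2 * pi) + \<phi>) = cos \<phi>" "sin (of_int n * (2 * pi) + \<phi>) = sin \<phi>" by (simp_all only:)
    qed
    have p: "?v (t, 2 * pi) = ?v (t, 0)"
      using periodic[OF t, of 0] by (simp only: snd_conv sc) simp
    from circle_integral_derivative_zero[OF dv p t] show ?thesis by simp
  qed
  then have "integral {0..2*pi} (\<lambda>\<theta>. u\<theta>\<theta> (t, \<theta>) * cos (of_int n * \<theta> + \<phi>) + of_int n ^ 2 * (u (t, \<theta>) * cos (of_int n * \<theta> + \<phi>))) = 0"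
    by (rule integral_unique)
  moreover have "integral {0..2*pi} (\<lambda>\<theta>. u\<theta>\<theta> (t, \<theta>) * cos (of_int n * \<theta> + \<phi>) + of_int n ^ 2 * (u (t, \<theta>) * cos (of_int n * \<theta> + \<phi>))) =
     integral {0..2*pi} (\<lambda>\<theta>. u\<theta>\<theta> (t, \<theta>) * cos (of_int n * \<theta> + \<phi>)) + of_int n ^ 2 * coeff n \<phi> t"
    unfolding coeff_def integral_mult_right[symmetric]
    by (rule integral_add)
       (intro integrable_continuous_real continuous_intros annulus_slice_continuous[OF cont(1) t] annulus_slice_continuous[OF cont(5) t])+
  moreover have "integral {0..2*pi} (\<lambda>\<theta>. utt (t, \<theta>) * cos (of_int n * \<theta> + \<phi>)) = - integral {0..2*pi} (\<lambda>\<theta>. u\<theta>\<theta> (t, \<theta>) * cos (of_int n * \<theta> + \<phi>))"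
    using laplace t by (simp add: annulus_def)
  ultimately have "integral {0..2*pi} (\<lambda>\<theta>. utt (t, \<theta>) * cos (of_int n * \<theta> + \<phi>)) = of_int n ^ 2 * coeff n \<phi> t" by simp
  then show "(coeff1 n \<phi> has_real_derivative of_int n ^ 2 * coeff n \<phi> t) (at t within {0..T})" using 1 by simp
qed

end

lemma nonneg_integral_zero:
  fixes f :: "real \<Rightarrow> real"
  assumes "continuous_on {a..b} f" "\<And>x. x \<in> {a..b} \<Longrightarrow> f x \<ge> 0" "integral {a..b} f \<le> 0" "x \<in> {a..b}" "a < b"
  shows "f x = 0"
proof -
  have "integral {a..b} f \<ge> 0" by (rule integral_nonneg) (use assms in \<open>auto intro: integrable_continuous_real\<close>)
  then have "integral {a..b} f = 0" using assms(3) by simp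
  then show ?thesis using assms by (subst (asm) integral_eq_0_iff) auto
qed

lemma has_real_derivative_integral:
  fixes F :: "real \<Rightarrow> real"
  assumes "a \<le> b" "\<And>t. t \<in> {a..b} \<Longrightarrow> (F has_real_derivative F' t) (at t within {a..b})"
  shows "(F' has_integral (F b - F a)) {a..b}"
  using fundamental_theorem_of_calculus[OF assms(1), of F F'] assms(2)
  by (simp add: has_real_derivative_iff_has_vector_derivative)

text \<open>
  Comparison with the positive solution \<open>cosh (t - p)\<close> of \<open>\<phi>'' = \<phi>\<close>, whose Robin parameters at the
  two ends are exactly \<open>tanh p\<close> and \<open>tanh (T - p)\<close>. Picone's identity for the quotient \<open>a / \<phi>\<close>
  says that \<open>F = a a' - a\<^sup>2 tanh (t - p)\<close> is nondecreasing when \<open>n \<ge> 1\<close>, whereas smaller Robin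
  parameters force \<open>F(0) \<ge> 0 \<ge> F(T)\<close>. Therefore \<open>F\<close> is constant, which makes \<open>a\<close> a multiple of \<open>\<phi>\<close>
  vanishing at \<open>0\<close>.
\<close>

lemma robin_ode_trivial:
  fixes a a1 :: "real \<Rightarrow> real"
  assumes T: "T > 0"
    and a: "\<And>t. t \<in> {0..T} \<Longrightarrow> (a has_real_derivative a1 t) (at t within {0..T})"
    and a1: "\<And>t. t \<in> {0..T} \<Longrightarrow> (a1 has_real_derivative n * a t) (at t within {0..T})" and n: "n \<ge> 1"
    and bc: "- a1 0 = r0 * a 0" "a1 T = r1 * a T"
    and r: "r0 < tanh p" "r1 < tanh (T - p)" and t: "t \<in> {0..T}"
  shows "a t = 0"
proof -
  let ?h = "\<lambda>t. tanh (t - p)"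
  have th: "(?h has_real_derivative 1 - (?h t)\<^sup>2) (at t within S)" for t S
    by (auto intro!: derivative_eq_intros)
  define F where "F t = a t * a1 t - (a t)\<^sup>2 * ?h t" for t
  define F' where "F' t = (a1 t - a t * ?h t)\<^sup>2 + (n - 1) * (a t)\<^sup>2" for t
  have dF: "(F has_real_derivative F' t) (at t within {0..T})" if "t \<in> {0..T}" for t
    unfolding F_def F'_def power2_eq_square[of "a _"]
    by (rule DERIV_cong[OF DERIV_diff[OF DERIV_mult[OF a[OF that] a1[OF that]]
          DERIV_mult[OF DERIV_mult[OF a[OF that] a[OF that]] th]]])
       (simp add: algebra_simps power2_eq_square)
  have I: "(F' has_integral (F T - F 0)) {0..T}"
    by (rule has_real_derivative_integral) (use T dF in auto)
  have ca: "continuous_on {0..T} a" "continuous_on {0..T} a1"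
    by (rule DERIV_continuous_on[OF a], assumption) (rule DERIV_continuous_on[OF a1], assumption)
  have ct: "continuous_on {0..T} ?h" by (rule DERIV_continuous_on[OF th])
  have cF: "continuous_on {0..T} F'" unfolding F'_def by (intro continuous_intros ca ct)
  have pos: "F' t \<ge> 0" for t unfolding F'_def using n by simp
  have F0: "F 0 = (tanh p - r0) * (a 0)\<^sup>2"
  proof -
    have "a1 0 = - (r0 * a 0)" using bc(1) by simp
    then show ?thesis by (simp add: F_def power2_eq_square algebra_simps)
  qed
  have FT: "F T = - ((tanh (T - p) - r1) * (a T)\<^sup>2)"
    using bc(2) by (simp add: F_def power2_eq_square algebra_simps)
  have s: "(tanh p - r0) * (a 0)\<^sup>2 \<ge> 0" "(tanh (T - p) - r1) * (a T)\<^sup>2 \<ge> 0" using r by auto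
  have "F T - F 0 \<ge> 0" using integral_nonneg[of F' "{0..T}"] I pos by (metis has_integral_integrable_integral)
  then have "(tanh p - r0) * (a 0)\<^sup>2 = 0" "F T - F 0 \<le> 0" using s F0 FT by linarith+
  then have a0: "a 0 = 0" using r by simp
  have F'0: "F' t = 0" if "t \<in> {0..T}" for t
    by (rule nonneg_integral_zero[OF cF pos _ that T]) (use I \<open>F T - F 0 \<le> 0\<close> in \<open>simp add: integral_unique\<close>)
  have eq: "a1 t = a t * ?h t" if "t \<in> {0..T}" for t
  proof -
    have "(a1 t - a t * ?h t)\<^sup>2 \<le> F' t" unfolding F'_def using n by simp
    then show ?thesis using F'0[OF that] by simp
  qed
  define g where "g t = a t / cosh (t - p)" for t
  have "(g has_real_derivative 0) (at t within {0..T})" if "t \<in> {0..T}" for t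
  proof -
    have "((\<lambda>t. cosh (t - p)) has_real_derivative sinh (t - p)) (at t within {0..T})"
      by (auto intro!: derivative_eq_intros)
    from DERIV_divide[OF a[OF that] this] show ?thesis
      unfolding g_def by (rule DERIV_cong) (simp_all add: eq[OF that] tanh_def)
  qed
  then have "\<exists>c. \<forall>t\<in>{0..T}. g t = c"
    by (intro has_field_derivative_zero_constant) auto
  then have "g t = g 0" using t T by auto
  then show ?thesis using a0 by (simp add: g_def)
qed

lemma linear_ode:
  fixes a a1 :: "real \<Rightarrow> real"
  assumes T: "T > 0"
    and a: "\<And>t. t \<in> {0..T} \<Longrightarrow> (a has_real_derivative a1 t) (at t within {0..T})"
    and a1: "\<And>t. t \<in> {0..T} \<Longrightarrow> (a1 has_real_derivative 0) (at t within {0..T})" and t: "t \<in> {0..T}"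
  shows "a t = a 0 + a1 0 * t" "a1 t = a1 0"
proof -
  have "\<exists>c. \<forall>t\<in>{0..T}. a1 t = c" by (intro has_field_derivative_zero_constant) (use a1 in auto)
  then have c: "a1 s = a1 0" if "s \<in> {0..T}" for s using that T by auto
  then show "a1 t = a1 0" using t by blast
  have "((\<lambda>t. a t - a1 0 * t) has_real_derivative 0) (at s within {0..T})" if "s \<in> {0..T}" for s
    by (rule DERIV_cong[OF DERIV_diff[OF a[OF that] DERIV_cmult[OF DERIV_ident]]]) (simp add: c[OF that])
  then have "\<exists>c. \<forall>t\<in>{0..T}. a t - a1 0 * t = c" by (intro has_field_derivative_zero_constant) auto
  then obtain c where "\<And>t. t \<in> {0..T} \<Longrightarrow> a t - a1 0 * t = c" by blast
  from this[of t] this[of 0] have "a t - a1 0 * t = a 0 - a1 0 * 0" using t T by simp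
  then show "a t = a 0 + a1 0 * t" by simp
qed

context harmonic_annulus
begin

text \<open>
  A harmonic function satisfying a Robin condition below the critical parameters has no Fourier
  coefficient of nonzero frequency. The mean over circles is affine in \<open>t\<close>, and by completeness
  the function equals its mean.
\<close>

theorem robin_affine:
  assumes bc: "\<And>\<theta>. - ut (0, \<theta>) = r0 * u (0, \<theta>)" "\<And>\<theta>. ut (T, \<theta>) = r1 * u (T, \<theta>)"
    and r: "r0 < tanh p" "r1 < tanh (T - p)"
  obtains \<alpha> \<gamma> where "\<And>t \<theta>. t \<in> {0..T} \<Longrightarrow> u (t, \<theta>) = \<alpha> + \<gamma> * t" "- \<gamma> = r0 * \<alpha>" "\<gamma> = r1 * (\<alpha> + \<gamma> * T)"
proof -
  have bc': "- coeff1 n \<phi> 0 = r0 * coeff n \<phi> 0" "coeff1 n \<phi> T = r1 * coeff n \<phi> T" for n \<phi>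
  proof -
    have e0: "ut (0, \<theta>) = - r0 * u (0, \<theta>)" for \<theta> using bc(1)[of \<theta>] by simp
    show "- coeff1 n \<phi> 0 = r0 * coeff n \<phi> 0" "coeff1 n \<phi> T = r1 * coeff n \<phi> T"
      unfolding coeff_def coeff1_def by (simp_all add: e0 bc(2) mult.assoc)
  qed
  have hi: "coeff n \<phi> t = 0" if "n \<noteq> 0" "t \<in> {0..T}" for n \<phi> t
  proof (rule robin_ode_trivial[OF T coeff_deriv(1) coeff_deriv(2) _ bc' r that(2)])
    have "1 \<le> \<bar>real_of_int n\<bar>" using that(1) by linarith
    then show "1 \<le> (real_of_int n)\<^sup>2" using power_mono[of 1 "\<bar>real_of_int n\<bar>" 2] by simp
  qed
  define \<alpha> where "\<alpha> = coeff 0 0 0 / (2 * pi)"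
  define \<gamma> where "\<gamma> = coeff1 0 0 0 / (2 * pi)"
  have lin: "coeff 0 0 t = 2 * pi * (\<alpha> + \<gamma> * t)" "coeff1 0 0 t = 2 * pi * \<gamma>" if "t \<in> {0..T}" for t
    using linear_ode[OF T coeff_deriv(1)[of _ 0 0] _ that] coeff_deriv(2)[of _ 0 0]
    by (simp_all add: \<alpha>_def \<gamma>_def distrib_left)
  have "u (t, \<theta>) = \<alpha> + \<gamma> * t" if t: "t \<in> {0..T}" for t \<theta>
  proof -
    have c: "continuous_on S (\<lambda>\<theta>. u (t, \<theta>))" for S by (rule annulus_slice_continuous[OF cont(1) t])
    note [continuous_intros] = c
    have "u (t, \<theta>) - (\<alpha> + \<gamma> * t) = 0"
    proof (rule trig_complete[where g = "\<lambda>\<theta>. u (t, \<theta>) - (\<alpha> + \<gamma> * t)"])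
      show "continuous_on UNIV (\<lambda>\<theta>. u (t, \<theta>) - (\<alpha> + \<gamma> * t))" by (intro continuous_intros)
      show "u (t, \<theta> + 2 * pi) - (\<alpha> + \<gamma> * t) = u (t, \<theta>) - (\<alpha> + \<gamma> * t)" for \<theta> using periodic(1)[OF t] by simp
      fix n :: int and \<phi>
      note I = integral_cos_freq[of n \<phi>]
      have "integral {0..2*pi} (\<lambda>\<theta>. (u (t, \<theta>) - (\<alpha> + \<gamma> * t)) * cos (of_int n * \<theta> + \<phi>)) =
        integral {0..2*pi} (\<lambda>\<theta>. u (t, \<theta>) * cos (of_int n * \<theta> + \<phi>) - (\<alpha> + \<gamma> * t) * cos (of_int n * \<theta> + \<phi>))"
        by (simp only: left_diff_distrib)
      also have "\<dots> = coeff n \<phi> t - (\<alpha> + \<gamma> * t) * (if n = 0 then 2 * pi * cos \<phi> else 0)"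
        unfolding coeff_def I[symmetric] integral_mult_right[symmetric]
        by (rule integral_diff) (intro integrable_continuous_real continuous_intros)+
      also have "\<dots> = 0"
      proof (cases "n = 0")
        case True
        have "coeff 0 \<phi> t = cos \<phi> * coeff 0 0 t"
          by (simp add: coeff_def mult.commute)
        then show ?thesis using True lin(1)[OF t] by simp
      next
        case False
        then show ?thesis using hi[OF False t] by simp
      qed
      finally show "integral {0..2*pi} (\<lambda>\<theta>. (u (t, \<theta>) - (\<alpha> + \<gamma> * t)) * cos (of_int n * \<theta> + \<phi>)) = 0" .
    qed
    then show ?thesis by simp
  qed
  moreover have "- \<gamma> = r0 * \<alpha>"
  proof -
    have "- (2 * pi * \<gamma>) = r0 * (2 * pi * \<alpha>)" using bc'(1)[of 0 0] lin[of 0] T by simp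
    then have "2 * pi * (- \<gamma>) = 2 * pi * (r0 * \<alpha>)" by simp
    moreover have "2 * pi \<noteq> 0" by simp
    ultimately show ?thesis using mult_left_cancel[of "2 * pi" "- \<gamma>" "r0 * \<alpha>"] by blast
  qed
  moreover have "\<gamma> = r1 * (\<alpha> + \<gamma> * T)"
  proof -
    have "2 * pi * \<gamma> = r1 * (2 * pi * (\<alpha> + \<gamma> * T))" using bc'(2)[of 0 0] lin[of T] T by simp
    then have "2 * pi * \<gamma> = 2 * pi * (r1 * (\<alpha> + \<gamma> * T))" by (simp only: mult.left_commute)
    then show ?thesis by simp
  qed
  ultimately show thesis by (rule that)
qed

text \<open>
  Green's formula, organized as a monotonicity in \<open>t\<close>: the flux \<open>F(t) = \<integral> u u\<^sub>t d\<theta>\<close> has derivative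
  \<open>\<integral> |\<nabla>u|\<^sup>2 d\<theta> \<ge> 0\<close>, while a negative eigenvalue makes \<open>F(T) \<le> 0 \<le> F(0)\<close>. Thus \<open>u\<close> is constant in
  \<open>t\<close> and vanishes at \<open>t = 0\<close>.
\<close>

theorem negative_eigenvalue_trivial:
  assumes bc: "\<And>\<theta>. - ut (0, \<theta>) = s * b0 \<theta> * u (0, \<theta>)" "\<And>\<theta>. ut (T, \<theta>) = s * b1 \<theta> * u (T, \<theta>)"
    and b: "\<And>\<theta>. b0 \<theta> > 0" "\<And>\<theta>. b1 \<theta> > 0" "continuous_on {0..2*pi} b0" "continuous_on {0..2*pi} b1"
    and s: "s < 0" and x: "x \<in> annulus T"
  shows "u x = 0"
proof -
  note [continuous_intros] = cont b(3,4)
  have sl: "continuous_on {0..2*pi} (\<lambda>\<theta>. v (t, \<theta>))" if "continuous_on (annulus T) v" "t \<in> {0..T}" for v :: "real \<times> real \<Rightarrow> real" and t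
    by (rule annulus_slice_continuous[OF that])
  have T0: "0 \<in> {0..T}" "T \<in> {0..T}" using T by auto
  define F where "F t = integral {0..2*pi} (\<lambda>\<theta>. u (t, \<theta>) * ut (t, \<theta>))" for t
  define F' where "F' t = integral {0..2*pi} (\<lambda>\<theta>. (ut (t, \<theta>))\<^sup>2 + (u\<theta> (t, \<theta>))\<^sup>2)" for t
  have dF: "(F has_real_derivative F' t) (at t within {0..T})" if t: "t \<in> {0..T}" for t
  proof -
    let ?v = "\<lambda>x. u x * ut x" and ?v1 = "\<lambda>x. (ut x)\<^sup>2 + u x * utt x" and ?v2 = "\<lambda>x. u\<theta> x * ut x + u x * d_theta ut x"
    have dv: "(?v has_derivative (\<lambda>h. fst h *\<^sub>R ?v1 x + snd h *\<^sub>R ?v2 x)) (at x within annulus T)" if "x \<in> annulus T" for x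
      by (rule has_derivative_eq_rhs[OF has_derivative_mult[OF derivs(1,2)[OF that]]])
         (auto simp: algebra_simps power2_eq_square)
    have "(F has_real_derivative integral {0..2*pi} (\<lambda>\<theta>. ?v1 (t, \<theta>))) (at t within {0..T})"
      unfolding F_def by (rule deriv_circle_integral[OF dv _ t]) (auto intro!: continuous_intros)
    moreover have "integral {0..2*pi} (\<lambda>\<theta>. ?v1 (t, \<theta>)) = F' t"
    proof -
      \<comment> \<open>Integration by parts on the circle, with Laplace's equation, turns \<open>u u\<^sub>t\<^sub>t\<close> into \<open>(u\<^sub>\<theta>)\<^sup>2\<close>.\<close>
      let ?w = "\<lambda>x. u x * u\<theta> x" and ?w1 = "\<lambda>x. ut x * u\<theta> x + u x * d_t T u\<theta> x" and ?w2 = "\<lambda>x. (u\<theta> x)\<^sup>2 + u x * u\<theta>\<theta> x"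
      have dw: "(?w has_derivative (\<lambda>h. fst h *\<^sub>R ?w1 x + snd h *\<^sub>R ?w2 x)) (at x within annulus T)" if "x \<in> annulus T" for x
        by (rule has_derivative_eq_rhs[OF has_derivative_mult[OF derivs(1,3)[OF that]]])
           (auto simp: algebra_simps power2_eq_square)
      have "?w (t, 2 * pi) = ?w (t, 0)" using periodic[OF t, of 0] by simp
      from circle_integral_derivative_zero[OF dw this t]
      have z: "integral {0..2*pi} (\<lambda>\<theta>. ?w2 (t, \<theta>)) = 0" by (rule integral_unique)
      have c1: "continuous_on {0..2*pi} (\<lambda>\<theta>. ?v1 (t, \<theta>))" by (rule sl[OF _ t]) (intro continuous_intros)
      have c2: "continuous_on {0..2*pi} (\<lambda>\<theta>. ?w2 (t, \<theta>))" by (rule sl[OF _ t]) (intro continuous_intros)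
      have "integral {0..2*pi} (\<lambda>\<theta>. ?v1 (t, \<theta>)) = integral {0..2*pi} (\<lambda>\<theta>. ?v1 (t, \<theta>)) + integral {0..2*pi} (\<lambda>\<theta>. ?w2 (t, \<theta>))"
        using z by simp
      also have "\<dots> = integral {0..2*pi} (\<lambda>\<theta>. ?v1 (t, \<theta>) + ?w2 (t, \<theta>))"
        by (rule integral_add[symmetric]) (intro integrable_continuous_real c1 c2)+
      also have "\<dots> = F' t" unfolding F'_def using laplace t by (simp add: annulus_def)
      finally show ?thesis .
    qed
    ultimately show ?thesis by simp
  qed
  have I: "(F' has_integral (F T - F 0)) {0..T}"
    by (rule has_real_derivative_integral) (use T dF in auto)
  have bT: "F T = s * integral {0..2*pi} (\<lambda>\<theta>. b1 \<theta> * (u (T, \<theta>))\<^sup>2)"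
  proof -
    have "(\<lambda>\<theta>. u (T, \<theta>) * ut (T, \<theta>)) = (\<lambda>\<theta>. s * (b1 \<theta> * (u (T, \<theta>))\<^sup>2))"
      by (rule ext) (simp add: bc(2) power2_eq_square)
    then show ?thesis unfolding F_def by (simp only: integral_mult_right)
  qed
  have b0': "F 0 = - s * integral {0..2*pi} (\<lambda>\<theta>. b0 \<theta> * (u (0, \<theta>))\<^sup>2)"
  proof -
    have "ut (0, \<theta>) = - s * b0 \<theta> * u (0, \<theta>)" for \<theta> using bc(1)[of \<theta>] by simp
    then have "(\<lambda>\<theta>. u (0, \<theta>) * ut (0, \<theta>)) = (\<lambda>\<theta>. (- s) * (b0 \<theta> * (u (0, \<theta>))\<^sup>2))"
      by (intro ext) (simp add: power2_eq_square)
    then show ?thesis unfolding F_def by (simp only: integral_mult_right)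
  qed
  have n1: "integral {0..2*pi} (\<lambda>\<theta>. b1 \<theta> * (u (T, \<theta>))\<^sup>2) \<ge> 0"
    by (rule integral_nonneg) (use b in \<open>auto intro!: integrable_continuous_real continuous_intros sl[OF cont(1) T0(2)] simp: less_imp_le\<close>)
  have n0: "integral {0..2*pi} (\<lambda>\<theta>. b0 \<theta> * (u (0, \<theta>))\<^sup>2) \<ge> 0"
    by (rule integral_nonneg) (use b in \<open>auto intro!: integrable_continuous_real continuous_intros sl[OF cont(1) T0(1)] simp: less_imp_le\<close>)
  have F'pos: "F' t \<ge> 0" if "t \<in> {0..T}" for t
    unfolding F'_def
    by (rule integral_nonneg) (use that in \<open>auto intro!: integrable_continuous_real continuous_intros sl[OF cont(2)] sl[OF cont(3)]\<close>)
  have "F T - F 0 \<ge> 0" using integral_nonneg[of F' "{0..T}"] I F'pos by (metis has_integral_integrable_integral)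
  moreover have "s * integral {0..2*pi} (\<lambda>\<theta>. b1 \<theta> * (u (T, \<theta>))\<^sup>2) \<le> 0" "s * integral {0..2*pi} (\<lambda>\<theta>. b0 \<theta> * (u (0, \<theta>))\<^sup>2) \<le> 0"
    using s n0 n1 by (simp_all add: mult_nonpos_nonneg)
  ultimately have z: "F T - F 0 = 0" "s * integral {0..2*pi} (\<lambda>\<theta>. b0 \<theta> * (u (0, \<theta>))\<^sup>2) = 0"
    using bT b0' by linarith+
  then have z0: "integral {0..2*pi} (\<lambda>\<theta>. b0 \<theta> * (u (0, \<theta>))\<^sup>2) = 0" using s by simp
  have u0: "u (0, \<theta>) = 0" if "\<theta> \<in> {0..2*pi}" for \<theta>
  proof -
    have "b0 \<theta> * (u (0, \<theta>))\<^sup>2 = 0"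
      by (rule nonneg_integral_zero[where f = "\<lambda>\<theta>. b0 \<theta> * (u (0, \<theta>))\<^sup>2", OF _ _ _ that])
         (use b z0 in \<open>auto intro!: continuous_intros sl[OF cont(1) T0(1)] simp: less_imp_le\<close>)
    then show ?thesis using b(1)[of \<theta>] by simp
  qed
  have cF': "continuous_on {0..T} F'"
  proof -
    have "continuous_on (annulus T) (\<lambda>x. (ut x)\<^sup>2 + (u\<theta> x)\<^sup>2)" by (intro continuous_intros)
    then have "continuous_on ({0..T} \<times> cbox 0 (2*pi)) (\<lambda>(t, \<theta>). (ut (t, \<theta>))\<^sup>2 + (u\<theta> (t, \<theta>))\<^sup>2)"
      by (auto intro: continuous_on_subset simp: annulus_def case_prod_unfold)
    from integral_continuous_on_param[OF this] show ?thesis unfolding F'_def by simp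
  qed
  have ut0: "ut (t, \<theta>) = 0" if t: "t \<in> {0..T}" and \<theta>: "\<theta> \<in> {0..2*pi}" for t \<theta>
  proof -
    have "F' t = 0" by (rule nonneg_integral_zero[OF cF' F'pos _ t T]) (use I z in \<open>simp_all add: integral_unique\<close>)
    have "(ut (t, \<theta>))\<^sup>2 + (u\<theta> (t, \<theta>))\<^sup>2 = 0"
      by (rule nonneg_integral_zero[where f = "\<lambda>\<theta>. (ut (t, \<theta>))\<^sup>2 + (u\<theta> (t, \<theta>))\<^sup>2", OF _ _ _ \<theta>])
         (use \<open>F' t = 0\<close> t in \<open>auto simp: F'_def intro!: continuous_intros sl[OF cont(2)] sl[OF cont(3)]\<close>)
    then show ?thesis by (simp add: sum_power2_eq_zero_iff)
  qed
  have uz: "u (t, \<theta>) = 0" if t: "t \<in> {0..T}" and \<theta>: "\<theta> \<in> {0..2*pi}" for t \<theta>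
  proof -
    have "((\<lambda>s. u (s, \<theta>)) has_real_derivative 0) (at s within {0..T})" if "s \<in> {0..T}" for s
    proof -
      have "(s, \<theta>) \<in> annulus T" using that by (simp add: annulus_def)
      from at_annulus_t[OF derivs(1)[OF this] that] ut0[OF that \<theta>] show ?thesis
        by (simp add: has_real_derivative_iff_has_vector_derivative)
    qed
    then have "\<exists>c. \<forall>s\<in>{0..T}. u (s, \<theta>) = c" by (intro has_field_derivative_zero_constant) auto
    then have "u (t, \<theta>) = u (0, \<theta>)" using t T0 by auto
    then show ?thesis using u0[OF \<theta>] by simp
  qed
  obtain t \<theta> where xt: "x = (t, \<theta>)" "t \<in> {0..T}" using x by (cases x) (auto simp: annulus_def)
  obtain \<theta>' where "\<theta>' \<in> {0..<2*pi}" "u (t, \<theta>) = u (t, \<theta>')"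
    using periodic_representative[of "\<lambda>\<theta>. u (t, \<theta>)" \<theta>] periodic(1)[OF xt(2)] by blast
  then show ?thesis using uz[OF xt(2)] xt by simp
qed

end

section \<open>The catenoidal maps\<close>

definition vec3 :: "real \<Rightarrow> real \<Rightarrow> real \<Rightarrow> real^3" where
  "vec3 x y z = x *\<^sub>R axis 1 1 + y *\<^sub>R axis 2 1 + z *\<^sub>R axis 3 1"

lemma vec3_nth [simp]: "vec3 x y z $ 1 = x" "vec3 x y z $ 2 = y" "vec3 x y z $ 3 = z"
  by (simp_all add: vec3_def axis_def)

lemma vec3_eqI: "v $ 1 = w $ 1 \<Longrightarrow> v $ 2 = w $ 2 \<Longrightarrow> v $ 3 = w $ 3 \<Longrightarrow> v = (w :: real^3)"
  by (simp add: vec_eq_iff forall_3)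

lemma vec3_inner: "vec3 x y z \<bullet> vec3 x' y' z' = x * x' + y * y' + z * z'"
  by (simp add: inner_vec_def sum_3)

lemma norm_vec3: "(norm (vec3 x y z))\<^sup>2 = x\<^sup>2 + y\<^sup>2 + z\<^sup>2"
  unfolding power2_norm_eq_inner vec3_inner by (simp add: power2_eq_square)

lemma vec3_scale: "r *\<^sub>R vec3 x y z = vec3 (r * x) (r * y) (r * z)"
  by (rule vec3_eqI) auto

lemma vec3_add: "vec3 x y z + vec3 x' y' z' = vec3 (x + x') (y + y') (z + z')"
  by (rule vec3_eqI) auto

lemma vec3_minus: "- vec3 x y z = vec3 (- x) (- y) (- z)"
  by (rule vec3_eqI) auto

lemma vec3_has_derivative:
  assumes "(f has_derivative f') F" "(g has_derivative g') F" "(k has_derivative k') F"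
  shows "((\<lambda>x. vec3 (f x) (g x) (k x)) has_derivative (\<lambda>h. vec3 (f' h) (g' h) (k' h))) F"
  unfolding vec3_def by (intro has_derivative_add has_derivative_scaleR_left assms)

lemma smooth_on_vec3:
  "smooth_on S f \<Longrightarrow> smooth_on S g \<Longrightarrow> smooth_on S k \<Longrightarrow> smooth_on S (\<lambda>x. vec3 (f x) (g x) (k x))"
  unfolding vec3_def by (intro smooth_on_add smooth_on_scaleR_const)

lemma smooth_on_uminus: "smooth_on S f \<Longrightarrow> smooth_on S (\<lambda>x. - f x :: real)"
  using smooth_on_mult[OF smooth_on_const[of S "-1"], of f] by simp

lemma smooth_on_diff: "smooth_on S f \<Longrightarrow> smooth_on S g \<Longrightarrow> smooth_on S (\<lambda>x. f x - g x :: real)"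
  using smooth_on_add_real[OF _ smooth_on_uminus, of S f g] by simp

lemma smooth_on_cosh: "smooth_on S f \<Longrightarrow> smooth_on S (\<lambda>x. cosh (f x :: real))"
  unfolding cosh_def scaleR_conv_of_real
  by (intro smooth_on_mult smooth_on_const smooth_on_add_real smooth_on_exp smooth_on_uminus)

lemma smooth_on_sinh: "smooth_on S f \<Longrightarrow> smooth_on S (\<lambda>x. sinh (f x :: real))"
  unfolding sinh_def scaleR_conv_of_real
  by (intro smooth_on_mult smooth_on_const smooth_on_diff smooth_on_exp smooth_on_uminus)

lemma smooth_on_sin: "smooth_on S f \<Longrightarrow> smooth_on S (\<lambda>x. sin (f x :: real))"
  using smooth_on_cos[OF smooth_on_diff[OF _ smooth_on_const[of S "pi/2"]], of f] by (simp add: cos_diff)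

lemma smooth_on_fst: "smooth_on S (fst :: real \<times> real \<Rightarrow> real)"
  by (rule smooth_on_linear) (rule bounded_linear_fst)

lemma smooth_on_snd: "smooth_on S (snd :: real \<times> real \<Rightarrow> real)"
  by (rule smooth_on_linear) (rule bounded_linear_snd)

lemmas smooth_intros = smooth_on_vec3 smooth_on_uminus smooth_on_diff smooth_on_cosh smooth_on_sinh smooth_on_sin
  smooth_on_cos smooth_on_fst smooth_on_snd smooth_on_mult smooth_on_add_real smooth_on_const

text \<open>
  The maps \<open>(a cosh (t - p) cos \<theta>, a cosh (t - p) sin \<theta>, b (t - q))\<close>, with the conditions that the
  normal derivative be proportional to the map at either end (\<open>q = coth p\<close> and
  \<open>T - q = coth (T - p)\<close>) and that the boundary lie on the unit sphere.
\<close>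

locale catenoidal_map =
  fixes T p a b q :: real
  assumes p: "0 < p" "p < T" and q: "q * tanh p = 1" "(T - q) * tanh (T - p) = 1"
    and ab: "a > 0" "b > 0"
    and unit: "a\<^sup>2 * (cosh p)\<^sup>2 + b\<^sup>2 * q\<^sup>2 = 1" "a\<^sup>2 * (cosh (T - p))\<^sup>2 + b\<^sup>2 * (T - q)\<^sup>2 = 1"
begin

lemma T: "T > 0" using p by simp

definition Psi :: "real \<times> real \<Rightarrow> real^3" where
  "Psi x = vec3 (a * cosh (fst x - p) * cos (snd x)) (a * cosh (fst x - p) * sin (snd x)) (b * (fst x - q))"

definition Psi_t :: "real \<times> real \<Rightarrow> real^3" where
  "Psi_t x = vec3 (a * sinh (fst x - p) * cos (snd x)) (a * sinh (fst x - p) * sin (snd x)) b"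

definition Psi_\<theta> :: "real \<times> real \<Rightarrow> real^3" where
  "Psi_\<theta> x = vec3 (- (a * cosh (fst x - p) * sin (snd x))) (a * cosh (fst x - p) * cos (snd x)) 0"

text \<open>The lengths of the normal derivative at the two ends, with respect to the flat metric.\<close>

definition rho0 :: real where "rho0 = tanh p"
definition rho1 :: real where "rho1 = tanh (T - p)"

lemma rho_pos: "rho0 > 0" "rho1 > 0" using p by (simp_all add: rho0_def rho1_def)

lemma cosh_sinh_fst_derivs:
  "((\<lambda>x :: real \<times> real. cosh (fst x - p)) has_derivative (\<lambda>h. fst h * sinh (fst x - p))) (at x within S)"
  "((\<lambda>x :: real \<times> real. sinh (fst x - p)) has_derivative (\<lambda>h. fst h * cosh (fst x - p))) (at x within S)"
proof -
  have f: "((\<lambda>x :: real \<times> real. fst x - p) has_derivative fst) (at x within S)"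
    by (auto intro!: derivative_eq_intros)
  have c: "(cosh has_real_derivative sinh y) (at y)" "(sinh has_real_derivative cosh y) (at y)" for y :: real
    by (auto intro!: derivative_eq_intros)
  show "((\<lambda>x :: real \<times> real. cosh (fst x - p)) has_derivative (\<lambda>h. fst h * sinh (fst x - p))) (at x within S)"
    "((\<lambda>x :: real \<times> real. sinh (fst x - p)) has_derivative (\<lambda>h. fst h * cosh (fst x - p))) (at x within S)"
    by (rule DERIV_compose_FDERIV[OF c(1) f], rule DERIV_compose_FDERIV[OF c(2) f])
qed

lemma Psi_derivs:
  "(Psi has_derivative (\<lambda>h. fst h *\<^sub>R Psi_t x + snd h *\<^sub>R Psi_\<theta> x)) (at x within S)"
  "(Psi_t has_derivative (\<lambda>h. fst h *\<^sub>R vec3 (a * cosh (fst x - p) * cos (snd x)) (a * cosh (fst x - p) * sin (snd x)) 0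
     + snd h *\<^sub>R vec3 (- (a * sinh (fst x - p) * sin (snd x))) (a * sinh (fst x - p) * cos (snd x)) 0)) (at x within S)"
  "(Psi_\<theta> has_derivative (\<lambda>h. fst h *\<^sub>R vec3 (- (a * sinh (fst x - p) * sin (snd x))) (a * sinh (fst x - p) * cos (snd x)) 0
     + snd h *\<^sub>R vec3 (- (a * cosh (fst x - p) * cos (snd x))) (- (a * cosh (fst x - p) * sin (snd x))) 0)) (at x within S)"
  unfolding Psi_def[abs_def] Psi_t_def[abs_def] Psi_\<theta>_def[abs_def] vec3_scale vec3_add
  by (rule vec3_has_derivative; (auto intro!: derivative_eq_intros cosh_sinh_fst_derivs simp: algebra_simps))+

lemma smooth_Psi: "smooth_on S Psi"
  unfolding Psi_def[abs_def] by (intro smooth_intros)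

lemma harmonic_Psi: "harmonic T w Psi"
  by (rule harmonicI[OF T smooth_Psi _ Psi_derivs(1) Psi_derivs(2) Psi_derivs(3)])
     (simp_all add: Psi_def vec3_add, simp add: vec3_def)

lemma d_Psi: assumes "x \<in> annulus T" shows "d_t T Psi x = Psi_t x" "d_theta Psi x = Psi_\<theta> x"
  by (rule d_t_d_theta_eq[OF T assms Psi_derivs(1)])+

lemma norm_circle: "(x * cos \<theta>)\<^sup>2 + (x * sin \<theta>)\<^sup>2 = (x :: real)\<^sup>2"
  by (simp add: power_mult_distrib distrib_left[symmetric])

lemma norm_Psi: "(norm (Psi x))\<^sup>2 = a\<^sup>2 * (cosh (fst x - p))\<^sup>2 + b\<^sup>2 * (fst x - q)\<^sup>2"
  unfolding Psi_def norm_vec3 norm_circle by (simp add: power_mult_distrib)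

lemma norm_Psi_t: "(norm (Psi_t x))\<^sup>2 = a\<^sup>2 * (sinh (fst x - p))\<^sup>2 + b\<^sup>2"
  unfolding Psi_t_def norm_vec3 norm_circle by (simp add: power_mult_distrib)

lemma norm_Psi_\<theta>: "(norm (Psi_\<theta> x))\<^sup>2 = a\<^sup>2 * (cosh (fst x - p))\<^sup>2"
  unfolding Psi_\<theta>_def norm_vec3 using norm_circle[of "a * cosh (fst x - p)" "snd x"]
  by (simp add: power_mult_distrib add.commute)

lemma norm_Psi_boundary: assumes "x \<in> annulus_bdry T" shows "norm (Psi x) = 1"
proof -
  have "cosh (- p) = cosh p" by simp
  then have "(norm (Psi x))\<^sup>2 = 1\<^sup>2"
    using assms unit unfolding norm_Psi by (auto simp: annulus_bdry_def)
  then show ?thesis using power2_eq_iff_nonneg[of "norm (Psi x)" 1] by simp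
qed

lemma bdry_subset: "annulus_bdry T \<subseteq> annulus T"
  using T by (auto simp: annulus_bdry_def annulus_def)

text \<open>
  Both \<open>cosh\<^sup>2\<close> and the square of an affine function are convex, the latter strictly, and
  \<open>|\<Psi>|\<^sup>2 = 1\<close> at both ends.
\<close>

lemma norm_Psi_interior:
  assumes "0 < t" "t < T" shows "norm (Psi (t, \<theta>)) < 1"
proof -
  define g where "g t = a\<^sup>2 * (cosh (t - p))\<^sup>2" for t
  have "convex_on {0..T} g"
  proof (rule f''_ge0_imp_convex[where f' = "\<lambda>t. a\<^sup>2 * (2 * cosh (t - p) * sinh (t - p))"
        and f'' = "\<lambda>t. a\<^sup>2 * (2 * (sinh (t - p))\<^sup>2 + 2 * (cosh (t - p))\<^sup>2)"])
    show "(g has_real_derivative a\<^sup>2 * (2 * cosh (t - p) * sinh (t - p))) (at t)" for t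
      unfolding g_def by (auto intro!: derivative_eq_intros)
    show "((\<lambda>t. a\<^sup>2 * (2 * cosh (t - p) * sinh (t - p))) has_real_derivative
        a\<^sup>2 * (2 * (sinh (t - p))\<^sup>2 + 2 * (cosh (t - p))\<^sup>2)) (at t)" for t
      by (auto intro!: derivative_eq_intros simp: power2_eq_square algebra_simps)
  qed auto
  then have "g ((1 - t / T) *\<^sub>R 0 + (t / T) *\<^sub>R T) \<le> (1 - t / T) * g 0 + (t / T) * g T"
    by (rule convex_onD) (use assms in auto)
  then have g: "g t \<le> (1 - t / T) * g 0 + (t / T) * g T" using T by simp
  have quad: "b\<^sup>2 * (t - q)\<^sup>2 = (1 - t / T) * (b\<^sup>2 * q\<^sup>2) + (t / T) * (b\<^sup>2 * (T - q)\<^sup>2) - b\<^sup>2 * (t * (T - t))"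
    using T by (simp add: power2_eq_square field_simps)
  have e: "g 0 + b\<^sup>2 * q\<^sup>2 = 1" "g T + b\<^sup>2 * (T - q)\<^sup>2 = 1" using unit by (simp_all add: g_def)
  have "(norm (Psi (t, \<theta>)))\<^sup>2 \<le> (1 - t / T) * (g 0 + b\<^sup>2 * q\<^sup>2) + (t / T) * (g T + b\<^sup>2 * (T - q)\<^sup>2) - b\<^sup>2 * (t * (T - t))"
    using g unfolding norm_Psi fst_conv quad g_def[of t, symmetric] by (simp add: distrib_left)
  also have "\<dots> = 1 - b\<^sup>2 * (t * (T - t))" unfolding e by simp
  also have "\<dots> < 1\<^sup>2" using ab assms by simp
  finally show ?thesis by (rule power2_less_imp_less) simp
qed

lemma Psi_normal:
  "- Psi_t (0, \<theta>) = rho0 *\<^sub>R Psi (0, \<theta>)" "Psi_t (T, \<theta>) = rho1 *\<^sub>R Psi (T, \<theta>)"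
proof -
  have 1: "tanh p * cosh p = sinh p" "tanh (T - p) * cosh (T - p) = sinh (T - p)" by (simp_all add: tanh_def)
  have 2: "tanh p * (b * q) = b" "tanh (T - p) * (b * (T - q)) = b"
  proof -
    have "tanh p * (b * q) = b * (q * tanh p)" "tanh (T - p) * (b * (T - q)) = b * ((T - q) * tanh (T - p))"
      by (simp_all only: mult.commute mult.left_commute)
    then show "tanh p * (b * q) = b" "tanh (T - p) * (b * (T - q)) = b" by (simp_all only: q mult_1_right)
  qed
  have 3: "tanh p * (a * cosh p * z) = a * sinh p * z" "tanh (T - p) * (a * cosh (T - p) * z) = a * sinh (T - p) * z" for z
    using 1 by (metis mult.commute mult.left_commute)+
  show "- Psi_t (0, \<theta>) = rho0 *\<^sub>R Psi (0, \<theta>)" "Psi_t (T, \<theta>) = rho1 *\<^sub>R Psi (T, \<theta>)"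
    unfolding Psi_def Psi_t_def vec3_scale vec3_minus fst_conv snd_conv rho0_def rho1_def
      diff_0 mult_minus_right 2 by (simp_all add: 3)
qed

lemma in_bdry_cases:
  assumes "x \<in> annulus_bdry T"
  obtains \<theta> where "x = (0, \<theta>)" | \<theta> where "x = (T, \<theta>)"
  using assms by (cases x) (auto simp: annulus_bdry_def)

lemma in_bdry [simp]: "(0, \<theta>) \<in> annulus_bdry T" "(T, \<theta>) \<in> annulus_bdry T"
  by (auto simp: annulus_bdry_def)

lemma normal_deriv_Psi:
  "normal_deriv T w Psi (0, \<theta>) = (rho0 / sqrt (w (0, \<theta>))) *\<^sub>R Psi (0, \<theta>)"
  "normal_deriv T w Psi (T, \<theta>) = (rho1 / sqrt (w (T, \<theta>))) *\<^sub>R Psi (T, \<theta>)"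
  using d_Psi(1)[OF subsetD[OF bdry_subset in_bdry(1)]] d_Psi(1)[OF subsetD[OF bdry_subset in_bdry(2)]] T
  by (simp_all add: normal_deriv_def Psi_normal divide_inverse mult.commute)

lemma norm_normal_deriv_Psi:
  assumes "\<And>x. x \<in> annulus_bdry T \<Longrightarrow> w x > 0"
  shows "norm (normal_deriv T w Psi (0, \<theta>)) = rho0 / sqrt (w (0, \<theta>))"
    "norm (normal_deriv T w Psi (T, \<theta>)) = rho1 / sqrt (w (T, \<theta>))"
  using norm_Psi_boundary[OF in_bdry(1)] norm_Psi_boundary[OF in_bdry(2)] rho_pos assms[OF in_bdry(1)] assms[OF in_bdry(2)]
  by (simp_all add: normal_deriv_Psi less_imp_le)

lemma free_boundary: "free_boundary_harmonic T flat Psi"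
proof -
  have "Psi x \<in> cball 0 1 \<and> (Psi x \<in> sphere 0 1 \<longleftrightarrow> x \<in> annulus_bdry T)" if x: "x \<in> annulus T" for x
  proof (cases "x \<in> annulus_bdry T")
    case True
    then show ?thesis using norm_Psi_boundary by simp
  next
    case False
    obtain t \<theta> where xt: "x = (t, \<theta>)" by (cases x)
    then have "0 < t" "t < T" using x False by (auto simp: annulus_def annulus_bdry_def)
    then show ?thesis using norm_Psi_interior[of t \<theta>] False xt by simp
  qed
  moreover have "normal_deriv T flat Psi x = norm (normal_deriv T flat Psi x) *\<^sub>R Psi x" if "x \<in> annulus_bdry T" for x
    using that by (rule in_bdry_cases)
      (use rho_pos in \<open>simp_all add: norm_Psi_boundary normal_deriv_Psi flat_def\<close>)
  ultimately show ?thesis unfolding free_boundary_harmonic_def using harmonic_Psi by blast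
qed

lemma nondegenerate_Psi: "nondegenerate T Psi"
proof -
  have "Psi_t x \<noteq> 0" for x using ab by (auto simp: Psi_t_def vec_eq_iff forall_3)
  then show ?thesis unfolding nondegenerate_def using d_Psi by simp
qed

lemma rot_symmetric_Psi: "rot_symmetric_map T Psi"
proof -
  have e: "axis 3 1 = vec3 0 0 1" by (simp add: vec3_def)
  have cr: "cross3 (vec3 0 0 1) (vec3 x y z) = vec3 (- y) x 0" for x y z
    by (rule vec3_eqI) (simp_all add: cross3_def)
  have "Psi (t, \<theta> + \<phi>) = rotation_about (axis 3 1) \<phi> (Psi (t, \<theta>))" for t \<theta> \<phi>
    unfolding rotation_about_def e Psi_def fst_conv snd_conv cr vec3_inner vec3_scale vec3_add
    by (rule vec3_eqI) (simp_all add: cos_add sin_add algebra_simps)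
  then show ?thesis unfolding rot_symmetric_map_def by (intro exI[of _ "axis 3 1"]) (auto simp: norm_axis_1)
qed

abbreviation "g \<equiv> induced_metric T flat Psi"
abbreviation "\<rho> \<equiv> induced_density T flat Psi"

text \<open>The conformal factor of the induced metric as a function of \<open>t\<close>.\<close>

definition factor :: "real \<Rightarrow> real" where
  "factor t = (a\<^sup>2 * (sinh (t - p))\<^sup>2 + b\<^sup>2 + a\<^sup>2 * (cosh (t - p))\<^sup>2) / 2"

lemma factor_pos: "factor t > 0"
proof -
  have "a\<^sup>2 * (sinh (t - p))\<^sup>2 \<ge> 0" "b\<^sup>2 > 0" "a\<^sup>2 * (cosh (t - p))\<^sup>2 \<ge> 0" using ab by simp_all
  then have "a\<^sup>2 * (sinh (t - p))\<^sup>2 + b\<^sup>2 + a\<^sup>2 * (cosh (t - p))\<^sup>2 > 0" by linarith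
  then show ?thesis by (simp add: factor_def)
qed

lemma g_eq: assumes "x \<in> annulus T" shows "g x = factor (fst x)"
  by (simp add: induced_metric_def differential_sq_def flat_def d_Psi[OF assms] norm_Psi_t norm_Psi_\<theta> factor_def)

lemma g_pos: "x \<in> annulus T \<Longrightarrow> g x > 0" by (simp add: g_eq factor_pos)

lemma rho_eq: "\<rho> (0, \<theta>) = rho0 / sqrt (factor 0)" "\<rho> (T, \<theta>) = rho1 / sqrt (factor T)"
  using norm_normal_deriv_Psi[of g \<theta>] g_pos bdry_subset g_eq[of "(0, \<theta>)"] g_eq[of "(T, \<theta>)"] T
  by (auto simp: induced_density_def annulus_def)

text \<open>
  In the Steklov problem the density enters only through its product with the length element, and
  for the induced pair this product is again the flat normal derivative.
\<close>

lemma weight_eq: "\<rho> (0, \<theta>) * sqrt (g (0, \<theta>)) = rho0" "\<rho> (T, \<theta>) * sqrt (g (T, \<theta>)) = rho1"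
  using g_eq[of "(0, \<theta>)"] g_eq[of "(T, \<theta>)"] T factor_pos[of 0] factor_pos[of T]
  by (simp_all add: rho_eq annulus_def)

lemma conformal_metric_g: "conformal_metric T g"
proof -
  have "smooth_on (annulus T) (\<lambda>x. factor (fst x))"
    unfolding factor_def power2_eq_square divide_inverse by (intro smooth_intros)
  then have "smooth_on (annulus T) g" by (rule smooth_on_cong) (simp add: g_eq)
  moreover have "g (t, \<theta> + 2 * pi) = g (t, \<theta>)" if "(t, \<theta>) \<in> annulus T" for t \<theta>
    using that g_eq[of "(t, \<theta>)"] g_eq[of "(t, \<theta> + 2 * pi)"] by (simp add: annulus_def)
  ultimately show ?thesis unfolding conformal_metric_def smooth_annulus_fun_def using g_pos by auto
qed

lemma bdry_density_rho: "bdry_density T \<rho>"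
proof -
  have "(\<lambda>\<theta>. \<rho> (0, \<theta>)) = (\<lambda>_. rho0 / sqrt (factor 0))" "(\<lambda>\<theta>. \<rho> (T, \<theta>)) = (\<lambda>_. rho1 / sqrt (factor T))"
    by (simp_all add: rho_eq)
  moreover have "\<rho> x > 0" if "x \<in> annulus_bdry T" for x
    using that by (rule in_bdry_cases) (simp_all add: rho_eq factor_pos rho_pos)
  ultimately show ?thesis unfolding bdry_density_def smooth_bdry_fun_def
    by (auto simp: smooth_on_const annulus_bdry_def rho_eq)
qed

lemma rot_symmetric_pair_Psi: "rot_symmetric_pair T g \<rho>"
  unfolding rot_symmetric_pair_def
proof (intro conjI ballI allI, clarify)
  fix t \<theta> \<phi> assume "(t, \<theta>) \<in> annulus T"
  then show "g (t, \<theta> + \<phi>) = g (t, \<theta>)"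
    using g_eq[of "(t, \<theta>)"] g_eq[of "(t, \<theta> + \<phi>)"] by (simp add: annulus_def)
next
  fix x assume "x \<in> annulus_bdry T"
  then show "case x of (t, \<theta>) \<Rightarrow> \<forall>\<phi>. \<rho> (t, \<theta> + \<phi>) = \<rho> (t, \<theta>)"
    by (rule in_bdry_cases) (simp_all add: rho_eq)
qed

text \<open>
  The energy density \<open>|\<nabla>\<Psi>|\<^sup>2\<close> is the \<open>t\<close>-derivative of \<open>a\<^sup>2 sinh (t - p) cosh (t - p) + b\<^sup>2 t\<close>; by
  the boundary conditions the difference of its values at the two ends is
  \<open>rho0 |\<Psi>|\<^sup>2 + rho1 |\<Psi>|\<^sup>2\<close>.
\<close>

lemma energy_Psi: "2 * energy T flat Psi = 2 * pi * (rho0 + rho1)"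
proof -
  have box: "{0..T} \<times> {0..2*pi} = cbox (0, 0) (T, 2 * pi)" by (simp add: cbox_Pair_eq)
  let ?f = "\<lambda>x :: real \<times> real. 2 * factor (fst x)"
  have "2 * energy T flat Psi = integral ({0..T} \<times> {0..2*pi}) (\<lambda>x. differential_sq T flat Psi x * flat x)"
    by (simp add: energy_def)
  also have "\<dots> = integral ({0..T} \<times> {0..2*pi}) ?f"
  proof (rule integral_cong)
    fix x assume "x \<in> {0..T} \<times> {0..2*pi}"
    then have "x \<in> annulus T" by (auto simp: annulus_def)
    from g_eq[OF this] show "differential_sq T flat Psi x * flat x = ?f x"
      by (simp add: induced_metric_def flat_def)
  qed
  also have "\<dots> = integral (cbox 0 T) (\<lambda>t. integral (cbox 0 (2*pi)) (\<lambda>\<theta>. ?f (t, \<theta>)))"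
    unfolding box by (rule integral_prod_continuous) (auto simp: factor_def intro!: continuous_intros)
  also have "\<dots> = 2 * pi * integral {0..T} (\<lambda>t. 2 * factor t)"
    by (simp add: mult.commute mult.left_commute)
  also have "integral {0..T} (\<lambda>t. 2 * factor t) = rho0 + rho1"
  proof -
    let ?F = "\<lambda>t. a\<^sup>2 * (sinh (t - p) * cosh (t - p)) + b\<^sup>2 * t"
    have "((\<lambda>t. 2 * factor t) has_integral (?F T - ?F 0)) {0..T}"
    proof (rule has_real_derivative_integral)
      show "(?F has_real_derivative 2 * factor t) (at t within {0..T})" for t
        unfolding factor_def by (auto intro!: derivative_eq_intros simp: power2_eq_square algebra_simps)
    qed (use T in simp)
    moreover have "?F T - ?F 0 = rho0 + rho1"
    proof -
      have 1: "sinh p * cosh p = rho0 * (cosh p)\<^sup>2" "sinh (T - p) * cosh (T - p) = rho1 * (cosh (T - p))\<^sup>2"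
        by (simp_all add: rho0_def rho1_def tanh_def power2_eq_square)
      have 2: "q = rho0 * q\<^sup>2" "T - q = rho1 * (T - q)\<^sup>2"
      proof -
        have "rho0 * q\<^sup>2 = q * (q * tanh p)" "rho1 * (T - q)\<^sup>2 = (T - q) * ((T - q) * tanh (T - p))"
          by (simp_all only: rho0_def rho1_def power2_eq_square mult.commute mult.left_commute)
        then show "q = rho0 * q\<^sup>2" "T - q = rho1 * (T - q)\<^sup>2" by (simp_all only: q mult_1_right)
      qed
      have 3: "b\<^sup>2 * q = rho0 * (b\<^sup>2 * q\<^sup>2)" "b\<^sup>2 * (T - q) = rho1 * (b\<^sup>2 * (T - q)\<^sup>2)"
        by (subst 2(1), simp only: mult.left_commute) (subst 2(2), simp only: mult.left_commute)
      have "?F T - ?F 0 = a\<^sup>2 * (sinh (T - p) * cosh (T - p)) + a\<^sup>2 * (sinh p * cosh p) + b\<^sup>2 * (T - q) + b\<^sup>2 * q"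
        by (simp add: algebra_simps)
      also have "\<dots> = rho1 * (a\<^sup>2 * (cosh (T - p))\<^sup>2 + b\<^sup>2 * (T - q)\<^sup>2) + rho0 * (a\<^sup>2 * (cosh p)\<^sup>2 + b\<^sup>2 * q\<^sup>2)"
        unfolding 1 3 by (simp only: distrib_left mult.left_commute add.assoc add.commute add.left_commute)
      also have "\<dots> = rho0 + rho1" unfolding unit by simp
      finally show ?thesis .
    qed
    ultimately have "((\<lambda>t. 2 * factor t) has_integral (rho0 + rho1)) {0..T}" by simp
    then show ?thesis by (rule integral_unique)
  qed
  finally show ?thesis .
qed

lemma bdry_integral_Psi: "bdry_integral T g \<rho> = 2 * pi * (rho0 + rho1)"
  using T by (simp add: bdry_integral_def weight_eq distrib_left)

end

section \<open>Position of the neck\<close>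

lemma coth_tanh: "coth t = 1 / tanh t" by (simp add: coth_def tanh_def)

text \<open>Monotonicity of \<open>t sinh t - cosh t\<close> gives uniqueness for \<open>t = coth t\<close>, of which it is a form without denominators.\<close>

lemma coth_equation_strict_mono: "(\<lambda>t. t * sinh t - cosh t) t < (\<lambda>t::real. t * sinh t - cosh t) s" if "0 \<le> t" "t < s"
proof (rule DERIV_pos_imp_increasing_open[OF that(2)])
  fix x assume "t < x" "x < s"
  moreover have "((\<lambda>t. t * sinh t - cosh t) has_real_derivative x * cosh x) (at x)"
    by (auto intro!: derivative_eq_intros)
  ultimately show "\<exists>y. ((\<lambda>t. t * sinh t - cosh t) has_real_derivative y) (at x) \<and> 0 < y"
    using that(1) by (intro exI[of _ "x * cosh x"]) simp
qed (auto intro!: continuous_intros)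

lemma coth_equation_iff: "t > 0 \<Longrightarrow> t = coth t \<longleftrightarrow> t * sinh t - cosh t = 0" for t :: real
  by (simp add: coth_def field_simps)

text \<open>These two bounds locate \<open>t\<^sub>1\<close> between \<open>1.15\<close> and \<open>1.25\<close>.\<close>

lemma exp_bounds: "exp (5/2 :: real) > 9" "exp (23/10 :: real) < 14"
proof -
  have e1: "exp (1 :: real) \<ge> 5/2" using exp_lower_Taylor_quadratic[of 1] by simp
  have "exp (5/2 :: real) = exp 1 * exp 1 * exp (1/2)" by (simp add: exp_add[symmetric])
  moreover have "exp (1/2 :: real) \<ge> 13/8" using exp_lower_Taylor_quadratic[of "1/2"] by (simp add: power2_eq_square)
  moreover have "(5/2) * (5/2) * (13/8) \<le> exp 1 * exp 1 * exp (1/2 :: real)"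
    using e1 calculation(2) by (intro mult_mono) auto
  ultimately show "exp (5/2 :: real) > 9" by simp
  have "exp (1/2 :: real) < 17/10"
  proof -
    have "(exp (1/2 :: real))\<^sup>2 = exp 1" by (simp add: exp_double[symmetric])
    also have "\<dots> < 272/100" using e_less_272 by simp
    also have "\<dots> < (17/10)\<^sup>2" by (simp add: power2_eq_square)
    finally show ?thesis by (rule power2_less_imp_less) simp
  qed
  then have "exp 1 * exp 1 * exp (1/2 :: real) \<le> (272/100) * (272/100) * (17/10)"
    using e_less_272 by (intro mult_mono) auto
  moreover have "exp (23/10 :: real) \<le> exp 1 * exp 1 * exp (1/2)" by (simp add: exp_add[symmetric])
  ultimately show "exp (23/10 :: real) < 14" by simp
qed

text \<open>The signs of \<open>t sinh t - cosh t\<close> at \<open>23/20\<close> and \<open>5/4\<close> bracket the root.\<close>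

lemma t1_bounds:
  shows ex1_coth_fixpoint: "\<exists>!t. t > 0 \<and> t = coth t" and t1_pos: "t1 > 0" and t1_fix: "t1 = coth t1"
    and t1_approx: "\<bar>t1 - 1.2\<bar> < 0.05"
    and t1_zero: "t1 * sinh t1 - cosh t1 = 0" and t1_gt: "t1 > 23/20"
proof -
  let ?f = "\<lambda>t :: real. t * sinh t - cosh t"
  have lo: "?f (23/20) < 0"
  proof -
    let ?E = "exp (23/20 :: real)"
    have "?E * ?E < 14" using exp_bounds(2) by (simp add: exp_add[symmetric])
    then have "?E < 14 * exp (- (23/20))" by (simp add: exp_minus field_simps)
    then have "3 * ?E < 43 * exp (- (23/20))" using exp_gt_zero[of "-(23/20)::real"] by linarith
    then show ?thesis by (simp add: sinh_def cosh_def field_simps)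
  qed
  have hi: "?f (5/4) > 0"
  proof -
    let ?E = "exp (5/4 :: real)"
    have "?E * ?E > 9" using exp_bounds(1) by (simp add: exp_add[symmetric])
    then have "?E > 9 * exp (- (5/4))" by (simp add: exp_minus field_simps)
    then show ?thesis by (simp add: sinh_def cosh_def field_simps)
  qed
  have "\<exists>t\<ge>23/20. t \<le> 5/4 \<and> ?f t = 0"
    using lo hi by (intro IVT') (auto intro!: continuous_intros)
  then obtain t where t: "23/20 \<le> t" "t \<le> 5/4" "?f t = 0" by blast
  have "t \<noteq> 23/20"
  proof
    assume h: "t = 23/20"
    show False using t(3)[unfolded h] lo by linarith
  qed
  moreover have "t \<noteq> 5/4"
  proof
    assume h: "t = 5/4"
    show False using t(3)[unfolded h] hi by linarith
  qed
  ultimately have range: "23/20 < t" "t < 5/4" using t by auto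
  have uniq: "s = t" if "s > 0" "?f s = 0" for s
    using coth_equation_strict_mono[of s t] coth_equation_strict_mono[of t s] that t by (cases s t rule: linorder_cases) auto
  show ex1: "\<exists>!t. t > 0 \<and> t = coth t"
    using t uniq coth_equation_iff by (intro ex1I[of _ t]) auto
  have t1: "t1 > 0 \<and> t1 = coth t1" unfolding t1_def by (rule theI'[OF ex1])
  then show "t1 > 0" "t1 = coth t1" by auto
  then show z: "?f t1 = 0" using coth_equation_iff by blast
  have "t1 = t" using uniq t1 z by blast
  then have r: "23/20 < t1" "t1 < 5/4" using range by simp_all
  then show "t1 > 23/20" by simp
  have "\<bar>t1 - 12/10\<bar> < 5/100" using r by linarith
  then show "\<bar>t1 - 1.2\<bar> < 0.05" by simp
qed

lemma t1_tanh: "t1 * tanh t1 = 1"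
  using t1_zero t1_pos by (simp add: tanh_def field_simps)

lemma tanh_less_self: "tanh x < x" if "x > 0" for x :: real
proof -
  have "(\<lambda>x. x - tanh x) 0 < (\<lambda>x::real. x - tanh x) x"
  proof (rule DERIV_pos_imp_increasing_open[OF that])
    fix y :: real assume "0 < y"
    have "((\<lambda>x. x - tanh x) has_real_derivative (tanh y)\<^sup>2) (at y)"
      by (auto intro!: derivative_eq_intros)
    then show "\<exists>d. ((\<lambda>x. x - tanh x) has_real_derivative d) (at y) \<and> 0 < d"
      using \<open>0 < y\<close> by (intro exI[of _ "(tanh y)\<^sup>2"]) simp
  qed (auto intro!: continuous_intros)
  then show ?thesis by simp
qed

text \<open>
  Intermediate value theorem on \<open>[1/T, T/2]\<close>. At \<open>T/2\<close> the left hand side is \<open>2 coth (T/2)\<close>, which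
  is at most \<open>T\<close> exactly because \<open>T/2 \<ge> t\<^sub>1\<close>; at \<open>1/T\<close> it exceeds \<open>T\<close> because \<open>tanh x < x\<close>.
\<close>

lemma ex_neck_parameter:
  assumes "T \<ge> T1"
  obtains p where "0 < p" "p \<le> T / 2" "1 / tanh p + 1 / tanh (T - p) = T"
proof -
  define k where "k s = 1 / tanh s + 1 / tanh (T - s) - T" for s
  have t1: "t1 > 0" "t1 \<ge> 23/20" using t1_pos t1_gt by auto
  have T: "T \<ge> 23/10" "T / 2 \<ge> t1" using assms t1 by (auto simp: T1_def)
  have T2: "T > 0" using T by simp
  have "k (T / 2) \<le> 0"
  proof -
    have "t1 * tanh t1 \<le> (T / 2) * tanh (T / 2)" using T t1 by (intro mult_mono) auto
    then have "1 \<le> (T / 2) * tanh (T / 2)" unfolding t1_tanh .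
    then have "1 / tanh (T / 2) \<le> T / 2" using T2 by (simp add: pos_divide_le_eq)
    moreover have "T - T / 2 = T / 2" by simp
    ultimately show ?thesis unfolding k_def by simp
  qed
  moreover have "k (1 / T) \<ge> 0"
  proof -
    have "(23/10) * (23/10) \<le> T * T" using T by (intro mult_mono) auto
    then have "1 / T < T" using T2 by (simp add: divide_less_eq)
    then have "tanh (T - 1 / T) > 0" by simp
    have "tanh (1 / T) < 1 / T" "tanh (1 / T) > 0" using tanh_less_self[of "1 / T"] T2 by simp_all
    then have "T < 1 / tanh (1 / T)" using T2 by (simp add: field_simps)
    moreover have "0 < 1 / tanh (T - 1 / T)" using \<open>tanh (T - 1 / T) > 0\<close> by simp
    ultimately show ?thesis unfolding k_def by linarith
  qed
  moreover have le: "1 / T \<le> T / 2"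
  proof -
    have "(23/10) * (23/10) \<le> T * T" using T by (intro mult_mono) auto
    then show ?thesis using T2 by (simp add: field_simps)
  qed
  moreover have "continuous_on {1 / T..T / 2} k"
  proof -
    have "tanh x \<noteq> 0 \<and> tanh (T - x) \<noteq> 0" if "x \<in> {1 / T..T / 2}" for x
    proof -
      have "1 / T > 0" using T2 by simp
      then have "x > 0" "T - x > 0" using that T2 by (simp_all, linarith)
      then show ?thesis by simp
    qed
    then show ?thesis unfolding k_def by (intro continuous_intros) (auto simp: cosh_real_nonzero)
  qed
  ultimately have "\<exists>x\<ge>1 / T. x \<le> T / 2 \<and> k x = 0"
    by (intro IVT2') auto
  then obtain p where "1 / T \<le> p" "p \<le> T / 2" "k p = 0" by blast
  moreover have "1 / T > 0" using T2 by simp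
  ultimately have "0 < p" "p \<le> T / 2" "1 / tanh p + 1 / tanh (T - p) = T" unfolding k_def by linarith+
  then show thesis by (rule that)
qed

text \<open>
  Admissible parameters for given \<open>T\<close>. At \<open>T = T1\<close> the two conditions on \<open>a\<close> and \<open>b\<close> coincide and
  leave one degree of freedom; the last conjunct selects the catenoid there.
\<close>

definition neck :: "real \<Rightarrow> real \<Rightarrow> real \<Rightarrow> real \<Rightarrow> bool" where
  "neck T p a b \<longleftrightarrow> 0 < p \<and> p \<le> T / 2 \<and> 1 / tanh p + 1 / tanh (T - p) = T \<and> a > 0 \<and> b > 0 \<and>
    a\<^sup>2 * (cosh p)\<^sup>2 + b\<^sup>2 * (1 / tanh p)\<^sup>2 = 1 \<and> a\<^sup>2 * (cosh (T - p))\<^sup>2 + b\<^sup>2 * (1 / tanh (T - p))\<^sup>2 = 1 \<and>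
    (T = T1 \<longrightarrow> p = t1 \<and> a = b)"

text \<open>
  For \<open>T > T1\<close> the neck is not in the middle, since \<open>p = T/2\<close> would give \<open>coth p = p\<close>. The
  conditions on \<open>a\<^sup>2\<close> and \<open>b\<^sup>2\<close> then form a nondegenerate linear system. Its solution by Cramer's
  rule is positive because \<open>cosh\<close> increases and \<open>coth\<close> decreases.
\<close>

lemma ex_neck:
  assumes "T \<ge> T1"
  obtains p a b where "neck T p a b"
proof (cases "T = T1")
  case True
  define a where "a = 1 / sqrt ((cosh t1)\<^sup>2 + (1 / tanh t1)\<^sup>2)"
  have s: "(cosh t1)\<^sup>2 + (1 / tanh t1)\<^sup>2 > 0" by (intro add_pos_nonneg) auto
  have a: "a > 0" using s by (simp add: a_def)
  have a2: "a\<^sup>2 = 1 / ((cosh t1)\<^sup>2 + (1 / tanh t1)\<^sup>2)" using s by (simp add: a_def power_divide)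
  have u: "a\<^sup>2 * (cosh t1)\<^sup>2 + a\<^sup>2 * (1 / tanh t1)\<^sup>2 = 1"
    unfolding distrib_left[symmetric] a2 using s by simp
  have h: "T1 - t1 = t1" "T1 / 2 = t1" by (simp_all add: T1_def)
  have c: "1 / tanh t1 = t1" using t1_tanh t1_pos by (simp add: field_simps)
  have "neck T t1 a a"
    unfolding neck_def True h using a u t1_pos c h by (auto simp: T1_def)
  then show thesis by (rule that)
next
  case False
  obtain p where p: "0 < p" "p \<le> T / 2" "1 / tanh p + 1 / tanh (T - p) = T"
    using ex_neck_parameter[OF assms] by blast
  define r where "r = T - p"
  have pT: "p \<noteq> T / 2"
  proof
    assume h: "p = T / 2"
    then have tp: "T - p = p" by simp
    have "1 / tanh p + 1 / tanh p = 2 * p" using p(3)[unfolded tp] h by linarith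
    then have "1 / tanh p = p" by linarith
    then have "p = coth p" by (simp add: coth_tanh)
    then have "p = t1" using ex1_coth_fixpoint t1_pos t1_fix p(1) by blast
    then show False using False h by (simp add: T1_def)
  qed
  then have pr: "p < r" using p by (simp add: r_def)
  define A where "A = (cosh r)\<^sup>2 - (cosh p)\<^sup>2"
  define C where "C = (1 / tanh p)\<^sup>2 - (1 / tanh r)\<^sup>2"
  have A: "A > 0" using pr p(1) unfolding A_def by (simp add: power_strict_mono cosh_real_nonneg_less_iff)
  have tr: "0 < tanh p" "tanh p < tanh r" using p(1) pr by simp_all
  have C: "C > 0"
  proof -
    have "1 / tanh r < 1 / tanh p" using tr by (simp add: field_simps)
    then have "(1 / tanh r)\<^sup>2 < (1 / tanh p)\<^sup>2" using tr by (intro power_strict_mono) auto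
    then show ?thesis by (simp add: C_def)
  qed
  define N where "N = C * (cosh p)\<^sup>2 + A * (1 / tanh p)\<^sup>2"
  have N: "N > 0" unfolding N_def using A C by (intro add_pos_nonneg mult_pos_pos mult_nonneg_nonneg) auto
  have N': "N = C * (cosh r)\<^sup>2 + A * (1 / tanh r)\<^sup>2" unfolding N_def A_def C_def by (simp add: algebra_simps)
  define a where "a = sqrt (C / N)"
  define b where "b = sqrt (A / N)"
  have ab: "a > 0" "b > 0" "a\<^sup>2 = C / N" "b\<^sup>2 = A / N" using A C N by (simp_all add: a_def b_def)
  have 1: "a\<^sup>2 * (cosh p)\<^sup>2 + b\<^sup>2 * (1 / tanh p)\<^sup>2 = 1"
    unfolding ab(3,4) times_divide_eq_left add_divide_distrib[symmetric] N_def[symmetric] using N by simp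
  have 2: "a\<^sup>2 * (cosh r)\<^sup>2 + b\<^sup>2 * (1 / tanh r)\<^sup>2 = 1"
    unfolding ab(3,4) times_divide_eq_left add_divide_distrib[symmetric] N'[symmetric] using N by simp
  have "neck T p a b" unfolding neck_def r_def[symmetric] using p ab(1,2) 1 2 N False by (simp add: r_def)
  then show thesis by (rule that)
qed

lemma one_minus_tanh: "1 - tanh r = 2 / (exp (2 * r) + 1)" for r :: real
proof -
  have "1 - (1 - 1 / y) / (1 + 1 / y) = 2 / (y + 1)" if "y > 0" for y :: real
  proof -
    have "1 - 1 / y = (y - 1) / y" "1 + 1 / y = (y + 1) / y" using that by (simp_all add: field_simps)
    then have "(1 - 1 / y) / (1 + 1 / y) = (y - 1) / (y + 1)" using that by simp
    then show ?thesis using that by (simp add: field_simps)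
  qed
  from this[of "exp (2 * r)"] show ?thesis
    by (simp add: tanh_real_altdef exp_minus inverse_eq_divide)
qed

text \<open>
  With \<open>r = T - p \<ge> p\<close>, the neck equation gives \<open>coth p = p + r - coth r < 2 r - 1\<close>. This makes
  \<open>tanh p\<close> larger than \<open>1 / (2 r - 1)\<close>, which beats the exponentially small number \<open>1 - tanh r\<close>.
\<close>

lemma neck_sum_gt_1:
  assumes "neck T p a b" "T \<ge> T1"
  shows "tanh p + tanh (T - p) > 1"
proof -
  define r where "r = T - p"
  have p: "0 < p" "p \<le> r" "1 / tanh p + 1 / tanh r = p + r" using assms(1) by (auto simp: neck_def r_def)
  have "2 * r \<ge> T" using p(2) by (simp add: r_def)
  then have r: "r > 1" using assms(2) t1_gt unfolding T1_def by linarith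
  have th: "0 < tanh p" "0 < tanh r" "tanh r < 1" using p(1,2) by (simp_all add: tanh_real_lt_1)
  have "1 < 1 / tanh r" using th by (simp add: field_simps)
  then have "1 / tanh p < 2 * r - 1" using p by linarith
  then have a: "1 / (2 * r - 1) < tanh p" using th r by (simp add: field_simps)
  have "1 - tanh r = 2 / (exp (2 * r) + 1)"
    by (rule one_minus_tanh)
  also have "\<dots> < 1 / (2 * r - 1)"
  proof -
    have "1 + 2 * r + 2 * (r * r) \<le> exp (2 * r)"
      using exp_lower_Taylor_quadratic[of "2 * r"] r by (simp add: power2_eq_square)
    moreover have "0 \<le> (r - 1) * (r - 1)" by simp
    then have "2 * r \<le> r * r + 1" by (simp add: algebra_simps)
    ultimately have "6 * r - 1 \<le> exp (2 * r)" by argo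
    then have "2 * (2 * r - 1) < exp (2 * r) + 1" using r by argo
    then show ?thesis using r by (simp add: field_simps add_pos_pos)
  qed
  finally show ?thesis using a by (simp add: r_def)
qed

text \<open>
  Once \<open>coth (T - p) \<le> 2\<close>, the neck equation confines \<open>coth p\<close> to \<open>[T - 2, T]\<close>. The comparison of
  \<open>tanh / cosh\<close> at the two ends, which will separate the two boundary densities, is one of order
  \<open>1/T\<close> against an exponentially small quantity; the threshold \<open>24\<close> is chosen for simple
  constants.
\<close>

lemma neck_large:
  assumes "neck T p a b" "T \<ge> 24"
  shows "tanh p \<le> 1 / (T - 2)" "tanh p \<ge> 1 / T" "tanh (T - p) \<ge> 1 - 2 * exp (- T)"
    "tanh (T - p) / cosh (T - p) < tanh p / cosh p" "tanh (T - p) < 1"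
proof -
  define r where "r = T - p"
  have p: "0 < p" "p \<le> T / 2" "1 / tanh p + 1 / tanh r = T" using assms(1) by (auto simp: neck_def r_def)
  have r: "r \<ge> T / 2" using p by (simp add: r_def)
  show "tanh (T - p) < 1" by (rule tanh_real_lt_1)
  have E: "1 - tanh r = 2 / (exp (2 * r) + 1)"
    by (rule one_minus_tanh)
  have "2 / (exp (2 * r) + 1) \<le> 2 / exp T"
    using r by (intro divide_left_mono mult_pos_pos) (auto simp: add_increasing2 add_pos_pos)
  moreover have "2 / exp T = 2 * exp (- T)" by (simp add: exp_minus divide_inverse)
  ultimately have rl: "tanh r \<ge> 1 - 2 * exp (- T)" using E by linarith
  then show "tanh (T - p) \<ge> 1 - 2 * exp (- T)" by (simp add: r_def)
  have "exp T \<ge> 1 + T" by (rule exp_ge_add_one_self)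
  then have "4 \<le> exp T" using assms(2) by linarith
  then have "1 / exp T \<le> 1 / 4" by (intro frac_le) auto
  then have "2 * exp (- T) \<le> 1 / 2" by (simp add: exp_minus inverse_eq_divide)
  then have r2: "tanh r \<ge> 1 / 2" using rl by linarith
  then have r0: "tanh r > 0" by linarith
  then have r3: "1 / tanh r \<le> 2" "0 < 1 / tanh r" using r2 pos_divide_le_eq[OF r0, of 1 2] by simp_all
  have tp: "0 < tanh p" using p by simp
  have "T - 2 \<le> 1 / tanh p" "1 / tanh p \<le> T" using p(3) r3 by linarith+
  then show u: "tanh p \<le> 1 / (T - 2)" and l: "tanh p \<ge> 1 / T" using tp assms(2) by (simp_all add: field_simps)
  have "1 / (T - 2) \<le> 1 / 12" using assms(2) by (simp add: field_simps)
  then have "tanh p \<le> 1 / 12" using u by linarith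
  then have "(tanh p)\<^sup>2 \<le> (1 / 12)\<^sup>2" using tp by (intro power_mono) auto
  then have tp2: "(tanh p)\<^sup>2 \<le> 1 / 144" by (simp add: power_divide)
  have "cosh p \<le> 2"
  proof -
    have "(tanh p)\<^sup>2 * (cosh p)\<^sup>2 = (sinh p)\<^sup>2" by (simp add: tanh_def power_divide)
    then have c: "(cosh p)\<^sup>2 = 1 + (tanh p)\<^sup>2 * (cosh p)\<^sup>2" by (simp add: cosh_square_eq)
    have "(tanh p)\<^sup>2 * (cosh p)\<^sup>2 \<le> 1 / 144 * (cosh p)\<^sup>2" by (intro mult_right_mono tp2) simp
    then have "(cosh p)\<^sup>2 \<le> 4" using c by linarith
    then have "(cosh p)\<^sup>2 \<le> 2\<^sup>2" by simp
    then show ?thesis by (rule power2_le_imp_le) simp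
  qed
  then have "(1 / T) / 2 \<le> tanh p / cosh p" using l tp assms(2) by (intro frac_le) auto
  moreover have "tanh r / cosh r < (1 / T) / 2"
  proof -
    have "tanh r / cosh r \<le> 1 / cosh r" using tanh_real_lt_1[of r] by (intro divide_right_mono) auto
    also have "\<dots> \<le> 1 / (exp r / 2)" by (intro frac_le) (auto simp: cosh_def)
    also have "\<dots> < (1 / T) / 2"
    proof -
      \<comment> \<open>A cubic lower bound for \<open>exp (T / 2)\<close> suffices against \<open>4 T\<close>.\<close>
      have e: "exp (T / 6) \<ge> 1 + T / 6" by (rule exp_ge_add_one_self)
      have "(1 + T / 6) ^ 3 \<le> exp (T / 6) ^ 3" using e assms(2) by (intro power_mono) auto
      also have "\<dots> = exp (T / 2)" by (simp add: exp_of_nat_mult[symmetric])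
      also have "\<dots> \<le> exp r" using r by simp
      finally have 1: "(1 + T / 6) ^ 3 \<le> exp r" .
      have "4 * T < (1 + T / 6) ^ 3"
      proof -
        define x where "x = T / 6"
        have x: "x \<ge> 4" using assms(2) by (simp add: x_def)
        have "4 * 4 \<le> x * x" using x by (intro mult_mono) auto
        then have "28 * x \<le> (x * x + 3 * x) * x" using x by (intro mult_right_mono) auto
        moreover have "(1 + x) ^ 3 = 1 + 3 * x + (x * x + 3 * x) * x" by (simp add: power3_eq_cube algebra_simps)
        ultimately have "24 * x < (1 + x) ^ 3" using x by linarith
        then show ?thesis by (simp add: x_def)
      qed
      then have "4 * T < exp r" using 1 by linarith
      then show ?thesis using assms(2) by (simp add: field_simps)
    qed
    finally show ?thesis .
  qed
  ultimately show "tanh (T - p) / cosh (T - p) < tanh p / cosh p" unfolding r_def by linarith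
qed

section \<open>Upper bounds for the first Steklov eigenvalue\<close>

lemma boundary_weight_of_density:
  assumes T: "T > 0" and w: "conformal_metric T w" and r: "bdry_density T r"
  shows "boundary_weight T (\<lambda>\<theta>. r (0, \<theta>) * sqrt (w (0, \<theta>))) (\<lambda>\<theta>. r (T, \<theta>) * sqrt (w (T, \<theta>)))"
proof -
  have wt: "smooth_on UNIV (\<lambda>\<theta>. w (t, \<theta>))" "w (t, \<theta> + 2 * pi) = w (t, \<theta>)" "w (t, \<theta>) > 0" if "t \<in> {0..T}" for t \<theta>
    using w that smooth_on_slice[of "{0..T}" w t]
    by (auto simp: conformal_metric_def smooth_annulus_fun_def annulus_def)
  have rt: "smooth_on UNIV (\<lambda>\<theta>. r (t, \<theta>))" "r (t, \<theta> + 2 * pi) = r (t, \<theta>)" "r (t, \<theta>) > 0" if "t \<in> {0, T}" for t \<theta>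
    using r that by (auto simp: bdry_density_def smooth_bdry_fun_def annulus_bdry_def)
  have t: "0 \<in> {0..T}" "T \<in> {0..T}" "0 \<in> {0, T}" "T \<in> {0, T}" using T by auto
  show ?thesis
    by unfold_locales
       (use T wt(2,3)[OF t(1)] wt(2,3)[OF t(2)] rt(2,3)[OF t(3)] rt(2,3)[OF t(4)] in
         \<open>auto intro!: smooth_on_mult smooth_on_sqrt wt(1) rt(1) simp: less_imp_le\<close>)
qed

lemma steklov_eigenfunction_weight_iff:
  assumes T: "T > 0" and w: "\<And>x. x \<in> annulus_bdry T \<Longrightarrow> w x > 0"
  shows "steklov_eigenfunction T w r s u \<longleftrightarrow> harmonic T w u \<and>
    (\<forall>\<theta>. - d_t T u (0, \<theta>) = s * (r (0, \<theta>) * sqrt (w (0, \<theta>))) * u (0, \<theta>)) \<and>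
    (\<forall>\<theta>. d_t T u (T, \<theta>) = s * (r (T, \<theta>) * sqrt (w (T, \<theta>))) * u (T, \<theta>))"
proof -
  have *: "x /\<^sub>R sqrt y = s * c * d \<longleftrightarrow> x = s * (c * sqrt y) * d" if "y > 0" for x y c d :: real
    using that by (simp add: divide_inverse[symmetric] inverse_eq_divide field_simps)
  have w0: "w (0, \<theta>) > 0" "w (T, \<theta>) > 0" for \<theta> using w by (auto simp: annulus_bdry_def)
  have "(\<forall>x\<in>annulus_bdry T. normal_deriv T w u x = s * r x * u x) \<longleftrightarrow>
    (\<forall>\<theta>. normal_deriv T w u (0, \<theta>) = s * r (0, \<theta>) * u (0, \<theta>)) \<and> (\<forall>\<theta>. normal_deriv T w u (T, \<theta>) = s * r (T, \<theta>) * u (T, \<theta>))"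
    by (auto simp: annulus_bdry_def)
  moreover have "normal_deriv T w u (0, \<theta>) = (- d_t T u (0, \<theta>)) /\<^sub>R sqrt (w (0, \<theta>))"
    "normal_deriv T w u (T, \<theta>) = d_t T u (T, \<theta>) /\<^sub>R sqrt (w (T, \<theta>))" for \<theta>
    using T by (simp_all add: normal_deriv_def)
  ultimately show ?thesis unfolding steklov_eigenfunction_def by (simp only: *[OF w0(1)] *[OF w0(2)])
qed

lemma constant_steklov_eigenfunction:
  assumes T: "T > 0" and w: "\<And>x. x \<in> annulus_bdry T \<Longrightarrow> w x > 0"
  shows "steklov_eigenfunction T w r 0 (\<lambda>_. 1)"
proof -
  have "harmonic T w (\<lambda>_. 1 :: real)"
    by (rule harmonicI[OF T smooth_on_const, where ?u1.0 = "\<lambda>_. 0" and ?u2.0 = "\<lambda>_. 0" and ?u11.0 = "\<lambda>_. 0"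
         and ?u12.0 = "\<lambda>_. 0" and ?u21.0 = "\<lambda>_. 0" and ?u22.0 = "\<lambda>_. 0"]) auto
  moreover have "d_t T (\<lambda>_. 1 :: real) x = 0" if "x \<in> annulus T" for x
    by (rule d_t_d_theta_eq(1)[OF T that, where b = 0]) auto
  moreover have "(0, \<theta>) \<in> annulus T" "(T, \<theta>) \<in> annulus T" for \<theta> using T by (auto simp: annulus_def)
  ultimately show ?thesis by (simp add: steklov_eigenfunction_weight_iff[OF T w])
qed

text \<open>The set whose infimum is the first eigenvalue.\<close>

definition steklov_candidates :: "real \<Rightarrow> (real \<times> real \<Rightarrow> real) \<Rightarrow> (real \<times> real \<Rightarrow> real) \<Rightarrow> real set" where
  "steklov_candidates T w r = {s. \<exists>us. length us = 2 \<and> lin_indep_on (annulus T) us \<and>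
     (\<forall>u \<in> set us. \<exists>s' \<le> s. steklov_eigenfunction T w r s' u)}"

lemma steklov_1: "steklov 1 T w r = Inf (steklov_candidates T w r)"
  by (simp add: steklov_def steklov_candidates_def numeral_2_eq_2)

lemma lin_indep_one_nonconstant:
  assumes "\<nexists>c. \<forall>x\<in>A. u x = c" shows "lin_indep_on A [\<lambda>_. 1, u]"
  unfolding lin_indep_on_def
proof (intro allI impI)
  fix c :: "nat \<Rightarrow> real" and i
  assume z: "\<forall>x\<in>A. (\<Sum>i<length [\<lambda>_. 1, u]. c i * ([\<lambda>_. 1, u] ! i) x) = 0" and i: "i < length [\<lambda>_. 1, u]"
  have e: "c 0 + c 1 * u x = 0" if "x \<in> A" for x using z that by (auto simp: numeral_2_eq_2)
  have "c 1 = 0"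
  proof (rule ccontr)
    assume "c 1 \<noteq> 0"
    then have "u x = - c 0 / c 1" if "x \<in> A" for x using e[OF that] by (simp add: field_simps eq_neg_iff_add_eq_0)
    then show False using assms by blast
  qed
  moreover obtain x where "x \<in> A" using assms by blast
  ultimately have "c 0 = 0" using e by fastforce
  then show "c i = 0" using \<open>c 1 = 0\<close> i by (cases i) auto
qed

lemma lin_indep_nonzero:
  assumes "lin_indep_on A us" "i < length us" shows "\<exists>x\<in>A. (us ! i) x \<noteq> 0"
proof (rule ccontr)
  assume "\<not> ?thesis"
  then have "\<forall>x\<in>A. (\<Sum>j<length us. (if j = i then 1 else 0) * (us ! j) x) = 0"
    using assms(2) by (simp add: if_distrib[of "\<lambda>c. c * _"] sum.delta cong: if_cong)
  from assms(1)[unfolded lin_indep_on_def, THEN spec, THEN mp, OF this] assms(2)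
  have "(if i = i then 1 else 0 :: real) = 0" by blast
  then show False by simp
qed

lemma steklov_candidates_nonneg:
  assumes T: "T > 0" and w: "conformal_metric T w" and r: "bdry_density T r" and s: "s \<in> steklov_candidates T w r"
  shows "s \<ge> 0"
proof -
  note bw = boundary_weight_of_density[OF T w r]
  note bw_pos = boundary_weight.pos[OF bw] and bw_cont = boundary_weight.cont[OF bw]
  have wp: "w x > 0" if "x \<in> annulus T" for x using w that by (auto simp: conformal_metric_def)
  have wb: "w x > 0" if "x \<in> annulus_bdry T" for x using wp that T by (auto simp: annulus_def annulus_bdry_def)
  obtain us where us: "length us = 2" "lin_indep_on (annulus T) us" "\<forall>u \<in> set us. \<exists>s' \<le> s. steklov_eigenfunction T w r s' u"
    using s by (auto simp: steklov_candidates_def)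
  have "0 < length us" using us(1) by simp
  then obtain s' where s': "s' \<le> s" "steklov_eigenfunction T w r s' (us ! 0)" using us(3) nth_mem by blast
  have h: "harmonic T w (us ! 0)" using s'(2) by (simp add: steklov_eigenfunction_def)
  interpret harmonic_annulus T w "us ! 0" by unfold_locales (use T h wp in auto)
  have "s' \<ge> 0"
  proof (rule ccontr)
    assume "\<not> s' \<ge> 0"
    have "(us ! 0) x = 0" if "x \<in> annulus T" for x
    proof (rule negative_eigenvalue_trivial[of s' "\<lambda>\<theta>. r (0, \<theta>) * sqrt (w (0, \<theta>))" "\<lambda>\<theta>. r (T, \<theta>) * sqrt (w (T, \<theta>))" x])
      fix \<theta>
      note iff = steklov_eigenfunction_weight_iff[of T w r s' "us ! 0"]
      show "- d_t T (us ! 0) (0, \<theta>) = s' * (r (0, \<theta>) * sqrt (w (0, \<theta>))) * (us ! 0) (0, \<theta>)"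
        using iff T wb s'(2) by blast
      show "d_t T (us ! 0) (T, \<theta>) = s' * (r (T, \<theta>) * sqrt (w (T, \<theta>))) * (us ! 0) (T, \<theta>)"
        using iff T wb s'(2) by blast
    qed (use \<open>\<not> s' \<ge> 0\<close> that bw_pos bw_cont in auto)
    then show False using lin_indep_nonzero[OF us(2) \<open>0 < length us\<close>] by blast
  qed
  then show ?thesis using s' by simp
qed

text \<open>
  The eigenvalue of \<open>ex_steklov_solution\<close>, whose eigenfunction is independent of the constants,
  belongs to the set of which \<open>\<sigma>\<^sub>1\<close> is the infimum. It is therefore at least \<open>\<sigma>\<^sub>1\<close>, and it lies
  below the Rayleigh quotients in question.
\<close>

theorem steklov_1_le_rayleigh:
  assumes T: "T > 0" and w: "conformal_metric T w" and r: "bdry_density T r"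
  defines "b0 \<equiv> \<lambda>\<theta>. r (0, \<theta>) * sqrt (w (0, \<theta>))" and "b1 \<equiv> \<lambda>\<theta>. r (T, \<theta>) * sqrt (w (T, \<theta>))"
  assumes d: "\<And>j. j \<ge> N \<Longrightarrow> d j = 0"
    and mean: "integral {0..2 * pi} (\<lambda>\<theta>. b0 \<theta> * trace0 N d \<theta> + b1 \<theta> * trace1 N d \<theta>) = 0"
  shows "steklov 1 T w r * integral {0..2 * pi} (\<lambda>\<theta>. b0 \<theta> * (trace0 N d \<theta>)\<^sup>2 + b1 \<theta> * (trace1 N d \<theta>)\<^sup>2)
    \<le> (\<Sum>j<N. dtn T j * mode_mass j * (d j)\<^sup>2)"
proof -
  interpret boundary_weight T b0 b1 unfolding b0_def b1_def by (rule boundary_weight_of_density[OF T w r])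
  have wp: "w x > 0" if "x \<in> annulus T" for x using w that by (auto simp: conformal_metric_def)
  have wb: "w x > 0" if "x \<in> annulus_bdry T" for x using wp that T by (auto simp: annulus_def annulus_bdry_def)
  obtain \<sigma> u where u: "smooth_on (annulus T) u" "\<And>t \<theta>. u (t, \<theta> + 2 * pi) = u (t, \<theta>)"
    and ex: "\<exists>u1 u2 u11 u12 u22. (\<forall>x\<in>annulus T.
        (u has_derivative (\<lambda>h. fst h * u1 x + snd h * u2 x)) (at x within annulus T) \<and>
        (u1 has_derivative (\<lambda>h. fst h * u11 x + snd h * u12 x)) (at x within annulus T) \<and>
        (u2 has_derivative (\<lambda>h. fst h * u12 x + snd h * u22 x)) (at x within annulus T) \<and>
        u11 x + u22 x = 0) \<and>
      (\<forall>\<theta>. - u1 (0, \<theta>) = \<sigma> * b0 \<theta> * u (0, \<theta>) \<and> u1 (T, \<theta>) = \<sigma> * b1 \<theta> * u (T, \<theta>))"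
    and nc: "\<nexists>c. \<forall>x\<in>annulus T. u x = c" and \<sigma>: "\<sigma> \<ge> 0"
    and test: "\<And>N d. (\<And>j. j \<ge> N \<Longrightarrow> d j = 0) \<Longrightarrow>
       integral {0..2 * pi} (\<lambda>\<theta>. b0 \<theta> * trace0 N d \<theta> + b1 \<theta> * trace1 N d \<theta>) = 0 \<Longrightarrow>
       \<sigma> * integral {0..2 * pi} (\<lambda>\<theta>. b0 \<theta> * (trace0 N d \<theta>)\<^sup>2 + b1 \<theta> * (trace1 N d \<theta>)\<^sup>2)
         \<le> (\<Sum>j<N. dtn T j * mode_mass j * (d j)\<^sup>2)"
    by (rule ex_steklov_solution) blast
  obtain u1 u2 u11 u12 u22 where D: "\<And>x. x \<in> annulus T \<Longrightarrow> (u has_derivative (\<lambda>h. fst h * u1 x + snd h * u2 x)) (at x within annulus T)"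
    "\<And>x. x \<in> annulus T \<Longrightarrow> (u1 has_derivative (\<lambda>h. fst h * u11 x + snd h * u12 x)) (at x within annulus T)"
    "\<And>x. x \<in> annulus T \<Longrightarrow> (u2 has_derivative (\<lambda>h. fst h * u12 x + snd h * u22 x)) (at x within annulus T)"
    "\<And>x. x \<in> annulus T \<Longrightarrow> u11 x + u22 x = 0"
    and bc: "\<And>\<theta>. - u1 (0, \<theta>) = \<sigma> * b0 \<theta> * u (0, \<theta>)" "\<And>\<theta>. u1 (T, \<theta>) = \<sigma> * b1 \<theta> * u (T, \<theta>)"
    using ex by blast
  have dt: "d_t T u x = u1 x" if "x \<in> annulus T" for x
    by (rule d_t_d_theta_eq(1)[OF T that, where b = "u2 x"]) (use D(1)[OF that] in simp)
  have "harmonic T w u" by (rule harmonicI[OF T u]) (use D in simp_all)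
  moreover have "(0, \<theta>) \<in> annulus T" "(T, \<theta>) \<in> annulus T" for \<theta> using T by (auto simp: annulus_def)
  ultimately have "steklov_eigenfunction T w r \<sigma> u"
    using bc by (simp add: steklov_eigenfunction_weight_iff[OF T wb] b0_def b1_def dt)
  then have "\<sigma> \<in> steklov_candidates T w r"
    using lin_indep_one_nonconstant[OF nc] constant_steklov_eigenfunction[OF T wb, where r = r] \<sigma>
    unfolding steklov_candidates_def by (intro CollectI exI[of _ "[\<lambda>_. 1, u]"]) auto
  then have le: "steklov 1 T w r \<le> \<sigma>"
    unfolding steklov_1 using steklov_candidates_nonneg[OF T w r] by (intro cInf_lower bdd_belowI[of _ 0]) auto
  have "integral {0..2 * pi} (\<lambda>\<theta>. b0 \<theta> * (trace0 N d \<theta>)\<^sup>2 + b1 \<theta> * (trace1 N d \<theta>)\<^sup>2) \<ge> 0"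
  proof (rule integral_nonneg)
    show "(\<lambda>\<theta>. b0 \<theta> * (trace0 N d \<theta>)\<^sup>2 + b1 \<theta> * (trace1 N d \<theta>)\<^sup>2) integrable_on {0..2 * pi}"
      unfolding trace0_def trace1_def by (intro integrable_continuous_real continuous_intros cont)
    show "0 \<le> b0 \<theta> * (trace0 N d \<theta>)\<^sup>2 + b1 \<theta> * (trace1 N d \<theta>)\<^sup>2" for \<theta>
      using pos[of \<theta>] by (simp add: less_imp_le)
  qed
  then show ?thesis using mult_right_mono[OF le] test[OF d mean] by (meson order_trans)
qed

text \<open>The coordinate functions of the catenoidal maps only involve the first six modes, of frequencies \<open>0\<close> and \<open>\<plusminus>1\<close>.\<close>

lemma low_modes:
  "freq 2 = - 1" "freq 3 = - 1" "freq 4 = 1" "freq 5 = 1"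
  by (simp_all add: freq_def int_decode_def sum_decode_def)

lemma trace_low:
  "trace0 6 d \<theta> = d 0 - d 1 + (d 3 - d 2) * sin \<theta> + (d 4 - d 5) * cos \<theta>"
  "trace1 6 d \<theta> = d 0 + d 1 - (d 2 + d 3) * sin \<theta> + (d 4 + d 5) * cos \<theta>"
proof -
  have s: "(\<Sum>j<6. F j) = F 0 + F 1 + F 2 + F 3 + F 4 + F 5" for F :: "nat \<Rightarrow> real"
    by (simp add: eval_nat_numeral)
  have a: "angular 0 0 \<theta> = 1" "angular 0 1 \<theta> = 1" "angular 0 2 \<theta> = - sin \<theta>" "angular 0 3 \<theta> = - sin \<theta>"
    "angular 0 4 \<theta> = cos \<theta>" "angular 0 5 \<theta> = cos \<theta>"
    using cos_add[of \<theta> "pi/2"] cos_minus[of "\<theta> + pi/2"] by (simp_all add: angular_def phase_def low_modes)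
  have p: "parity 2 = 1" "parity 3 = - 1" "parity 4 = 1" "parity 5 = - 1" by (simp_all add: parity_def)
  show "trace0 6 d \<theta> = d 0 - d 1 + (d 3 - d 2) * sin \<theta> + (d 4 - d 5) * cos \<theta>"
    "trace1 6 d \<theta> = d 0 + d 1 - (d 2 + d 3) * sin \<theta> + (d 4 + d 5) * cos \<theta>"
    unfolding trace0_def trace1_def s a p by (simp_all add: algebra_simps)
qed

text \<open>These are \<open>tanh (T/2)\<close> and \<open>coth (T/2)\<close>, the eigenvalues for frequency one.\<close>

definition dtn_even :: "real \<Rightarrow> real" where "dtn_even T = (1 - exp (- T)) / (1 + exp (- T))"
definition dtn_odd :: "real \<Rightarrow> real" where "dtn_odd T = (1 + exp (- T)) / (1 - exp (- T))"

lemma dirichlet_low: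
  "(\<Sum>j<6. dtn T j * mode_mass j * (d j)\<^sup>2) = 8 * pi / T * (d 1)\<^sup>2 +
    2 * pi * (dtn_even T * ((d 2)\<^sup>2 + (d 4)\<^sup>2) + dtn_odd T * ((d 3)\<^sup>2 + (d 5)\<^sup>2))"
proof -
  have s: "(\<Sum>j<6. F j) = F 0 + F 1 + F 2 + F 3 + F 4 + F 5" for F :: "nat \<Rightarrow> real"
    by (simp add: eval_nat_numeral)
  have p: "parity 2 = 1" "parity 3 = - 1" "parity 4 = 1" "parity 5 = - 1" by (simp_all add: parity_def)
  have d: "dtn T 1 = 2 / T" "dtn T 2 = dtn_even T" "dtn T 3 = dtn_odd T" "dtn T 4 = dtn_even T" "dtn T 5 = dtn_odd T"
    by (simp_all add: dtn_def radial_def p low_modes dtn_even_def dtn_odd_def)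
  have m: "mode_mass 1 = 4 * pi" "mode_mass 2 = 2 * pi" "mode_mass 3 = 2 * pi" "mode_mass 4 = 2 * pi" "mode_mass 5 = 2 * pi"
    by (simp_all add: mode_mass_def low_modes)
  show ?thesis unfolding s d m dtn_0 by (simp add: algebra_simps)
qed

text \<open>
  The Rayleigh bound for test functions with boundary values \<open>A + P cos \<theta> + Q sin \<theta>\<close>, expressed
  directly by their coefficients at the two ends; the right hand side is the Dirichlet energy of
  the harmonic extension.
\<close>

lemma steklov_1_le_low:
  assumes T: "T > 0" and w: "conformal_metric T w" and r: "bdry_density T r"
    and b0: "\<And>\<theta>. b0 \<theta> = r (0, \<theta>) * sqrt (w (0, \<theta>))" and b1: "\<And>\<theta>. b1 \<theta> = r (T, \<theta>) * sqrt (w (T, \<theta>))"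
    and mean: "integral {0..2 * pi} (\<lambda>\<theta>. b0 \<theta> * (A0 + P0 * cos \<theta> + Q0 * sin \<theta>) + b1 \<theta> * (A1 + P1 * cos \<theta> + Q1 * sin \<theta>)) = 0"
  shows "steklov 1 T w r * integral {0..2 * pi} (\<lambda>\<theta>. b0 \<theta> * (A0 + P0 * cos \<theta> + Q0 * sin \<theta>)\<^sup>2 + b1 \<theta> * (A1 + P1 * cos \<theta> + Q1 * sin \<theta>)\<^sup>2)
    \<le> 2 * pi / T * (A1 - A0)\<^sup>2 + pi / 2 * (dtn_even T * ((P0 + P1)\<^sup>2 + (Q0 + Q1)\<^sup>2) + dtn_odd T * ((P1 - P0)\<^sup>2 + (Q1 - Q0)\<^sup>2))"
proof -
  define d :: "nat \<Rightarrow> real" where "d = (\<lambda>j. if j = 0 then (A0 + A1) / 2 else if j = 1 then (A1 - A0) / 2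
    else if j = 2 then - (Q0 + Q1) / 2 else if j = 3 then (Q0 - Q1) / 2 else if j = 4 then (P0 + P1) / 2
    else if j = 5 then (P1 - P0) / 2 else 0)"
  have dv: "d 0 = (A0 + A1) / 2" "d 1 = (A1 - A0) / 2" "d 2 = - (Q0 + Q1) / 2" "d 3 = (Q0 - Q1) / 2"
    "d 4 = (P0 + P1) / 2" "d 5 = (P1 - P0) / 2" by (simp_all add: d_def)
  have c: "d 0 - d 1 = A0" "d 3 - d 2 = Q0" "d 4 - d 5 = P0" "d 0 + d 1 = A1" "- (d 2 + d 3) = Q1" "d 4 + d 5 = P1"
    unfolding dv by (simp_all add: field_simps)
  have t0: "trace0 6 d \<theta> = A0 + P0 * cos \<theta> + Q0 * sin \<theta>" for \<theta>
    unfolding trace_low c by simp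
  have t1: "trace1 6 d \<theta> = A1 + P1 * cos \<theta> + Q1 * sin \<theta>" for \<theta>
  proof -
    have "trace1 6 d \<theta> = (d 0 + d 1) + (- (d 2 + d 3)) * sin \<theta> + (d 4 + d 5) * cos \<theta>"
      unfolding trace_low by (simp add: algebra_simps)
    then show ?thesis unfolding c by simp
  qed
  have "steklov 1 T w r * integral {0..2 * pi} (\<lambda>\<theta>. b0 \<theta> * (A0 + P0 * cos \<theta> + Q0 * sin \<theta>)\<^sup>2 + b1 \<theta> * (A1 + P1 * cos \<theta> + Q1 * sin \<theta>)\<^sup>2)
    \<le> (\<Sum>j<6. dtn T j * mode_mass j * (d j)\<^sup>2)"
    using steklov_1_le_rayleigh[OF T w r, of 6 d] mean unfolding t0 t1 b0 b1 by (simp add: d_def)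
  also have "\<dots> = 2 * pi / T * (A1 - A0)\<^sup>2 + pi / 2 * (dtn_even T * ((P0 + P1)\<^sup>2 + (Q0 + Q1)\<^sup>2) + dtn_odd T * ((P1 - P0)\<^sup>2 + (Q1 - Q0)\<^sup>2))"
    unfolding dirichlet_low dv using T by (simp add: power2_eq_square field_simps)
  finally show ?thesis .
qed

context catenoidal_map
begin

text \<open>Boundary values of the radius and of the height of the map at the two ends.\<close>

definition f0 where "f0 = a * cosh p"
definition f1 where "f1 = a * cosh (T - p)"
definition h0 where "h0 = - (b * q)"
definition h1 where "h1 = b * (T - q)"

lemma sphere: "f0\<^sup>2 + h0\<^sup>2 = 1" "f1\<^sup>2 + h1\<^sup>2 = 1"
  using unit by (simp_all add: f0_def f1_def h0_def h1_def power_mult_distrib)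

text \<open>The centre of mass of the induced boundary measure lies on the equatorial plane; by symmetry it lies on the axis as well.\<close>

lemma balance: "rho0 * h0 + rho1 * h1 = 0"
proof -
  have "rho0 * h0 + rho1 * h1 = - b * (q * tanh p) + b * ((T - q) * tanh (T - p))"
    by (simp add: rho0_def rho1_def h0_def h1_def algebra_simps)
  then show ?thesis unfolding q by simp
qed

text \<open>
  The Dirichlet energies of the three coordinate functions, computed with the modes as in
  \<open>steklov_1_le_low\<close>, add up to twice the energy of the map.
\<close>

lemma dirichlet_Psi:
  "2 * pi / T * (h1 - h0)\<^sup>2 + pi * (dtn_even T * (f0 + f1)\<^sup>2 + dtn_odd T * (f1 - f0)\<^sup>2) = 2 * pi * (rho0 + rho1)"
proof -
  define X where "X = exp p"
  define Y where "Y = exp (T - p)"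
  have X: "X > 0" and Y: "Y > 0" by (simp_all add: X_def Y_def)
  have XY: "exp T = X * Y" by (simp add: X_def Y_def exp_add[symmetric])
  have XY1: "X * Y > 1" using T by (simp add: XY[symmetric])
  have e: "exp (- T) = 1 / (X * Y)" by (simp add: exp_minus XY inverse_eq_divide)
  have ch: "cosh p = (X + 1 / X) / 2" "sinh p = (X - 1 / X) / 2" "cosh (T - p) = (Y + 1 / Y) / 2" "sinh (T - p) = (Y - 1 / Y) / 2"
    by (simp_all add: cosh_def sinh_def X_def Y_def exp_minus inverse_eq_divide exp_diff)
  have s: "f0 + f1 = a / 2 * ((X + Y) * (1 + exp (- T)))" "f1 - f0 = a / 2 * ((Y - X) * (1 - exp (- T)))"
    unfolding f0_def f1_def ch e using X Y by (simp_all add: field_simps)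
  have "exp (- T) < 1" "exp (- T) > 0" using T by simp_all
  then have n: "1 - exp (- T) \<noteq> 0" "1 + exp (- T) \<noteq> 0" by linarith+
  have E: "dtn_even T * (f0 + f1)\<^sup>2 = a\<^sup>2 / 4 * ((X + Y)\<^sup>2 * (1 - (exp (- T))\<^sup>2))"
    unfolding dtn_even_def s using n(2) by (simp add: power2_eq_square field_simps)
  have O: "dtn_odd T * (f1 - f0)\<^sup>2 = a\<^sup>2 / 4 * ((Y - X)\<^sup>2 * (1 - (exp (- T))\<^sup>2))"
    unfolding dtn_odd_def s using n(1) by (simp add: power2_eq_square field_simps)
  have "dtn_even T * (f0 + f1)\<^sup>2 + dtn_odd T * (f1 - f0)\<^sup>2 = 2 * (a\<^sup>2 * (sinh p * cosh p) + a\<^sup>2 * (sinh (T - p) * cosh (T - p)))"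
    unfolding E O ch e using X Y by (simp add: power2_eq_square field_simps)
  also have "\<dots> = 2 * (rho0 * f0\<^sup>2 + rho1 * f1\<^sup>2)"
    by (simp add: rho0_def rho1_def f0_def f1_def tanh_def power2_eq_square)
  finally have 1: "dtn_even T * (f0 + f1)\<^sup>2 + dtn_odd T * (f1 - f0)\<^sup>2 = 2 * (rho0 * f0\<^sup>2 + rho1 * f1\<^sup>2)" .
  have "2 * pi / T * (h1 - h0)\<^sup>2 = 2 * pi * (b\<^sup>2 * T)"
    using T by (simp add: h0_def h1_def power2_eq_square field_simps)
  also have "b\<^sup>2 * T = rho0 * h0\<^sup>2 + rho1 * h1\<^sup>2"
  proof -
    have "rho0 * h0\<^sup>2 + rho1 * h1\<^sup>2 = b\<^sup>2 * (q * (q * tanh p) + (T - q) * ((T - q) * tanh (T - p)))"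
      by (simp add: rho0_def rho1_def h0_def h1_def power2_eq_square algebra_simps)
    then show ?thesis unfolding q by simp
  qed
  finally have 2: "2 * pi / T * (h1 - h0)\<^sup>2 = 2 * pi * (rho0 * h0\<^sup>2 + rho1 * h1\<^sup>2)" .
  have "2 * pi * (rho0 * h0\<^sup>2 + rho1 * h1\<^sup>2) + pi * (2 * (rho0 * f0\<^sup>2 + rho1 * f1\<^sup>2)) =
    2 * pi * (rho0 * (f0\<^sup>2 + h0\<^sup>2) + rho1 * (f1\<^sup>2 + h1\<^sup>2))" by (simp add: algebra_simps)
  then show ?thesis unfolding 1 2 sphere by simp
qed

text \<open>
  Hersch's trick. Here \<open>M\<close> is the total mass and \<open>(N1, N2, N3)\<close> the first moment of the
  push-forward of the boundary measure by the map, so that \<open>c = (N1, N2, N3) / M\<close> is its centre of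
  mass. The coordinates of \<open>\<Psi> - c\<close> have mean zero and are thus admissible test functions.
  Subtracting \<open>c\<close> does not change their Dirichlet energies, and since \<open>|\<Psi>| = 1\<close> on the boundary
  their squared norms add up to \<open>M (1 - |c|\<^sup>2)\<close>.
\<close>

theorem hersch:
  assumes w: "conformal_metric T w" and r: "bdry_density T r"
  defines "b0 \<equiv> \<lambda>\<theta>. r (0, \<theta>) * sqrt (w (0, \<theta>))" and "b1 \<equiv> \<lambda>\<theta>. r (T, \<theta>) * sqrt (w (T, \<theta>))"
  defines "M \<equiv> integral {0..2 * pi} (\<lambda>\<theta>. b0 \<theta> + b1 \<theta>)"
  defines "N1 \<equiv> integral {0..2 * pi} (\<lambda>\<theta>. (b0 \<theta> * f0 + b1 \<theta> * f1) * cos \<theta>)"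
    and "N2 \<equiv> integral {0..2 * pi} (\<lambda>\<theta>. (b0 \<theta> * f0 + b1 \<theta> * f1) * sin \<theta>)"
    and "N3 \<equiv> integral {0..2 * pi} (\<lambda>\<theta>. b0 \<theta> * h0 + b1 \<theta> * h1)"
  shows "M > 0" "steklov 1 T w r * (M\<^sup>2 - (N1\<^sup>2 + N2\<^sup>2 + N3\<^sup>2)) \<le> 2 * pi * (rho0 + rho1) * M"
proof -
  interpret boundary_weight T b0 b1 unfolding b0_def b1_def by (rule boundary_weight_of_density[OF T w r])
  let ?I = "integral {0..2 * pi}"
  note [continuous_intros] = cont
  show M: "M > 0"
  proof (rule ccontr)
    assume "\<not> M > 0"
    then have "b0 0 + b1 0 = 0" using pos
      by (intro nonneg_integral_zero[where f = "\<lambda>\<theta>. b0 \<theta> + b1 \<theta>" and a = 0 and b = "2 * pi"])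
         (auto intro!: continuous_intros add_nonneg_nonneg simp: M_def less_imp_le)
    then show False using pos[of 0] by simp
  qed
  define c1 c2 c3 where "c1 = N1 / M" and "c2 = N2 / M" and "c3 = N3 / M"
  have c: "c1 * M = N1" "c2 * M = N2" "c3 * M = N3" using M by (simp_all add: c1_def c2_def c3_def)
  have int: "(\<lambda>\<theta>. b0 \<theta> * F \<theta> + b1 \<theta> * G \<theta>) integrable_on {0..2*pi}"
    if "continuous_on {0..2*pi} F" "continuous_on {0..2*pi} G" for F G
    by (intro integrable_continuous_real continuous_intros that)
  have sub: "?I (\<lambda>\<theta>. b0 \<theta> * (F \<theta> - k) + b1 \<theta> * (G \<theta> - k)) = ?I (\<lambda>\<theta>. b0 \<theta> * F \<theta> + b1 \<theta> * G \<theta>) - k * M"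
    if "continuous_on {0..2*pi} F" "continuous_on {0..2*pi} G" for F G k
  proof -
    have "?I (\<lambda>\<theta>. b0 \<theta> * (F \<theta> - k) + b1 \<theta> * (G \<theta> - k)) = ?I (\<lambda>\<theta>. (b0 \<theta> * F \<theta> + b1 \<theta> * G \<theta>) - k * (b0 \<theta> + b1 \<theta>))"
      by (simp add: algebra_simps)
    also have "\<dots> = ?I (\<lambda>\<theta>. b0 \<theta> * F \<theta> + b1 \<theta> * G \<theta>) - ?I (\<lambda>\<theta>. k * (b0 \<theta> + b1 \<theta>))"
      by (rule integral_diff[OF int[OF that]]) (intro integrable_continuous_real continuous_intros)
    finally show ?thesis by (simp add: M_def)
  qed
  define S where "S = steklov 1 T w r"
  let ?v = "\<lambda>A P Q \<theta>. A + P * cos \<theta> + Q * sin \<theta> :: real"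
  let ?E = "\<lambda>A0 P0 Q0 A1 P1 Q1. ?I (\<lambda>\<theta>. b0 \<theta> * (?v A0 P0 Q0 \<theta>)\<^sup>2 + b1 \<theta> * (?v A1 P1 Q1 \<theta>)\<^sup>2)"
  have b: "\<And>\<theta>. b0 \<theta> = r (0, \<theta>) * sqrt (w (0, \<theta>))" "\<And>\<theta>. b1 \<theta> = r (T, \<theta>) * sqrt (w (T, \<theta>))"
    by (simp_all add: b0_def b1_def)
  note low = steklov_1_le_low[OF T w r b, folded S_def]
  have "?I (\<lambda>\<theta>. b0 \<theta> * (f0 * cos \<theta> - c1) + b1 \<theta> * (f1 * cos \<theta> - c1)) = 0"
  proof -
    have "?I (\<lambda>\<theta>. b0 \<theta> * (f0 * cos \<theta>) + b1 \<theta> * (f1 * cos \<theta>)) = N1"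
      unfolding N1_def by (simp only: distrib_right mult.assoc)
    moreover have "continuous_on {0..2*pi} (\<lambda>\<theta>. f0 * cos \<theta>)" "continuous_on {0..2*pi} (\<lambda>\<theta>. f1 * cos \<theta>)"
      by (intro continuous_intros)+
    ultimately show ?thesis using sub[of "\<lambda>\<theta>. f0 * cos \<theta>" "\<lambda>\<theta>. f1 * cos \<theta>" c1] c(1) by simp
  qed
  then have "?I (\<lambda>\<theta>. b0 \<theta> * ?v (- c1) f0 0 \<theta> + b1 \<theta> * ?v (- c1) f1 0 \<theta>) = 0" by (simp add: algebra_simps)
  from low[OF this] have 1: "S * ?E (- c1) f0 0 (- c1) f1 0 \<le> pi / 2 * (dtn_even T * (f0 + f1)\<^sup>2 + dtn_odd T * (f1 - f0)\<^sup>2)"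
    by simp
  have "?I (\<lambda>\<theta>. b0 \<theta> * (f0 * sin \<theta> - c2) + b1 \<theta> * (f1 * sin \<theta> - c2)) = 0"
  proof -
    have "?I (\<lambda>\<theta>. b0 \<theta> * (f0 * sin \<theta>) + b1 \<theta> * (f1 * sin \<theta>)) = N2"
      unfolding N2_def by (simp only: distrib_right mult.assoc)
    moreover have "continuous_on {0..2*pi} (\<lambda>\<theta>. f0 * sin \<theta>)" "continuous_on {0..2*pi} (\<lambda>\<theta>. f1 * sin \<theta>)"
      by (intro continuous_intros)+
    ultimately show ?thesis using sub[of "\<lambda>\<theta>. f0 * sin \<theta>" "\<lambda>\<theta>. f1 * sin \<theta>" c2] c(2) by simp
  qed
  then have "?I (\<lambda>\<theta>. b0 \<theta> * ?v (- c2) 0 f0 \<theta> + b1 \<theta> * ?v (- c2) 0 f1 \<theta>) = 0" by (simp add: algebra_simps)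
  from low[OF this] have 2: "S * ?E (- c2) 0 f0 (- c2) 0 f1 \<le> pi / 2 * (dtn_even T * (f0 + f1)\<^sup>2 + dtn_odd T * (f1 - f0)\<^sup>2)"
    by simp
  have "?I (\<lambda>\<theta>. b0 \<theta> * (h0 - c3) + b1 \<theta> * (h1 - c3)) = 0"
    using sub[of "\<lambda>_. h0" "\<lambda>_. h1" c3] c(3) by (simp add: N3_def)
  then have "?I (\<lambda>\<theta>. b0 \<theta> * ?v (h0 - c3) 0 0 \<theta> + b1 \<theta> * ?v (h1 - c3) 0 0 \<theta>) = 0" by simp
  from low[OF this] have 3: "S * ?E (h0 - c3) 0 0 (h1 - c3) 0 0 \<le> 2 * pi / T * (h1 - h0)\<^sup>2" by simp
  have "?E (- c1) f0 0 (- c1) f1 0 + ?E (- c2) 0 f0 (- c2) 0 f1 + ?E (h0 - c3) 0 0 (h1 - c3) 0 0 =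
    ?I (\<lambda>\<theta>. (b0 \<theta> * (?v (- c1) f0 0 \<theta>)\<^sup>2 + b1 \<theta> * (?v (- c1) f1 0 \<theta>)\<^sup>2) +
      (b0 \<theta> * (?v (- c2) 0 f0 \<theta>)\<^sup>2 + b1 \<theta> * (?v (- c2) 0 f1 \<theta>)\<^sup>2) +
      (b0 \<theta> * (?v (h0 - c3) 0 0 \<theta>)\<^sup>2 + b1 \<theta> * (?v (h1 - c3) 0 0 \<theta>)\<^sup>2))"
    by (rule integral_unique[symmetric]) (intro has_integral_add integrable_integral int continuous_intros)
  also have "\<dots> = ?I (\<lambda>\<theta>. (1 + (c1\<^sup>2 + c2\<^sup>2 + c3\<^sup>2)) * (b0 \<theta> + b1 \<theta>) - (2 * c1 * ((b0 \<theta> * f0 + b1 \<theta> * f1) * cos \<theta>)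
      + 2 * c2 * ((b0 \<theta> * f0 + b1 \<theta> * f1) * sin \<theta>) + 2 * c3 * (b0 \<theta> * h0 + b1 \<theta> * h1)))"
  proof (rule integral_cong)
    fix \<theta> :: real
    have trig: "f * f * (cos \<theta> * cos \<theta>) + f * f * (sin \<theta> * sin \<theta>) = f * f" for f
      unfolding distrib_left[symmetric] using sin_cos_squared_add3[of \<theta>] by (simp add: add.commute)
    have sq: "(?v (- c1) f 0 \<theta>)\<^sup>2 + (?v (- c2) 0 f \<theta>)\<^sup>2 + (?v (h - c3) 0 0 \<theta>)\<^sup>2 =
      (f\<^sup>2 + h\<^sup>2) + (c1\<^sup>2 + c2\<^sup>2 + c3\<^sup>2) - 2 * (c1 * (f * cos \<theta>) + c2 * (f * sin \<theta>) + c3 * h)" for f h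
      using trig[of f] by (simp add: power2_eq_square algebra_simps)
    have "b0 \<theta> * ((?v (- c1) f0 0 \<theta>)\<^sup>2 + (?v (- c2) 0 f0 \<theta>)\<^sup>2 + (?v (h0 - c3) 0 0 \<theta>)\<^sup>2) +
       b1 \<theta> * ((?v (- c1) f1 0 \<theta>)\<^sup>2 + (?v (- c2) 0 f1 \<theta>)\<^sup>2 + (?v (h1 - c3) 0 0 \<theta>)\<^sup>2) =
       (1 + (c1\<^sup>2 + c2\<^sup>2 + c3\<^sup>2)) * (b0 \<theta> + b1 \<theta>) - (2 * c1 * ((b0 \<theta> * f0 + b1 \<theta> * f1) * cos \<theta>)
      + 2 * c2 * ((b0 \<theta> * f0 + b1 \<theta> * f1) * sin \<theta>) + 2 * c3 * (b0 \<theta> * h0 + b1 \<theta> * h1))"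
      unfolding sq sphere by (simp add: algebra_simps)
    then show "(b0 \<theta> * (?v (- c1) f0 0 \<theta>)\<^sup>2 + b1 \<theta> * (?v (- c1) f1 0 \<theta>)\<^sup>2) +
      (b0 \<theta> * (?v (- c2) 0 f0 \<theta>)\<^sup>2 + b1 \<theta> * (?v (- c2) 0 f1 \<theta>)\<^sup>2) +
      (b0 \<theta> * (?v (h0 - c3) 0 0 \<theta>)\<^sup>2 + b1 \<theta> * (?v (h1 - c3) 0 0 \<theta>)\<^sup>2) =
      (1 + (c1\<^sup>2 + c2\<^sup>2 + c3\<^sup>2)) * (b0 \<theta> + b1 \<theta>) - (2 * c1 * ((b0 \<theta> * f0 + b1 \<theta> * f1) * cos \<theta>)
      + 2 * c2 * ((b0 \<theta> * f0 + b1 \<theta> * f1) * sin \<theta>) + 2 * c3 * (b0 \<theta> * h0 + b1 \<theta> * h1))"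
      by (simp only: distrib_left add.assoc add.commute add.left_commute)
  qed
  also have "\<dots> = (1 + (c1\<^sup>2 + c2\<^sup>2 + c3\<^sup>2)) * M - (2 * c1 * N1 + 2 * c2 * N2 + 2 * c3 * N3)"
  proof -
    let ?A = "\<lambda>\<theta>. b0 \<theta> + b1 \<theta>" and ?B1 = "\<lambda>\<theta>. (b0 \<theta> * f0 + b1 \<theta> * f1) * cos \<theta>"
      and ?B2 = "\<lambda>\<theta>. (b0 \<theta> * f0 + b1 \<theta> * f1) * sin \<theta>" and ?B3 = "\<lambda>\<theta>. b0 \<theta> * h0 + b1 \<theta> * h1"
    have i: "?A integrable_on {0..2*pi}" "?B1 integrable_on {0..2*pi}" "?B2 integrable_on {0..2*pi}" "?B3 integrable_on {0..2*pi}"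
      by (intro integrable_continuous_real continuous_intros)+
    have "((\<lambda>\<theta>. (1 + (c1\<^sup>2 + c2\<^sup>2 + c3\<^sup>2)) * ?A \<theta> - (2 * c1 * ?B1 \<theta> + 2 * c2 * ?B2 \<theta> + 2 * c3 * ?B3 \<theta>)) has_integral
      ((1 + (c1\<^sup>2 + c2\<^sup>2 + c3\<^sup>2)) * M - (2 * c1 * N1 + 2 * c2 * N2 + 2 * c3 * N3))) {0..2*pi}"
      unfolding M_def N1_def N2_def N3_def
      by (intro has_integral_diff has_integral_add has_integral_mult_right integrable_integral i)
    then show ?thesis by (rule integral_unique)
  qed
  also have "\<dots> = M - (c1\<^sup>2 + c2\<^sup>2 + c3\<^sup>2) * M" unfolding c[symmetric] by (simp add: power2_eq_square algebra_simps)
  finally have tot: "?E (- c1) f0 0 (- c1) f1 0 + ?E (- c2) 0 f0 (- c2) 0 f1 + ?E (h0 - c3) 0 0 (h1 - c3) 0 0 = M - (c1\<^sup>2 + c2\<^sup>2 + c3\<^sup>2) * M" .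
  have "S * (M - (c1\<^sup>2 + c2\<^sup>2 + c3\<^sup>2) * M) \<le> 2 * pi / T * (h1 - h0)\<^sup>2 + pi * (dtn_even T * (f0 + f1)\<^sup>2 + dtn_odd T * (f1 - f0)\<^sup>2)"
    unfolding tot[symmetric] distrib_left using 1 2 3 by argo
  then have "S * (M - (c1\<^sup>2 + c2\<^sup>2 + c3\<^sup>2) * M) \<le> 2 * pi * (rho0 + rho1)" unfolding dirichlet_Psi .
  then have "S * (M - (c1\<^sup>2 + c2\<^sup>2 + c3\<^sup>2) * M) * M \<le> 2 * pi * (rho0 + rho1) * M" using M by (intro mult_right_mono) auto
  moreover have "S * (M - (c1\<^sup>2 + c2\<^sup>2 + c3\<^sup>2) * M) * M = S * (M\<^sup>2 - (N1\<^sup>2 + N2\<^sup>2 + N3\<^sup>2))"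
    unfolding c[symmetric] by (simp add: power2_eq_square algebra_simps)
  ultimately show "steklov 1 T w r * (M\<^sup>2 - (N1\<^sup>2 + N2\<^sup>2 + N3\<^sup>2)) \<le> 2 * pi * (rho0 + rho1) * M"
    by (simp only: S_def)
qed

end

section \<open>Conformal extremality\<close>

lemma smooth_family_lipschitz:
  fixes g :: "real \<times> real \<Rightarrow> real"
  assumes e: "\<epsilon> > 0" and g: "smooth_on ({-\<epsilon><..<\<epsilon>} \<times> UNIV) g"
  obtains K where "K \<ge> 0" "\<And>s \<theta>. \<bar>s\<bar> \<le> \<epsilon> / 2 \<Longrightarrow> \<theta> \<in> {0..2 * pi} \<Longrightarrow> \<bar>g (s, \<theta>) - g (0, \<theta>)\<bar> \<le> K * \<bar>s\<bar>"
proof -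
  let ?S = "{-\<epsilon><..<\<epsilon>} \<times> (UNIV :: real set)" and ?C = "{- (\<epsilon> / 2)..\<epsilon> / 2} \<times> {0..2 * pi}"
  obtain D :: "real \<times> real \<Rightarrow> real \<times> real \<Rightarrow> real"
    where D: "\<And>x. x \<in> ?S \<Longrightarrow> (g has_derivative (\<lambda>h. fst h *\<^sub>R D (1,0) x + snd h *\<^sub>R D (0,1) x)) (at x within ?S)"
    and D1: "smooth_on ?S (D (1,0))"
  proof -
    obtain D where D: "\<And>x. x \<in> ?S \<Longrightarrow> (g has_derivative (\<lambda>h. \<Sum>b\<in>Basis. (h \<bullet> b) *\<^sub>R D b x)) (at x within ?S)"
      "\<And>b. b \<in> Basis \<Longrightarrow> smooth_on ?S (D b)"
      using g unfolding smooth_on_unfold[of _ g] by blast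
    show thesis
    proof (rule that[of D])
      show "(g has_derivative (\<lambda>h. fst h *\<^sub>R D (1,0) x + snd h *\<^sub>R D (0,1) x)) (at x within ?S)" if "x \<in> ?S" for x
        using D(1)[OF that] by (simp only: partials_real2)
    qed (simp add: D(2) Basis_real2)
  qed
  have sub: "?C \<subseteq> ?S" using e by auto
  have "compact (D (1,0) ` ?C)"
    by (intro compact_continuous_image compact_Times continuous_on_subset[OF smooth_on_imp_continuous_on[OF D1] sub]) auto
  then obtain K where K: "\<And>x. x \<in> ?C \<Longrightarrow> \<bar>D (1,0) x\<bar> \<le> K"
    using compact_imp_bounded[of "D (1,0) ` ?C"] unfolding bounded_iff by auto
  have K0: "K \<ge> 0" using K[of "(0, 0)"] e by force
  have "\<bar>g (s, \<theta>) - g (0, \<theta>)\<bar> \<le> K * \<bar>s\<bar>" if s: "\<bar>s\<bar> \<le> \<epsilon> / 2" and \<theta>: "\<theta> \<in> {0..2 * pi}" for s \<theta>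
  proof -
    let ?J = "{- (\<epsilon> / 2)..\<epsilon> / 2}"
    have "norm (g (s, \<theta>) - g (0, \<theta>)) \<le> K * norm (s - 0)"
    proof (rule field_differentiable_bound[where S = ?J and f = "\<lambda>s. g (s, \<theta>)" and f' = "\<lambda>s. D (1,0) (s, \<theta>)"])
      fix s assume s: "s \<in> ?J"
      have x: "(s, \<theta>) \<in> ?S" using s e by auto
      have 1: "((\<lambda>s. (s, \<theta>)) has_derivative (\<lambda>h. (h, 0))) (at s within ?J)"
        by (auto intro!: derivative_eq_intros)
      have 2: "(g has_derivative (\<lambda>h. fst h *\<^sub>R D (1,0) (s, \<theta>) + snd h *\<^sub>R D (0,1) (s, \<theta>))) (at (s, \<theta>) within (\<lambda>s. (s, \<theta>)) ` ?J)"
        by (rule has_derivative_subset[OF D[OF x]]) (use e in auto)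
      from has_derivative_in_compose[OF 1 2]
      show "((\<lambda>s. g (s, \<theta>)) has_field_derivative D (1,0) (s, \<theta>)) (at s within ?J)"
        by (simp add: has_field_derivative_def mult.commute[of _ "D (1,0) _"])
      show "norm (D (1,0) (s, \<theta>)) \<le> K" using K[of "(s, \<theta>)"] s \<theta> by simp
    qed (use s e in auto)
    then show ?thesis by simp
  qed
  then show thesis using that K0 by blast
qed

lemma smooth_family_weight:
  assumes T: "T > 0" and F: "smooth_family T \<epsilon> W P" and t: "t \<in> {0, T}"
  shows "smooth_on ({-\<epsilon><..<\<epsilon>} \<times> UNIV) (\<lambda>x. P (fst x) (t, snd x) * sqrt (W (fst x) (t, snd x)))"
proof -
  let ?S = "{-\<epsilon><..<\<epsilon>} \<times> (UNIV :: real set)"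
  have ta: "(t, \<theta>) \<in> annulus T" for \<theta> using t T by (auto simp: annulus_def)
  have "smooth_on ({-\<epsilon><..<\<epsilon>} \<times> annulus T) (\<lambda>(s, x). W s x)" using F by (simp add: smooth_family_def)
  then have "smooth_on ?S (\<lambda>y. (\<lambda>(s, x). W s x) ((0, (t, 0)) + (fst y, (0, snd y))))"
  proof (rule smooth_on_affine_subst)
    show "bounded_linear (\<lambda>y :: real \<times> real. (fst y, (0 :: real, snd y)))"
      by (intro bounded_linear_Pair bounded_linear_fst bounded_linear_snd bounded_linear_zero)
    show "(fst e, (0, snd e)) \<in> Basis" if "e \<in> Basis" for e :: "real \<times> real"
      using that unfolding Basis_real2 by (auto simp: Basis_prod_def zero_prod_def)
    show "(0, (t, 0)) + (fst y, (0, snd y)) \<in> {-\<epsilon><..<\<epsilon>} \<times> annulus T" if "y \<in> ?S" for y :: "real \<times> real"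
      using that ta by auto
  qed
  then have W: "smooth_on ?S (\<lambda>y. W (fst y) (t, snd y))" by simp
  have "smooth_on ?S (\<lambda>(s, \<theta>). P s (t, \<theta>))" using F t by (auto simp: smooth_family_def)
  then have P: "smooth_on ?S (\<lambda>y. P (fst y) (t, snd y))" by (simp add: case_prod_unfold)
  have "W (fst y) (t, snd y) > 0" if "y \<in> ?S" for y
  proof -
    have "conformal_metric T (W (fst y))" using F that by (auto simp: smooth_family_def)
    then show ?thesis using ta by (auto simp: conformal_metric_def)
  qed
  then show ?thesis by (intro smooth_on_mult P smooth_on_sqrt W)
qed

lemma square_smallo: "(\<lambda>s :: real. C * s\<^sup>2) \<in> o[at 0](\<lambda>s. s)"
proof (rule smalloI_tendsto)
  have "((\<lambda>s :: real. C * s) \<longlongrightarrow> C * 0) (at 0)" by (intro tendsto_intros)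
  then have "((\<lambda>s :: real. C * s) \<longlongrightarrow> 0) (at 0)" by simp
  then show "((\<lambda>s. C * s\<^sup>2 / s) \<longlongrightarrow> 0) (at 0)"
    by (rule Lim_transform_eventually) (auto simp: eventually_at_filter power2_eq_square)
  show "\<forall>\<^sub>F s :: real in at 0. s \<noteq> 0" by (simp add: eventually_at_filter)
qed

lemma not_lin_indep_multiples:
  assumes len: "length us \<ge> 2" and u: "\<And>x. x \<in> A \<Longrightarrow> (us ! 0) x = \<alpha> * \<phi> x" "\<And>x. x \<in> A \<Longrightarrow> (us ! 1) x = \<beta> * \<phi> x"
  shows "\<not> lin_indep_on A us"
proof
  assume li: "lin_indep_on A us"
  define c :: "nat \<Rightarrow> real" where "c j = (if j = 0 then \<beta> else if j = 1 then - \<alpha> else 0)" for j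
  have "(\<Sum>i<length us. c i * (us ! i) x) = 0" if "x \<in> A" for x
  proof -
    have "(\<Sum>i<length us. c i * (us ! i) x) = (\<Sum>i\<in>{0, 1}. c i * (us ! i) x)"
      by (rule sum.mono_neutral_right) (use len in \<open>auto simp: c_def\<close>)
    also have "\<dots> = 0" using u[OF that] by (simp add: c_def)
    finally show ?thesis .
  qed
  with li have "\<forall>i<length us. c i = 0" unfolding lin_indep_on_def by blast
  moreover have "0 < length us" "1 < length us" using len by auto
  ultimately have "c 1 = 0" by blast
  then have "(us ! 0) x = 0" if "x \<in> A" for x using u(1)[OF that] by (simp add: c_def)
  then show False using lin_indep_nonzero[OF li \<open>0 < length us\<close>] by blast
qed

lemma harmonic_affine:
  assumes T: "T > 0"
  shows "harmonic T w (\<lambda>x. \<alpha> + \<gamma> * fst x)" "x \<in> annulus T \<Longrightarrow> d_t T (\<lambda>x. \<alpha> + \<gamma> * fst x) x = (\<gamma> :: real)"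
proof -
  have d: "((\<lambda>x :: real \<times> real. \<alpha> + \<gamma> * fst x) has_derivative (\<lambda>h. fst h *\<^sub>R \<gamma> + snd h *\<^sub>R 0)) (at x within S)" for x S
    by (auto intro!: derivative_eq_intros)
  show "harmonic T w (\<lambda>x. \<alpha> + \<gamma> * fst x)"
    by (rule harmonicI[OF T, where ?u1.0 = "\<lambda>_. \<gamma>" and ?u2.0 = "\<lambda>_. 0" and ?u11.0 = "\<lambda>_. 0"
         and ?u12.0 = "\<lambda>_. 0" and ?u21.0 = "\<lambda>_. 0" and ?u22.0 = "\<lambda>_. 0"])
       (use d in \<open>auto intro!: smooth_intros\<close>)
  show "x \<in> annulus T \<Longrightarrow> d_t T (\<lambda>x. \<alpha> + \<gamma> * fst x) x = \<gamma>" by (rule d_t_d_theta_eq(1)[OF T _ d])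
qed

context catenoidal_map
begin

text \<open>The neck equation \<open>coth p + coth (T - p) = T\<close> in terms of the boundary weights.\<close>

lemma rho_sum: "rho0 + rho1 = T * rho0 * rho1"
proof -
  have "T * rho0 * rho1 = (q * tanh p) * rho1 + ((T - q) * tanh (T - p)) * rho0"
    by (simp add: rho0_def rho1_def algebra_simps)
  then show ?thesis unfolding q by simp
qed

lemma in_annulus: "(0, \<theta>) \<in> annulus T" "(T, \<theta>) \<in> annulus T"
  using T by (auto simp: annulus_def)

lemma gb_pos: "x \<in> annulus_bdry T \<Longrightarrow> g x > 0" using g_pos bdry_subset by blast

text \<open>
  Below eigenvalue \<open>1\<close> the Robin parameters \<open>s rho0\<close> and \<open>s rho1\<close> are subcritical, so the
  eigenfunction is affine in \<open>t\<close>; \<open>rho_sum\<close> says that \<open>1\<close> is the only eigenvalue with a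
  nonconstant affine eigenfunction.
\<close>

lemma subcritical_eigenfunction_constant:
  assumes u: "steklov_eigenfunction T g \<rho> s u" and s: "s < 1"
  shows "\<exists>\<alpha>. \<forall>x\<in>annulus T. u x = \<alpha>"
proof -
  have e: "harmonic T g u" "\<And>\<theta>. - d_t T u (0, \<theta>) = s * rho0 * u (0, \<theta>)" "\<And>\<theta>. d_t T u (T, \<theta>) = s * rho1 * u (T, \<theta>)"
    using u steklov_eigenfunction_weight_iff[of T g \<rho> s u] T gb_pos unfolding weight_eq by blast+
  interpret H: harmonic_annulus T g u by unfold_locales (use T e g_pos in auto)
  have "s * rho0 < tanh p" "s * rho1 < tanh (T - p)"
    using s rho_pos unfolding rho0_def rho1_def by simp_all
  then obtain \<alpha> \<gamma> where a: "\<And>t \<theta>. t \<in> {0..T} \<Longrightarrow> u (t, \<theta>) = \<alpha> + \<gamma> * t" "- \<gamma> = s * rho0 * \<alpha>" "\<gamma> = s * rho1 * (\<alpha> + \<gamma> * T)"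
    by (rule H.robin_affine[OF e(2,3)]) blast
  have "\<gamma> = 0"
  proof (rule ccontr)
    assume g0: "\<gamma> \<noteq> 0"
    have "rho0 * \<gamma> = rho1 * (s * rho0 * \<alpha>) + s * (T * rho0 * rho1) * \<gamma>"
      by (subst a(3)) (simp add: algebra_simps)
    then have "(rho0 + rho1) * \<gamma> = s * (rho0 + rho1) * \<gamma>"
      unfolding a(2)[symmetric] rho_sum[symmetric] by (simp add: algebra_simps)
    then show False using g0 s rho_pos by simp
  qed
  then have "\<forall>x\<in>annulus T. u x = \<alpha>" using a(1) by (auto simp: annulus_def)
  then show ?thesis by blast
qed

text \<open>The eigenvalue \<open>1\<close> is attained by the height function of the map.\<close>

lemma steklov_1_Psi: "steklov 1 T g \<rho> = 1"
proof -
  have lower: "1 \<le> s" if cand: "s \<in> steklov_candidates T g \<rho>" for s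
  proof (rule ccontr)
    assume s: "\<not> 1 \<le> s"
    obtain us where us: "length us = 2" "lin_indep_on (annulus T) us" "\<forall>u \<in> set us. \<exists>s' \<le> s. steklov_eigenfunction T g \<rho> s' u"
      using cand unfolding steklov_candidates_def by blast
    have c: "\<exists>\<alpha>. \<forall>x\<in>annulus T. (us ! i) x = \<alpha>" if i: "i < 2" for i
    proof -
      have "us ! i \<in> set us" using i us(1) by simp
      then obtain s' where "s' \<le> s" "steklov_eigenfunction T g \<rho> s' (us ! i)" using us(3) by blast
      then show ?thesis using subcritical_eigenfunction_constant[of s' "us ! i"] s by simp
    qed
    obtain \<alpha> where "\<forall>x\<in>annulus T. (us ! 0) x = \<alpha>" using c[of 0] by auto
    moreover obtain \<beta> where "\<forall>x\<in>annulus T. (us ! 1) x = \<beta>" using c[of 1] by auto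
    ultimately have "\<not> lin_indep_on (annulus T) us"
      using us(1) by (intro not_lin_indep_multiples[of us "annulus T" \<alpha> "\<lambda>_. 1" \<beta>]) auto
    then show False using us(2) by blast
  qed
  have "1 \<in> steklov_candidates T g \<rho>"
  proof -
    define u where "u x = - (b * q) + b * fst x" for x :: "real \<times> real"
    have u: "harmonic T g u" "\<And>x. x \<in> annulus T \<Longrightarrow> d_t T u x = b" "u (0, \<theta>) = - (b * q)" "u (T, \<theta>) = - (b * q) + b * T" for \<theta>
      using harmonic_affine[OF T, where \<alpha> = "- (b * q)" and \<gamma> = b] by (simp_all add: u_def[abs_def])
    have "rho0 * (- (b * q)) = - (b * (q * tanh p))" "rho1 * (- (b * q) + b * T) = b * ((T - q) * tanh (T - p))"
      by (simp_all add: rho0_def rho1_def algebra_simps)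
    then have bc: "rho0 * (- (b * q)) = - b" "rho1 * (- (b * q) + b * T) = b" unfolding q by simp_all
    have "steklov_eigenfunction T g \<rho> 1 u"
    proof (subst steklov_eigenfunction_weight_iff[OF T])
      show "0 < g x" if "x \<in> annulus_bdry T" for x by (rule gb_pos[OF that])
      show "harmonic T g u \<and> (\<forall>\<theta>. - d_t T u (0, \<theta>) = 1 * (\<rho> (0, \<theta>) * sqrt (g (0, \<theta>))) * u (0, \<theta>)) \<and>
          (\<forall>\<theta>. d_t T u (T, \<theta>) = 1 * (\<rho> (T, \<theta>) * sqrt (g (T, \<theta>))) * u (T, \<theta>))"
        unfolding weight_eq u(3,4) mult_1_left bc using u(1,2) in_annulus by simp
    qed
    moreover have "steklov_eigenfunction T g \<rho> 0 (\<lambda>_. 1)"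
      by (rule constant_steklov_eigenfunction[OF T gb_pos])
    moreover have "\<nexists>c. \<forall>x\<in>annulus T. u x = c"
    proof
      assume "\<exists>c. \<forall>x\<in>annulus T. u x = c"
      then obtain c where "\<And>x. x \<in> annulus T \<Longrightarrow> u x = c" by blast
      from this[OF in_annulus(1)] this[OF in_annulus(2)] show False using ab T by (simp add: u_def)
    qed
    ultimately show ?thesis
      using lin_indep_one_nonconstant[of "annulus T" u]
      unfolding steklov_candidates_def by (intro CollectI exI[of _ "[\<lambda>_. 1, u]"]) (auto intro: exI[of _ "0 :: real"])
  qed
  then show ?thesis unfolding steklov_1
    using lower by (intro cInf_eq_minimum) auto
qed

lemma steklov_bar_Psi: "steklov_bar 1 T g \<rho> = 2 * pi * (rho0 + rho1)"
  unfolding steklov_bar_def steklov_1_Psi bdry_integral_Psi by simp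

text \<open>
  Of the two alternatives in the definition it is the upper bound that holds, for every family,
  with a quadratic error. Along the family the total mass \<open>M\<close> stays close to its initial value
  \<open>m = 2E\<close>, and the moments of \<open>hersch\<close> are at most \<open>K |s|\<close> because they vanish at \<open>s = 0\<close>. So
  \<open>\<sigma>\<^sub>1 M \<le> m M\<^sup>2 / (M\<^sup>2 - N)\<close> with \<open>N = O(s\<^sup>2)\<close>. The bound \<open>d\<close> on \<open>|s|\<close> guarantees \<open>N \<le> M\<^sup>2 / 2\<close>
  and \<open>M \<ge> m / 2\<close>, and the constant \<open>C\<close> is then what the expansion of the quotient requires.
\<close>

theorem conformally_extremal_Psi: "conformally_extremal 1 T g \<rho>"
  unfolding conformally_extremal_def
proof (intro conjI allI impI disjI1)
  show "conformal_metric T g" by (rule conformal_metric_g)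
  show "bdry_density T \<rho>" by (rule bdry_density_rho)
  fix \<epsilon> :: real and W P
  assume e: "0 < \<epsilon>" and F: "smooth_family T \<epsilon> W P" and W0: "\<forall>x\<in>annulus T. W 0 x = g x"
    and P0: "\<forall>x\<in>annulus_bdry T. P 0 x = \<rho> x"
  define B where "B t s \<theta> = P s (t, \<theta>) * sqrt (W s (t, \<theta>))" for t s \<theta>
  have B0: "B 0 0 \<theta> = rho0" "B T 0 \<theta> = rho1" for \<theta>
    using W0 P0 in_annulus in_bdry weight_eq by (simp_all add: B_def)
  have sm: "smooth_on ({-\<epsilon><..<\<epsilon>} \<times> UNIV) (\<lambda>x. B t (fst x) (snd x))" if "t \<in> {0, T}" for t
    using smooth_family_weight[OF T F that] by (simp add: B_def)
  obtain K0 where K0: "K0 \<ge> 0" "\<And>s \<theta>. \<bar>s\<bar> \<le> \<epsilon> / 2 \<Longrightarrow> \<theta> \<in> {0..2 * pi} \<Longrightarrow> \<bar>B 0 s \<theta> - rho0\<bar> \<le> K0 * \<bar>s\<bar>"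
    using smooth_family_lipschitz[OF e sm[of 0]] B0(1) by auto
  obtain K1 where K1: "K1 \<ge> 0" "\<And>s \<theta>. \<bar>s\<bar> \<le> \<epsilon> / 2 \<Longrightarrow> \<theta> \<in> {0..2 * pi} \<Longrightarrow> \<bar>B T s \<theta> - rho1\<bar> \<le> K1 * \<bar>s\<bar>"
    using smooth_family_lipschitz[OF e sm[of T]] B0(2) by auto
  define K where "K = 2 * pi * (K0 + K1)"
  have K: "K \<ge> 0" using K0 K1 by (simp add: K_def)
  define m where "m = 2 * pi * (rho0 + rho1)"
  have m: "m > 0" using rho_pos by (simp add: m_def)
  let ?I = "integral {0..2 * pi}"
  define C where "C = 8 * (3 * K\<^sup>2) / m"
  define d where "d = min (\<epsilon> / 2) (m / (8 * K + 8))"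
  have d: "d > 0" "d \<le> \<epsilon> / 2" "d \<le> m / (8 * K + 8)"
  proof -
    show "d > 0" unfolding d_def using e m K by simp
    show "d \<le> \<epsilon> / 2" unfolding d_def by (rule min.cobounded1)
    show "d \<le> m / (8 * K + 8)" unfolding d_def by (rule min.cobounded2)
  qed
  have key: "steklov_bar 1 T (W s) (P s) \<le> m + C * s\<^sup>2" if s: "\<bar>s\<bar> \<le> d" for s
  proof -
    have s': "\<bar>s\<bar> \<le> \<epsilon> / 2" "s \<in> {-\<epsilon><..<\<epsilon>}" using s d(2) e by (auto simp: abs_le_iff)
    have wr: "conformal_metric T (W s)" "bdry_density T (P s)" using F s'(2) by (auto simp: smooth_family_def)
    interpret bw: boundary_weight T "B 0 s" "B T s"
      using boundary_weight_of_density[OF T wr] unfolding B_def[abs_def] .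
    note [continuous_intros] = bw.cont
    have ci: "continuous_on {0..2*pi} (\<lambda>\<theta>. (B 0 s \<theta> * x + B T s \<theta> * y) * w \<theta>)" if "continuous_on {0..2*pi} w" for x y and w :: "real \<Rightarrow> real"
      by (intro continuous_intros that)
    have close: "\<bar>?I (\<lambda>\<theta>. (B 0 s \<theta> * x + B T s \<theta> * y) * w \<theta>) - (rho0 * x + rho1 * y) * ?I w\<bar> \<le> K * \<bar>s\<bar>"
      if xy: "\<bar>x\<bar> \<le> 1" "\<bar>y\<bar> \<le> 1" and w: "continuous_on {0..2*pi} w" "\<And>\<theta>. \<bar>w \<theta>\<bar> \<le> 1" for x y and w :: "real \<Rightarrow> real"
    proof -
      let ?F = "\<lambda>\<theta>. ((B 0 s \<theta> - rho0) * x + (B T s \<theta> - rho1) * y) * w \<theta>"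
      have "?I (\<lambda>\<theta>. (B 0 s \<theta> * x + B T s \<theta> * y) * w \<theta>) - (rho0 * x + rho1 * y) * ?I w =
        ?I (\<lambda>\<theta>. (B 0 s \<theta> * x + B T s \<theta> * y) * w \<theta>) - ?I (\<lambda>\<theta>. (rho0 * x + rho1 * y) * w \<theta>)" by simp
      also have "\<dots> = ?I (\<lambda>\<theta>. (B 0 s \<theta> * x + B T s \<theta> * y) * w \<theta> - (rho0 * x + rho1 * y) * w \<theta>)"
        by (rule integral_diff[symmetric]) (intro integrable_continuous_real ci w continuous_intros)+
      also have "\<dots> = ?I ?F" by (simp add: algebra_simps)
      finally have eq: "?I (\<lambda>\<theta>. (B 0 s \<theta> * x + B T s \<theta> * y) * w \<theta>) - (rho0 * x + rho1 * y) * ?I w = ?I ?F" .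
      have "norm (?I ?F) \<le> ?I (\<lambda>_. (K0 + K1) * \<bar>s\<bar>)"
      proof (rule integral_norm_bound_integral)
        show "?F integrable_on {0..2*pi}" by (intro integrable_continuous_real continuous_intros w)
        fix \<theta> assume \<theta>: "\<theta> \<in> {0..2*pi}"
        have "\<bar>(B 0 s \<theta> - rho0) * x\<bar> \<le> (K0 * \<bar>s\<bar>) * 1" "\<bar>(B T s \<theta> - rho1) * y\<bar> \<le> (K1 * \<bar>s\<bar>) * 1"
          unfolding abs_mult using K0(1) K1(1)
          by (intro mult_mono K0(2)[OF s'(1) \<theta>] K1(2)[OF s'(1) \<theta>] xy; simp)+
        then have "\<bar>(B 0 s \<theta> - rho0) * x + (B T s \<theta> - rho1) * y\<bar> \<le> (K0 + K1) * \<bar>s\<bar>"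
          unfolding distrib_right by linarith
        then have "\<bar>(B 0 s \<theta> - rho0) * x + (B T s \<theta> - rho1) * y\<bar> * \<bar>w \<theta>\<bar> \<le> (K0 + K1) * \<bar>s\<bar> * 1"
          using w(2) K0 K1 by (intro mult_mono) auto
        then show "norm (?F \<theta>) \<le> (K0 + K1) * \<bar>s\<bar>" by (simp add: abs_mult)
      qed auto
      then show ?thesis unfolding eq K_def by (simp add: algebra_simps)
    qed
    define M where "M = ?I (\<lambda>\<theta>. B 0 s \<theta> + B T s \<theta>)"
    define N1 where "N1 = ?I (\<lambda>\<theta>. (B 0 s \<theta> * f0 + B T s \<theta> * f1) * cos \<theta>)"
    define N2 where "N2 = ?I (\<lambda>\<theta>. (B 0 s \<theta> * f0 + B T s \<theta> * f1) * sin \<theta>)"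
    define N3 where "N3 = ?I (\<lambda>\<theta>. B 0 s \<theta> * h0 + B T s \<theta> * h1)"
    have le1: "\<bar>f0\<bar> \<le> 1" "\<bar>f1\<bar> \<le> 1" "\<bar>h0\<bar> \<le> 1" "\<bar>h1\<bar> \<le> 1"
    proof -
      have "f0\<^sup>2 \<le> 1" "f1\<^sup>2 \<le> 1" "h0\<^sup>2 \<le> 1" "h1\<^sup>2 \<le> 1"
        using sphere zero_le_power2[of f0] zero_le_power2[of f1] zero_le_power2[of h0] zero_le_power2[of h1] by linarith+
      then show "\<bar>f0\<bar> \<le> 1" "\<bar>f1\<bar> \<le> 1" "\<bar>h0\<bar> \<le> 1" "\<bar>h1\<bar> \<le> 1" by (simp_all add: abs_square_le_1)
    qed
    have I0: "?I cos = 0" "?I sin = 0"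
      using integral_cos_freq[of 1 0] integral_cos_freq[of 1 "- pi / 2"] by (simp_all add: cos_diff)
    have N1: "\<bar>N1\<bar> \<le> K * \<bar>s\<bar>" using close[OF le1(1,2), of cos] I0 by (simp add: N1_def continuous_intros)
    have N2: "\<bar>N2\<bar> \<le> K * \<bar>s\<bar>" using close[OF le1(1,2), of sin] I0 by (simp add: N2_def continuous_intros)
    have N3: "\<bar>N3\<bar> \<le> K * \<bar>s\<bar>" using close[OF le1(3,4), of "\<lambda>_. 1"] balance by (simp add: N3_def)
    have Mm: "\<bar>M - m\<bar> \<le> K * \<bar>s\<bar>" using close[of 1 1 "\<lambda>_. 1"] by (simp add: M_def m_def mult.commute)
    have H: "M > 0" "steklov 1 T (W s) (P s) * (M\<^sup>2 - (N1\<^sup>2 + N2\<^sup>2 + N3\<^sup>2)) \<le> m * M"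
      using hersch[OF wr] unfolding M_def N1_def N2_def N3_def m_def B_def by simp_all
    have bi: "bdry_integral T (W s) (P s) = M"
    proof -
      have "?I (\<lambda>\<theta>. B 0 s \<theta> + B T s \<theta>) = ?I (B 0 s) + ?I (B T s)"
        by (rule integral_add) (intro integrable_continuous_real bw.cont)+
      then show ?thesis using T by (simp add: bdry_integral_def M_def B_def[abs_def])
    qed
    define N where "N = N1\<^sup>2 + N2\<^sup>2 + N3\<^sup>2"
    have sq: "x\<^sup>2 \<le> K\<^sup>2 * s\<^sup>2" if "\<bar>x\<bar> \<le> K * \<bar>s\<bar>" for x
      using power_mono[OF that, of 2] by (simp add: power_mult_distrib)
    have N: "N \<le> 3 * K\<^sup>2 * s\<^sup>2" "N \<ge> 0" unfolding N_def using sq[OF N1] sq[OF N2] sq[OF N3] by auto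
    have Ks: "K * \<bar>s\<bar> \<le> m / 8"
    proof -
      have "\<bar>s\<bar> \<le> m / (8 * K + 8)" using s d(3) by simp
      then have "K * \<bar>s\<bar> \<le> K * (m / (8 * K + 8))" using K by (rule mult_left_mono)
      also have "\<dots> \<le> m / 8" using K m by (simp add: field_simps)
      finally show ?thesis .
    qed
    then have Mlow: "M \<ge> m / 2" using Mm m by (auto simp: abs_le_iff)
    have M2: "M\<^sup>2 \<ge> m\<^sup>2 / 4" using power_mono[OF Mlow, of 2] m by (simp add: power_divide)
    have "(K * \<bar>s\<bar>)\<^sup>2 \<le> (m / 8)\<^sup>2" using Ks K by (intro power_mono) auto
    then have "K\<^sup>2 * s\<^sup>2 \<le> m\<^sup>2 / 64" by (simp add: power_mult_distrib power_divide)
    then have N2': "N \<le> M\<^sup>2 / 2" using N(1) M2 zero_le_power2[of m] by linarith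
    define S where "S = steklov_bar 1 T (W s) (P s)"
    have "S * (M\<^sup>2 - N) \<le> m * M\<^sup>2"
      using mult_right_mono[OF H(2), of M] H(1) by (simp add: S_def steklov_bar_def bi N_def power2_eq_square mult.commute mult.left_commute)
    also have "\<dots> \<le> (m + C * s\<^sup>2) * (M\<^sup>2 - N)"
    proof -
      have "C * s\<^sup>2 * (M\<^sup>2 - N) \<ge> C * s\<^sup>2 * (m\<^sup>2 / 8)"
        using N2' M2 m K by (intro mult_left_mono) (auto simp: C_def)
      moreover have "C * s\<^sup>2 * (m\<^sup>2 / 8) = m * (3 * K\<^sup>2 * s\<^sup>2)" using m by (simp add: C_def power2_eq_square)
      moreover have "m * N \<le> m * (3 * K\<^sup>2 * s\<^sup>2)" using N m by (intro mult_left_mono) auto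
      moreover have "(m + C * s\<^sup>2) * (M\<^sup>2 - N) = m * M\<^sup>2 - m * N + C * s\<^sup>2 * (M\<^sup>2 - N)" by (simp add: algebra_simps)
      ultimately show ?thesis by linarith
    qed
    finally have "S * (M\<^sup>2 - N) \<le> (m + C * s\<^sup>2) * (M\<^sup>2 - N)" .
    moreover have "M\<^sup>2 - N > 0"
    proof -
      have "M\<^sup>2 > 0" using H(1) by simp
      then show ?thesis using N2' by linarith
    qed
    ultimately show ?thesis by (simp add: S_def)
  qed
  show "\<exists>r\<in>o[at 0](\<lambda>s. s). \<forall>\<^sub>F s in at 0. steklov_bar 1 T (W s) (P s) \<le> steklov_bar 1 T g \<rho> + r s"
  proof (rule bexI[OF _ square_smallo[of C]])
    have "\<forall>\<^sub>F s in at 0. \<bar>s\<bar> < d" using d(1) by (auto simp: eventually_at dist_real_def)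
    then show "\<forall>\<^sub>F s in at 0. steklov_bar 1 T (W s) (P s) \<le> steklov_bar 1 T g \<rho> + C * s\<^sup>2"
      unfolding steklov_bar_Psi m_def[symmetric] by eventually_elim (rule key, simp)
  qed
qed

section \<open>Spectral index\<close>

text \<open>
  For functions affine in \<open>t\<close>, the eigenvalue equation of the index operator is quadratic in \<open>\<mu>\<close>.
  One root is \<open>0\<close>, with the height function as eigenfunction, and \<open>mu0\<close> is the other one.
\<close>

definition mu0 :: real where "mu0 = 2 / T - (rho0 + rho1)"

text \<open>
  By \<open>rho_sum\<close> and the arithmetic-geometric mean inequality,
  \<open>T (rho0 + rho1)\<^sup>2 \<ge> 4 T rho0 rho1 = 4 (rho0 + rho1)\<close>.
\<close>

lemma mu0_neg: "mu0 < 0"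
proof -
  have "0 \<le> (rho0 - rho1)\<^sup>2" by simp
  then have "4 * (rho0 * rho1) \<le> (rho0 + rho1)\<^sup>2" by (simp add: power2_eq_square algebra_simps)
  then have "T * (4 * (rho0 * rho1)) \<le> T * (rho0 + rho1)\<^sup>2" using T by (intro mult_left_mono) auto
  then have "4 * (rho0 + rho1) \<le> (T * (rho0 + rho1)) * (rho0 + rho1)"
    using rho_sum by (simp add: power2_eq_square mult.assoc)
  then have "4 \<le> T * (rho0 + rho1)" by (rule mult_right_le_imp_le) (use rho_pos in simp)
  then have "2 < T * (rho0 + rho1)" by linarith
  then show ?thesis unfolding mu0_def using T by (simp add: field_simps)
qed

lemma index_eigenfunction_iff:
  "index_eigenfunction T flat Psi \<mu> u \<longleftrightarrow> smooth_bdry_fun T u \<and> (\<exists>v. harmonic T flat v \<and>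
     (\<forall>\<theta>. v (0, \<theta>) = u (0, \<theta>) \<and> v (T, \<theta>) = u (T, \<theta>) \<and>
       - d_t T v (0, \<theta>) = (rho0 + \<mu>) * v (0, \<theta>) \<and> d_t T v (T, \<theta>) = (rho1 + \<mu>) * v (T, \<theta>)))"
proof -
  have n: "norm (normal_deriv T flat Psi (0, \<theta>)) = rho0" "norm (normal_deriv T flat Psi (T, \<theta>)) = rho1" for \<theta>
    using norm_normal_deriv_Psi[of flat \<theta>] by (simp_all add: flat_def)
  have nd: "normal_deriv T flat v (0, \<theta>) = - d_t T v (0, \<theta>)" "normal_deriv T flat v (T, \<theta>) = d_t T v (T, \<theta>)"
    for v :: "real \<times> real \<Rightarrow> real" and \<theta> using T by (simp_all add: normal_deriv_def flat_def)
  have "(\<forall>x\<in>annulus_bdry T. v x = u x \<and> normal_deriv T flat v x - norm (normal_deriv T flat Psi x) * u x = \<mu> * u x) \<longleftrightarrow>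
    (\<forall>\<theta>. v (0, \<theta>) = u (0, \<theta>) \<and> v (T, \<theta>) = u (T, \<theta>) \<and>
       - d_t T v (0, \<theta>) = (rho0 + \<mu>) * v (0, \<theta>) \<and> d_t T v (T, \<theta>) = (rho1 + \<mu>) * v (T, \<theta>))" for v
    unfolding annulus_bdry_def by (auto simp: n nd algebra_simps)
  then show ?thesis unfolding index_eigenfunction_def by simp
qed

text \<open>
  A negative \<open>\<mu>\<close> makes the Robin parameters \<open>rho0 + \<mu>\<close> and \<open>rho1 + \<mu>\<close> subcritical, so
  \<open>robin_affine\<close> applies. The boundary conditions then force \<open>\<mu> = mu0\<close> and determine the affine
  function up to a factor.
\<close>

lemma index_eigenfunction_multiple:
  assumes u: "index_eigenfunction T flat Psi \<mu> u" and \<mu>: "\<mu> < 0"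
  shows "\<exists>\<alpha>. \<forall>x\<in>annulus_bdry T. u x = \<alpha> * (1 - (rho0 + mu0) * fst x)"
proof -
  obtain v where v: "harmonic T flat v" "\<And>\<theta>. v (0, \<theta>) = u (0, \<theta>)" "\<And>\<theta>. v (T, \<theta>) = u (T, \<theta>)"
    "\<And>\<theta>. - d_t T v (0, \<theta>) = (rho0 + \<mu>) * v (0, \<theta>)" "\<And>\<theta>. d_t T v (T, \<theta>) = (rho1 + \<mu>) * v (T, \<theta>)"
    using u unfolding index_eigenfunction_iff by blast
  interpret H: harmonic_annulus T flat v by unfold_locales (use T v in \<open>auto simp: flat_def\<close>)
  have "rho0 + \<mu> < tanh p" "rho1 + \<mu> < tanh (T - p)" using \<mu> by (simp_all add: rho0_def rho1_def)
  then obtain \<alpha> \<gamma> where a: "\<And>t \<theta>. t \<in> {0..T} \<Longrightarrow> v (t, \<theta>) = \<alpha> + \<gamma> * t" "- \<gamma> = (rho0 + \<mu>) * \<alpha>" "\<gamma> = (rho1 + \<mu>) * (\<alpha> + \<gamma> * T)"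
    by (rule H.robin_affine[OF v(4,5)]) blast
  have \<gamma>: "\<gamma> = - (rho0 + mu0) * \<alpha>"
  proof (cases "\<alpha> = 0")
    case False
    have g: "\<gamma> = - ((rho0 + \<mu>) * \<alpha>)" using a(2) by simp
    have "- ((rho0 + \<mu>) * \<alpha>) = (rho1 + \<mu>) * (\<alpha> + - ((rho0 + \<mu>) * \<alpha>) * T)"
      using a(3) unfolding g .
    then have "\<alpha> * ((rho0 + \<mu>) + (rho1 + \<mu>) - T * (rho0 + \<mu>) * (rho1 + \<mu>)) = 0"
      by (simp add: algebra_simps)
    then have "(rho0 + \<mu>) + (rho1 + \<mu>) - T * (rho0 + \<mu>) * (rho1 + \<mu>) = 0" using False by simp
    moreover have "(rho0 + \<mu>) + (rho1 + \<mu>) - T * (rho0 + \<mu>) * (rho1 + \<mu>) =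
      \<mu> * (2 - T * (rho0 + rho1 + \<mu>)) + (rho0 + rho1 - T * rho0 * rho1)" by (simp add: algebra_simps)
    ultimately have "\<mu> * (2 - T * (rho0 + rho1 + \<mu>)) = 0" using rho_sum by simp
    then have "T * (rho0 + rho1 + \<mu>) = 2" using \<mu> by simp
    then have "\<mu> = mu0" using T by (simp add: mu0_def field_simps)
    then show ?thesis using g by (simp add: algebra_simps)
  qed (use a(2) in simp)
  have "u x = \<alpha> * (1 - (rho0 + mu0) * fst x)" if "x \<in> annulus_bdry T" for x
    using that
  proof (rule in_bdry_cases)
    fix \<theta> assume "x = (0, \<theta>)"
    then show ?thesis using v(2)[of \<theta>] a(1)[of 0 \<theta>] T by simp
  next
    fix \<theta> assume "x = (T, \<theta>)"
    then show ?thesis using v(3)[of \<theta>] a(1)[of T \<theta>] T unfolding \<gamma> by (simp add: algebra_simps)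
  qed
  then show ?thesis by blast
qed

theorem spectral_index_Psi: "spectral_index T flat Psi = 1"
proof -
  define S where "S = {enat n |n. \<exists>us. length us = n \<and> lin_indep_on (annulus_bdry T) us \<and>
     (\<forall>u \<in> set us. \<exists>\<mu> < 0. index_eigenfunction T flat Psi \<mu> u)}"
  have "k \<le> 1" if k: "k \<in> S" for k
  proof -
    obtain us where us: "k = enat (length us)" "lin_indep_on (annulus_bdry T) us"
      "\<forall>u \<in> set us. \<exists>\<mu> < 0. index_eigenfunction T flat Psi \<mu> u"
      using k by (auto simp: S_def)
    have "length us \<le> 1"
    proof (rule ccontr)
      assume "\<not> length us \<le> 1"
      then have len: "length us \<ge> 2" by simp
      have m: "\<exists>\<alpha>. \<forall>x\<in>annulus_bdry T. (us ! i) x = \<alpha> * (1 - (rho0 + mu0) * fst x)" if "i < 2" for i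
      proof -
        have "us ! i \<in> set us" using that len by simp
        then show ?thesis using us(3) index_eigenfunction_multiple by blast
      qed
      obtain \<alpha> where "\<forall>x\<in>annulus_bdry T. (us ! 0) x = \<alpha> * (1 - (rho0 + mu0) * fst x)" using m[of 0] by auto
      moreover obtain \<beta> where "\<forall>x\<in>annulus_bdry T. (us ! 1) x = \<beta> * (1 - (rho0 + mu0) * fst x)" using m[of 1] by auto
      ultimately show False
        using us(2) not_lin_indep_multiples[OF len, of "annulus_bdry T" \<alpha> "\<lambda>x. 1 - (rho0 + mu0) * fst x" \<beta>] by blast
    qed
    then show ?thesis unfolding us(1) one_enat_def by simp
  qed
  moreover have "1 \<in> S"
  proof -
    define \<kappa> where "\<kappa> = - (rho0 + mu0)"
    define u where "u x = 1 + \<kappa> * fst x" for x :: "real \<times> real"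
    have u: "harmonic T flat u" "\<And>x. x \<in> annulus T \<Longrightarrow> d_t T u x = \<kappa>" "u (0, \<theta>) = 1" "u (T, \<theta>) = 1 + \<kappa> * T" for \<theta>
      using harmonic_affine[OF T, where \<alpha> = 1 and \<gamma> = \<kappa>] by (simp_all add: u_def[abs_def])
    have root: "(rho1 + mu0) * (1 + \<kappa> * T) = \<kappa>"
    proof -
      have "T * (rho0 + rho1 + mu0) = 2" using T by (simp add: mu0_def algebra_simps)
      moreover have "(rho1 + mu0) * (1 + \<kappa> * T) - \<kappa> =
        mu0 * (2 - T * (rho0 + rho1 + mu0)) + (rho0 + rho1 - T * rho0 * rho1)" by (simp add: \<kappa>_def algebra_simps)
      ultimately show ?thesis using rho_sum by simp
    qed
    have "smooth_bdry_fun T u" by (auto simp: smooth_bdry_fun_def smooth_on_const u_def)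
    moreover have "- \<kappa> = (rho0 + mu0) * 1" by (simp add: \<kappa>_def)
    ultimately have "index_eigenfunction T flat Psi mu0 u"
      unfolding index_eigenfunction_iff using u(1,2) in_annulus root
      by (intro conjI exI[of _ u]) (simp_all add: u(3,4))
    moreover have "lin_indep_on (annulus_bdry T) [u]"
      unfolding lin_indep_on_def
    proof (intro allI impI)
      fix c :: "nat \<Rightarrow> real" and i
      assume z: "\<forall>x\<in>annulus_bdry T. (\<Sum>i<length [u]. c i * ([u] ! i) x) = 0" and "i < length [u]"
      then show "c i = 0" using bspec[OF z in_bdry(1)[of 0]] by (simp add: u(3))
    qed
    ultimately have "enat 1 \<in> S" unfolding S_def using mu0_neg by (intro CollectI exI[of _ 1] conjI refl exI[of _ "[u]"]) auto
    then show ?thesis by (simp add: one_enat_def)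
  qed
  ultimately have "Sup S = 1" by (intro antisym Sup_least Sup_upper) auto
  then show ?thesis by (simp add: spectral_index_def S_def)
qed

section \<open>Distinct boundary densities\<close>

text \<open>
  On the boundary \<open>|\<Psi>\<^sub>t|\<close> is the flat normal derivative and \<open>|\<Psi>\<^sub>\<theta>|\<close> the radius.
\<close>

lemma factor_boundary: "2 * factor 0 = rho0\<^sup>2 + f0\<^sup>2" "2 * factor T = rho1\<^sup>2 + f1\<^sup>2"
proof -
  have t: "(norm (Psi_t (0, 0)))\<^sup>2 = rho0\<^sup>2" "(norm (Psi_t (T, 0)))\<^sup>2 = rho1\<^sup>2"
  proof -
    have "norm (- Psi_t (0, 0)) = rho0" "norm (Psi_t (T, 0)) = rho1"
      unfolding Psi_normal using norm_Psi_boundary[OF in_bdry(1)] norm_Psi_boundary[OF in_bdry(2)] rho_pos by simp_all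
    then show "(norm (Psi_t (0, 0)))\<^sup>2 = rho0\<^sup>2" "(norm (Psi_t (T, 0)))\<^sup>2 = rho1\<^sup>2" by simp_all
  qed
  show "2 * factor 0 = rho0\<^sup>2 + f0\<^sup>2" "2 * factor T = rho1\<^sup>2 + f1\<^sup>2"
    using t unfolding norm_Psi_t by (simp_all add: factor_def f0_def f1_def power_mult_distrib)
qed

text \<open>
  The square of the density at an end is \<open>2 \<rho>\<^sup>2 / (\<rho>\<^sup>2 + f\<^sup>2)\<close>, with \<open>\<rho>\<close> the flat normal
  derivative and \<open>f\<close> the radius there. It determines the ratio \<open>\<rho> / f\<close>, and \<open>f\<close> is proportional to
  \<open>cosh p\<close> and \<open>cosh (T - p)\<close>, respectively.
\<close>

lemma rho_distinct:
  assumes "rho1 / cosh (T - p) < rho0 / cosh p"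
  shows "\<rho> (0, \<theta>) \<noteq> \<rho> (T, \<theta>')"
proof
  assume "\<rho> (0, \<theta>) = \<rho> (T, \<theta>')"
  then have "rho0 / sqrt (factor 0) = rho1 / sqrt (factor T)" by (simp add: rho_eq)
  then have "(rho0 / sqrt (factor 0))\<^sup>2 = (rho1 / sqrt (factor T))\<^sup>2" by simp
  then have "rho0\<^sup>2 / factor 0 = rho1\<^sup>2 / factor T"
    using factor_pos[of 0] factor_pos[of T] by (simp add: power_divide less_imp_le)
  then have "rho0\<^sup>2 * factor T = rho1\<^sup>2 * factor 0" using factor_pos[of 0] factor_pos[of T] by (simp add: field_simps)
  then have "rho0\<^sup>2 * (2 * factor T) = rho1\<^sup>2 * (2 * factor 0)" by simp
  then have "(rho0 * f1)\<^sup>2 = (rho1 * f0)\<^sup>2"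
    unfolding factor_boundary by (simp add: power_mult_distrib algebra_simps)
  then have "rho0 * f1 = rho1 * f0"
    using rho_pos ab by (subst (asm) power2_eq_iff_nonneg) (auto simp: f0_def f1_def less_imp_le)
  then have "rho0 * cosh (T - p) = rho1 * cosh p" using ab by (simp add: f0_def f1_def)
  then have "rho0 / cosh p = rho1 / cosh (T - p)" by (simp add: field_simps)
  then show False using assms by simp
qed

end

section \<open>The critical catenoid\<close>

lemma catenoid_vec3:
  assumes "v = vec3 x y z"
  shows "v \<in> catenoid (axis 3 1) c \<longleftrightarrow> sqrt (x\<^sup>2 + y\<^sup>2) = c * cosh (z / c)"
proof -
  have e: "axis 3 1 = vec3 0 0 1" by (simp add: vec3_def)
  have z: "v \<bullet> vec3 0 0 1 = z" by (simp add: assms vec3_inner)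
  have "v - z *\<^sub>R vec3 0 0 1 = vec3 x y 0" unfolding assms by (rule vec3_eqI) simp_all
  moreover have "norm (vec3 x y 0) = sqrt (x\<^sup>2 + y\<^sup>2)"
    using norm_vec3[of x y 0] by (metis add_0_right norm_ge_zero real_sqrt_abs abs_of_nonneg zero_power2)
  ultimately show ?thesis unfolding catenoid_def e using z by simp
qed

definition catenoid_point :: "real \<Rightarrow> real \<Rightarrow> real \<Rightarrow> real^3" where
  "catenoid_point c \<tau> \<theta> = vec3 (c * cosh \<tau> * cos \<theta>) (c * cosh \<tau> * sin \<theta>) (c * \<tau>)"

lemma norm_catenoid_point: "(norm (catenoid_point c \<tau> \<theta>))\<^sup>2 = c\<^sup>2 * ((cosh \<tau>)\<^sup>2 + \<tau>\<^sup>2)"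
proof -
  have "(c * cosh \<tau> * cos \<theta>)\<^sup>2 + (c * cosh \<tau> * sin \<theta>)\<^sup>2 = (c * cosh \<tau>)\<^sup>2"
    by (simp add: power_mult_distrib distrib_left[symmetric])
  then show ?thesis unfolding catenoid_point_def norm_vec3 by (simp add: power_mult_distrib distrib_left)
qed

lemma catenoid_point_in: assumes "c > 0" shows "catenoid_point c \<tau> \<theta> \<in> catenoid (axis 3 1) c"
proof -
  have "(c * cosh \<tau> * cos \<theta>)\<^sup>2 + (c * cosh \<tau> * sin \<theta>)\<^sup>2 = (c * cosh \<tau>)\<^sup>2"
    by (simp add: power_mult_distrib distrib_left[symmetric])
  then show ?thesis
    using assms by (subst catenoid_vec3[OF catenoid_point_def]) simp
qed

lemma catenoid_point_surj:
  assumes c: "c > 0" and v: "v \<in> catenoid (axis 3 1) c"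
  obtains \<tau> \<theta> where "0 \<le> \<theta>" "\<theta> < 2 * pi" "v = catenoid_point c \<tau> \<theta>"
proof -
  define x y z where "x = v $ 1" and "y = v $ 2" and "z = v $ 3"
  have vv: "v = vec3 x y z" by (rule vec3_eqI) (simp_all add: x_def y_def z_def)
  define R where "R = c * cosh (z / c)"
  have R: "R > 0" using c by (simp add: R_def)
  have "sqrt (x\<^sup>2 + y\<^sup>2) = R" using v catenoid_vec3[OF vv] by (simp add: R_def)
  then have s: "x\<^sup>2 + y\<^sup>2 = R\<^sup>2" by (metis real_sqrt_pow2_iff sum_power2_ge_zero)
  have "(x / R)\<^sup>2 + (y / R)\<^sup>2 = 1" using s R by (simp add: power_divide add_divide_distrib[symmetric])
  then obtain \<theta> where \<theta>: "0 \<le> \<theta>" "\<theta> < 2 * pi" "x / R = cos \<theta>" "y / R = sin \<theta>"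
    using sincos_total_2pi by blast
  have "x = R * cos \<theta>" "y = R * sin \<theta>" using \<theta>(3,4) R by (simp_all add: field_simps)
  moreover have "z = c * (z / c)" using c by simp
  ultimately have "v = catenoid_point c (z / c) \<theta>" unfolding vv catenoid_point_def R_def by simp
  then show thesis by (rule that[OF \<theta>(1,2)])
qed

lemma catenoid_point_inj:
  assumes c: "c > 0" and eq: "catenoid_point c \<tau> \<theta> = catenoid_point c \<tau>' \<theta>'"
    and \<theta>: "0 \<le> \<theta>" "\<theta> < 2 * pi" "0 \<le> \<theta>'" "\<theta>' < 2 * pi"
  shows "\<tau> = \<tau>' \<and> \<theta> = \<theta>'"
proof -
  have "catenoid_point c \<tau> \<theta> $ i = catenoid_point c \<tau>' \<theta>' $ i" for i using eq by simp
  from this[of 1] this[of 2] this[of 3]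
  have e: "c * \<tau> = c * \<tau>'" "c * cosh \<tau> * cos \<theta> = c * cosh \<tau>' * cos \<theta>'" "c * cosh \<tau> * sin \<theta> = c * cosh \<tau>' * sin \<theta>'"
    by (simp_all add: catenoid_point_def)
  have t: "\<tau> = \<tau>'" using e(1) c by simp
  then have "cos \<theta> = cos \<theta>'" "sin \<theta> = sin \<theta>'" using e(2,3) c by (simp_all add: cosh_real_nonzero)
  then have "sin \<theta> = sin \<theta>' \<and> cos \<theta> = cos \<theta>'" by simp
  then obtain n :: int where n: "\<theta> = \<theta>' + 2 * pi * n" using sin_cos_eq_iff by blast
  have "\<bar>2 * pi * n\<bar> < 2 * pi * 1" using n \<theta> by linarith
  then have "\<bar>real_of_int n\<bar> < 1" by (simp add: abs_mult)
  then have "n = 0" by linarith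
  then show ?thesis using n t by simp
qed

lemma cosh_abs_mono: "\<bar>x\<bar> < \<bar>y\<bar> \<Longrightarrow> (cosh x)\<^sup>2 + x\<^sup>2 < (cosh y)\<^sup>2 + y\<^sup>2" for x y :: real
proof -
  assume h: "\<bar>x\<bar> < \<bar>y\<bar>"
  have "cosh \<bar>x\<bar> < cosh \<bar>y\<bar>" by (rule iffD2[OF cosh_real_nonneg_less_iff h]) simp_all
  then have "(cosh \<bar>x\<bar>)\<^sup>2 < (cosh \<bar>y\<bar>)\<^sup>2" by (rule power_strict_mono) simp_all
  moreover have "\<bar>x\<bar>\<^sup>2 < \<bar>y\<bar>\<^sup>2" using h by (intro power_strict_mono) auto
  ultimately show ?thesis by simp
qed

definition catenoid_in_ball :: "real \<Rightarrow> (real^3) set" where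
  "catenoid_in_ball c = catenoid (axis 3 1) c \<inter> cball 0 1"

text \<open>
  A point of the catenoid with parameter \<open>\<tau>\<close> has squared norm \<open>c\<^sup>2 (cosh\<^sup>2 \<tau> + \<tau>\<^sup>2)\<close>, which is
  increasing in \<open>|\<tau>|\<close>, so the catenoid meets the sphere exactly at \<open>\<tau> = \<plusminus>t1\<close>. There
  \<open>\<tau> sinh \<tau> = cosh \<tau>\<close>, and this means that the velocity of the meridian, multiplied by \<open>\<tau>\<close>, is the
  position vector.
\<close>

lemma critical_catenoid_in_ball:
  assumes c: "c > 0" and unit: "c\<^sup>2 * ((cosh t1)\<^sup>2 + t1\<^sup>2) = 1"
  shows "critical_catenoid (catenoid_in_ball c)"
proof -
  have on_sphere: "catenoid_point c \<tau> \<theta> \<in> sphere 0 1 \<longleftrightarrow> \<bar>\<tau>\<bar> = t1" for \<tau> \<theta>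
  proof -
    have "catenoid_point c \<tau> \<theta> \<in> sphere 0 1 \<longleftrightarrow> (norm (catenoid_point c \<tau> \<theta>))\<^sup>2 = 1\<^sup>2"
      using power2_eq_iff_nonneg[of "norm (catenoid_point c \<tau> \<theta>)" 1] by simp
    also have "\<dots> \<longleftrightarrow> c\<^sup>2 * ((cosh \<tau>)\<^sup>2 + \<tau>\<^sup>2) = c\<^sup>2 * ((cosh t1)\<^sup>2 + t1\<^sup>2)"
      unfolding norm_catenoid_point unit by simp
    also have "\<dots> \<longleftrightarrow> (cosh \<tau>)\<^sup>2 + \<tau>\<^sup>2 = (cosh t1)\<^sup>2 + t1\<^sup>2" using c by simp
    also have "\<dots> \<longleftrightarrow> \<bar>\<tau>\<bar> = \<bar>t1\<bar>"
    proof
      assume "(cosh \<tau>)\<^sup>2 + \<tau>\<^sup>2 = (cosh t1)\<^sup>2 + t1\<^sup>2"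
      then show "\<bar>\<tau>\<bar> = \<bar>t1\<bar>" using cosh_abs_mono[of \<tau> t1] cosh_abs_mono[of t1 \<tau>]
        by (cases "\<bar>\<tau>\<bar>" "\<bar>t1\<bar>" rule: linorder_cases) auto
    next
      assume h: "\<bar>\<tau>\<bar> = \<bar>t1\<bar>"
      then have "\<tau> = t1 \<or> \<tau> = - t1" by linarith
      then show "(cosh \<tau>)\<^sup>2 + \<tau>\<^sup>2 = (cosh t1)\<^sup>2 + t1\<^sup>2" by auto
    qed
    finally show ?thesis using t1_pos by simp
  qed
  have ne: "catenoid (axis 3 1) c \<inter> sphere 0 1 \<noteq> {}"
    using catenoid_point_in[OF c, of t1 0] on_sphere[of t1 0] t1_pos by auto
  have tang: "v \<in> tangent_vectors (catenoid (axis 3 1) c) v" if vK: "v \<in> catenoid (axis 3 1) c \<inter> sphere 0 1" for v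
  proof -
    obtain \<tau> \<theta> where v: "v = catenoid_point c \<tau> \<theta>" using catenoid_point_surj[OF c, of v] vK by blast
    have "\<bar>\<tau>\<bar> = t1" using vK on_sphere unfolding v by blast
    then have "\<tau> = t1 \<or> \<tau> = - t1" by linarith
    then have crit: "\<tau> * sinh \<tau> = cosh \<tau>" using t1_zero by auto
    define \<gamma> where "\<gamma> s = catenoid_point c (\<tau> + \<tau> * s) \<theta>" for s
    have ch: "((\<lambda>s. c * cosh (\<tau> + \<tau> * s) * k) has_derivative (\<lambda>h. h * (c * (\<tau> * sinh \<tau>) * k))) (at 0)" for k
      by (auto intro!: derivative_eq_intros simp: fun_eq_iff)
    have li: "((\<lambda>s. c * (\<tau> + \<tau> * s)) has_derivative (\<lambda>h. h * (c * \<tau>))) (at 0)"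
      by (auto intro!: derivative_eq_intros simp: fun_eq_iff)
    have "(\<gamma> has_derivative (\<lambda>h. vec3 (h * (c * (\<tau> * sinh \<tau>) * cos \<theta>)) (h * (c * (\<tau> * sinh \<tau>) * sin \<theta>)) (h * (c * \<tau>)))) (at 0)"
      unfolding \<gamma>_def[abs_def] catenoid_point_def
      by (rule vec3_has_derivative[OF ch ch li])
    then have "(\<gamma> has_vector_derivative v) (at 0)"
      unfolding has_vector_derivative_def v catenoid_point_def vec3_scale crit .
    moreover have "range \<gamma> \<subseteq> catenoid (axis 3 1) c" using catenoid_point_in[OF c] by (auto simp: \<gamma>_def)
    moreover have "\<gamma> 0 = v" by (simp add: \<gamma>_def v)
    ultimately show ?thesis unfolding tangent_vectors_def by blast
  qed
  show ?thesis unfolding critical_catenoid_def catenoid_in_ball_def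
    by (intro exI[of _ "axis 3 1"] exI[of _ c] conjI ballI ne c refl tang) (simp_all add: norm_axis_1)
qed

text \<open>
  In this case the map is the conformal parametrization of the catenoid by \<open>\<tau> = t - t1\<close> and \<open>\<theta>\<close>,
  and the unit ball cuts out exactly \<open>|\<tau>| \<le> t1\<close>.
\<close>

lemma (in catenoidal_map) conformal_parametrization_Psi:
  assumes "T = T1" "p = t1" "b = a" "q = t1"
  shows "critical_catenoid (catenoid_in_ball a)" "conformal_parametrization T Psi (catenoid_in_ball a)"
proof -
  have a: "a > 0" using ab by simp
  have Ppt: "Psi (t, \<theta>) = catenoid_point a (t - t1) \<theta>" for t \<theta>
    unfolding Psi_def catenoid_point_def fst_conv snd_conv by (simp only: assms)
  have u: "a\<^sup>2 * ((cosh t1)\<^sup>2 + t1\<^sup>2) = 1" using unit(1) assms by (simp add: distrib_left)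
  show "critical_catenoid (catenoid_in_ball a)" by (rule critical_catenoid_in_ball[OF a u])
  have T2: "T - t1 = t1" using assms(1) by (simp add: T1_def)
  have "bij_betw Psi ({0..T} \<times> {0..<2 * pi}) (catenoid_in_ball a)"
  proof (rule bij_betw_imageI)
    show "inj_on Psi ({0..T} \<times> {0..<2 * pi})"
      by (rule inj_onI) (auto simp: Ppt dest!: catenoid_point_inj[OF a])
    show "Psi ` ({0..T} \<times> {0..<2 * pi}) = catenoid_in_ball a"
    proof
      show "Psi ` ({0..T} \<times> {0..<2 * pi}) \<subseteq> catenoid_in_ball a"
      proof clarify
        fix t \<theta> assume "t \<in> {0..T}" "\<theta> \<in> {0..<2 * pi}"
        then have "(t, \<theta>) \<in> annulus T" by (simp add: annulus_def)
        then have "Psi (t, \<theta>) \<in> cball 0 1" using free_boundary unfolding free_boundary_harmonic_def by blast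
        then show "Psi (t, \<theta>) \<in> catenoid_in_ball a" unfolding catenoid_in_ball_def Ppt using catenoid_point_in[OF a] by blast
      qed
      show "catenoid_in_ball a \<subseteq> Psi ` ({0..T} \<times> {0..<2 * pi})"
      proof
        fix v assume v: "v \<in> catenoid_in_ball a"
        then obtain \<tau> \<theta> where \<theta>: "0 \<le> \<theta>" "\<theta> < 2 * pi" "v = catenoid_point a \<tau> \<theta>"
          using catenoid_point_surj[OF a] unfolding catenoid_in_ball_def by blast
        have "norm v \<le> 1" using v by (simp add: catenoid_in_ball_def)
        then have "(norm v)\<^sup>2 \<le> 1\<^sup>2" by (intro power_mono) auto
        then have "a\<^sup>2 * ((cosh \<tau>)\<^sup>2 + \<tau>\<^sup>2) \<le> a\<^sup>2 * ((cosh t1)\<^sup>2 + t1\<^sup>2)" unfolding u \<theta>(3) norm_catenoid_point by simp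
        then have "(cosh \<tau>)\<^sup>2 + \<tau>\<^sup>2 \<le> (cosh t1)\<^sup>2 + t1\<^sup>2" using a by simp
        then have "\<bar>\<tau>\<bar> \<le> t1" using cosh_abs_mono[of t1 \<tau>] t1_pos by force
        then have "\<tau> + t1 \<in> {0..T}" using T2 by (auto simp: abs_le_iff)
        moreover have "v = Psi (\<tau> + t1, \<theta>)" by (simp add: Ppt \<theta>)
        ultimately show "v \<in> Psi ` ({0..T} \<times> {0..<2 * pi})" using \<theta> by (intro image_eqI[of _ _ "(\<tau> + t1, \<theta>)"]) auto
      qed
    qed
  qed
  moreover have "d_t T Psi x \<noteq> 0 \<and> d_t T Psi x \<bullet> d_theta Psi x = 0 \<and> norm (d_t T Psi x) = norm (d_theta Psi x)"
    if x: "x \<in> annulus T" for x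
  proof -
    have "Psi_t x \<noteq> 0" using ab by (auto simp: Psi_t_def vec_eq_iff forall_3)
    moreover have "Psi_t x \<bullet> Psi_\<theta> x = 0" by (simp add: Psi_t_def Psi_\<theta>_def vec3_inner)
    moreover have "(norm (Psi_t x))\<^sup>2 = (norm (Psi_\<theta> x))\<^sup>2"
      unfolding norm_Psi_t norm_Psi_\<theta> using assms(3) by (simp add: cosh_square_eq algebra_simps)
    then have "norm (Psi_t x) = norm (Psi_\<theta> x)" by (simp add: power2_eq_iff_nonneg)
    ultimately show ?thesis unfolding d_Psi[OF x] by blast
  qed
  moreover have "smooth_annulus_fun T Psi" using harmonic_Psi[of flat] by (simp add: harmonic_def)
  ultimately show "conformal_parametrization T Psi (catenoid_in_ball a)" unfolding conformal_parametrization_def by blast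
qed

section \<open>The family of free boundary harmonic maps\<close>

lemma neck_catenoidal_map:
  assumes "neck T p a b" shows "catenoidal_map T p a b (1 / tanh p)"
proof
  have p: "0 < p" "p \<le> T / 2" "1 / tanh p + 1 / tanh (T - p) = T" using assms by (auto simp: neck_def)
  show "0 < p" by (rule p)
  show "p < T" using p by simp
  then have "tanh (T - p) \<noteq> 0" "tanh p \<noteq> 0" using p by simp_all
  moreover have "T - 1 / tanh p = 1 / tanh (T - p)" using p(3) by linarith
  ultimately show "1 / tanh p * tanh p = 1" "(T - 1 / tanh p) * tanh (T - p) = 1"
    "a\<^sup>2 * (cosh p)\<^sup>2 + b\<^sup>2 * (1 / tanh p)\<^sup>2 = 1" "a\<^sup>2 * (cosh (T - p))\<^sup>2 + b\<^sup>2 * (T - 1 / tanh p)\<^sup>2 = 1"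
    using assms by (simp_all add: neck_def)
qed (use assms in \<open>auto simp: neck_def\<close>)

theorem theorem2p11:
  shows "(\<exists>!t. t > 0 \<and> t = coth t) \<and> \<bar>t1 - 1.2\<bar> < 0.05 \<and>
    (\<exists>\<Psi> :: real \<Rightarrow> real \<times> real \<Rightarrow> real^3.
      let g = (\<lambda>T. induced_metric T flat (\<Psi> T));
          \<rho> = (\<lambda>T. induced_density T flat (\<Psi> T))
      in
        (\<forall>T \<ge> T1.
           free_boundary_harmonic T flat (\<Psi> T) \<and> nondegenerate T (\<Psi> T) \<and>
           rot_symmetric_map T (\<Psi> T) \<and> spectral_index T flat (\<Psi> T) = 1 \<and>
           conformally_extremal 1 T (g T) (\<rho> T)) \<and>
        (\<exists>K. critical_catenoid K \<and> conformal_parametrization T1 (\<Psi> T1) K) \<and>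
        (\<forall>T \<ge> T1.
           rot_symmetric_pair T (g T) (\<rho> T) \<and>
           (\<forall>t \<in> {0, T}. \<forall>\<theta> \<theta>'. \<rho> T (t, \<theta>) = \<rho> T (t, \<theta>'))) \<and>
        (\<exists>T2 \<ge> T1. \<forall>T \<ge> T2. \<forall>\<theta> \<theta>'. \<rho> T (0, \<theta>) \<noteq> \<rho> T (T, \<theta>')) \<and>
        (\<forall>T \<ge> T1.
           steklov_bar 1 T (g T) (\<rho> T) = 2 * energy T flat (\<Psi> T) \<and>
           2 * energy T flat (\<Psi> T) > 2 * pi) \<and>
        ((\<lambda>T. steklov_bar 1 T (g T) (\<rho> T)) \<longlongrightarrow> 2 * pi) at_top)"
proof -
  have "\<forall>T. \<exists>x. T \<ge> T1 \<longrightarrow> neck T (fst x) (fst (snd x)) (snd (snd x))"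
  proof
    fix T
    show "\<exists>x. T \<ge> T1 \<longrightarrow> neck T (fst x) (fst (snd x)) (snd (snd x))"
    proof (cases "T \<ge> T1")
      case True
      then obtain p a b where "neck T p a b" by (rule ex_neck)
      then show ?thesis by (intro exI[of _ "(p, a, b)"]) simp
    qed simp
  qed
  then obtain X where X: "\<And>T. T \<ge> T1 \<Longrightarrow> neck T (fst (X T)) (fst (snd (X T))) (snd (snd (X T)))" by metis
  define p a b where "p T = fst (X T)" and "a T = fst (snd (X T))" and "b T = snd (snd (X T))" for T
  have neck: "neck T (p T) (a T) (b T)" if "T \<ge> T1" for T
    using X[OF that] by (simp add: p_def a_def b_def)
  have cm: "catenoidal_map T (p T) (a T) (b T) (1 / tanh (p T))" if "T \<ge> T1" for T
    by (rule neck_catenoidal_map[OF neck[OF that]])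
  define \<Psi> where "\<Psi> T = catenoidal_map.Psi (p T) (a T) (b T) (1 / tanh (p T))" for T
  define g where "g T = induced_metric T flat (\<Psi> T)" for T
  define \<rho> where "\<rho> T = induced_density T flat (\<Psi> T)" for T
  note defs = g_def \<rho>_def \<Psi>_def
  have props: "free_boundary_harmonic T flat (\<Psi> T)" "nondegenerate T (\<Psi> T)"
      "rot_symmetric_map T (\<Psi> T)" "spectral_index T flat (\<Psi> T) = 1" "conformally_extremal 1 T (g T) (\<rho> T)"
      "rot_symmetric_pair T (g T) (\<rho> T)" "\<forall>t \<in> {0, T}. \<forall>\<theta> \<theta>'. \<rho> T (t, \<theta>) = \<rho> T (t, \<theta>')"
      "steklov_bar 1 T (g T) (\<rho> T) = 2 * pi * (tanh (p T) + tanh (T - p T))"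
      "2 * energy T flat (\<Psi> T) = 2 * pi * (tanh (p T) + tanh (T - p T))"
    if T: "T \<ge> T1" for T
  proof -
    interpret catenoidal_map T "p T" "a T" "b T" "1 / tanh (p T)" by (rule cm[OF T])
    show "free_boundary_harmonic T flat (\<Psi> T)" "nondegenerate T (\<Psi> T)"
      "rot_symmetric_map T (\<Psi> T)" "spectral_index T flat (\<Psi> T) = 1" "conformally_extremal 1 T (g T) (\<rho> T)"
      "rot_symmetric_pair T (g T) (\<rho> T)"
      unfolding defs by (rule free_boundary nondegenerate_Psi rot_symmetric_Psi spectral_index_Psi conformally_extremal_Psi rot_symmetric_pair_Psi)+
    show "\<forall>t \<in> {0, T}. \<forall>\<theta> \<theta>'. \<rho> T (t, \<theta>) = \<rho> T (t, \<theta>')" unfolding defs by (simp add: rho_eq)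
    show "steklov_bar 1 T (g T) (\<rho> T) = 2 * pi * (tanh (p T) + tanh (T - p T))"
      unfolding defs steklov_bar_Psi rho0_def rho1_def ..
    show "2 * energy T flat (\<Psi> T) = 2 * pi * (tanh (p T) + tanh (T - p T))"
      unfolding defs energy_Psi rho0_def rho1_def ..
  qed
  have cat: "\<exists>K. critical_catenoid K \<and> conformal_parametrization T1 (\<Psi> T1) K"
  proof -
    interpret catenoidal_map T1 "p T1" "a T1" "b T1" "1 / tanh (p T1)" by (rule cm) simp
    have n: "p T1 = t1" "a T1 = b T1" using neck[of T1] by (auto simp: neck_def)
    have "1 / tanh (p T1) = t1" unfolding n(1) using t1_tanh t1_pos by (simp add: field_simps)
    from conformal_parametrization_Psi[OF refl n(1) n(2)[symmetric] this] show ?thesis unfolding defs by blast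
  qed
  have distinct: "\<rho> T (0, \<theta>) \<noteq> \<rho> T (T, \<theta>')" if T: "T \<ge> max T1 24" for T \<theta> \<theta>'
  proof -
    have T': "T \<ge> T1" "T \<ge> 24" using T by auto
    interpret catenoidal_map T "p T" "a T" "b T" "1 / tanh (p T)" by (rule cm[OF T'(1)])
    show ?thesis unfolding defs
      by (rule rho_distinct) (use neck_large(4)[OF neck[OF T'(1)] T'(2)] in \<open>simp add: rho0_def rho1_def\<close>)
  qed
  \<comment> \<open>Since \<open>2E = 2\<pi> (tanh p + tanh (T - p))\<close>, the estimates of \<open>neck_large\<close> squeeze the limit.\<close>
  have lim: "((\<lambda>T. steklov_bar 1 T (g T) (\<rho> T)) \<longlongrightarrow> 2 * pi) at_top"
  proof (rule tendsto_sandwich)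
    have ev: "\<forall>\<^sub>F T in at_top. T \<ge> max T1 24" by (rule eventually_ge_at_top)
    show "\<forall>\<^sub>F T in at_top. 2 * pi * (1 / T + (1 - 2 * exp (- T))) \<le> steklov_bar 1 T (g T) (\<rho> T)"
      using ev
    proof eventually_elim
      case (elim T)
      then have T: "T \<ge> T1" "T \<ge> 24" by auto
      have "1 / T + (1 - 2 * exp (- T)) \<le> tanh (p T) + tanh (T - p T)"
        using neck_large(2,3)[OF neck[OF T(1)] T(2)] by linarith
      then show ?case unfolding props(8)[OF T(1)] by (intro mult_left_mono) auto
    qed
    show "\<forall>\<^sub>F T in at_top. steklov_bar 1 T (g T) (\<rho> T) \<le> 2 * pi * (1 / (T - 2) + 1)"
      using ev
    proof eventually_elim
      case (elim T)
      then have T: "T \<ge> T1" "T \<ge> 24" by auto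
      have "tanh (p T) + tanh (T - p T) \<le> 1 / (T - 2) + 1"
        using neck_large(1,5)[OF neck[OF T(1)] T(2)] by linarith
      then show ?case unfolding props(8)[OF T(1)] by (intro mult_left_mono) auto
    qed
    have i: "((\<lambda>T :: real. 1 / T) \<longlongrightarrow> 0) at_top"
      by (simp add: tendsto_inverse_0_at_top filterlim_ident divide_inverse)
    have i2: "((\<lambda>T :: real. 1 / (T - 2)) \<longlongrightarrow> 0) at_top"
    proof -
      have "filterlim (\<lambda>T :: real. - 2 + T) at_top at_top"
        by (rule filterlim_tendsto_add_at_top[OF tendsto_const filterlim_ident])
      then have "filterlim (\<lambda>T :: real. T - 2) at_top at_top" by (simp add: add.commute)
      then show ?thesis unfolding divide_inverse mult_1_left by (rule tendsto_inverse_0_at_top)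
    qed
    have ex: "((\<lambda>T :: real. exp (- T)) \<longlongrightarrow> 0) at_top"
      by (rule filterlim_compose[OF exp_at_bot filterlim_uminus_at_bot_at_top])
    have "((\<lambda>T. 2 * pi * (1 / T + (1 - 2 * exp (- T)))) \<longlongrightarrow> 2 * pi * (0 + (1 - 2 * 0))) at_top"
      by (intro tendsto_intros i ex)
    then show "((\<lambda>T. 2 * pi * (1 / T + (1 - 2 * exp (- T)))) \<longlongrightarrow> 2 * pi) at_top" by simp
    have "((\<lambda>T. 2 * pi * (1 / (T - 2) + 1)) \<longlongrightarrow> 2 * pi * (0 + 1)) at_top"
      by (intro tendsto_intros i2)
    then show "((\<lambda>T. 2 * pi * (1 / (T - 2) + 1)) \<longlongrightarrow> 2 * pi) at_top" by simp
  qed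
  have gt: "2 * energy T flat (\<Psi> T) > 2 * pi" if T: "T \<ge> T1" for T
    unfolding props(9)[OF T] using neck_sum_gt_1[OF neck[OF T] T] by simp
  have T2: "\<exists>T2\<ge>T1. \<forall>T\<ge>T2. \<forall>\<theta> \<theta>'. \<rho> T (0, \<theta>) \<noteq> \<rho> T (T, \<theta>')"
    by (rule exI[of _ "max T1 24"]) (use distinct in auto)
  show ?thesis
  proof (intro conjI exI[of _ \<Psi>])
    show "\<exists>!t. t > 0 \<and> t = coth t" by (rule ex1_coth_fixpoint)
    show "\<bar>t1 - 1.2\<bar> < 0.05" by (rule t1_approx)
    show "let g = (\<lambda>T. induced_metric T flat (\<Psi> T));
          \<rho> = (\<lambda>T. induced_density T flat (\<Psi> T))
      in
        (\<forall>T \<ge> T1.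
           free_boundary_harmonic T flat (\<Psi> T) \<and> nondegenerate T (\<Psi> T) \<and>
           rot_symmetric_map T (\<Psi> T) \<and> spectral_index T flat (\<Psi> T) = 1 \<and>
           conformally_extremal 1 T (g T) (\<rho> T)) \<and>
        (\<exists>K. critical_catenoid K \<and> conformal_parametrization T1 (\<Psi> T1) K) \<and>
        (\<forall>T \<ge> T1.
           rot_symmetric_pair T (g T) (\<rho> T) \<and>
           (\<forall>t \<in> {0, T}. \<forall>\<theta> \<theta>'. \<rho> T (t, \<theta>) = \<rho> T (t, \<theta>'))) \<and>
        (\<exists>T2 \<ge> T1. \<forall>T \<ge> T2. \<forall>\<theta> \<theta>'. \<rho> T (0, \<theta>) \<noteq> \<rho> T (T, \<theta>')) \<and>
        (\<forall>T \<ge> T1.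
           steklov_bar 1 T (g T) (\<rho> T) = 2 * energy T flat (\<Psi> T) \<and>
           2 * energy T flat (\<Psi> T) > 2 * pi) \<and>
        ((\<lambda>T. steklov_bar 1 T (g T) (\<rho> T)) \<longlongrightarrow> 2 * pi) at_top"
      unfolding Let_def g_def[symmetric] \<rho>_def[symmetric]
      using props cat T2 gt lim by auto
  qed
qed

end
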